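(* Let $G$ be a compact (connected) simple Lie group, equipped with its Haar probability measure and with a Riemannian metric. For $(g_1,\dots,g_k)\in G^k$ let $\Gamma(g_1,\dots,g_k)<G$ be the subgroup generated by $g_1,\dots,g_k$, acting on $G$ by left multiplication. The following are equivalent: (i) for every $k\ge2$ and for almost every $k$-tuple $(g_1,\dots,g_k)\in G^k$ (with respect to the product Haar measure), the action $\Gamma(g_1,\dots,g_k)\curvearrowright G$ by left multiplication has a spectral gap; (ii) for every $k\ge2$ and for almost every $k$-tuple $(g_1,\dots,g_k)\in G^k$, one (equivalently, any) unbounded sequence of level sets $G\times\{t_n\}$, $t_n\to\infty$, of the warped cone $\mathcal{O}_{\Gamma(g_1,\dots,g_k)}(G)$ forms a family of expanders.
   Context: Write $\Gamma=\Gamma(g_1,\dots,g_k)$ and $S=\{1,g_1^{\pm1},\dots,g_k^{\pm1}\}$. The action of $\Gamma$ on $G$ has a \emph{spectral gap} if there is $\delta>0$ with $\sum_{s\in S}\|s\cdot f-f\|_2\ge\delta\|f\|_2$ for all $f\in L^2_0(G)=\{f\in L^2(G):\int f=0\}$, where $(s\cdot f)(x)=f(s^{-1}x)$ and $L^2$ is with respect to Haar measure. \emph{Warped cone} of an action of $\Gamma=\langle S\rangle$ on a compact Riemannian manifold $(M,\varrho)$ (here $M=G$): the open cone is $\mathcal{O}(M)=M\times[1,\infty)$ with the distance $d_{\mathcal O}$ induced by the Riemannian metric $t^2\varrho+dt^2$; $\Gamma$ acts by $g\cdot(x,t)=(g\cdot x,t)$. The warped cone $\mathcal{O}_\Gamma(M)$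 is $\mathcal{O}(M)$ with the warped metric $\delta_\Gamma$, the largest distance such that $\delta_\Gamma(z,w)\le d_{\mathcal O}(z,w)$ and $\delta_\Gamma(z,s\cdot z)\le1$ for all $z,w\in\mathcal{O}(M)$, $s\in S$. Level sets $M\times\{t\}$ carry the restriction of $\delta_\Gamma$. A sequence of finite graphs $\mathcal{G}_n$ is a \emph{family of expanders} if $|V(\mathcal{G}_n)|\to\infty$ and there are $C,\varepsilon>0$ such that every $\mathcal{G}_n$ has all degrees at most $C$ and Cheeger constant $h(\mathcal{G}_n)\ge\varepsilon$, where $h(\mathcal{G})=\inf\{|\partial W|/|W| : \emptyset\ne W\subset V(\mathcal{G}),\ |W|\le\frac12|V(\mathcal{G})|\}$ and $\partial W$ is the set of vertices outside $W$ adjacent to $W$. A sequence of metric spaces $(X_n,d_n)$ \emph{forms a family of expanders} if it is uniformly quasi-isometric to a family of expander graphs $\mathcal{X}_n$ (with path metrics): there are $L,A$ independent of $n$ and maps $f_n\colon X_n\to\mathcal{X}_n$ with $\frac1Ld_n(x,x')-A\le d(f_n(x),f_n(x'))\le Ld_n(x,x')+A$ for all $x,x'$, and every point of $\mathcal{X}_n$ within distance $A$ of $f_n(X_n)$. *)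

theory Defs
  imports "HOL-Probability.Probability" "HOL-Algebra.Coset"
begin

section \<open>Smooth manifolds and Lie groups\<close>

text \<open>Both predicates below are meant for open sets \<open>S\<close>.\<close>

primrec Ck_on :: "nat \<Rightarrow> 'e::euclidean_space set \<Rightarrow> ('e \<Rightarrow> 'f::real_normed_vector) \<Rightarrow> bool" where
  "Ck_on 0 S f \<longleftrightarrow> continuous_on S f"
| "Ck_on (Suc k) S f \<longleftrightarrow>
     (\<forall>x\<in>S. f differentiable (at x)) \<and>
     (\<forall>v. Ck_on k S (\<lambda>x. frechet_derivative f (at x) v))"

definition smooth_on :: "'e::euclidean_space set \<Rightarrow> ('e \<Rightarrow> 'f::real_normed_vector) \<Rightarrow> bool" where
  "smooth_on S f \<longleftrightarrow> (\<forall>k. Ck_on k S f)"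

text \<open>A chart is a pair \<open>(U, \<phi>)\<close>; only the values of \<open>\<phi>\<close> on \<open>U\<close> matter.  The underlying set of
  the manifold is the whole type \<open>'a\<close>, its dimension is \<open>DIM('e)\<close>.  Atlases need not be maximal:
  everything below depends only on the smooth structure which the atlas generates.\<close>

type_synonym ('a, 'e) chart = "'a set \<times> ('a \<Rightarrow> 'e)"

definition transition :: "('a, 'e) chart \<Rightarrow> ('b, 'f) chart \<Rightarrow> ('a \<Rightarrow> 'b) \<Rightarrow> 'e \<Rightarrow> 'f" where
  "transition c c' f = snd c' \<circ> f \<circ> inv_into (fst c) (snd c)"

definition smooth_atlas ::
  "('a::topological_space, 'e::euclidean_space) chart set \<Rightarrow> bool" where
  "smooth_atlas \<A> \<longleftrightarrow>
     (\<Union>c\<in>\<A>. fst c) = UNIV \<and>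
     (\<forall>(U, \<phi>)\<in>\<A>. open U \<and> open (\<phi> ` U) \<and> (\<exists>\<psi>. homeomorphism U (\<phi> ` U) \<phi> \<psi>)) \<and>
     (\<forall>c\<in>\<A>. \<forall>c'\<in>\<A>. smooth_on (snd c ` (fst c \<inter> fst c')) (transition c c' (\<lambda>x. x)))"

definition prod_atlas ::
  "('a, 'e) chart set \<Rightarrow> ('b, 'f) chart set \<Rightarrow> ('a \<times> 'b, 'e \<times> 'f) chart set" where
  "prod_atlas \<A> \<B> = {(U \<times> V, map_prod \<phi> \<psi>) | U \<phi> V \<psi>. (U, \<phi>) \<in> \<A> \<and> (V, \<psi>) \<in> \<B>}"

definition smooth_map ::
  "('a::topological_space, 'e::euclidean_space) chart set \<Rightarrow>
   ('b::topological_space, 'f::euclidean_space) chart set \<Rightarrow> ('a \<Rightarrow> 'b) \<Rightarrow> bool" where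
  "smooth_map \<A> \<B> f \<longleftrightarrow>
     continuous_on UNIV f \<and>
     (\<forall>c\<in>\<A>. \<forall>c'\<in>\<B>. smooth_on (snd c ` (fst c \<inter> f -` fst c')) (transition c c' f))"

text \<open>The Hausdorff and countability axioms of a manifold are supplied by the sort of \<open>'a\<close>.\<close>

definition lie_group ::
  "'a::{t2_space,second_countable_topology} monoid \<Rightarrow>
   ('a, 'e::euclidean_space) chart set \<Rightarrow> bool" where
  "lie_group G \<A> \<longleftrightarrow>
     group G \<and> carrier G = UNIV \<and> smooth_atlas \<A> \<and>
     smooth_map (prod_atlas \<A> \<A>) \<A> (\<lambda>(x, y). x \<otimes>\<^bsub>G\<^esub> y) \<and>
     smooth_map \<A> \<A> (\<lambda>x. inv\<^bsub>G\<^esub> x)"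

text \<open>Simplicity is meant in the sense of Lie groups: non-abelian, and without non-trivial proper
  closed connected normal subgroups (equivalently, the Lie algebra is simple).  Discrete normal
  subgroups, such as the centre of \<open>SU(2)\<close>, are allowed, so this is not simplicity of the abstract
  group.\<close>

definition compact_simple_lie_group ::
  "'a::{t2_space,second_countable_topology} monoid \<Rightarrow>
   ('a, 'e::euclidean_space) chart set \<Rightarrow> bool" where
  "compact_simple_lie_group G \<A> \<longleftrightarrow>
     lie_group G \<A> \<and> compact (UNIV :: 'a set) \<and> connected (UNIV :: 'a set) \<and>
     \<not> comm_group G \<and>
     (\<forall>N. N \<lhd> G \<and> closed N \<and> connected N \<longrightarrow> N = {\<one>\<^bsub>G\<^esub>} \<or> N = carrier G)"

definition haar_prob :: "'a::topological_space monoid \<Rightarrow> 'a measure \<Rightarrow> bool" where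
  "haar_prob G \<mu> \<longleftrightarrow>
     sets \<mu> = sets borel \<and> prob_space \<mu> \<and> (\<forall>g\<in>carrier G. distr \<mu> \<mu> (\<lambda>x. g \<otimes>\<^bsub>G\<^esub> x) = \<mu>)"


section \<open>Riemannian metrics and the open cone\<close>

text \<open>\<open>\<rho> c p\<close> is the inner product on the tangent space at \<open>p\<close>, written in the coordinates of the
  chart \<open>c\<close> around \<open>p\<close>; the last clause is the transformation law of a covariant 2-tensor.\<close>

definition riemannian_metric ::
  "('a::topological_space, 'e::euclidean_space) chart set \<Rightarrow>
   (('a, 'e) chart \<Rightarrow> 'a \<Rightarrow> 'e \<Rightarrow> 'e \<Rightarrow> real) \<Rightarrow> bool" where
  "riemannian_metric \<A> \<rho> \<longleftrightarrow>
     (\<forall>c\<in>\<A>. \<forall>p\<in>fst c. bilinear (\<rho> c p) \<and>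
        (\<forall>v w. \<rho> c p v w = \<rho> c p w v) \<and> (\<forall>v. v \<noteq> 0 \<longrightarrow> \<rho> c p v v > 0)) \<and>
     (\<forall>c\<in>\<A>. \<forall>v w. smooth_on (snd c ` fst c) (\<lambda>x. \<rho> c (inv_into (fst c) (snd c) x) v w)) \<and>
     (\<forall>c\<in>\<A>. \<forall>c'\<in>\<A>. \<forall>p\<in>fst c \<inter> fst c'.
        let D = frechet_derivative (transition c c' (\<lambda>x. x)) (at (snd c p))
        in \<forall>v w. \<rho> c' p (D v) (D w) = \<rho> c p v w)"

definition cone :: "('a \<times> real) set" where
  "cone = UNIV \<times> {1..}"

text \<open>Piecewise \<open>C\<^sup>1\<close> curves in the cone, parametrised by \<open>[0,1]\<close>, with the convention of
  \<^const>\<open>piecewise_C1_differentiable_on\<close>: continuous, and \<open>C\<^sup>1\<close> in charts off a finite set.\<close>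

definition cone_curve ::
  "('a::topological_space, 'e::euclidean_space) chart set \<Rightarrow> (real \<Rightarrow> 'a \<times> real) \<Rightarrow> bool" where
  "cone_curve \<A> \<gamma> \<longleftrightarrow>
     continuous_on {0..1} \<gamma> \<and> \<gamma> ` {0..1} \<subseteq> cone \<and>
     (\<exists>F. finite F \<and>
        (\<forall>(U, \<phi>)\<in>\<A>. (\<lambda>s. (\<phi> (fst (\<gamma> s)), snd (\<gamma> s)))
            C1_differentiable_on {s \<in> {0<..<1} - F. fst (\<gamma> s) \<in> U}))"

text \<open>The norm of the velocity for \<open>t\<^sup>2\<rho> + dt\<^sup>2\<close>.  By the transformation law for \<open>\<rho>\<close> the value does
  not depend on which chart is picked.\<close>

definition cone_speed ::
  "('a::topological_space, 'e::euclidean_space) chart set \<Rightarrow>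
   (('a, 'e) chart \<Rightarrow> 'a \<Rightarrow> 'e \<Rightarrow> 'e \<Rightarrow> real) \<Rightarrow> (real \<Rightarrow> 'a \<times> real) \<Rightarrow> real \<Rightarrow> real" where
  "cone_speed \<A> \<rho> \<gamma> s =
     (let c = (SOME c. c \<in> \<A> \<and> fst (\<gamma> s) \<in> fst c);
          v = vector_derivative (\<lambda>r. snd c (fst (\<gamma> r))) (at s);
          \<tau> = vector_derivative (\<lambda>r. snd (\<gamma> r)) (at s)
      in sqrt ((snd (\<gamma> s))\<^sup>2 * \<rho> c (fst (\<gamma> s)) v v + \<tau>\<^sup>2))"

definition cone_length ::
  "('a::topological_space, 'e::euclidean_space) chart set \<Rightarrow>
   (('a, 'e) chart \<Rightarrow> 'a \<Rightarrow> 'e \<Rightarrow> 'e \<Rightarrow> real) \<Rightarrow> (real \<Rightarrow> 'a \<times> real) \<Rightarrow> ennreal" where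
  "cone_length \<A> \<rho> \<gamma> = (\<integral>\<^sup>+ s\<in>{0<..<1}. ennreal (cone_speed \<A> \<rho> \<gamma> s) \<partial>lborel)"

text \<open>The infimum is finite when the manifold is connected.\<close>

definition cone_dist ::
  "('a::topological_space, 'e::euclidean_space) chart set \<Rightarrow>
   (('a, 'e) chart \<Rightarrow> 'a \<Rightarrow> 'e \<Rightarrow> 'e \<Rightarrow> real) \<Rightarrow> 'a \<times> real \<Rightarrow> 'a \<times> real \<Rightarrow> real" where
  "cone_dist \<A> \<rho> z w =
     enn2real (INF \<gamma>\<in>{\<gamma>. cone_curve \<A> \<gamma> \<and> \<gamma> 0 = z \<and> \<gamma> 1 = w}. cone_length \<A> \<rho> \<gamma>)"


section \<open>Warped cones\<close>

text \<open>The pointwise supremum of the admissible distances on \<open>Z\<close> is itself one of them, hence the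
  largest.\<close>

definition warped_dist ::
  "'z set \<Rightarrow> ('z \<Rightarrow> 'z \<Rightarrow> real) \<Rightarrow> 's set \<Rightarrow> ('s \<Rightarrow> 'z \<Rightarrow> 'z) \<Rightarrow> 'z \<Rightarrow> 'z \<Rightarrow> real" where
  "warped_dist Z d S act z w =
     (SUP \<delta>\<in>{\<delta>. Metric_space Z \<delta> \<and> (\<forall>x\<in>Z. \<forall>y\<in>Z. \<delta> x y \<le> d x y) \<and>
               (\<forall>s\<in>S. \<forall>x\<in>Z. \<delta> x (act s x) \<le> 1)}. \<delta> z w)"

definition gens :: "'a monoid \<Rightarrow> nat \<Rightarrow> (nat \<Rightarrow> 'a) \<Rightarrow> 'a set" where
  "gens G k g = {\<one>\<^bsub>G\<^esub>} \<union> g ` {..<k} \<union> (\<lambda>i. inv\<^bsub>G\<^esub> (g i)) ` {..<k}"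

text \<open>The warped metric for the action of the subgroup generated by \<open>S\<close> on \<open>G\<close> by left
  multiplication.\<close>

definition warped_cone_dist ::
  "'a::topological_space monoid \<Rightarrow> ('a, 'e::euclidean_space) chart set \<Rightarrow>
   (('a, 'e) chart \<Rightarrow> 'a \<Rightarrow> 'e \<Rightarrow> 'e \<Rightarrow> real) \<Rightarrow> 'a set \<Rightarrow> 'a \<times> real \<Rightarrow> 'a \<times> real \<Rightarrow> real" where
  "warped_cone_dist G \<A> \<rho> S =
     warped_dist cone (cone_dist \<A> \<rho>) S (\<lambda>s (x, t). (s \<otimes>\<^bsub>G\<^esub> x, t))"


section \<open>Spectral gap\<close>

definition L2 :: "'a measure \<Rightarrow> ('a \<Rightarrow> complex) set" where
  "L2 \<mu> = {f \<in> borel_measurable \<mu>. integrable \<mu> (\<lambda>x. (cmod (f x))\<^sup>2)}"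

definition L2_norm :: "'a measure \<Rightarrow> ('a \<Rightarrow> complex) \<Rightarrow> real" where
  "L2_norm \<mu> f = sqrt (\<integral>x. (cmod (f x))\<^sup>2 \<partial>\<mu>)"

definition spectral_gap :: "'a monoid \<Rightarrow> 'a measure \<Rightarrow> 'a set \<Rightarrow> bool" where
  "spectral_gap G \<mu> S \<longleftrightarrow>
     (\<exists>\<delta>>0. \<forall>f\<in>L2 \<mu>. (\<integral>x. f x \<partial>\<mu>) = 0 \<longrightarrow>
        (\<Sum>s\<in>S. L2_norm \<mu> (\<lambda>x. f (inv\<^bsub>G\<^esub> s \<otimes>\<^bsub>G\<^esub> x) - f x)) \<ge> \<delta> * L2_norm \<mu> f)"


section \<open>Expanders\<close>

text \<open>A finite simple graph is given by its vertex set and its symmetric irreflexive adjacency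
  relation.\<close>

definition fin_graph :: "'v set \<Rightarrow> 'v rel \<Rightarrow> bool" where
  "fin_graph V E \<longleftrightarrow> finite V \<and> E \<subseteq> V \<times> V \<and> sym E \<and> irrefl E"

definition vertex_boundary :: "'v rel \<Rightarrow> 'v set \<Rightarrow> 'v set" where
  "vertex_boundary E W = E `` W - W"

text \<open>Extended real values, so that the infimum over the empty family is \<open>\<infinity>\<close>.\<close>

definition cheeger :: "'v set \<Rightarrow> 'v rel \<Rightarrow> ereal" where
  "cheeger V E =
     (INF W\<in>{W. W \<noteq> {} \<and> W \<subset> V \<and> real (card W) \<le> real (card V) / 2}.
        ereal (real (card (vertex_boundary E W)) / real (card W)))"

definition expander_graphs :: "(nat \<Rightarrow> 'v set) \<Rightarrow> (nat \<Rightarrow> 'v rel) \<Rightarrow> bool" where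
  "expander_graphs V E \<longleftrightarrow>
     (\<forall>n. fin_graph (V n) (E n)) \<and>
     filterlim (\<lambda>n. card (V n)) at_top sequentially \<and>
     (\<exists>C::real. \<exists>\<epsilon>::real. C > 0 \<and> \<epsilon> > 0 \<and>
        (\<forall>n. (\<forall>v\<in>V n. real (card (E n `` {v})) \<le> C) \<and> cheeger (V n) (E n) \<ge> ereal \<epsilon>))"

text \<open>The length of a shortest path.  Graphs with positive Cheeger constant are connected, so the
  \<open>LEAST\<close> is over a non-empty set wherever this is used.\<close>

definition path_dist :: "'v rel \<Rightarrow> 'v \<Rightarrow> 'v \<Rightarrow> real" where
  "path_dist E x y = real (LEAST n. (x, y) \<in> E ^^ n)"

definition quasi_isometry ::
  "real \<Rightarrow> real \<Rightarrow> 'x set \<Rightarrow> ('x \<Rightarrow> 'x \<Rightarrow> real) \<Rightarrow> 'y set \<Rightarrow> ('y \<Rightarrow> 'y \<Rightarrow> real) \<Rightarrow> ('x \<Rightarrow> 'y) \<Rightarrow> bool"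
  where
  "quasi_isometry L A X d Y d' f \<longleftrightarrow>
     f ` X \<subseteq> Y \<and>
     (\<forall>x\<in>X. \<forall>x'\<in>X. d x x' / L - A \<le> d' (f x) (f x') \<and> d' (f x) (f x') \<le> L * d x x' + A) \<and>
     (\<forall>y\<in>Y. \<exists>x\<in>X. d' y (f x) \<le> A)"

text \<open>Finite graphs are considered up to isomorphism, so vertices may be taken in \<^typ>\<open>nat\<close>.\<close>

definition forms_expanders :: "(nat \<Rightarrow> 'x set) \<Rightarrow> (nat \<Rightarrow> 'x \<Rightarrow> 'x \<Rightarrow> real) \<Rightarrow> bool" where
  "forms_expanders X d \<longleftrightarrow>
     (\<exists>(V :: nat \<Rightarrow> nat set) E. expander_graphs V E \<and>
        (\<exists>L>0. \<exists>A\<ge>0. \<forall>n. \<exists>f. quasi_isometry L A (X n) (d n) (V n) (path_dist (E n)) f))"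

definition levels_form_expanders :: "('a \<times> real \<Rightarrow> 'a \<times> real \<Rightarrow> real) \<Rightarrow> (nat \<Rightarrow> real) \<Rightarrow> bool" where
  "levels_form_expanders \<delta> t \<longleftrightarrow> forms_expanders (\<lambda>n. UNIV \<times> {t n}) (\<lambda>n. \<delta>)"

definition level_seq :: "(nat \<Rightarrow> real) \<Rightarrow> bool" where
  "level_seq t \<longleftrightarrow> (\<forall>n. t n \<ge> 1) \<and> filterlim t at_top sequentially"

end

theory Submission
  imports Defs
begin

text \<open>The equivalence holds for every tuple. Cut-off coordinates of finitely many charts give a
  distance \<open>d\<close> on \<open>G\<close> which is bi-Lipschitz to the Riemannian one, and for which left translations
  are uniformly Lipschitz. The warped distance on the level \<open>T\<close> is then comparable, up to additive
  constants, with the least number of hops, a hop being a translation by some \<open>s \<in> S\<close> combined with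
  a move of size \<open>1/T\<close>; the lower bound comes from test functions that are 1-Lipschitz for the cone
  metric and change by at most 1 under \<open>S\<close>.

  If the action has a spectral gap, take nets at scale \<open>1/T\<close> whose cells have comparable Haar
  measure. The gap, applied to the centred indicator of a union of cells, bounds the vertex expansion
  of the hop graph on the net from below. Conversely, if the levels \<open>t\<^sub>n\<close> are expanders, the discrete
  Cheeger inequality gives \<open>L\<^sup>2\<close> Poincare inequalities on the graphs. Sampling a continuous function
  near the vertices and letting \<open>t\<^sub>n \<rightarrow> \<infinity>\<close> turns them into the spectral gap for continuous functions,
  which are dense in \<open>L\<^sup>2\<close>.\<close>

section \<open>Functions with locally bounded derivative\<close>

text \<open>The distance \<open>d\<close> is not left invariant, so a translation costs a factor
  \<open>\<Lambda>\<close>. This is harmless because only words of bounded length, hence bounded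
  powers of \<open>\<Lambda>\<close>, ever occur, and because Haar measure itself is invariant. The
  warped metric is a supremum: an upper bound has to hold for every admissible distance, whereas a
  lower bound only needs one good function. The basic functions on the cone are
  \<open>t * f x\<close>; along a curve they change at rate \<open>t * Df + f * dt\<close>, which is
  at most a constant times the cone speed when \<open>f\<close> and its gradient are bounded.
  Packing and doubling estimates, uniform in centre and scale, come from counting grid cells in the
  Euclidean embedding given by the finite family of functions. In the converse direction nothing is
  known about the Haar measure of the fibres of a quasi-isometry, so they are never integrated over.
  Each vertex gets one sample point; the balls of radius \<open>1/T\<close> about the sample points
  have bounded overlap, larger balls about their translates by bounded words cover the group, and
  doubling compares the two kinds of balls.\<close>

lemma compact_local_bound:
  fixes K :: "'a::topological_space set"
  assumes K: "compact K" and mono: "\<And>y (b::real) b'. P y b \<Longrightarrow> b \<le> b' \<Longrightarrow> P y b'"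
    and loc: "\<And>x. x \<in> K \<Longrightarrow> \<exists>U b. open U \<and> x \<in> U \<and> (\<forall>y\<in>U. P y b)"
  shows "\<exists>b. \<forall>y\<in>K. P y b"
proof -
  obtain U b where U: "\<And>x. x \<in> K \<Longrightarrow> open (U x)" "\<And>x. x \<in> K \<Longrightarrow> x \<in> U x" "\<And>x y. x \<in> K \<Longrightarrow> y \<in> U x \<Longrightarrow> P y (b x)"
    using loc by metis
  have "K \<subseteq> (\<Union>x\<in>K. U x)" using U(2) by auto
  then obtain C where C: "C \<subseteq> K" "finite C" "K \<subseteq> (\<Union>x\<in>C. U x)" using compactE_image[OF K, of K U] U(1) by metis
  \<comment> \<open>Summing the absolute values gives one bound for all points of the subcover;
    unlike a maximum it also makes sense for an empty subcover.\<close>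
  have "P y (\<Sum>x\<in>C. \<bar>b x\<bar>)" if y: "y \<in> K" for y
  proof -
    obtain x where x: "x \<in> C" "y \<in> U x" using C y by blast
    have "\<bar>b x\<bar> \<le> (\<Sum>x\<in>C. \<bar>b x\<bar>)" using x C by (intro member_le_sum) auto
    then have "b x \<le> (\<Sum>x\<in>C. \<bar>b x\<bar>)" by linarith
    moreover have "P y (b x)" using U(3) x C by blast
    ultimately show ?thesis using mono by blast
  qed
  then show ?thesis by blast
qed

text \<open>A weak form of \<open>C^1\<close>: differentiability is required on a whole
  neighbourhood of each point, with a bound on the derivative but no continuity of it. This is
  stable under composition and pairing and still gives Lipschitz bounds.\<close>

definition loc_bdd_deriv :: "'e::euclidean_space set \<Rightarrow> ('e \<Rightarrow> 'f::real_normed_vector) \<Rightarrow> bool" where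
  "loc_bdd_deriv S f \<longleftrightarrow> (\<forall>x\<in>S. \<exists>U b. open U \<and> x \<in> U \<and>
     (\<forall>y\<in>U. \<exists>D. (f has_derivative D) (at y) \<and> (\<forall>v. norm (D v) \<le> b * norm v)))"

lemma loc_bdd_derivE:
  assumes "loc_bdd_deriv S f" "x \<in> S"
  obtains U b where "open U" "x \<in> U" "b \<ge> 0"
    "\<And>y. y \<in> U \<Longrightarrow> \<exists>D. (f has_derivative D) (at y) \<and> (\<forall>v. norm (D v) \<le> b * norm v)"
proof -
  obtain U b where U: "open U" "x \<in> U" "\<And>y. y \<in> U \<Longrightarrow> \<exists>D. (f has_derivative D) (at y) \<and> (\<forall>v. norm (D v) \<le> b * norm v)"
    using assms unfolding loc_bdd_deriv_def by metis
  have "\<exists>D. (f has_derivative D) (at y) \<and> (\<forall>v. norm (D v) \<le> \<bar>b\<bar> * norm v)" if y: "y \<in> U" for y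
  proof -
    obtain D where D: "(f has_derivative D) (at y)" "\<And>v. norm (D v) \<le> b * norm v" using U(3)[OF y] by blast
    have "norm (D v) \<le> \<bar>b\<bar> * norm v" for v
      by (rule order_trans[OF D(2)]) (auto intro: mult_right_mono)
    then show ?thesis using D(1) by blast
  qed
  then show ?thesis using that[of U "\<bar>b\<bar>"] U by simp
qed

lemma loc_bdd_deriv_has_derivative: "loc_bdd_deriv S f \<Longrightarrow> x \<in> S \<Longrightarrow> \<exists>D. (f has_derivative D) (at x)"
  by (meson loc_bdd_derivE)

lemma loc_bdd_deriv_isCont: "loc_bdd_deriv S f \<Longrightarrow> x \<in> S \<Longrightarrow> isCont f x"
  by (meson loc_bdd_deriv_has_derivative has_derivative_continuous)

text \<open>The gluing principle, needed for functions that are given by different formulas inside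
  and outside a chart domain.\<close>

lemma loc_bdd_deriv_local:
  assumes "\<And>x. x \<in> S \<Longrightarrow> \<exists>N T g. open N \<and> x \<in> N \<and> loc_bdd_deriv T g \<and> x \<in> T \<and> (\<forall>y\<in>N. f y = g y)"
  shows "loc_bdd_deriv S f"
  unfolding loc_bdd_deriv_def
proof
  fix x assume "x \<in> S"
  then obtain N T g where N: "open N" "x \<in> N" "loc_bdd_deriv T g" "x \<in> T" "\<And>y. y \<in> N \<Longrightarrow> f y = g y" using assms by metis
  obtain U b where U: "open U" "x \<in> U"
    "\<And>y. y \<in> U \<Longrightarrow> \<exists>D. (g has_derivative D) (at y) \<and> (\<forall>v. norm (D v) \<le> b * norm v)"
    using loc_bdd_derivE[OF N(3,4)] by metis
  have "\<exists>D. (f has_derivative D) (at y) \<and> (\<forall>v. norm (D v) \<le> b * norm v)" if y: "y \<in> U \<inter> N" for y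
  proof -
    obtain D where D: "(g has_derivative D) (at y)" "\<And>v. norm (D v) \<le> b * norm v" using U(3) y by blast
    have "(f has_derivative D) (at y)"
      by (rule has_derivative_transform_within_open[OF D(1) N(1)]) (use y N(5) in auto)
    then show ?thesis using D(2) by blast
  qed
  then show "\<exists>U b. open U \<and> x \<in> U \<and> (\<forall>y\<in>U. \<exists>D. (f has_derivative D) (at y) \<and> (\<forall>v. norm (D v) \<le> b * norm v))"
    using U N by (intro exI[of _ "U \<inter> N"] exI[of _ b]) auto
qed

lemma loc_bdd_deriv_subset: "loc_bdd_deriv S f \<Longrightarrow> T \<subseteq> S \<Longrightarrow> loc_bdd_deriv T f"
  unfolding loc_bdd_deriv_def by blast

lemma loc_bdd_deriv_compose:
  assumes f: "loc_bdd_deriv S f" and g: "loc_bdd_deriv T g" and "f ` S \<subseteq> T"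
  shows "loc_bdd_deriv S (\<lambda>x. g (f x))"
  unfolding loc_bdd_deriv_def
proof
  fix x assume x: "x \<in> S"
  obtain U b where U: "open U" "x \<in> U" "b \<ge> 0"
    "\<And>y. y \<in> U \<Longrightarrow> \<exists>D. (f has_derivative D) (at y) \<and> (\<forall>v. norm (D v) \<le> b * norm v)" using loc_bdd_derivE[OF f x] by metis
  have "f x \<in> T" using assms x by auto
  then obtain V c where V: "open V" "f x \<in> V" "c \<ge> 0"
    "\<And>y. y \<in> V \<Longrightarrow> \<exists>D. (g has_derivative D) (at y) \<and> (\<forall>v. norm (D v) \<le> c * norm v)" using loc_bdd_derivE[OF g] by metis
  have "continuous_on U f"
    by (rule continuous_at_imp_continuous_on) (use U(4) has_derivative_continuous in blast)
  then have "open (U \<inter> f -` V)" using U(1) V(1) continuous_open_preimage by blast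
  moreover have "\<exists>D. ((\<lambda>x. g (f x)) has_derivative D) (at y) \<and> (\<forall>v. norm (D v) \<le> (c * b) * norm v)" if y: "y \<in> U \<inter> f -` V" for y
  proof -
    obtain D where D: "(f has_derivative D) (at y)" "\<And>v. norm (D v) \<le> b * norm v" using U(4) y by blast
    obtain D' where D': "(g has_derivative D') (at (f y))" "\<And>v. norm (D' v) \<le> c * norm v" using V(4)[of "f y"] y by blast
    have "((\<lambda>x. g (f x)) has_derivative (\<lambda>v. D' (D v))) (at y)" using diff_chain_at[OF D(1) D'(1)] by (simp add: o_def)
    moreover have "norm (D' (D v)) \<le> (c * b) * norm v" for v
    proof -
      have "norm (D' (D v)) \<le> c * norm (D v)" by (rule D'(2))
      also have "\<dots> \<le> c * (b * norm v)" using D(2) V(3) by (rule mult_left_mono)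
      finally show ?thesis by (simp add: mult_ac)
    qed
    ultimately show ?thesis by blast
  qed
  ultimately show "\<exists>U b. open U \<and> x \<in> U \<and> (\<forall>y\<in>U. \<exists>D. ((\<lambda>x. g (f x)) has_derivative D) (at y) \<and> (\<forall>v. norm (D v) \<le> b * norm v))"
    using U V by (intro exI[of _ "U \<inter> f -` V"] exI[of _ "c * b"]) auto
qed

lemma loc_bdd_deriv_Pair:
  assumes f: "loc_bdd_deriv S f" and g: "loc_bdd_deriv S g"
  shows "loc_bdd_deriv S (\<lambda>x. (f x, g x))"
  unfolding loc_bdd_deriv_def
proof
  fix x assume x: "x \<in> S"
  obtain U b where U: "open U" "x \<in> U" "b \<ge> 0"
    "\<And>y. y \<in> U \<Longrightarrow> \<exists>D. (f has_derivative D) (at y) \<and> (\<forall>v. norm (D v) \<le> b * norm v)" using loc_bdd_derivE[OF f x] by metis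
  obtain V c where V: "open V" "x \<in> V" "c \<ge> 0"
    "\<And>y. y \<in> V \<Longrightarrow> \<exists>D. (g has_derivative D) (at y) \<and> (\<forall>v. norm (D v) \<le> c * norm v)" using loc_bdd_derivE[OF g x] by metis
  have "\<exists>D. ((\<lambda>x. (f x, g x)) has_derivative D) (at y) \<and> (\<forall>v. norm (D v) \<le> (b + c) * norm v)" if y: "y \<in> U \<inter> V" for y
  proof -
    obtain D where D: "(f has_derivative D) (at y)" "\<And>v. norm (D v) \<le> b * norm v" using U(4) y by blast
    obtain D' where D': "(g has_derivative D') (at y)" "\<And>v. norm (D' v) \<le> c * norm v" using V(4) y by blast
    have "norm (D v, D' v) \<le> (b + c) * norm v" for v
      using norm_Pair_le[of "D v" "D' v"] D(2)[of v] D'(2)[of v] by (simp add: algebra_simps)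
    then show ?thesis using has_derivative_Pair[OF D(1) D'(1)] by blast
  qed
  then show "\<exists>U b. open U \<and> x \<in> U \<and> (\<forall>y\<in>U. \<exists>D. ((\<lambda>x. (f x, g x)) has_derivative D) (at y) \<and> (\<forall>v. norm (D v) \<le> b * norm v))"
    using U V by (intro exI[of _ "U \<inter> V"] exI[of _ "b + c"]) auto
qed

text \<open>A linear map is bounded by the sum of its norms on the basis vectors, and each of these
  changes by less than 1 near \<open>x\<close>. Hence continuity in each fixed direction, which is
  what \<open>smooth_on\<close> provides, is enough.\<close>

lemma loc_bdd_deriv_of_continuous:
  fixes f :: "'e::euclidean_space \<Rightarrow> 'f::real_normed_vector"
  assumes S: "open S" and D: "\<And>x. x \<in> S \<Longrightarrow> (f has_derivative D x) (at x)" and cont: "\<And>v. continuous_on S (\<lambda>x. D x v)"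
  shows "loc_bdd_deriv S f"
  unfolding loc_bdd_deriv_def
proof
  fix x assume x: "x \<in> S"
  define U where "U = (\<Inter>i\<in>Basis. S \<inter> (\<lambda>y. D y i) -` ball (D x i) 1)"
  have "open (S \<inter> (\<lambda>y. D y i) -` ball (D x i) 1)" for i
    using cont S by (intro continuous_open_preimage) auto
  then have "open U" unfolding U_def by (intro open_INT) auto
  have US: "U \<subseteq> S" unfolding U_def using nonempty_Basis by blast
  define b where "b = (\<Sum>i\<in>Basis. norm (D x i) + 1)"
  have "norm (D y v) \<le> b * norm v" if y: "y \<in> U" for y v
  proof -
    have lin: "linear (D y)" using D[of y] US y by (meson has_derivative_linear subsetD)
    have "D y v = D y (\<Sum>i\<in>Basis. (v \<bullet> i) *\<^sub>R i)" by (simp add: euclidean_representation)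
    also have "\<dots> = (\<Sum>i\<in>Basis. (v \<bullet> i) *\<^sub>R D y i)" by (simp add: linear_sum[OF lin] linear_scale[OF lin])
    finally have "norm (D y v) \<le> (\<Sum>i\<in>Basis. norm ((v \<bullet> i) *\<^sub>R D y i))"
      using norm_sum[of "\<lambda>i. (v \<bullet> i) *\<^sub>R D y i" Basis] by simp
    also have "\<dots> \<le> (\<Sum>i\<in>Basis. (norm (D x i) + 1) * norm v)"
    proof (rule sum_mono)
      fix i :: 'e assume i: "i \<in> Basis"
      have "dist (D x i) (D y i) < 1" using y i by (auto simp: U_def)
      then have "norm (D y i) \<le> norm (D x i) + 1"
        using norm_triangle_ineq2[of "D y i" "D x i"] by (simp add: dist_norm norm_minus_commute)
      moreover have "\<bar>v \<bullet> i\<bar> \<le> norm v" using Basis_le_norm[OF i] .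
      ultimately have "\<bar>v \<bullet> i\<bar> * norm (D y i) \<le> norm v * (norm (D x i) + 1)" by (intro mult_mono) auto
      then show "norm ((v \<bullet> i) *\<^sub>R D y i) \<le> (norm (D x i) + 1) * norm v" by (simp add: mult.commute)
    qed
    finally show ?thesis by (simp add: b_def sum_distrib_right)
  qed
  then have "\<forall>y\<in>U. \<exists>D. (f has_derivative D) (at y) \<and> (\<forall>v. norm (D v) \<le> b * norm v)" using D US by blast
  moreover have "x \<in> U" using x by (auto simp: U_def)
  ultimately show "\<exists>U b. open U \<and> x \<in> U \<and> (\<forall>y\<in>U. \<exists>D. (f has_derivative D) (at y) \<and> (\<forall>v. norm (D v) \<le> b * norm v))"
    using \<open>open U\<close> by blast
qed

lemma smooth_on_derivative:
  assumes "smooth_on S f"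
  shows "\<And>x. x \<in> S \<Longrightarrow> (f has_derivative frechet_derivative f (at x)) (at x)"
    and "\<And>v. continuous_on S (\<lambda>x. frechet_derivative f (at x) v)"
proof -
  have "Ck_on (Suc 0) S f" using assms unfolding smooth_on_def by blast
  then show "\<And>x. x \<in> S \<Longrightarrow> (f has_derivative frechet_derivative f (at x)) (at x)"
    "\<And>v. continuous_on S (\<lambda>x. frechet_derivative f (at x) v)" by (auto simp: frechet_derivative_works)
qed

lemma smooth_on_continuous: "smooth_on S f \<Longrightarrow> continuous_on S f"
  unfolding smooth_on_def by (metis Ck_on.simps(1))

lemma loc_bdd_deriv_smooth: "smooth_on S f \<Longrightarrow> open S \<Longrightarrow> loc_bdd_deriv S f"
  by (rule loc_bdd_deriv_of_continuous[of S f "\<lambda>x. frechet_derivative f (at x)"]) (auto intro: smooth_on_derivative)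

lemma loc_bdd_deriv_const: "loc_bdd_deriv S (\<lambda>_. c)"
  by (rule loc_bdd_deriv_subset[OF loc_bdd_deriv_of_continuous[of UNIV _ "\<lambda>_ _. 0"]]) auto

lemma loc_bdd_deriv_linear: "bounded_linear f \<Longrightarrow> loc_bdd_deriv S f"
  by (rule loc_bdd_deriv_subset[OF loc_bdd_deriv_of_continuous[of UNIV _ "\<lambda>_. f"]])
    (auto intro: bounded_linear_imp_has_derivative)

lemma loc_bdd_deriv_mult:
  fixes f g :: "'e::euclidean_space \<Rightarrow> real"
  assumes "loc_bdd_deriv S f" "loc_bdd_deriv S g" shows "loc_bdd_deriv S (\<lambda>x. f x * g x)"
proof -
  have "loc_bdd_deriv UNIV (\<lambda>p::real \<times> real. fst p * snd p)"
    by (rule loc_bdd_deriv_of_continuous[of UNIV _ "\<lambda>p h. fst p * snd h + fst h * snd p"])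
      (auto intro!: derivative_eq_intros continuous_intros)
  from loc_bdd_deriv_compose[OF loc_bdd_deriv_Pair[OF assms] this] show ?thesis by simp
qed

lemma loc_bdd_deriv_diff:
  assumes "loc_bdd_deriv S f" "loc_bdd_deriv S g" shows "loc_bdd_deriv S (\<lambda>x. f x - (g x :: real))"
proof -
  have "loc_bdd_deriv UNIV (\<lambda>p::real \<times> real. fst p - snd p)"
    by (rule loc_bdd_deriv_linear) (intro bounded_linear_sub bounded_linear_fst bounded_linear_snd)
  from loc_bdd_deriv_compose[OF loc_bdd_deriv_Pair[OF assms] this] show ?thesis by simp
qed

text \<open>Compactness makes the bound on the derivative uniform on \<open>K\<close>; convexity
  then allows the mean value inequality.\<close>

lemma loc_bdd_deriv_lipschitz:
  fixes f :: "'e::euclidean_space \<Rightarrow> 'f::real_normed_vector"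
  assumes f: "loc_bdd_deriv S f" and K: "compact K" "convex K" "K \<subseteq> S"
  shows "\<exists>b\<ge>0. \<forall>y\<in>K. (\<exists>D. (f has_derivative D) (at y) \<and> (\<forall>v. norm (D v) \<le> b * norm v)) \<and>
     (\<forall>z\<in>K. norm (f y - f z) \<le> b * norm (y - z))"
proof -
  have "\<exists>b. \<forall>y\<in>K. \<exists>D. (f has_derivative D) (at y) \<and> (\<forall>v. norm (D v) \<le> b * norm v)"
  proof (rule compact_local_bound[OF K(1)])
    fix y b b'
    assume "\<exists>D. (f has_derivative D) (at y) \<and> (\<forall>v. norm (D v) \<le> b * norm v)" and b: "b \<le> b'"
    then obtain D where D: "(f has_derivative D) (at y)" "\<And>v. norm (D v) \<le> b * norm v" by blast
    have "norm (D v) \<le> b' * norm v" for v using D(2)[of v] mult_right_mono[OF b, of "norm v"] by simp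
    then show "\<exists>D. (f has_derivative D) (at y) \<and> (\<forall>v. norm (D v) \<le> b' * norm v)" using D by blast
  next
    fix x assume "x \<in> K"
    then show "\<exists>U b. open U \<and> x \<in> U \<and> (\<forall>y\<in>U. \<exists>D. (f has_derivative D) (at y) \<and> (\<forall>v. norm (D v) \<le> b * norm v))"
      using f K(3) unfolding loc_bdd_deriv_def by blast
  qed
  then obtain b0 where b0: "\<And>y. y \<in> K \<Longrightarrow> \<exists>D. (f has_derivative D) (at y) \<and> (\<forall>v. norm (D v) \<le> b0 * norm v)" by blast
  define b where "b = \<bar>b0\<bar>"
  have b: "\<exists>D. (f has_derivative D) (at y) \<and> (\<forall>v. norm (D v) \<le> b * norm v)" if y: "y \<in> K" for y
  proof -
    obtain D where D: "(f has_derivative D) (at y)" "\<And>v. norm (D v) \<le> b0 * norm v" using b0[OF y] by blast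
    have "norm (D v) \<le> b * norm v" for v
      by (rule order_trans[OF D(2)]) (auto simp: b_def intro: mult_right_mono)
    then show ?thesis using D by blast
  qed
  then obtain D where D: "\<And>y. y \<in> K \<Longrightarrow> (f has_derivative D y) (at y)" "\<And>y v. y \<in> K \<Longrightarrow> norm (D y v) \<le> b * norm v" by metis
  have "norm (f y - f z) \<le> b * norm (y - z)" if "y \<in> K" "z \<in> K" for y z
  proof (rule differentiable_bound[OF K(2) _ _ that])
    show "(f has_derivative D x) (at x within K)" if "x \<in> K" for x using D(1)[OF that] by (rule has_derivative_at_withinI)
    show "onorm (D x) \<le> b" if "x \<in> K" for x using D(2)[OF that] by (intro onorm_le)
  qed
  moreover have "b \<ge> 0" by (simp add: b_def)
  ultimately show ?thesis using b by blast
qed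

section \<open>A cut-off function\<close>

text \<open>With the \<open>C\<^sup>1\<close> function \<open>q u = (max 0 u)\<^sup>2\<close>, this is \<open>1 - q (1 - q u)\<close> at \<open>u = 2 - \<bar>v - p\<bar>\<^sup>2 / r\<^sup>2\<close>.\<close>

definition plateau :: "'e::euclidean_space \<Rightarrow> real \<Rightarrow> 'e \<Rightarrow> real" where
  "plateau p r v = 1 - (max 0 (1 - (max 0 (2 - (norm (v - p))\<^sup>2 / r\<^sup>2))\<^sup>2))\<^sup>2"

lemma plateau_one: "r > 0 \<Longrightarrow> norm (v - p) \<le> r \<Longrightarrow> plateau p r v = 1"
proof -
  assume r: "r > 0" and v: "norm (v - p) \<le> r"
  then have "(norm (v - p))\<^sup>2 \<le> r\<^sup>2" by (intro power_mono) auto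
  then have "(norm (v - p))\<^sup>2 / r\<^sup>2 \<le> 1" using r by simp
  then have "max 0 (2 - (norm (v - p))\<^sup>2 / r\<^sup>2) \<ge> 1" by simp
  then have "(max 0 (2 - (norm (v - p))\<^sup>2 / r\<^sup>2))\<^sup>2 \<ge> 1" by (rule one_le_power)
  then show ?thesis by (simp add: plateau_def)
qed

lemma plateau_zero: "r > 0 \<Longrightarrow> (norm (v - p))\<^sup>2 \<ge> 2 * r\<^sup>2 \<Longrightarrow> plateau p r v = 0"
proof -
  assume r: "r > 0" and "(norm (v - p))\<^sup>2 \<ge> 2 * r\<^sup>2"
  then have "(norm (v - p))\<^sup>2 / r\<^sup>2 \<ge> 2" by (simp add: pos_le_divide_eq)
  then show ?thesis by (simp add: plateau_def max_def)
qed

lemma loc_bdd_deriv_max_sq: "loc_bdd_deriv UNIV (\<lambda>u::real. (max 0 u)\<^sup>2)"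
proof (rule loc_bdd_deriv_of_continuous[of UNIV _ "\<lambda>u h. 2 * max 0 u * h"])
  fix u :: real
  have "((\<lambda>u::real. (max 0 u)\<^sup>2) has_real_derivative 2 * max 0 u) (at u)"
  proof -
    consider "u > 0" | "u < 0" | "u = 0" by linarith
    then show ?thesis
    proof cases
      case 1
      have "((\<lambda>u::real. u\<^sup>2) has_real_derivative 2 * max 0 u) (at u)" using 1 by (auto intro!: derivative_eq_intros)
      then show ?thesis by (rule has_field_derivative_transform_within_open[of _ _ _ "{0<..}"]) (use 1 in auto)
    next
      case 2
      have "((\<lambda>u::real. 0) has_real_derivative 2 * max 0 u) (at u)" using 2 by auto
      then show ?thesis by (rule has_field_derivative_transform_within_open[of _ _ _ "{..<0}"]) (use 2 in auto)
    next
      case 3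
      have "((\<lambda>h::real. (max 0 (0 + h))\<^sup>2 / h - 0) \<longlongrightarrow> 0) (at 0)"
      proof (rule Lim_null_comparison)
        show "\<forall>\<^sub>F h in at 0. norm ((max 0 (0 + h))\<^sup>2 / h - 0) \<le> \<bar>h\<bar>"
          by (intro always_eventually) (auto simp: max_def power2_eq_square)
        show "((\<lambda>h::real. \<bar>h\<bar>) \<longlongrightarrow> 0) (at 0)" by (rule tendsto_rabs_zero) (rule tendsto_ident_at)
      qed
      then show ?thesis using 3 by (simp add: DERIV_def)
    qed
  qed
  then show "((\<lambda>u. (max 0 u)\<^sup>2) has_derivative (\<lambda>h. 2 * max 0 u * h)) (at u)" by (simp add: has_field_derivative_def)
qed (auto intro!: continuous_intros)

lemma loc_bdd_deriv_plateau: "loc_bdd_deriv UNIV (plateau p r)"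
proof -
  have 1: "loc_bdd_deriv UNIV (\<lambda>v. 2 - (norm (v - p))\<^sup>2 / r\<^sup>2)"
    by (rule loc_bdd_deriv_of_continuous[of UNIV _ "\<lambda>v h. - (2 * ((v - p) \<bullet> h)) / r\<^sup>2"])
      (auto simp: power2_norm_eq_inner inner_commute divide_inverse intro!: derivative_eq_intros continuous_intros)
  have 2: "loc_bdd_deriv UNIV (\<lambda>v. 1 - (max 0 (2 - (norm (v - p))\<^sup>2 / r\<^sup>2))\<^sup>2)"
    by (intro loc_bdd_deriv_diff loc_bdd_deriv_const loc_bdd_deriv_compose[OF 1 loc_bdd_deriv_max_sq]) auto
  show ?thesis unfolding plateau_def
    by (intro loc_bdd_deriv_diff loc_bdd_deriv_const loc_bdd_deriv_compose[OF 2 loc_bdd_deriv_max_sq]) auto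
qed

section \<open>A finite family of functions controlling the charts\<close>

locale atlas =
  fixes \<A> :: "('a::{t2_space,second_countable_topology}, 'e::euclidean_space) chart set"
  assumes atlas: "smooth_atlas \<A>" and compact_space: "compact (UNIV :: 'a set)"
begin

abbreviation dom :: "('a, 'e) chart \<Rightarrow> 'a set" where "dom c \<equiv> fst c"
abbreviation img :: "('a, 'e) chart \<Rightarrow> 'e set" where "img c \<equiv> snd c ` fst c"
abbreviation chart_inv :: "('a, 'e) chart \<Rightarrow> 'e \<Rightarrow> 'a" where "chart_inv c \<equiv> inv_into (fst c) (snd c)"

lemma chart_ex: "\<exists>c\<in>\<A>. p \<in> dom c"
  using atlas unfolding smooth_atlas_def by blast

lemma chart_open: "c \<in> \<A> \<Longrightarrow> open (dom c)" "c \<in> \<A> \<Longrightarrow> open (img c)"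
  using atlas unfolding smooth_atlas_def by (cases c; auto)+

lemma chart_homeo: assumes "c \<in> \<A>" obtains \<psi> where "homeomorphism (dom c) (img c) (snd c) \<psi>"
  using atlas assms unfolding smooth_atlas_def by (cases c) auto

lemma chart_inj: "c \<in> \<A> \<Longrightarrow> inj_on (snd c) (dom c)"
proof -
  assume "c \<in> \<A>"
  then obtain \<psi> where h: "homeomorphism (dom c) (img c) (snd c) \<psi>" by (rule chart_homeo)
  show "inj_on (snd c) (dom c)" by (rule inj_on_inverseI[of _ \<psi>]) (rule homeomorphism_apply1[OF h])
qed

lemma chart_cont: "c \<in> \<A> \<Longrightarrow> continuous_on (dom c) (snd c)"
proof -
  assume "c \<in> \<A>"
  then obtain \<psi> where h: "homeomorphism (dom c) (img c) (snd c) \<psi>" by (rule chart_homeo)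
  show "continuous_on (dom c) (snd c)" by (rule homeomorphism_cont1[OF h])
qed

lemma chart_inv_left [simp]: "c \<in> \<A> \<Longrightarrow> p \<in> dom c \<Longrightarrow> chart_inv c (snd c p) = p"
  using chart_inj by (rule inv_into_f_f)

lemma chart_inv_right: "x \<in> img c \<Longrightarrow> snd c (chart_inv c x) = x" "x \<in> img c \<Longrightarrow> chart_inv c x \<in> dom c"
  by (auto intro: f_inv_into_f inv_into_into)

lemma chart_inv_cont: assumes "c \<in> \<A>" shows "continuous_on (img c) (chart_inv c)"
proof -
  obtain \<psi> where h: "homeomorphism (dom c) (img c) (snd c) \<psi>" by (rule chart_homeo[OF assms])
  have "chart_inv c x = \<psi> x" if "x \<in> img c" for x
    using that homeomorphism_apply1[OF h] assms by auto
  then show ?thesis using homeomorphism_cont2[OF h] by (simp cong: continuous_on_cong)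
qed

lemma chart_image_open:
  assumes c: "c \<in> \<A>" and N: "open N" shows "open (snd c ` (dom c \<inter> N))"
proof -
  have "snd c ` (dom c \<inter> N) = img c \<inter> chart_inv c -` N"
    using c by (auto simp: chart_inv_right)
  then show ?thesis using continuous_open_preimage[OF chart_inv_cont[OF c] chart_open(2)[OF c] N] by simp
qed

lemma chart_preimage_open:
  assumes c: "c \<in> \<A>" and N: "open N" shows "open (dom c \<inter> snd c -` N)"
  by (rule continuous_open_preimage[OF chart_cont[OF c] chart_open(1)[OF c] N])

lemma transition_smooth:
  assumes "c \<in> \<A>" "c' \<in> \<A>" shows "smooth_on (snd c ` (dom c \<inter> dom c')) (transition c c' (\<lambda>x. x))"
  using assms atlas unfolding smooth_atlas_def by blast

lemma transition_open: "c \<in> \<A> \<Longrightarrow> c' \<in> \<A> \<Longrightarrow> open (snd c ` (dom c \<inter> dom c'))"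
  by (intro chart_image_open chart_open)

lemma transition_bdd:
  assumes "c \<in> \<A>" "c' \<in> \<A>" shows "loc_bdd_deriv (snd c ` (dom c \<inter> dom c')) (\<lambda>y. snd c' (chart_inv c y))"
  using loc_bdd_deriv_smooth[OF transition_smooth[OF assms] transition_open[OF assms]]
  by (simp add: transition_def o_def)

text \<open>The class of test functions on the manifold: \<open>C^1\<close> in the weak sense of
  \<open>loc_bdd_deriv\<close>, read in every chart of the atlas.\<close>

definition mfun :: "('a \<Rightarrow> real) \<Rightarrow> bool" where
  "mfun f \<longleftrightarrow> (\<forall>c\<in>\<A>. loc_bdd_deriv (img c) (\<lambda>y. f (chart_inv c y)))"

lemma mfun_continuous: assumes "mfun f" shows "continuous_on UNIV f"
proof (rule continuous_at_imp_continuous_on, rule ballI)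
  fix p :: 'a
  obtain c where c: "c \<in> \<A>" "p \<in> dom c" using chart_ex by blast
  have "continuous_on (img c) (\<lambda>y. f (chart_inv c y))"
    using assms c unfolding mfun_def by (intro continuous_at_imp_continuous_on ballI loc_bdd_deriv_isCont[of "img c"]) auto
  then have "continuous_on (dom c) (\<lambda>q. f (chart_inv c (snd c q)))"
    by (rule continuous_on_compose2[OF _ chart_cont[OF c(1)]]) auto
  then have "continuous_on (dom c) f" using c by (simp cong: continuous_on_cong)
  then show "isCont f p" using chart_open(1)[OF c(1)] c(2) by (simp add: continuous_on_eq_continuous_at)
qed

text \<open>Inside the chart domain the function is a composition with a transition map. At a point
  outside, the preimage of \<open>K\<close> is compact, hence closed in a Hausdorff space, so the
  function vanishes on a whole neighbourhood.\<close>

lemma mfun_bump: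
  fixes g :: "'e \<Rightarrow> real"
  assumes c: "c \<in> \<A>" and g: "loc_bdd_deriv UNIV g" and K: "compact K" "K \<subseteq> img c" and z: "\<And>y. y \<notin> K \<Longrightarrow> g y = 0"
  shows "mfun (\<lambda>p. if p \<in> dom c then g (snd c p) else 0)" (is "mfun ?f")
  unfolding mfun_def
proof (intro ballI loc_bdd_deriv_local)
  fix c' y assume c': "c' \<in> \<A>" and y: "y \<in> img c'"
  define p where "p = chart_inv c' y"
  have p: "p \<in> dom c'" "snd c' p = y" using y by (auto simp: p_def chart_inv_right)
  show "\<exists>N T g. open N \<and> y \<in> N \<and> loc_bdd_deriv T g \<and> y \<in> T \<and> (\<forall>y\<in>N. ?f (chart_inv c' y) = g y)"
  proof (cases "p \<in> dom c")
    case True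
    define T where "T = snd c' ` (dom c' \<inter> dom c)"
    have "loc_bdd_deriv T (\<lambda>y. g (snd c (chart_inv c' y)))"
      unfolding T_def by (rule loc_bdd_deriv_compose[OF transition_bdd[OF c' c] g]) auto
    moreover have "open T" unfolding T_def by (rule transition_open[OF c' c])
    moreover have "y \<in> T" using p True by (auto simp: T_def)
    moreover have "?f (chart_inv c' u) = g (snd c (chart_inv c' u))" if "u \<in> T" for u
      using that c' by (auto simp: T_def)
    ultimately show ?thesis
      by (intro exI[of _ T] exI[of _ "\<lambda>y. g (snd c (chart_inv c' y))"]) auto
  next
    case False
    have "compact (chart_inv c ` K)" using K chart_inv_cont[OF c] by (intro compact_continuous_image continuous_on_subset[OF chart_inv_cont[OF c]]) auto
    then have "closed (chart_inv c ` K)" by (rule compact_imp_closed)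
    then have o: "open (snd c' ` (dom c' \<inter> - chart_inv c ` K))" by (intro chart_image_open[OF c'] open_Compl)
    have "p \<notin> chart_inv c ` K" using False K chart_inv_right(2)[of _ c] by auto
    then have "y \<in> snd c' ` (dom c' \<inter> - chart_inv c ` K)" using p by auto
    moreover have "?f (chart_inv c' u) = 0" if u: "u \<in> snd c' ` (dom c' \<inter> - chart_inv c ` K)" for u
    proof -
      obtain q where q: "u = snd c' q" "q \<in> dom c'" "q \<notin> chart_inv c ` K" using u by auto
      have "snd c q \<notin> K" if "q \<in> dom c" using q(3) c that by (metis chart_inv_left image_eqI)
      then show ?thesis using q c' z by auto
    qed
    ultimately show ?thesis using o loc_bdd_deriv_const[of UNIV "0::real"]
      by (intro exI[of _ "snd c' ` (dom c' \<inter> - chart_inv c ` K)"] exI[of _ UNIV] exI[of _ "\<lambda>_. 0"]) auto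
  qed
qed

end

text \<open>The finite family consists of the plateau functions of finitely many charts together with
  the cut-off coordinates; near a point where the plateau function is 1 it controls the chart.\<close>

locale atlas_family = atlas \<A>
  for \<A> :: "('a::{t2_space,second_countable_topology}, 'e::euclidean_space) chart set" +
  fixes P :: "(('a, 'e) chart \<times> 'e \<times> real) set"
  assumes P_fin: "finite P"
    and P_chart: "\<And>c x r. (c,x,r) \<in> P \<Longrightarrow> c \<in> \<A> \<and> r > 0 \<and> cball x (2 * r) \<subseteq> img c"
    and P_cover: "\<And>p. \<exists>(c,x,r)\<in>P. p \<in> dom c \<and> norm (snd c p - x) < r"
begin

definition bump :: "(('a, 'e) chart \<times> 'e \<times> real) \<Rightarrow> 'a \<Rightarrow> real" where
  "bump = (\<lambda>(c,x,r) p. if p \<in> dom c then plateau x r (snd c p) else 0)"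

definition coord :: "(('a, 'e) chart \<times> 'e \<times> real) \<Rightarrow> 'e \<Rightarrow> 'a \<Rightarrow> real" where
  "coord = (\<lambda>(c,x,r) b p. if p \<in> dom c then plateau x r (snd c p) * (snd c p \<bullet> b) else 0)"

text \<open>Evaluating all these functions embeds the compact manifold into a Euclidean space, as in
  the elementary form of the Whitney embedding theorem; \<open>d\<close> below is the
  \<open>l^1\<close> distance of the images.\<close>

definition \<Phi> :: "('a \<Rightarrow> real) set" where
  "\<Phi> = bump ` P \<union> (\<lambda>(k,b). coord k b) ` (P \<times> Basis)"

lemma Phi_finite: "finite \<Phi>" using P_fin by (auto simp: \<Phi>_def)

text \<open>The plateau function vanishes from radius \<open>sqrt 2 * r\<close> on, so it is
  supported well inside the ball of radius \<open>2 * r\<close> that lies in the chart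
  image.\<close>

lemma norm_sq_lower: "r > 0 \<Longrightarrow> \<not> norm y \<le> 2 * r \<Longrightarrow> 2 * r\<^sup>2 \<le> (norm (y :: 'e))\<^sup>2"
proof -
  assume "r > 0" "\<not> norm y \<le> 2 * r"
  then have "2 * r \<le> norm y" "0 \<le> 2 * r" by auto
  then have "(2 * r)\<^sup>2 \<le> (norm y)\<^sup>2" by (rule power_mono)
  moreover have "(2 * r)\<^sup>2 = 4 * r\<^sup>2" by (simp add: power_mult_distrib)
  ultimately show ?thesis using zero_le_power2[of r] by linarith
qed

lemma Phi_mfun: assumes "f \<in> \<Phi>" shows "mfun f"
proof -
  have cb: "y \<notin> cball x (2 * r) \<Longrightarrow> r > 0 \<Longrightarrow> plateau x r y = 0" for x y :: 'e and r
  proof -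
    assume y: "y \<notin> cball x (2 * r)" and r: "r > 0"
    have "\<not> norm (y - x) \<le> 2 * r" using y by (simp add: dist_norm norm_minus_commute)
    then show "plateau x r y = 0" by (intro plateau_zero[OF r] norm_sq_lower[OF r])
  qed
  have "mfun (bump k)" if "k \<in> P" for k
  proof -
    obtain c x r where k: "k = (c,x,r)" by (cases k)
    have "c \<in> \<A>" "r > 0" "cball x (2 * r) \<subseteq> img c" using P_chart that k by auto
    then show ?thesis unfolding bump_def k prod.case
      by (intro mfun_bump[OF _ loc_bdd_deriv_plateau compact_cball]) (auto simp: cb)
  qed
  moreover have "mfun (coord k b)" if "k \<in> P" for k b
  proof -
    obtain c x r where k: "k = (c,x,r)" by (cases k)
    have cr: "c \<in> \<A>" "r > 0" "cball x (2 * r) \<subseteq> img c" using P_chart that k by auto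
    have "loc_bdd_deriv UNIV (\<lambda>v. plateau x r v * (v \<bullet> b))"
      by (intro loc_bdd_deriv_mult loc_bdd_deriv_plateau loc_bdd_deriv_linear bounded_linear_inner_left)
    from mfun_bump[OF cr(1) this compact_cball cr(3)] show ?thesis
      unfolding coord_def k prod.case using cb cr(2) by simp
  qed
  ultimately show ?thesis using assms by (auto simp: \<Phi>_def)
qed

abbreviation d :: "'a \<Rightarrow> 'a \<Rightarrow> real" where "d x y \<equiv> (\<Sum>f\<in>\<Phi>. \<bar>f x - f y\<bar>)"

lemma Phi_le: "f \<in> \<Phi> \<Longrightarrow> \<bar>f x - f y\<bar> \<le> d x y"
  using Phi_finite by (intro member_le_sum) auto

text \<open>The plateau function is 1 at \<open>p\<close>, so at a point \<open>q\<close> with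
  \<open>d p q\<close> at most 1/2 it is still positive; this puts \<open>q\<close> into the same
  chart. The cut-off coordinates then control the true coordinates, because the cut-off factor at
  \<open>q\<close> differs from 1 by at most \<open>d p q\<close>.\<close>

lemma chart_control:
  assumes k: "(c,x,r) \<in> P" and p: "p \<in> dom c" "norm (snd c p - x) \<le> r" and q: "d p q \<le> 1/2"
  shows "q \<in> dom c" "norm (snd c q - x) < 3/2 * r"
    "norm (snd c p - snd c q) \<le> DIM('e) * (1 + norm x + 2 * r) * d p q"
proof -
  have cr: "c \<in> \<A>" "r > 0" using P_chart[OF k] by auto
  have "bump (c,x,r) \<in> \<Phi>" using k by (auto simp: \<Phi>_def)
  then have bd: "\<bar>bump (c,x,r) p - bump (c,x,r) q\<bar> \<le> d p q" by (rule Phi_le)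
  have bp: "bump (c,x,r) p = 1" using p cr by (simp add: bump_def plateau_one)
  define \<beta> where "\<beta> = bump (c,x,r) q"
  have \<beta>: "\<beta> > 0" "\<bar>1 - \<beta>\<bar> \<le> d p q" using bd bp q by (auto simp: \<beta>_def)
  show qd: "q \<in> dom c" using \<beta> by (auto simp: \<beta>_def bump_def split: if_splits)
  then have pl: "plateau x r (snd c q) = \<beta>" by (simp add: \<beta>_def bump_def)
  then have "\<not> 2 * r\<^sup>2 \<le> (norm (snd c q - x))\<^sup>2" using plateau_zero[OF cr(2), of "snd c q" x] \<beta> by auto
  \<comment> \<open>A positive plateau value only gives radius \<open>sqrt 2 * r\<close>, which is
    rounded up to \<open>3/2 * r\<close>.\<close>
  moreover have "2 * r\<^sup>2 \<le> (3/2 * r)\<^sup>2" by (simp add: power2_eq_square)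
  ultimately have "(norm (snd c q - x))\<^sup>2 < (3/2 * r)\<^sup>2" by linarith
  then show n: "norm (snd c q - x) < 3/2 * r" using cr by (intro power2_less_imp_less[of _ "3/2 * r"]) auto
  have nq: "norm (snd c q) \<le> norm x + 2 * r"
    using norm_triangle_sub[of "snd c q" x] n cr by linarith
  have "\<bar>(snd c p - snd c q) \<bullet> b\<bar> \<le> (1 + norm x + 2 * r) * d p q" if b: "b \<in> Basis" for b
  proof -
    have "coord (c,x,r) b \<in> \<Phi>" using k b by (auto simp: \<Phi>_def)
    then have "\<bar>coord (c,x,r) b p - coord (c,x,r) b q\<bar> \<le> d p q" by (rule Phi_le)
    then have 1: "\<bar>snd c p \<bullet> b - \<beta> * (snd c q \<bullet> b)\<bar> \<le> d p q"
      using p qd pl cr by (simp add: coord_def plateau_one)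
    have "\<bar>(\<beta> - 1) * (snd c q \<bullet> b)\<bar> \<le> d p q * (norm x + 2 * r)"
      unfolding abs_mult using \<beta> nq Basis_le_norm[OF b, of "snd c q"] by (intro mult_mono) (auto simp: abs_minus_commute intro: sum_nonneg)
    \<comment> \<open>The first bracket is a difference of values of one function of the family; the
      second term is the error made by the cut-off factor \<open>\<beta>\<close> at
      \<open>q\<close>.\<close>
    moreover have "(snd c p - snd c q) \<bullet> b = (snd c p \<bullet> b - \<beta> * (snd c q \<bullet> b)) + (\<beta> - 1) * (snd c q \<bullet> b)"
      by (simp add: inner_diff_left algebra_simps)
    ultimately show ?thesis using 1 by (simp add: algebra_simps)
  qed
  then have "(\<Sum>b\<in>Basis. \<bar>(snd c p - snd c q) \<bullet> b\<bar>) \<le> (\<Sum>b\<in>(Basis::'e set). (1 + norm x + 2 * r) * d p q)"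
    by (intro sum_mono)
  then show "norm (snd c p - snd c q) \<le> DIM('e) * (1 + norm x + 2 * r) * d p q"
    using norm_le_l1[of "snd c p - snd c q"] by (simp add: mult.assoc)
qed

lemma Phi_separates: assumes "p \<noteq> q" shows "\<exists>f\<in>\<Phi>. f p \<noteq> f q"
proof (rule ccontr)
  assume "\<not> ?thesis"
  then have d0: "d p q = 0" by (intro sum.neutral) simp
  obtain c x r where k: "(c,x,r) \<in> P" "p \<in> dom c" "norm (snd c p - x) < r" using P_cover[of p] by auto
  have "q \<in> dom c" "norm (snd c p - snd c q) \<le> DIM('e) * (1 + norm x + 2 * r) * d p q"
    using chart_control[OF k(1,2), of q] k(3) d0 by simp_all
  then have "snd c p = snd c q" "q \<in> dom c" using d0 by simp_all
  then show False using assms chart_inj[of c] P_chart[OF k(1)] k(2) by (auto dest: inj_onD)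
qed

lemma chart_lipschitz_const:
  obtains Lc where "Lc > 0" "\<And>c x r. (c,x,r) \<in> P \<Longrightarrow> DIM('e) * (1 + norm x + 2 * r) \<le> Lc"
proof -
  define Lc where "Lc = (\<Sum>(c,x,r)\<in>P. \<bar>DIM('e) * (1 + norm x + 2 * r)\<bar>) + 1"
  have "DIM('e) * (1 + norm x + 2 * r) \<le> Lc" if "(c,x,r) \<in> P" for c x r
  proof -
    have "\<bar>DIM('e) * (1 + norm x + 2 * r)\<bar> \<le> (\<Sum>(c,x,r)\<in>P. \<bar>DIM('e) * (1 + norm x + 2 * r)\<bar>)"
      using member_le_sum[OF that, of "\<lambda>(c,x,r). \<bar>DIM('e) * (1 + norm x + 2 * r)\<bar>"] P_fin by auto
    then show ?thesis unfolding Lc_def by linarith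
  qed
  moreover have "Lc > 0" unfolding Lc_def by (auto intro!: add_nonneg_pos sum_nonneg)
  ultimately show ?thesis using that by blast
qed

lemma segment_in_ball:
  fixes u v :: 'e
  assumes "norm (u - x) \<le> \<rho>" "norm (v - x) \<le> \<rho>" "s \<in> {0..1}"
  shows "norm ((1 - s) *\<^sub>R u + s *\<^sub>R v - x) \<le> \<rho>"
proof -
  have "(1 - s) *\<^sub>R u + s *\<^sub>R v \<in> cball x \<rho>"
    using convex_cball[of x \<rho>, unfolded convex_alt] assms by (auto simp: dist_norm norm_minus_commute)
  then show ?thesis by (simp add: dist_norm norm_minus_commute)
qed

text \<open>Each of the finitely many functions is Lipschitz on each of the finitely many closed
  coordinate balls, and a coordinate segment is traversed at constant speed. Radius
  \<open>3/2 * r\<close> is the one delivered by \<open>chart_control\<close>.\<close>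

lemma segment_lipschitz:
  obtains Ls where "Ls > 0"
    "\<And>c x r u v s s'. (c,x,r) \<in> P \<Longrightarrow> norm (u - x) \<le> 3/2 * r \<Longrightarrow> norm (v - x) \<le> 3/2 * r \<Longrightarrow> s \<in> {0..1} \<Longrightarrow> s' \<in> {0..1} \<Longrightarrow>
      d (chart_inv c ((1 - s) *\<^sub>R u + s *\<^sub>R v)) (chart_inv c ((1 - s') *\<^sub>R u + s' *\<^sub>R v)) \<le> Ls * norm (u - v) * \<bar>s - s'\<bar>"
proof -
  define Q where "Q = (\<lambda>((c, x, r), f :: 'a \<Rightarrow> real) b. \<forall>y\<in>cball x (3/2 * r). \<forall>z\<in>cball (x :: 'e) (3/2 * r).
    norm (f (chart_inv (c :: ('a, 'e) chart) y) - f (chart_inv c z)) \<le> b * norm (y - z))"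
  have "\<exists>b\<ge>0. \<forall>y\<in>cball x (3/2 * r). \<forall>z\<in>cball x (3/2 * r). norm (f (chart_inv c y) - f (chart_inv c z)) \<le> b * norm (y - z)"
    if "(c,x,r) \<in> P" "f \<in> \<Phi>" for c x r f
  proof -
    have "loc_bdd_deriv (img c) (\<lambda>y. f (chart_inv c y))" using Phi_mfun[OF that(2)] P_chart[OF that(1)] unfolding mfun_def by blast
    moreover have "cball x (3/2 * r) \<subseteq> img c" using P_chart[OF that(1)] by (intro order_trans[OF subset_cball, of "3/2 * r" "2 * r" x "img c"]) auto
    ultimately show ?thesis using loc_bdd_deriv_lipschitz[of "img c" "\<lambda>y. f (chart_inv c y)" "cball x (3/2 * r)"] by auto
  qed
  then have "\<forall>k\<in>P \<times> \<Phi>. \<exists>b. 0 \<le> b \<and> Q k b" by (auto simp: Q_def)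
  then obtain b where b: "\<And>k. k \<in> P \<times> \<Phi> \<Longrightarrow> b k \<ge> 0" "\<And>k. k \<in> P \<times> \<Phi> \<Longrightarrow> Q k (b k)"
    by metis
  define Ls where "Ls = (\<Sum>k\<in>P \<times> \<Phi>. b k) + 1"
  have "Ls > 0" unfolding Ls_def using b(1) by (intro add_nonneg_pos sum_nonneg) auto
  moreover have "d (chart_inv c ((1 - s) *\<^sub>R u + s *\<^sub>R v)) (chart_inv c ((1 - s') *\<^sub>R u + s' *\<^sub>R v)) \<le> Ls * norm (u - v) * \<bar>s - s'\<bar>"
    if k: "(c,x,r) \<in> P" and uv: "norm (u - x) \<le> 3/2 * r" "norm (v - x) \<le> 3/2 * r" and s: "s \<in> {0..1}" "s' \<in> {0..1}" for c x r u v s s'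
  proof -
    define y z where "y = (1 - s) *\<^sub>R u + s *\<^sub>R v" and "z = (1 - s') *\<^sub>R u + s' *\<^sub>R v"
    have yz: "y \<in> cball x (3/2 * r)" "z \<in> cball x (3/2 * r)"
      using segment_in_ball[OF uv s(1)] segment_in_ball[OF uv s(2)] by (auto simp: y_def z_def dist_norm norm_minus_commute)
    have "y - z = (s' - s) *\<^sub>R (u - v)" by (simp add: y_def z_def algebra_simps)
    then have nyz: "norm (y - z) = norm (u - v) * \<bar>s - s'\<bar>" by (simp add: abs_minus_commute)
    have "d (chart_inv c y) (chart_inv c z) \<le> (\<Sum>f\<in>\<Phi>. b ((c,x,r),f) * norm (y - z))"
    proof (rule sum_mono)
      fix f assume "f \<in> \<Phi>"
      then have "Q ((c,x,r),f) (b ((c,x,r),f))" using k by (intro b(2)) simp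
      then show "\<bar>f (chart_inv c y) - f (chart_inv c z)\<bar> \<le> b ((c,x,r),f) * norm (y - z)"
        unfolding Q_def prod.case using yz by fastforce
    qed
    also have "\<dots> = (\<Sum>f\<in>\<Phi>. b ((c,x,r),f)) * norm (y - z)" by (simp add: sum_distrib_right)
    also have "\<dots> \<le> Ls * norm (y - z)"
    proof (intro mult_right_mono)
      have "(\<Sum>f\<in>\<Phi>. b ((c,x,r),f)) \<le> (\<Sum>k\<in>P. \<Sum>f\<in>\<Phi>. b (k,f))"
        using k b(1) P_fin by (intro member_le_sum[of "(c,x,r)" P "\<lambda>k. \<Sum>f\<in>\<Phi>. b (k,f)"]) (auto intro: sum_nonneg)
      also have "\<dots> = (\<Sum>k\<in>P \<times> \<Phi>. b k)" using P_fin Phi_finite by (simp add: sum.cartesian_product)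
      finally show "(\<Sum>f\<in>\<Phi>. b ((c,x,r),f)) \<le> Ls" by (simp add: Ls_def)
    qed simp
    finally show ?thesis unfolding y_def[symmetric] z_def[symmetric] using nyz by (simp add: mult.assoc)
  qed
  ultimately show ?thesis using that by blast
qed

end

lemma (in atlas) family_exists: obtains P where "atlas_family \<A> P"
proof -
  have "\<forall>p. \<exists>c r. c \<in> \<A> \<and> p \<in> dom c \<and> r > 0 \<and> cball (snd c p) (2 * r) \<subseteq> img c"
  proof
    fix p
    obtain c where c: "c \<in> \<A>" "p \<in> dom c" using chart_ex by blast
    then have "snd c p \<in> img c" by blast
    then obtain e where e: "e > 0" "cball (snd c p) e \<subseteq> img c"
      using chart_open(2)[OF c(1)] unfolding open_contains_cball by blast
    show "\<exists>c r. c \<in> \<A> \<and> p \<in> dom c \<and> r > 0 \<and> cball (snd c p) (2 * r) \<subseteq> img c"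
      by (rule exI[of _ c], rule exI[of _ "e / 2"]) (use c e in simp)
  qed
  then obtain c r where cr: "\<And>p. c p \<in> \<A>" "\<And>p. p \<in> dom (c p)" "\<And>p. r p > 0"
    "\<And>p. cball (snd (c p) p) (2 * r p) \<subseteq> img (c p)" by metis
  define N where "N = (\<lambda>p. dom (c p) \<inter> snd (c p) -` ball (snd (c p) p) (r p))"
  have N: "open (N p)" for p unfolding N_def by (rule chart_preimage_open[OF cr(1) open_ball])
  have "UNIV \<subseteq> (\<Union>p\<in>UNIV. N p)" using cr(2,3) by (auto simp: N_def)
  then obtain C where C: "finite C" "UNIV \<subseteq> (\<Union>p\<in>C. N p)"
    by (rule compactE_image[OF compact_space N])
  define k where "k = (\<lambda>p. (c p, snd (c p) p, r p))"
  have "atlas_family \<A> (k ` C)"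
  proof
    show "finite (k ` C)" using C by simp
    show "c' \<in> \<A> \<and> r' > 0 \<and> cball x (2 * r') \<subseteq> img c'" if "(c',x,r') \<in> k ` C" for c' x r'
    proof -
      obtain p where "c' = c p" "x = snd (c p) p" "r' = r p" using \<open>(c',x,r') \<in> k ` C\<close> by (auto simp: k_def)
      then show ?thesis using cr(1,3,4)[of p] by simp
    qed
    show "\<exists>(c,x,r)\<in>k ` C. q \<in> dom c \<and> norm (snd c q - x) < r" for q
    proof -
      obtain p where p: "p \<in> C" "q \<in> N p" using C(2) by blast
      then have "q \<in> dom (c p) \<and> norm (snd (c p) q - snd (c p) p) < r p"
        by (simp add: N_def dist_norm norm_minus_commute)
      then show ?thesis using p(1) by (intro bexI[of _ "k p"]) (auto simp: k_def)
    qed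
  qed
  then show ?thesis by (rule that)
qed

section \<open>Riemannian metrics and curves\<close>

lemma vector_chain:
  assumes "(f has_vector_derivative v) (at s)" "(g has_derivative T) (at (f s))"
  shows "((\<lambda>r. g (f r)) has_vector_derivative T v) (at s)"
  using vector_derivative_diff_chain_within[of f v s UNIV g T] assms
  by (simp add: o_def has_derivative_at_withinI)

locale riemannian_atlas = atlas \<A>
  for \<A> :: "('a::{t2_space,second_countable_topology}, 'e::euclidean_space) chart set" +
  fixes \<rho> :: "('a, 'e) chart \<Rightarrow> 'a \<Rightarrow> 'e \<Rightarrow> 'e \<Rightarrow> real"
  assumes riemannian: "riemannian_metric \<A> \<rho>"
begin

lemma rho_props:
  assumes "c \<in> \<A>" "p \<in> dom c"
  shows "bilinear (\<rho> c p)" "v \<noteq> 0 \<Longrightarrow> \<rho> c p v v > 0"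
  using riemannian assms unfolding riemannian_metric_def by blast+

lemma rho_nonneg: assumes "c \<in> \<A>" "p \<in> dom c" shows "\<rho> c p v v \<ge> 0"
proof (cases "v = 0")
  case True
  then show ?thesis using bilinear_lzero[OF rho_props(1)[OF assms]] by simp
qed (use rho_props(2)[OF assms] in \<open>simp add: less_imp_le\<close>)

lemma rho_continuous:
  assumes "c \<in> \<A>" shows "continuous_on (img c) (\<lambda>x. \<rho> c (chart_inv c x) v w)"
  using riemannian assms unfolding riemannian_metric_def by (blast intro: smooth_on_continuous)

lemma rho_transform:
  assumes "c \<in> \<A>" "c' \<in> \<A>" "p \<in> dom c" "p \<in> dom c'"
  shows "\<rho> c' p (frechet_derivative (transition c c' (\<lambda>x. x)) (at (snd c p)) v)
    (frechet_derivative (transition c c' (\<lambda>x. x)) (at (snd c p)) w) = \<rho> c p v w"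
  using riemannian assms unfolding riemannian_metric_def Let_def by blast

lemma rho_scale: "c \<in> \<A> \<Longrightarrow> p \<in> dom c \<Longrightarrow> \<rho> c p (k *\<^sub>R v) (k *\<^sub>R v) = k\<^sup>2 * \<rho> c p v v"
  using bilinear_lmul[OF rho_props(1)] bilinear_rmul[OF rho_props(1)] by (simp add: power2_eq_square)

lemma bilinear_expand:
  assumes "bilinear (h :: 'e \<Rightarrow> 'e \<Rightarrow> real)"
  shows "h v v = (\<Sum>i\<in>Basis. \<Sum>j\<in>Basis. (v \<bullet> i) * (v \<bullet> j) * h i j)"
proof -
  have l: "linear (\<lambda>x. h x w)" "linear (h w)" for w using assms by (auto simp: bilinear_def)
  have e1: "h v w = (\<Sum>i\<in>Basis. (v \<bullet> i) * h i w)" for w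
  proof -
    have "h v w = h (\<Sum>i\<in>Basis. (v \<bullet> i) *\<^sub>R i) w" by (simp add: euclidean_representation)
    also have "\<dots> = (\<Sum>i\<in>Basis. (v \<bullet> i) * h i w)" by (simp add: linear_sum[OF l(1)] linear_scale[OF l(1)])
    finally show ?thesis .
  qed
  have e2: "h i v = (\<Sum>j\<in>Basis. (v \<bullet> j) * h i j)" for i
  proof -
    have "h i v = h i (\<Sum>j\<in>Basis. (v \<bullet> j) *\<^sub>R j)" by (simp add: euclidean_representation)
    also have "\<dots> = (\<Sum>j\<in>Basis. (v \<bullet> j) * h i j)" by (simp add: linear_sum[OF l(2)] linear_scale[OF l(2)])
    finally show ?thesis .
  qed
  show ?thesis unfolding e1[of v] by (intro sum.cong refl) (simp add: e2 sum_distrib_left mult.assoc)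
qed

text \<open>By homogeneity it suffices to treat unit vectors, where the form is a positive
  continuous function on the compact set \<open>K\<close> times the sphere and so has positive
  minimum and finite maximum.\<close>

lemma rho_bounds:
  assumes c: "c \<in> \<A>" and K: "compact K" "K \<subseteq> img c"
  obtains b where "b > 0" "\<And>y v. y \<in> K \<Longrightarrow> \<rho> c (chart_inv c y) v v \<le> b * (norm v)\<^sup>2"
    "\<And>y v. y \<in> K \<Longrightarrow> (norm v)\<^sup>2 \<le> b * \<rho> c (chart_inv c y) v v"
proof (cases "K = {}")
  case True then show ?thesis using that[of 1] by simp
next
  case False
  have pd: "chart_inv c y \<in> dom c" if "y \<in> K" for y using that K chart_inv_right(2) by blast
  \<comment> \<open>Smoothness of \<open>\<rho>\<close> is available only for fixed pairs of
    vectors. Expanding in the basis yields continuity jointly in the point and the vector.\<close>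
  define H where "H = (\<lambda>q. \<Sum>i\<in>Basis. \<Sum>j\<in>Basis. (snd q \<bullet> i) * (snd q \<bullet> j) * \<rho> c (chart_inv c (fst q)) i j)"
  have H: "H (y,v) = \<rho> c (chart_inv c y) v v" if "y \<in> K" for y v
    unfolding H_def using bilinear_expand[OF rho_props(1)[OF c pd[OF that]], of v] by simp
  have KS: "compact (K \<times> sphere (0::'e) 1)" "K \<times> sphere (0::'e) 1 \<noteq> {}" using K False by (auto intro: compact_Times)
  have cont: "continuous_on (K \<times> sphere (0::'e) 1) H" unfolding H_def
    by (intro continuous_intros continuous_on_compose2[OF rho_continuous[OF c]]) (use K in auto)
  obtain q1 where q1: "q1 \<in> K \<times> sphere 0 1" "\<And>q. q \<in> K \<times> sphere 0 1 \<Longrightarrow> H q1 \<le> H q"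
    using continuous_attains_inf[OF KS cont] by blast
  obtain q2 where q2: "q2 \<in> K \<times> sphere 0 1" "\<And>q. q \<in> K \<times> sphere 0 1 \<Longrightarrow> H q \<le> H q2"
    using continuous_attains_sup[OF KS cont] by blast
  have "H q1 > 0"
  proof -
    obtain y v where yv: "q1 = (y,v)" "y \<in> K" "norm v = 1" using q1(1) by auto
    then have "v \<noteq> 0" by auto
    then show ?thesis using H[OF yv(2)] rho_props(2)[OF c pd[OF yv(2)]] yv(1) by simp
  qed
  define b where "b = max (H q2) (1 / H q1)"
  have b: "b > 0" "H q2 \<le> b" "1 \<le> b * H q1"
    using \<open>H q1 > 0\<close> by (auto simp: b_def less_max_iff_disj max_mult_distrib_right le_max_iff_disj)
  have main: "\<rho> c (chart_inv c y) v v \<le> b * (norm v)\<^sup>2 \<and> (norm v)\<^sup>2 \<le> b * \<rho> c (chart_inv c y) v v" if y: "y \<in> K" for y v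
  proof (cases "v = 0")
    case True then show ?thesis using bilinear_lzero[OF rho_props(1)[OF c pd[OF y]]] by simp
  next
    case False
    define u where "u = (1 / norm v) *\<^sub>R v"
    have u: "norm u = 1" "v = norm v *\<^sub>R u" using False by (auto simp: u_def)
    have q: "(y,u) \<in> K \<times> sphere 0 1" using y u by simp
    have "\<rho> c (chart_inv c y) v v = (norm v)\<^sup>2 * \<rho> c (chart_inv c y) u u"
      using rho_scale[OF c pd[OF y], of "norm v" u] u(2) by metis
    then have e: "\<rho> c (chart_inv c y) v v = (norm v)\<^sup>2 * H (y,u)" using H[OF y] by simp
    have "H (y,u) \<le> b" using q2(2)[OF q] b by linarith
    then have 1: "(norm v)\<^sup>2 * H (y,u) \<le> (norm v)\<^sup>2 * b" by (intro mult_left_mono) auto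
    have "1 \<le> b * H (y,u)" using b q1(2)[OF q] mult_left_mono[of "H q1" "H (y,u)" b] by linarith
    then have "(norm v)\<^sup>2 * 1 \<le> (norm v)\<^sup>2 * (b * H (y,u))" by (intro mult_left_mono) auto
    then show ?thesis using 1 e by (simp add: mult_ac)
  qed
  show ?thesis by (rule that[OF b(1)]) (use main in auto)
qed

lemma transition_derivative:
  assumes "c \<in> \<A>" "c' \<in> \<A>" "p \<in> dom c" "p \<in> dom c'"
  shows "((\<lambda>y. snd c' (chart_inv c y)) has_derivative
    frechet_derivative (transition c c' (\<lambda>x. x)) (at (snd c p))) (at (snd c p))"
  using smooth_on_derivative(1)[OF transition_smooth[OF assms(1,2)], of "snd c p"] assms(3,4)
  by (simp add: transition_def o_def)

text \<open>A bound for the norm of the differential of \<open>f\<close> at \<open>p\<close>, dual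
  to the Riemannian norm. Quantifying over all charts and all derivatives avoids choosing
  one.\<close>

definition grad_le :: "('a \<Rightarrow> real) \<Rightarrow> 'a \<Rightarrow> real \<Rightarrow> bool" where
  "grad_le f p b \<longleftrightarrow> (\<forall>c\<in>\<A>. p \<in> dom c \<longrightarrow> (\<forall>D. ((\<lambda>y. f (chart_inv c y)) has_derivative D) (at (snd c p)) \<longrightarrow>
     (\<forall>v. \<bar>D v\<bar> \<le> b * sqrt (\<rho> c p v v))))"

text \<open>Near a point the Euclidean bound in one chart \<open>c0\<close> is turned into a
  Riemannian one by \<open>rho_bounds\<close>; the transformation law of \<open>\<rho>\<close>
  transports it to every other chart, and compactness makes it global.\<close>

lemma mfun_grad_bound: assumes f: "mfun f" shows "\<exists>b. \<forall>p. grad_le f p b"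
proof -
  have "\<exists>b. \<forall>p\<in>UNIV. grad_le f p b"
  proof (rule compact_local_bound[OF compact_space])
    fix p and b b' :: real assume "grad_le f p b" and b: "b \<le> b'"
    moreover have "b * sqrt (\<rho> c p v v) \<le> b' * sqrt (\<rho> c p v v)" if "c \<in> \<A>" "p \<in> dom c" for c v
      using b rho_nonneg[OF that] by (intro mult_right_mono) auto
    ultimately show "grad_le f p b'" unfolding grad_le_def by (meson order_trans)
  next
    fix p0
    obtain c0 where c0: "c0 \<in> \<A>" "p0 \<in> dom c0" using chart_ex by blast
    then have "snd c0 p0 \<in> img c0" by blast
    then obtain e where e: "e > 0" "cball (snd c0 p0) e \<subseteq> img c0"
      using chart_open(2)[OF c0(1)] unfolding open_contains_cball by blast
    define K where "K = cball (snd c0 p0) e"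
    have "loc_bdd_deriv (img c0) (\<lambda>y. f (chart_inv c0 y))" using f c0 by (simp add: mfun_def)
    then obtain b where b: "b \<ge> 0" "\<And>y. y \<in> K \<Longrightarrow> \<exists>D. ((\<lambda>y. f (chart_inv c0 y)) has_derivative D) (at y) \<and> (\<forall>v. norm (D v) \<le> b * norm v)"
      using loc_bdd_deriv_lipschitz[of "img c0" "\<lambda>y. f (chart_inv c0 y)" K] e by (auto simp: K_def)
    have cK: "compact K" "K \<subseteq> img c0" using e by (auto simp: K_def)
    obtain b' where b': "b' > 0" "\<And>y v. y \<in> K \<Longrightarrow> \<rho> c0 (chart_inv c0 y) v v \<le> b' * (norm v)\<^sup>2"
      "\<And>y v. y \<in> K \<Longrightarrow> (norm v)\<^sup>2 \<le> b' * \<rho> c0 (chart_inv c0 y) v v"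
      by (rule rho_bounds[OF c0(1) cK]) (rule that)
    define N where "N = dom c0 \<inter> snd c0 -` ball (snd c0 p0) e"
    have "open N" unfolding N_def by (rule chart_preimage_open[OF c0(1) open_ball])
    moreover have "p0 \<in> N" using c0 e by (simp add: N_def)
    moreover have "grad_le f q (b * sqrt b')" if q: "q \<in> N" for q
      unfolding grad_le_def
    proof (intro ballI impI allI)
      fix c D v assume c: "c \<in> \<A>" and qc: "q \<in> dom c" and D: "((\<lambda>y. f (chart_inv c y)) has_derivative D) (at (snd c q))"
      have q0: "q \<in> dom c0" "snd c0 q \<in> K" using q by (auto simp: N_def K_def)
      obtain D0 where D0: "((\<lambda>y. f (chart_inv c0 y)) has_derivative D0) (at (snd c0 q))" "\<And>v. norm (D0 v) \<le> b * norm v"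
        using b(2)[OF q0(2)] by blast
      define T where "T = frechet_derivative (transition c c0 (\<lambda>x. x)) (at (snd c q))"
      have T: "((\<lambda>y. snd c0 (chart_inv c y)) has_derivative T) (at (snd c q))"
        unfolding T_def by (rule transition_derivative[OF c c0(1) qc q0(1)])
      have "snd c0 (chart_inv c (snd c q)) = snd c0 q" using c qc by simp
      then have "((\<lambda>y. f (chart_inv c0 (snd c0 (chart_inv c y)))) has_derivative (\<lambda>v. D0 (T v))) (at (snd c q))"
        using diff_chain_at[OF T, of "\<lambda>y. f (chart_inv c0 y)" D0] D0(1) by (simp add: o_def)
      then have "((\<lambda>y. f (chart_inv c y)) has_derivative (\<lambda>v. D0 (T v))) (at (snd c q))"
      proof (rule has_derivative_transform_within_open)
        show "open (snd c ` (dom c \<inter> dom c0))" by (rule transition_open[OF c c0(1)])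
        show "snd c q \<in> snd c ` (dom c \<inter> dom c0)" using qc q0 by blast
        show "f (chart_inv c0 (snd c0 (chart_inv c y))) = f (chart_inv c y)" if "y \<in> snd c ` (dom c \<inter> dom c0)" for y
          using that c c0 by auto
      qed
      then have "D = (\<lambda>v. D0 (T v))" using D has_derivative_unique by blast
      then have "\<bar>D v\<bar> \<le> b * norm (T v)" using D0(2)[of "T v"] by simp
      also have "norm (T v) \<le> sqrt (b' * \<rho> c0 q (T v) (T v))"
        using b'(3)[OF q0(2), of "T v"] c0 q0 by (intro real_le_rsqrt) simp
      also have "\<rho> c0 q (T v) (T v) = \<rho> c q v v" unfolding T_def by (rule rho_transform[OF c c0(1) qc q0(1)])
      finally show "\<bar>D v\<bar> \<le> b * sqrt b' * sqrt (\<rho> c q v v)" using b(1) by (simp add: real_sqrt_mult mult_left_mono mult.assoc)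
    qed
    ultimately show "\<exists>U b. open U \<and> p0 \<in> U \<and> (\<forall>p\<in>U. grad_le f p b)" by blast
  qed
  then show ?thesis by simp
qed

section \<open>Curves of bounded Riemannian speed\<close>

definition gcurve :: "(real \<Rightarrow> 'a) \<Rightarrow> real \<Rightarrow> bool" where
  "gcurve \<gamma> b \<longleftrightarrow> continuous_on {0..1} \<gamma> \<and> (\<exists>F. finite F \<and>
     (\<forall>c\<in>\<A>. (\<lambda>s. snd c (\<gamma> s)) C1_differentiable_on {s \<in> {0<..<1} - F. \<gamma> s \<in> dom c}) \<and>
     (\<forall>s\<in>{0<..<1} - F. \<forall>c\<in>\<A>. \<gamma> s \<in> dom c \<longrightarrow> (\<forall>v. ((\<lambda>r. snd c (\<gamma> r)) has_vector_derivative v) (at s) \<longrightarrow> sqrt (\<rho> c (\<gamma> s) v v) \<le> b)))"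

text \<open>In the chart \<open>c\<close> the velocity is the constant vector \<open>v - u\<close>.
  In any other chart it is its image under the derivative of the transition map, which has the same
  \<open>\<rho>\<close>-length.\<close>

lemma gcurve_chart_segment:
  assumes c: "c \<in> \<A>" and K: "convex K" "K \<subseteq> img c" and u: "u \<in> K" and v: "v \<in> K"
    and b: "b \<ge> 0" "\<And>y w. y \<in> K \<Longrightarrow> \<rho> c (chart_inv c y) w w \<le> b * (norm w)\<^sup>2"
  shows "gcurve (\<lambda>s. chart_inv c ((1 - s) *\<^sub>R u + s *\<^sub>R v)) (sqrt b * norm (u - v))"
proof -
  define seg where "seg = (\<lambda>s. (1 - s) *\<^sub>R u + s *\<^sub>R v)"
  have segK: "seg s \<in> K" if "s \<in> {0..1}" for s
    using K(1) u v that unfolding seg_def convex_alt by auto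
  have segc: "continuous_on A seg" for A unfolding seg_def by (intro continuous_intros)
  have segd: "(seg has_vector_derivative (v - u)) (at s)" for s
    unfolding seg_def by (auto intro!: derivative_eq_intros simp: algebra_simps)
  have cont: "continuous_on {0..1} (\<lambda>s. chart_inv c (seg s))"
    by (rule continuous_on_compose2[OF chart_inv_cont[OF c] segc]) (use segK K in auto)
  have gd: "chart_inv c (seg s) \<in> dom c" "snd c (chart_inv c (seg s)) = seg s" if "s \<in> {0..1}" for s
    using segK[OF that] K chart_inv_right[of "seg s" c] by auto
  have der: "((\<lambda>s. snd c' (chart_inv c (seg s))) has_vector_derivative
      frechet_derivative (transition c c' (\<lambda>x. x)) (at (seg s)) (v - u)) (at s)"
    if "c' \<in> \<A>" "s \<in> {0<..<1}" "chart_inv c (seg s) \<in> dom c'" for c' s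
  proof -
    have "s \<in> {0..1}" using that by auto
    then have "((\<lambda>y. snd c' (chart_inv c y)) has_derivative frechet_derivative (transition c c' (\<lambda>x. x)) (at (seg s))) (at (seg s))"
      using transition_derivative[OF c that(1) gd(1) that(3)] gd(2) by simp
    from vector_chain[OF segd this] show ?thesis .
  qed
  have "(\<lambda>s. snd c' (chart_inv c (seg s))) C1_differentiable_on {s \<in> {0<..<1} - {}. chart_inv c (seg s) \<in> dom c'}" if c': "c' \<in> \<A>" for c'
    unfolding C1_differentiable_on_def
  proof (intro exI conjI ballI)
    show "((\<lambda>s. snd c' (chart_inv c (seg s))) has_vector_derivative
      frechet_derivative (transition c c' (\<lambda>x. x)) (at (seg s)) (v - u)) (at s)" if "s \<in> {s \<in> {0<..<1} - {}. chart_inv c (seg s) \<in> dom c'}" for s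
      using that c' by (intro der) auto
    have "seg s \<in> snd c ` (dom c \<inter> dom c')" if "s \<in> {0<..<1}" "chart_inv c (seg s) \<in> dom c'" for s
      using gd[of s] that by (metis IntI atLeastAtMost_iff greaterThanLessThan_iff image_eqI less_imp_le)
    then show "continuous_on {s \<in> {0<..<1} - {}. chart_inv c (seg s) \<in> dom c'}
        (\<lambda>s. frechet_derivative (transition c c' (\<lambda>x. x)) (at (seg s)) (v - u))"
      by (intro continuous_on_compose2[OF smooth_on_derivative(2)[OF transition_smooth[OF c c']] segc]) auto
  qed
  moreover have "sqrt (\<rho> c' (chart_inv c (seg s)) w w) \<le> sqrt b * norm (u - v)"
    if s: "s \<in> {0<..<1} - {}" and c': "c' \<in> \<A>" "chart_inv c (seg s) \<in> dom c'"
      and w: "((\<lambda>s. snd c' (chart_inv c (seg s))) has_vector_derivative w) (at s)" for s c' w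
  proof -
    have s01: "s \<in> {0..1}" using s by auto
    have "w = frechet_derivative (transition c c' (\<lambda>x. x)) (at (seg s)) (v - u)"
      by (rule vector_derivative_unique_at[OF w der]) (use s c' in auto)
    then have "\<rho> c' (chart_inv c (seg s)) w w = \<rho> c (chart_inv c (seg s)) (v - u) (v - u)"
      using rho_transform[OF c c'(1) gd(1)[OF s01] c'(2), of "v - u" "v - u"] gd(2)[OF s01] by simp
    also have "\<dots> \<le> b * (norm (u - v))\<^sup>2" using b(2)[OF segK[OF s01], of "v - u"] by (simp add: norm_minus_commute)
    finally have "sqrt (\<rho> c' (chart_inv c (seg s)) w w) \<le> sqrt (b * (norm (u - v))\<^sup>2)" by simp
    then show ?thesis by (simp add: real_sqrt_mult)
  qed
  ultimately show ?thesis using cont unfolding gcurve_def seg_def by (intro conjI exI[of _ "{}"]) auto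
qed

lemma gcurve_mono: "gcurve \<gamma> b \<Longrightarrow> b \<le> b' \<Longrightarrow> gcurve \<gamma> b'"
  unfolding gcurve_def by (meson order_trans)

lemma gcurve_const: "gcurve (\<lambda>_. p) 0"
proof -
  have "sqrt (\<rho> c p v v) \<le> 0" if "c \<in> \<A>" "p \<in> dom c" "((\<lambda>r::real. snd c p) has_vector_derivative v) (at s)" for c v and s :: real
  proof -
    have "v = 0" using that(3) vector_derivative_unique_at[OF _ has_vector_derivative_const] by blast
    then show ?thesis using bilinear_lzero[OF rho_props(1)[OF that(1,2)]] by simp
  qed
  then show ?thesis unfolding gcurve_def by (auto intro!: exI[of _ "{}"])
qed

lemma C1_affine:
  fixes f :: "real \<Rightarrow> 'e"
  assumes f: "f C1_differentiable_on S"
  shows "(\<lambda>s. f (a * s + e)) C1_differentiable_on {s. a * s + e \<in> S}"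
proof -
  obtain D where D: "\<And>x. x \<in> S \<Longrightarrow> (f has_vector_derivative D x) (at x)" "continuous_on S D"
    using f unfolding C1_differentiable_on_def by blast
  have "((\<lambda>s. f (a * s + e)) has_vector_derivative a *\<^sub>R D (a * s + e)) (at s)" if "a * s + e \<in> S" for s
  proof -
    have "((\<lambda>s. a * s + e) has_vector_derivative a) (at s)"
      unfolding has_real_derivative_iff_has_vector_derivative[symmetric] by (auto intro!: derivative_eq_intros)
    from vector_diff_chain_at[OF this D(1)[OF that]] show ?thesis by (simp add: o_def)
  qed
  moreover have "continuous_on {s. a * s + e \<in> S} (\<lambda>s. a *\<^sub>R D (a * s + e))"
    by (intro continuous_intros continuous_on_compose2[OF D(2)]) auto
  ultimately show ?thesis unfolding C1_differentiable_on_def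
    by (intro exI[of _ "\<lambda>s. a *\<^sub>R D (a * s + e)"]) auto
qed

lemma C1_local_eq:
  fixes f g :: "real \<Rightarrow> 'e"
  assumes f: "f C1_differentiable_on S" and O: "open O'" and eq: "\<And>x. x \<in> O' \<Longrightarrow> f x = g x" and T: "T \<subseteq> S \<inter> O'"
  shows "g C1_differentiable_on T"
proof -
  obtain D where D: "\<And>x. x \<in> S \<Longrightarrow> (f has_vector_derivative D x) (at x)" "continuous_on S D"
    using f unfolding C1_differentiable_on_def by blast
  have "(g has_vector_derivative D x) (at x)" if "x \<in> T" for x
    by (rule has_vector_derivative_transform_within_open[OF D(1) O]) (use that T eq in auto)
  moreover have "continuous_on T D" using D(2) T by (auto intro: continuous_on_subset)
  ultimately show ?thesis unfolding C1_differentiable_on_def by (intro exI[of _ D]) auto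
qed

text \<open>Continuity of the derivative is relative to the set, and around a point of one piece the
  other piece is absent. So a corner at \<open>m\<close>, which belongs to neither, is
  invisible.\<close>

lemma C1_Un_separated:
  fixes f :: "real \<Rightarrow> 'e"
  assumes f: "f C1_differentiable_on S" "f C1_differentiable_on T" and sep: "S \<subseteq> {..<m}" "T \<subseteq> {m<..}"
  shows "f C1_differentiable_on (S \<union> T)"
proof -
  have d: "continuous_on S (\<lambda>x. vector_derivative f (at x))" "continuous_on T (\<lambda>x. vector_derivative f (at x))"
    "\<And>x. x \<in> S \<union> T \<Longrightarrow> f differentiable at x" using f by (auto simp: C1_differentiable_on_eq)
  have "continuous (at x within S \<union> T) (\<lambda>x. vector_derivative f (at x))" if "x \<in> S \<union> T" for x
  proof (cases "x \<in> S")
    case True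
    have "at x within S \<union> T = at x within S" by (rule at_within_nhd[of x "{..<m}"]) (use True sep in auto)
    then show ?thesis using d(1) True by (simp add: continuous_on_eq_continuous_within)
  next
    case False
    then have xT: "x \<in> T" using that by blast
    have "at x within S \<union> T = at x within T" by (rule at_within_nhd[of x "{m<..}"]) (use xT sep in auto)
    then show ?thesis using d(2) xT by (simp add: continuous_on_eq_continuous_within)
  qed
  then show ?thesis using d(3) by (auto simp: C1_differentiable_on_eq continuous_on_eq_continuous_within)
qed

text \<open>The factor 2 arises because each of the two curves is run through in half the
  time.\<close>

lemma gcurve_join:
  assumes g1: "gcurve \<gamma>1 b" and g2: "gcurve \<gamma>2 b" and eq: "\<gamma>1 1 = \<gamma>2 0" and b: "b \<ge> 0"
  shows "gcurve (\<gamma>1 +++ \<gamma>2) (2 * b)"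
proof -
  obtain F1 where F1: "finite F1" "\<And>c. c \<in> \<A> \<Longrightarrow> (\<lambda>s. snd c (\<gamma>1 s)) C1_differentiable_on {s \<in> {0<..<1} - F1. \<gamma>1 s \<in> dom c}"
    "\<And>s c v. s \<in> {0<..<1} - F1 \<Longrightarrow> c \<in> \<A> \<Longrightarrow> \<gamma>1 s \<in> dom c \<Longrightarrow> ((\<lambda>r. snd c (\<gamma>1 r)) has_vector_derivative v) (at s) \<Longrightarrow> sqrt (\<rho> c (\<gamma>1 s) v v) \<le> b"
    using g1 unfolding gcurve_def by blast
  obtain F2 where F2: "finite F2" "\<And>c. c \<in> \<A> \<Longrightarrow> (\<lambda>s. snd c (\<gamma>2 s)) C1_differentiable_on {s \<in> {0<..<1} - F2. \<gamma>2 s \<in> dom c}"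
    "\<And>s c v. s \<in> {0<..<1} - F2 \<Longrightarrow> c \<in> \<A> \<Longrightarrow> \<gamma>2 s \<in> dom c \<Longrightarrow> ((\<lambda>r. snd c (\<gamma>2 r)) has_vector_derivative v) (at s) \<Longrightarrow> sqrt (\<rho> c (\<gamma>2 s) v v) \<le> b"
    using g2 unfolding gcurve_def by blast
  \<comment> \<open>The corner at 1/2 is added to the exceptional points of the two curves, rescaled
    to their halves.\<close>
  define F where "F = insert (1/2) ((\<lambda>x. x / 2) ` F1 \<union> (\<lambda>x. (x + 1) / 2) ` F2)"
  have finF: "finite F" using F1 F2 by (simp add: F_def)
  have cont: "continuous_on {0..1} (\<gamma>1 +++ \<gamma>2)"
    using g1 g2 eq path_join_imp[of \<gamma>1 \<gamma>2] by (simp add: gcurve_def path_def pathfinish_def pathstart_def)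
  have lo: "2 * s + 0 \<in> {0<..<1} - F1" if "s \<in> {0<..<1} - F" "s < 1/2" for s
  proof -
    have "s = (2 * s + 0) / 2" by simp
    then have "2 * s + 0 \<notin> F1" using that(1) unfolding F_def by blast
    then show ?thesis using that by auto
  qed
  have hi: "2 * s + (-1) \<in> {0<..<1} - F2" if "s \<in> {0<..<1} - F" "s > 1/2" for s
  proof -
    have "s = ((2 * s + (-1)) + 1) / 2" by simp
    then have "2 * s + (-1) \<notin> F2" using that(1) unfolding F_def by blast
    then show ?thesis using that by auto
  qed
  have jl: "(\<gamma>1 +++ \<gamma>2) s = \<gamma>1 (2 * s + 0)" if "s < 1/2" for s using that by (simp add: joinpaths_def)
  have jr: "(\<gamma>1 +++ \<gamma>2) s = \<gamma>2 (2 * s + (-1))" if "s > 1/2" for s using that by (simp add: joinpaths_def)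
  have "(\<lambda>s. snd c ((\<gamma>1 +++ \<gamma>2) s)) C1_differentiable_on {s \<in> {0<..<1} - F. (\<gamma>1 +++ \<gamma>2) s \<in> dom c}" if c: "c \<in> \<A>" for c
  proof -
    have "(\<lambda>s. snd c ((\<gamma>1 +++ \<gamma>2) s)) C1_differentiable_on ({s \<in> {0<..<1} - F. (\<gamma>1 +++ \<gamma>2) s \<in> dom c} \<inter> {..<1/2})"
      by (rule C1_local_eq[OF C1_affine[OF F1(2)[OF c], of 2 0], of "{..<1/2}"]) (use lo jl in auto)
    moreover have "(\<lambda>s. snd c ((\<gamma>1 +++ \<gamma>2) s)) C1_differentiable_on ({s \<in> {0<..<1} - F. (\<gamma>1 +++ \<gamma>2) s \<in> dom c} \<inter> {1/2<..})"
      by (rule C1_local_eq[OF C1_affine[OF F2(2)[OF c], of 2 "-1"], of "{1/2<..}"]) (use hi jr in auto)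
    ultimately have "(\<lambda>s. snd c ((\<gamma>1 +++ \<gamma>2) s)) C1_differentiable_on
        (({s \<in> {0<..<1} - F. (\<gamma>1 +++ \<gamma>2) s \<in> dom c} \<inter> {..<1/2}) \<union> ({s \<in> {0<..<1} - F. (\<gamma>1 +++ \<gamma>2) s \<in> dom c} \<inter> {1/2<..}))"
      by (rule C1_Un_separated[where m = "1/2"]) auto
    moreover have "({s \<in> {0<..<1} - F. (\<gamma>1 +++ \<gamma>2) s \<in> dom c} \<inter> {..<1/2}) \<union> ({s \<in> {0<..<1} - F. (\<gamma>1 +++ \<gamma>2) s \<in> dom c} \<inter> {1/2<..})
        = {s \<in> {0<..<1} - F. (\<gamma>1 +++ \<gamma>2) s \<in> dom c}" by (auto simp: F_def)
    ultimately show ?thesis by simp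
  qed
  moreover have "sqrt (\<rho> c ((\<gamma>1 +++ \<gamma>2) s) v v) \<le> 2 * b"
    if s: "s \<in> {0<..<1} - F" and c: "c \<in> \<A>" and dm: "(\<gamma>1 +++ \<gamma>2) s \<in> dom c"
      and v: "((\<lambda>r. snd c ((\<gamma>1 +++ \<gamma>2) r)) has_vector_derivative v) (at s)" for s c v
  proof -
    have half: "sqrt (\<rho> c (\<gamma> (2 * s + e)) v v) \<le> 2 * b"
      if g: "\<And>w. ((\<lambda>r. snd c (\<gamma> r)) has_vector_derivative w) (at (2 * s + e)) \<Longrightarrow> sqrt (\<rho> c (\<gamma> (2 * s + e)) w w) \<le> b"
        and O: "open O'" "s \<in> O'" "\<And>r. r \<in> O' \<Longrightarrow> (\<gamma>1 +++ \<gamma>2) r = \<gamma> (2 * r + e)" and dm': "\<gamma> (2 * s + e) \<in> dom c" for \<gamma> :: "real \<Rightarrow> 'a" and e O'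
    proof -
      have "((\<lambda>r. snd c (\<gamma> (2 * r + e))) has_vector_derivative v) (at s)"
        by (rule has_vector_derivative_transform_within_open[OF v O(1,2)]) (simp add: O(3))
      \<comment> \<open>The affine reparametrisation is inverted in order to read off the velocity
        of the original curve, which is half of \<open>v\<close>.\<close>
      moreover have "s = (1/2) * (2 * s + e) + (- e / 2)" by (simp add: algebra_simps)
      ultimately have v': "((\<lambda>r. snd c (\<gamma> (2 * r + e))) has_vector_derivative v) (at ((1/2) * (2 * s + e) + (- e / 2)))" by simp
      have "((\<lambda>r. (1/2) * r + (- e / 2)) has_vector_derivative 1/2) (at (2 * s + e))"
        unfolding has_real_derivative_iff_has_vector_derivative[symmetric] by (auto intro!: derivative_eq_intros)
      from vector_diff_chain_at[OF this v']
      have "((\<lambda>r. snd c (\<gamma> (2 * ((1/2) * r + (- e / 2)) + e))) has_vector_derivative (1/2) *\<^sub>R v) (at (2 * s + e))"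
        by (simp only: o_def)
      moreover have "2 * ((1/2) * r + (- e / 2)) + e = r" for r by (simp add: algebra_simps)
      ultimately have "((\<lambda>r. snd c (\<gamma> r)) has_vector_derivative (1/2) *\<^sub>R v) (at (2 * s + e))" by simp
      then have "sqrt (\<rho> c (\<gamma> (2 * s + e)) ((1/2) *\<^sub>R v) ((1/2) *\<^sub>R v)) \<le> b" by (rule g)
      then show ?thesis unfolding rho_scale[OF c dm'] by (simp add: real_sqrt_mult real_sqrt_divide power_divide)
    qed
    have "s \<noteq> 1/2" using s by (auto simp: F_def)
    then consider "s < 1/2" | "s > 1/2" by linarith
    then show ?thesis
    proof cases
      case 1
      have "sqrt (\<rho> c (\<gamma>1 (2 * s + 0)) v v) \<le> 2 * b"
        by (rule half[of \<gamma>1 0 "{..<1/2}"]) (use F1(3)[OF lo[OF s 1] c] dm jl 1 in auto)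
      then show ?thesis using jl[OF 1] by simp
    next
      case 2
      have "sqrt (\<rho> c (\<gamma>2 (2 * s + (-1))) v v) \<le> 2 * b"
        by (rule half[of \<gamma>2 "-1" "{1/2<..}"]) (use F2(3)[OF hi[OF s 2] c] dm jr 2 in auto)
      then show ?thesis using jr[OF 2] by simp
    qed
  qed
  ultimately show ?thesis using cont finF unfolding gcurve_def by (intro conjI exI[of _ F]) auto
qed

end

section \<open>The distance of the open cone\<close>

text \<open>The fundamental theorem of calculus off the finite set \<open>F\<close> gives the
  increment as a gauge integral of \<open>g'\<close>. Neither \<open>g'\<close> nor
  \<open>sp\<close> is known to be Borel, so \<open>g'\<close> is replaced by a Borel function equal
  to it almost everywhere, which is Lebesgue integrable since the length is finite.\<close>

lemma variation_le_length:
  fixes g g' sp :: "real \<Rightarrow> real"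
  assumes g: "continuous_on {0..1} g" and F: "finite F" and K: "K > 0"
    and g': "\<And>s. s \<in> {0<..<1} - F \<Longrightarrow> (g has_vector_derivative g' s) (at s)"
    and le: "\<And>s. s \<in> {0<..<1} - F \<Longrightarrow> \<bar>g' s\<bar> \<le> K * sp s"
  shows "ennreal (\<bar>g 1 - g 0\<bar> / K) \<le> (\<integral>\<^sup>+ s\<in>{0<..<1}. ennreal (sp s) \<partial>lborel)"
proof (cases "(\<integral>\<^sup>+ s\<in>{0<..<1}. ennreal (sp s) \<partial>lborel) = \<infinity>")
  case False
  define I where "I = (\<integral>\<^sup>+ s\<in>{0<..<1}. ennreal (sp s) \<partial>lborel)"
  have hi: "(g' has_integral (g 1 - g 0)) {0..1}"
    by (rule fundamental_theorem_of_calculus_interior_strong[OF F _ g' g]) auto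
  obtain f1 where f1: "f1 \<in> borel_measurable lborel" "AE x in lborel. g' x * indicator {0..1} x = f1 x"
    using completion_ex_borel_measurable_real[OF has_integral_implies_lebesgue_measurable_real[OF hi]] by blast
  have aeF: "AE x in lborel. x \<notin> F \<union> {0,1}" by (intro AE_not_in finite_imp_null_set_lborel) (use F in simp)
  have "(\<integral>\<^sup>+ x. ennreal (norm (f1 x / K)) \<partial>lborel) \<le> I"
    unfolding I_def
  proof (rule nn_integral_mono_AE)
    show "AE x in lborel. ennreal (norm (f1 x / K)) \<le> ennreal (sp x) * indicator {0<..<1} x"
      using f1(2) aeF
    proof eventually_elim
      case (elim x)
      show ?case
      proof (cases "x \<in> {0<..<1}")
        case True
        have "f1 x = g' x" using elim(1) True by simp
        moreover have "x \<in> {0<..<1} - F" using elim(2) True by blast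
        ultimately have "\<bar>f1 x\<bar> \<le> K * sp x" using le[of x] by simp
        then have "norm (f1 x / K) \<le> sp x" using K by (simp add: abs_divide divide_le_eq mult.commute)
        then show ?thesis using True by (simp add: ennreal_leI)
      next
        case False
        then have "f1 x = 0" using elim by (auto simp: indicator_def)
        then show ?thesis by simp
      qed
    qed
  qed
  then have nn: "(\<integral>\<^sup>+ x. ennreal (norm (f1 x / K)) \<partial>lborel) \<le> I" .
  have int: "integrable lborel (\<lambda>x. f1 x / K)"
  proof (rule integrableI_bounded)
    show "(\<lambda>x. f1 x / K) \<in> borel_measurable lborel" using f1(1) by measurable
    show "(\<integral>\<^sup>+ x. ennreal (norm (f1 x / K)) \<partial>lborel) < \<infinity>"
      by (rule le_less_trans[OF nn]) (use False in \<open>simp add: I_def less_top[symmetric]\<close>)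
  qed
  have h1: "((\<lambda>x. if x \<in> {0..1} then g' x else 0) has_integral (g 1 - g 0)) UNIV"
    using hi by (simp only: has_integral_restrict_UNIV)
  have h2: "AE x in lborel. x \<in> UNIV \<longrightarrow> (if x \<in> {0..1} then g' x else 0) = f1 x"
    using f1(2) by eventually_elim (auto simp: indicator_def)
  have "(f1 has_integral (g 1 - g 0)) UNIV" by (rule has_integral_AE[OF h2, THEN iffD1, OF h1])
  then have "((\<lambda>x. f1 x / K) has_integral ((g 1 - g 0) / K)) UNIV" by (rule has_integral_divide)
  then have eq: "(g 1 - g 0) / K = integral\<^sup>L lborel (\<lambda>x. f1 x / K)"
    by (rule has_integral_unique[OF _ has_integral_integral_lborel[OF int]])
  have "\<bar>g 1 - g 0\<bar> / K = norm ((g 1 - g 0) / K)" using K by simp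
  also have "\<dots> = norm (integral\<^sup>L lborel (\<lambda>x. f1 x / K))" by (simp only: eq)
  also have "\<dots> \<le> (\<integral>x. norm (f1 x / K) \<partial>lborel)" by (rule integral_norm_bound)
  finally have "ennreal (\<bar>g 1 - g 0\<bar> / K) \<le> ennreal (\<integral>x. norm (f1 x / K) \<partial>lborel)" by (rule ennreal_leI)
  also have "\<dots> = (\<integral>\<^sup>+ x. ennreal (norm (f1 x / K)) \<partial>lborel)"
    by (rule nn_integral_eq_integral[symmetric, OF integrable_norm[OF int]]) simp
  also have "\<dots> \<le> I" by (rule nn)
  finally show ?thesis by (simp add: I_def)
qed simp

context riemannian_atlas begin

text \<open>Along the curve the function \<open>t * f\<close> changes at rate
  \<open>t * D v + \<tau> * f\<close>. Both \<open>\<bar>\<tau>\<bar>\<close> and \<open>t\<close>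
  times the Riemannian norm of \<open>v\<close> are at most the cone speed, whence the factor
  \<open>M + b\<close>.\<close>

lemma cone_length_lower:
  assumes f: "mfun f" and M: "\<And>p. \<bar>f p\<bar> \<le> M" and b: "\<And>p. grad_le f p b" "b \<ge> 0" "M + b > 0"
    and \<gamma>: "cone_curve \<A> \<gamma>"
  shows "ennreal (\<bar>snd (\<gamma> 1) * f (fst (\<gamma> 1)) - snd (\<gamma> 0) * f (fst (\<gamma> 0))\<bar> / (M + b)) \<le> cone_length \<A> \<rho> \<gamma>"
proof -
  obtain F where F: "finite F" "\<And>U \<phi>. (U, \<phi>) \<in> \<A> \<Longrightarrow> (\<lambda>s. (\<phi> (fst (\<gamma> s)), snd (\<gamma> s)))
            C1_differentiable_on {s \<in> {0<..<1} - F. fst (\<gamma> s) \<in> U}"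
    using \<gamma> unfolding cone_curve_def by blast
  have \<gamma>c: "continuous_on {0..1} \<gamma>" "\<gamma> ` {0..1} \<subseteq> cone" using \<gamma> by (auto simp: cone_curve_def)
  have fc: "continuous_on UNIV f" by (rule mfun_continuous[OF f])
  define g where "g = (\<lambda>s. snd (\<gamma> s) * f (fst (\<gamma> s)))"
  have gc: "continuous_on {0..1} g" unfolding g_def
    by (intro continuous_intros \<gamma>c continuous_on_compose2[OF fc]) auto
  have der: "\<exists>g'. (g has_vector_derivative g') (at s) \<and> \<bar>g'\<bar> \<le> (M + b) * cone_speed \<A> \<rho> \<gamma> s" if s: "s \<in> {0<..<1} - F" for s
  proof -
    define p where "p = fst (\<gamma> s)"
    define c where "c = (SOME c. c \<in> \<A> \<and> p \<in> dom c)"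
    have "\<exists>c. c \<in> \<A> \<and> p \<in> dom c" using chart_ex by blast
    then have c: "c \<in> \<A>" "p \<in> dom c" unfolding c_def by (metis (mono_tags, lifting) someI_ex)+
    have "(\<lambda>s. (snd c (fst (\<gamma> s)), snd (\<gamma> s))) C1_differentiable_on {s \<in> {0<..<1} - F. fst (\<gamma> s) \<in> dom c}"
      using F(2)[of "fst c" "snd c"] c by simp
    then obtain D' where "\<forall>x\<in>{s \<in> {0<..<1} - F. fst (\<gamma> s) \<in> dom c}.
        ((\<lambda>s. (snd c (fst (\<gamma> s)), snd (\<gamma> s))) has_vector_derivative D' x) (at x)"
      unfolding C1_differentiable_on_def by blast
    then have D0: "((\<lambda>s. (snd c (fst (\<gamma> s)), snd (\<gamma> s))) has_vector_derivative D' s) (at s)"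
      using s c(2) by (simp add: p_def)
    define v \<tau> where "v = fst (D' s)" and "\<tau> = snd (D' s)"
    have v: "((\<lambda>r. snd c (fst (\<gamma> r))) has_vector_derivative v) (at s)"
      using bounded_linear.has_vector_derivative[OF bounded_linear_fst D0] by (simp add: v_def)
    have \<tau>: "((\<lambda>r. snd (\<gamma> r)) has_vector_derivative \<tau>) (at s)"
      using bounded_linear.has_vector_derivative[OF bounded_linear_snd D0] by (simp add: \<tau>_def)
    have cs: "isCont \<gamma> s" using \<gamma>c(1) s by (intro continuous_on_interior[of "{0..1}"]) auto
    \<comment> \<open>The curve stays in the chart domain near \<open>s\<close>, so there the chart
      expression represents \<open>f\<close> along the curve.\<close>
    have ev: "eventually (\<lambda>r. fst (\<gamma> r) \<in> dom c) (nhds s)"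
    proof -
      have "isCont (\<lambda>r. fst (\<gamma> r)) s" using cs by (intro continuous_intros)
      then have "eventually (\<lambda>r. fst (\<gamma> r) \<in> dom c) (at s)"
        using topological_tendstoD[OF _ chart_open(1)[OF c(1)]] c(2) by (auto simp: isCont_def p_def)
      then show ?thesis using c(2) by (auto simp: eventually_nhds_conv_at p_def)
    qed
    obtain D where D: "((\<lambda>y. f (chart_inv c y)) has_derivative D) (at (snd c p))"
      using loc_bdd_deriv_has_derivative[of "img c" "\<lambda>y. f (chart_inv c y)" "snd c p"] f c by (auto simp: mfun_def)
    have Dv: "\<bar>D v\<bar> \<le> b * sqrt (\<rho> c p v v)" using b(1)[of p] c D unfolding grad_le_def by blast
    have "((\<lambda>r. f (chart_inv c (snd c (fst (\<gamma> r))))) has_vector_derivative D v) (at s)"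
      by (rule vector_chain[OF v]) (use D in \<open>simp add: p_def\<close>)
    then have fd: "((\<lambda>r. f (fst (\<gamma> r))) has_vector_derivative D v) (at s)"
      using ev
      by (subst has_vector_derivative_cong_ev[where g = "\<lambda>r. f (chart_inv c (snd c (fst (\<gamma> r))))"])
        (use c in \<open>auto elim!: eventually_mono simp: p_def\<close>)
    have gd: "(g has_vector_derivative (snd (\<gamma> s) * D v + \<tau> * f p)) (at s)"
      unfolding g_def p_def by (rule has_vector_derivative_mult[OF \<tau> fd])
    define t where "t = snd (\<gamma> s)"
    have "\<gamma> s \<in> cone" using \<gamma>c(2) s by auto
    then have t: "t \<ge> 1" by (cases "\<gamma> s") (auto simp: t_def cone_def)
    have rn: "\<rho> c p v v \<ge> 0" by (rule rho_nonneg[OF c])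
    have sp: "cone_speed \<A> \<rho> \<gamma> s = sqrt (t\<^sup>2 * \<rho> c p v v + \<tau>\<^sup>2)"
      unfolding cone_speed_def Let_def p_def[symmetric] c_def[symmetric] t_def[symmetric]
      using vector_derivative_at[OF v] vector_derivative_at[OF \<tau>] by simp
    have 1: "\<bar>\<tau>\<bar> \<le> cone_speed \<A> \<rho> \<gamma> s" unfolding sp using rn by (intro real_le_rsqrt) auto
    have "t * sqrt (\<rho> c p v v) = sqrt (t\<^sup>2 * \<rho> c p v v)" using t by (simp add: real_sqrt_mult)
    also have "\<dots> \<le> cone_speed \<A> \<rho> \<gamma> s" unfolding sp by simp
    finally have 2: "t * sqrt (\<rho> c p v v) \<le> cone_speed \<A> \<rho> \<gamma> s" .
    have "\<bar>t * D v + \<tau> * f p\<bar> \<le> t * \<bar>D v\<bar> + \<bar>\<tau>\<bar> * \<bar>f p\<bar>"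
      using abs_triangle_ineq[of "t * D v" "\<tau> * f p"] t by (simp add: abs_mult)
    also have "\<dots> \<le> t * (b * sqrt (\<rho> c p v v)) + cone_speed \<A> \<rho> \<gamma> s * M"
      using Dv t 1 M[of p] by (intro add_mono mult_mono) auto
    also have "t * (b * sqrt (\<rho> c p v v)) \<le> b * cone_speed \<A> \<rho> \<gamma> s"
      using mult_left_mono[OF 2 b(2)] by (simp add: mult_ac)
    finally show ?thesis using gd by (intro exI conjI) (auto simp: t_def algebra_simps)
  qed
  then obtain g' where g': "\<And>s. s \<in> {0<..<1} - F \<Longrightarrow> (g has_vector_derivative g' s) (at s)"
    "\<And>s. s \<in> {0<..<1} - F \<Longrightarrow> \<bar>g' s\<bar> \<le> (M + b) * cone_speed \<A> \<rho> \<gamma> s" by metis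
  from variation_le_length[OF gc F(1) b(3) g'] show ?thesis by (simp add: g_def cone_length_def)
qed

lemma cone_curve_of_gcurve:
  assumes g: "gcurve \<gamma> b" and b: "b \<ge> 0" and t: "t \<ge> 1" "t' \<ge> 1"
  defines "\<Gamma> \<equiv> \<lambda>s. (\<gamma> s, t + s * (t' - t))"
  shows "cone_curve \<A> \<Gamma>" "cone_length \<A> \<rho> \<Gamma> \<le> ennreal (sqrt ((max t t' * b)\<^sup>2 + (t' - t)\<^sup>2))"
proof -
  obtain F where F: "finite F" "\<And>c. c \<in> \<A> \<Longrightarrow> (\<lambda>s. snd c (\<gamma> s)) C1_differentiable_on {s \<in> {0<..<1} - F. \<gamma> s \<in> dom c}"
    "\<And>s c v. s \<in> {0<..<1} - F \<Longrightarrow> c \<in> \<A> \<Longrightarrow> \<gamma> s \<in> dom c \<Longrightarrow> ((\<lambda>r. snd c (\<gamma> r)) has_vector_derivative v) (at s) \<Longrightarrow> sqrt (\<rho> c (\<gamma> s) v v) \<le> b"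
    and gc: "continuous_on {0..1} \<gamma>"
    using g unfolding gcurve_def by blast
  have ht: "1 \<le> t + s * (t' - t) \<and> t + s * (t' - t) \<le> max t t'" if "s \<in> {0..1}" for s
  proof -
    have e: "t + s * (t' - t) = (1 - s) * t + s * t'" by (simp add: algebra_simps)
    have "(1 - s) * 1 + s * 1 \<le> (1 - s) * t + s * t'" using that t by (intro add_mono mult_left_mono) auto
    moreover have "(1 - s) * t + s * t' \<le> (1 - s) * max t t' + s * max t t'" using that by (intro add_mono mult_left_mono) auto
    moreover have "(1 - s) * max t t' + s * max t t' = max t t'" by (simp add: algebra_simps)
    ultimately show ?thesis unfolding e by simp
  qed
  have td: "((\<lambda>s. t + s * (t' - t)) has_vector_derivative (t' - t)) (at s)" for s
    unfolding has_real_derivative_iff_has_vector_derivative[symmetric] by (auto intro!: derivative_eq_intros)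
  show "cone_curve \<A> \<Gamma>"
    unfolding cone_curve_def
  proof (intro conjI exI[of _ F])
    show "continuous_on {0..1} \<Gamma>" unfolding \<Gamma>_def by (intro continuous_intros gc)
    show "\<Gamma> ` {0..1} \<subseteq> cone" using ht by (auto simp: \<Gamma>_def cone_def)
    show "\<forall>(U, \<phi>)\<in>\<A>. (\<lambda>s. (\<phi> (fst (\<Gamma> s)), snd (\<Gamma> s))) C1_differentiable_on {s \<in> {0<..<1} - F. fst (\<Gamma> s) \<in> U}"
    proof (intro ballI, clarify)
      fix U \<phi> assume c: "(U, \<phi>) \<in> \<A>"
      define X where "X = {s \<in> {0<..<1} - F. \<gamma> s \<in> U}"
      obtain D where D: "\<And>x. x \<in> X \<Longrightarrow> ((\<lambda>s. \<phi> (\<gamma> s)) has_vector_derivative D x) (at x)" "continuous_on X D"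
        using F(2)[OF c] unfolding C1_differentiable_on_def X_def by auto
      have "((\<lambda>s. (\<phi> (\<gamma> s), t + s * (t' - t))) has_vector_derivative (D x, t' - t)) (at x)" if "x \<in> X" for x
        by (rule has_vector_derivative_Pair[OF D(1)[OF that] td])
      moreover have "continuous_on X (\<lambda>x. (D x, t' - t))" by (intro continuous_intros D(2))
      ultimately show "(\<lambda>s. (\<phi> (fst (\<Gamma> s)), snd (\<Gamma> s))) C1_differentiable_on {s \<in> {0<..<1} - F. fst (\<Gamma> s) \<in> U}"
        unfolding C1_differentiable_on_def \<Gamma>_def fst_conv snd_conv X_def[symmetric]
        by (intro exI[of _ "\<lambda>x. (D x, t' - t)"]) auto
    qed
  qed (rule F(1))
  define Q where "Q = sqrt ((max t t' * b)\<^sup>2 + (t' - t)\<^sup>2)"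
  have sp: "cone_speed \<A> \<rho> \<Gamma> s \<le> Q" if s: "s \<in> {0<..<1} - F" for s
  proof -
    define p where "p = \<gamma> s"
    define c where "c = (SOME c. c \<in> \<A> \<and> p \<in> dom c)"
    have "\<exists>c. c \<in> \<A> \<and> p \<in> dom c" using chart_ex by blast
    then have c: "c \<in> \<A>" "p \<in> dom c" unfolding c_def by (metis (mono_tags, lifting) someI_ex)+
    obtain v where v: "((\<lambda>r. snd c (\<gamma> r)) has_vector_derivative v) (at s)"
      using F(2)[OF c(1)] s c unfolding C1_differentiable_on_def by (auto simp: p_def)
    define h where "h = t + s * (t' - t)"
    have h: "0 \<le> h" "h \<le> max t t'" using ht[of s] s by (auto simp: h_def)
    have "cone_speed \<A> \<rho> \<Gamma> s = sqrt (h\<^sup>2 * \<rho> c p v v + (t' - t)\<^sup>2)"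
      unfolding cone_speed_def Let_def \<Gamma>_def fst_conv snd_conv p_def[symmetric] c_def[symmetric] h_def[symmetric]
      using vector_derivative_at[OF v] vector_derivative_at[OF td] by simp
    also have "\<dots> \<le> Q" unfolding Q_def
    proof (intro real_sqrt_le_mono add_right_mono)
      have rn: "0 \<le> \<rho> c p v v" by (rule rho_nonneg[OF c])
      have "sqrt (\<rho> c p v v) \<le> b" using F(3)[OF s c(1) _ v] c(2) by (simp add: p_def)
      then have "h * sqrt (\<rho> c p v v) \<le> max t t' * b" using h rn by (intro mult_mono) auto
      then have "(h * sqrt (\<rho> c p v v))\<^sup>2 \<le> (max t t' * b)\<^sup>2" using h rn by (intro power_mono) auto
      then show "h\<^sup>2 * \<rho> c p v v \<le> (max t t' * b)\<^sup>2" using rn by (simp add: power_mult_distrib)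
    qed
    finally show ?thesis .
  qed
  have "cone_length \<A> \<rho> \<Gamma> \<le> (\<integral>\<^sup>+ s. ennreal Q * indicator {0<..<1} s \<partial>(lborel :: real measure))"
    unfolding cone_length_def
  proof (rule nn_integral_mono_AE)
    have "AE s in lborel. s \<notin> F" by (rule AE_not_in) (use F(1) finite_imp_null_set_lborel in auto)
    then show "AE s in lborel. ennreal (cone_speed \<A> \<rho> \<Gamma> s) * indicator {0<..<1} s \<le> ennreal Q * indicator {0<..<1} s"
    proof eventually_elim
      case (elim s)
      then show ?case using sp[of s] by (auto simp: indicator_def ennreal_leI)
    qed
  qed
  also have "\<dots> = ennreal Q * emeasure lborel {0<..<1::real}" by (rule nn_integral_cmult_indicator) simp
  also have "\<dots> = ennreal Q" by simp
  finally show "cone_length \<A> \<rho> \<Gamma> \<le> ennreal (sqrt ((max t t' * b)\<^sup>2 + (t' - t)\<^sup>2))" by (simp add: Q_def)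
qed

lemma cone_dist_le:
  assumes g: "gcurve \<gamma> b" "b \<ge> 0" "\<gamma> 0 = x" "\<gamma> 1 = y" and t: "t \<ge> 1"
  shows "cone_dist \<A> \<rho> (x,t) (y,t) \<le> t * b"
proof -
  note c = cone_curve_of_gcurve[OF g(1,2) t t]
  have "(INF \<gamma>\<in>{\<gamma>. cone_curve \<A> \<gamma> \<and> \<gamma> 0 = (x,t) \<and> \<gamma> 1 = (y,t)}. cone_length \<A> \<rho> \<gamma>) \<le> ennreal (sqrt ((max t t * b)\<^sup>2 + (t - t)\<^sup>2))"
    by (rule INF_lower2[of "\<lambda>s. (\<gamma> s, t + s * (t - t))"]) (use c g(3,4) in auto)
  also have "sqrt ((max t t * b)\<^sup>2 + (t - t)\<^sup>2) = t * b" using t g(2) by simp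
  finally have "enn2real (INF \<gamma>\<in>{\<gamma>. cone_curve \<A> \<gamma> \<and> \<gamma> 0 = (x,t) \<and> \<gamma> 1 = (y,t)}. cone_length \<A> \<rho> \<gamma>) \<le> enn2real (ennreal (t * b))"
    by (rule enn2real_mono) simp
  then show ?thesis using t g(2) by (simp add: cone_dist_def)
qed

text \<open>\<open>enn2real\<close> sends infinity to 0, so the bound needs at least one curve of
  finite length; this is what the hypothesis on joining curves supplies.\<close>

lemma cone_dist_ge:
  assumes conn: "\<And>x y. \<exists>\<gamma> b. b \<ge> 0 \<and> gcurve \<gamma> b \<and> \<gamma> 0 = x \<and> \<gamma> 1 = y" and zw: "z \<in> cone" "w \<in> cone"
    and f: "mfun f" "\<And>p. \<bar>f p\<bar> \<le> M" "\<And>p. grad_le f p b" "b \<ge> 0" "M + b > 0"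
  shows "\<bar>snd z * f (fst z) - snd w * f (fst w)\<bar> \<le> (M + b) * cone_dist \<A> \<rho> z w"
proof -
  obtain x t y t' where [simp]: "z = (x,t)" "w = (y,t')" by fastforce
  have t: "t \<ge> 1" "t' \<ge> 1" using zw by (auto simp: cone_def)
  obtain \<gamma> b' where g: "b' \<ge> 0" "gcurve \<gamma> b'" "\<gamma> 0 = x" "\<gamma> 1 = y" using conn by blast
  note c = cone_curve_of_gcurve[OF g(2,1) t]
  define I where "I = (INF \<gamma>\<in>{\<gamma>. cone_curve \<A> \<gamma> \<and> \<gamma> 0 = z \<and> \<gamma> 1 = w}. cone_length \<A> \<rho> \<gamma>)"
  have "I \<le> ennreal (sqrt ((max t t' * b')\<^sup>2 + (t' - t)\<^sup>2))"
    unfolding I_def by (rule INF_lower2[of "\<lambda>s. (\<gamma> s, t + s * (t' - t))"]) (use c g in auto)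
  then have fin: "I < \<top>" by (rule le_less_trans) simp
  have "ennreal (\<bar>snd z * f (fst z) - snd w * f (fst w)\<bar> / (M + b)) \<le> I"
    unfolding I_def
  proof (rule INF_greatest)
    fix \<gamma> assume "\<gamma> \<in> {\<gamma>. cone_curve \<A> \<gamma> \<and> \<gamma> 0 = z \<and> \<gamma> 1 = w}"
    then show "ennreal (\<bar>snd z * f (fst z) - snd w * f (fst w)\<bar> / (M + b)) \<le> cone_length \<A> \<rho> \<gamma>"
      using cone_length_lower[OF f, of \<gamma>] by (simp add: abs_minus_commute)
  qed
  then have "enn2real (ennreal (\<bar>snd z * f (fst z) - snd w * f (fst w)\<bar> / (M + b))) \<le> enn2real I"
    using fin by (rule enn2real_mono)
  then have "\<bar>snd z * f (fst z) - snd w * f (fst w)\<bar> / (M + b) \<le> cone_dist \<A> \<rho> z w"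
    using f(5) by (simp add: I_def cone_dist_def)
  then show ?thesis using f(5) by (simp add: divide_le_eq mult.commute)
qed

end

locale riemannian_family = riemannian_atlas \<A> \<rho> + atlas_family \<A> P
  for \<A> :: "('a::{t2_space,second_countable_topology}, 'e::euclidean_space) chart set" and \<rho> P
begin

text \<open>Nearby points lie in a common coordinate ball, and the coordinate segment between them
  is short both for \<open>d\<close> and for the Riemannian metric. This is the local comparison of
  the two.\<close>

lemma near_segment:
  obtains L where "L > 0" "\<And>x y. d x y \<le> 1/2 \<Longrightarrow> \<exists>\<gamma>. \<gamma> 0 = x \<and> \<gamma> 1 = y \<and>
     (\<forall>s\<in>{0..1}. \<forall>s'\<in>{0..1}. d (\<gamma> s) (\<gamma> s') \<le> L * d x y * \<bar>s - s'\<bar>) \<and> gcurve \<gamma> (L * d x y)"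
proof -
  obtain Lc where Lc: "Lc > 0" "\<And>c x r. (c,x,r) \<in> P \<Longrightarrow> DIM('e) * (1 + norm x + 2 * r) \<le> Lc" by (rule chart_lipschitz_const) (rule that)
  obtain Ls where Ls: "Ls > 0"
    "\<And>c x r u v s s'. (c,x,r) \<in> P \<Longrightarrow> norm (u - x) \<le> 3/2 * r \<Longrightarrow> norm (v - x) \<le> 3/2 * r \<Longrightarrow> s \<in> {0..1} \<Longrightarrow> s' \<in> {0..1} \<Longrightarrow>
      d (chart_inv c ((1 - s) *\<^sub>R u + s *\<^sub>R v)) (chart_inv c ((1 - s') *\<^sub>R u + s' *\<^sub>R v)) \<le> Ls * norm (u - v) * \<bar>s - s'\<bar>"
    by (rule segment_lipschitz) (rule that)
  define Q where "Q = (\<lambda>(c :: ('a, 'e) chart, x :: 'e, r :: real) b. \<forall>y\<in>cball x (3/2 * r). \<forall>w. \<rho> c (chart_inv c y) w w \<le> b * (norm w)\<^sup>2)"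
  have sub: "cball x (3/2 * r) \<subseteq> img c" if "(c,x,r) \<in> P" for c x r
    using P_chart[OF that] by (intro order_trans[OF subset_cball, of "3/2 * r" "2 * r" x "img c"]) auto
  have "\<exists>b. 0 \<le> b \<and> Q k b" if k: "k \<in> P" for k
  proof -
    obtain c x r where kk: "k = (c,x,r)" by (cases k)
    have c: "c \<in> \<A>" using P_chart k kk by blast
    obtain b where "b > 0" "\<And>y v. y \<in> cball x (3/2 * r) \<Longrightarrow> \<rho> c (chart_inv c y) v v \<le> b * (norm v)\<^sup>2"
      "\<And>y v. y \<in> cball x (3/2 * r) \<Longrightarrow> (norm v)\<^sup>2 \<le> b * \<rho> c (chart_inv c y) v v"
      by (rule rho_bounds[OF c compact_cball sub[OF k[unfolded kk]]]) (rule that)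
    then show ?thesis unfolding Q_def kk by (intro exI[of _ b]) auto
  qed
  then obtain b where b: "\<And>k. k \<in> P \<Longrightarrow> 0 \<le> b k" "\<And>k. k \<in> P \<Longrightarrow> Q k (b k)" by metis
  define bm where "bm = (\<Sum>k\<in>P. b k)"
  have bm: "b k \<le> bm" if "k \<in> P" for k unfolding bm_def using P_fin b(1) that by (intro member_le_sum) auto
  \<comment> \<open>The first summand serves the Lipschitz bound for \<open>d\<close>, the second
    the bound on the Riemannian speed.\<close>
  define L where "L = Ls * Lc + sqrt bm * Lc"
  have bm0: "bm \<ge> 0" unfolding bm_def using b(1) by (intro sum_nonneg)
  have L: "L > 0" unfolding L_def using Ls(1) Lc(1) bm0 by (intro add_pos_nonneg) auto
  have "\<exists>\<gamma>. \<gamma> 0 = x \<and> \<gamma> 1 = y \<and>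
     (\<forall>s\<in>{0..1}. \<forall>s'\<in>{0..1}. d (\<gamma> s) (\<gamma> s') \<le> L * d x y * \<bar>s - s'\<bar>) \<and> gcurve \<gamma> (L * d x y)" if xy: "d x y \<le> 1/2" for x y
  proof -
    have dn: "d x y \<ge> 0" by (intro sum_nonneg) auto
    obtain c x0 r where k: "(c,x0,r) \<in> P" "x \<in> dom c" "norm (snd c x - x0) < r" using P_cover[of x] by auto
    have cr: "c \<in> \<A>" "r > 0" using P_chart[OF k(1)] by auto
    define u v where "u = snd c x" and "v = snd c y"
    have cc: "y \<in> dom c" "norm (v - x0) < 3/2 * r" "norm (u - v) \<le> DIM('e) * (1 + norm x0 + 2 * r) * d x y"
      using chart_control[OF k(1,2) less_imp_le[OF k(3)] xy] by (auto simp: u_def v_def)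
    have "DIM('e) * (1 + norm x0 + 2 * r) * d x y \<le> Lc * d x y" using Lc(2)[OF k(1)] dn by (rule mult_right_mono)
    then have uv: "norm (u - v) \<le> Lc * d x y" using cc(3) by linarith
    have u: "norm (u - x0) \<le> 3/2 * r" and v: "norm (v - x0) \<le> 3/2 * r" using k(3) cc(2) cr by (auto simp: u_def)
    define \<gamma> where "\<gamma> = (\<lambda>s. chart_inv c ((1 - s) *\<^sub>R u + s *\<^sub>R v))"
    have "\<gamma> 0 = x" "\<gamma> 1 = y" using cr k(2) cc(1) by (auto simp: \<gamma>_def u_def v_def)
    moreover have "d (\<gamma> s) (\<gamma> s') \<le> L * d x y * \<bar>s - s'\<bar>" if "s \<in> {0..1}" "s' \<in> {0..1}" for s s'
    proof -
      have "d (\<gamma> s) (\<gamma> s') \<le> Ls * norm (u - v) * \<bar>s - s'\<bar>" unfolding \<gamma>_def by (rule Ls(2)[OF k(1) u v that])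
      also have "\<dots> \<le> Ls * (Lc * d x y) * \<bar>s - s'\<bar>" using uv Ls(1) by (intro mult_right_mono mult_left_mono) auto
      also have "\<dots> = (Ls * Lc) * (d x y * \<bar>s - s'\<bar>)" by simp
      also have "\<dots> \<le> L * (d x y * \<bar>s - s'\<bar>)" unfolding L_def using dn Lc(1) bm0 by (intro mult_right_mono) auto
      finally show ?thesis by (simp add: mult.assoc)
    qed
    moreover have "gcurve \<gamma> (L * d x y)"
    proof (rule gcurve_mono)
      have "Q (c,x0,r) (b (c,x0,r))" using b(2)[OF k(1)] .
      then show "gcurve \<gamma> (sqrt (b (c,x0,r)) * norm (u - v))" unfolding \<gamma>_def
        by (intro gcurve_chart_segment[OF cr(1) convex_cball sub[OF k(1)]] b(1)[OF k(1)])
          (use u v in \<open>auto simp: Q_def dist_norm norm_minus_commute\<close>)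
      have "sqrt (b (c,x0,r)) * norm (u - v) \<le> sqrt bm * (Lc * d x y)"
        using uv bm[OF k(1)] b(1)[OF k(1)] bm0 by (intro mult_mono) auto
      also have "\<dots> = (sqrt bm * Lc) * d x y" by simp
      also have "\<dots> \<le> L * d x y" unfolding L_def using dn Lc(1) Ls(1) by (intro mult_right_mono) auto
      finally show "sqrt (b (c,x0,r)) * norm (u - v) \<le> L * d x y" .
    qed
    ultimately show ?thesis by blast
  qed
  then show ?thesis using that[OF L] by blast
qed

lemma d_cont: "continuous_on UNIV (\<lambda>y. d x y)"
  using mfun_continuous[OF Phi_mfun] by (intro continuous_intros) auto

text \<open>The set of points reachable from \<open>x\<close> is open and closed, since
  \<open>near_segment\<close> joins any two points at distance at most 1/2.\<close>

lemma gcurve_connected: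
  assumes conn: "connected (UNIV :: 'a set)"
  shows "\<exists>\<gamma> b. b \<ge> 0 \<and> gcurve \<gamma> b \<and> \<gamma> 0 = x \<and> \<gamma> 1 = y"
proof -
  obtain L where L: "L > 0" "\<And>x y. d x y \<le> 1/2 \<Longrightarrow> \<exists>\<gamma>. \<gamma> 0 = x \<and> \<gamma> 1 = y \<and>
     (\<forall>s\<in>{0..1}. \<forall>s'\<in>{0..1}. d (\<gamma> s) (\<gamma> s') \<le> L * d x y * \<bar>s - s'\<bar>) \<and> gcurve \<gamma> (L * d x y)" by (rule near_segment) (rule that)
  define R where "R = {y. \<exists>\<gamma> b. b \<ge> 0 \<and> gcurve \<gamma> b \<and> \<gamma> 0 = x \<and> \<gamma> 1 = y}"
  have step: "z \<in> R" if yR: "y \<in> R" and yz: "d y z \<le> 1/2" for y z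
  proof -
    obtain \<gamma>1 b1 where g1: "b1 \<ge> 0" "gcurve \<gamma>1 b1" "\<gamma>1 0 = x" "\<gamma>1 1 = y" using yR by (auto simp: R_def)
    obtain \<gamma>2 where g2: "gcurve \<gamma>2 (L * d y z)" "\<gamma>2 0 = y" "\<gamma>2 1 = z" using L(2)[OF yz] by blast
    define b where "b = max b1 (L * d y z)"
    have "gcurve (\<gamma>1 +++ \<gamma>2) (2 * b)"
      using g1 g2 by (intro gcurve_join gcurve_mono[OF g1(2)] gcurve_mono[OF g2(1)]) (auto simp: b_def)
    moreover have "(\<gamma>1 +++ \<gamma>2) 0 = x" "(\<gamma>1 +++ \<gamma>2) 1 = z" using g1 g2 by (auto simp: joinpaths_def)
    moreover have "2 * b \<ge> 0" using g1 by (simp add: b_def)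
    ultimately show ?thesis unfolding R_def by blast
  qed
  have ob: "open {z. d y z < 1/2}" for y by (rule open_Collect_less[OF d_cont continuous_on_const])
  have "open R"
  proof (subst open_subopen, rule ballI)
    fix y assume "y \<in> R"
    then show "\<exists>T. open T \<and> y \<in> T \<and> T \<subseteq> R"
      using step[of y] ob[of y] by (intro exI[of _ "{z. d y z < 1/2}"]) (auto intro: less_imp_le)
  qed
  moreover have "open (- R)"
  proof (subst open_subopen, rule ballI)
    fix y assume y: "y \<in> - R"
    have "z \<notin> R" if "d y z < 1/2" for z using step[of z y] y that by (auto simp: abs_minus_commute)
    then show "\<exists>T. open T \<and> y \<in> T \<and> T \<subseteq> - R"
      using ob[of y] by (intro exI[of _ "{z. d y z < 1/2}"]) auto
  qed
  moreover have "x \<in> R" unfolding R_def using gcurve_const[of x] by auto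
  ultimately have "R = UNIV" using connectedD[OF conn, of R "- R"] by auto
  then have "y \<in> R" by simp
  then show ?thesis by (simp add: R_def)
qed

end

locale lie_geometry = riemannian_family \<A> \<rho> P
  for \<A> :: "('a::{t2_space,second_countable_topology}, 'e::euclidean_space) chart set" and \<rho> P +
  fixes G :: "'a monoid" (structure)
  assumes lie: "lie_group G \<A>"
begin

lemma mult_continuous: "continuous_on UNIV (\<lambda>p. fst p \<otimes> snd p)"
  using lie by (simp add: lie_group_def smooth_map_def case_prod_beta)

text \<open>The Lie group axiom speaks about product charts. The work is to identify the inverse of
  a product chart with the product of the inverses and to see that \<open>T\<close> is exactly the
  domain of the coordinate expression.\<close>

lemma mult_chart_bdd:
  assumes f: "mfun f" and c: "c1 \<in> \<A>" "c2 \<in> \<A>" "c3 \<in> \<A>"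
  defines "T \<equiv> {p \<in> img c1 \<times> img c2. chart_inv c1 (fst p) \<otimes> chart_inv c2 (snd p) \<in> dom c3}"
  shows "open T" "loc_bdd_deriv T (\<lambda>p. f (chart_inv c1 (fst p) \<otimes> chart_inv c2 (snd p)))"
proof -
  define m where "m = (\<lambda>p. chart_inv c1 (fst p) \<otimes> chart_inv c2 (snd p))"
  have mc: "continuous_on (img c1 \<times> img c2) m"
    unfolding m_def
    by (rule continuous_on_compose2[OF mult_continuous, of _ "\<lambda>p. (chart_inv c1 (fst p), chart_inv c2 (snd p))", simplified])
      (intro continuous_intros continuous_on_compose2[OF chart_inv_cont[OF c(1)]] continuous_on_compose2[OF chart_inv_cont[OF c(2)]]; auto)
  have "T = (img c1 \<times> img c2) \<inter> m -` dom c3" by (auto simp: T_def m_def)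
  then show oT: "open T"
    using continuous_open_preimage[OF mc open_Times[OF chart_open(2)[OF c(1)] chart_open(2)[OF c(2)]] chart_open(1)[OF c(3)]] by simp
  define C where "C = (dom c1 \<times> dom c2, map_prod (snd c1) (snd c2))"
  have "\<exists>U \<phi> V \<psi>. C = (U \<times> V, map_prod \<phi> \<psi>) \<and> (U, \<phi>) \<in> \<A> \<and> (V, \<psi>) \<in> \<A>"
    by (rule exI[of _ "fst c1"], rule exI[of _ "snd c1"], rule exI[of _ "fst c2"], rule exI[of _ "snd c2"])
      (use c in \<open>simp add: C_def\<close>)
  then have C: "C \<in> prod_atlas \<A> \<A>" unfolding prod_atlas_def by blast
  define \<mu> where "\<mu> = (\<lambda>(x, y). x \<otimes> y)"
  have "smooth_map (prod_atlas \<A> \<A>) \<A> \<mu>" using lie by (simp add: lie_group_def \<mu>_def)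
  then have sm: "smooth_on (snd C ` (fst C \<inter> \<mu> -` dom c3)) (transition C c3 \<mu>)"
    using C c(3) by (auto simp: smooth_map_def)
  have inj: "inj_on (map_prod (snd c1) (snd c2)) (dom c1 \<times> dom c2)"
    by (rule map_prod_inj_on[OF chart_inj[OF c(1)] chart_inj[OF c(2)]])
  have iv: "inv_into (fst C) (snd C) p = (chart_inv c1 (fst p), chart_inv c2 (snd p))" if p: "p \<in> img c1 \<times> img c2" for p
  proof -
    have "map_prod (snd c1) (snd c2) (chart_inv c1 (fst p), chart_inv c2 (snd p)) = p"
      using p by (auto simp: chart_inv_right)
    moreover have "(chart_inv c1 (fst p), chart_inv c2 (snd p)) \<in> dom c1 \<times> dom c2"
      using p by (auto simp: chart_inv_right)
    then have "inv_into (dom c1 \<times> dom c2) (map_prod (snd c1) (snd c2))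
        (map_prod (snd c1) (snd c2) (chart_inv c1 (fst p), chart_inv c2 (snd p))) = (chart_inv c1 (fst p), chart_inv c2 (snd p))"
      by (rule inv_into_f_f[OF inj])
    ultimately show ?thesis by (simp only: C_def fst_conv snd_conv)
  qed
  have im: "snd C ` (fst C \<inter> \<mu> -` dom c3) = T"
  proof (rule equalityI; rule subsetI)
    fix p assume "p \<in> snd C ` (fst C \<inter> \<mu> -` dom c3)"
    then obtain x y where "p = (snd c1 x, snd c2 y)" "x \<in> dom c1" "y \<in> dom c2" "x \<otimes> y \<in> dom c3" by (auto simp: C_def \<mu>_def)
    then show "p \<in> T" using c by (auto simp: T_def)
  next
    fix p assume p: "p \<in> T"
    show "p \<in> snd C ` (fst C \<inter> \<mu> -` dom c3)"
      by (rule image_eqI[of _ _ "(chart_inv c1 (fst p), chart_inv c2 (snd p))"])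
        (use p in \<open>auto simp: T_def C_def \<mu>_def chart_inv_right\<close>)
  qed
  have "loc_bdd_deriv T (transition C c3 \<mu>)" using loc_bdd_deriv_smooth[OF sm[unfolded im] oT] .
  moreover have "transition C c3 \<mu> ` T \<subseteq> img c3" using iv by (auto simp: transition_def \<mu>_def T_def)
  moreover have "loc_bdd_deriv (img c3) (\<lambda>y. f (chart_inv c3 y))" using f c by (simp add: mfun_def)
  ultimately have l: "loc_bdd_deriv T (\<lambda>p. f (chart_inv c3 (transition C c3 \<mu> p)))" using loc_bdd_deriv_compose by blast
  have eq: "f (chart_inv c1 (fst p) \<otimes> chart_inv c2 (snd p)) = f (chart_inv c3 (transition C c3 \<mu> p))" if "p \<in> T" for p
    using that iv[of p] c by (auto simp: T_def transition_def \<mu>_def)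
  show "loc_bdd_deriv T (\<lambda>p. f (chart_inv c1 (fst p) \<otimes> chart_inv c2 (snd p)))"
    by (rule loc_bdd_deriv_local) (use l oT eq in blast)
qed

text \<open>The compactness argument runs over pairs \<open>(g, p)\<close>, so the constant does not
  depend on \<open>g\<close>. For \<open>q\<close> close to \<open>p\<close> the coordinate
  expression of the product is Lipschitz; for \<open>q\<close> far from \<open>p\<close> boundedness
  of \<open>f\<close> suffices.\<close>

lemma left_mult_lipschitz_fun:
  assumes f: "mfun f" shows "\<exists>b. \<forall>g p q. \<bar>f (g \<otimes> p) - f (g \<otimes> q)\<bar> \<le> b * d p q"
proof -
  have dn: "d p q \<ge> 0" for p q by (intro sum_nonneg) auto
  have "bounded (f ` UNIV)" by (intro compact_imp_bounded compact_continuous_image mfun_continuous[OF f] compact_space)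
  then obtain M where M: "\<And>p. \<bar>f p\<bar> \<le> M" by (auto simp: bounded_iff)
  have cpt2: "compact (UNIV :: ('a \<times> 'a) set)" using compact_Times[OF compact_space compact_space] by simp
  have "\<exists>b. \<forall>z\<in>UNIV. \<forall>q. \<bar>f (fst z \<otimes> snd z) - f (fst z \<otimes> q)\<bar> \<le> b * d (snd z) q"
  proof (rule compact_local_bound[OF cpt2])
    fix z :: "'a \<times> 'a" and b b' :: real
    assume "\<forall>q. \<bar>f (fst z \<otimes> snd z) - f (fst z \<otimes> q)\<bar> \<le> b * d (snd z) q" and b: "b \<le> b'"
    moreover have "b * d (snd z) q \<le> b' * d (snd z) q" for q using b dn by (rule mult_right_mono)
    ultimately show "\<forall>q. \<bar>f (fst z \<otimes> snd z) - f (fst z \<otimes> q)\<bar> \<le> b' * d (snd z) q" by (meson order_trans)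
  next
    fix z :: "'a \<times> 'a"
    obtain g0 p0 where z: "z = (g0,p0)" by (cases z)
    obtain c1 where c1: "c1 \<in> \<A>" "g0 \<in> dom c1" using chart_ex by blast
    obtain c2 x0 r where k: "(c2,x0,r) \<in> P" "p0 \<in> dom c2" "norm (snd c2 p0 - x0) < r" using P_cover[of p0] by auto
    have cr: "c2 \<in> \<A>" "r > 0" using P_chart[OF k(1)] by auto
    obtain c3 where c3: "c3 \<in> \<A>" "g0 \<otimes> p0 \<in> dom c3" using chart_ex by blast
    define T where "T = {p \<in> img c1 \<times> img c2. chart_inv c1 (fst p) \<otimes> chart_inv c2 (snd p) \<in> dom c3}"
    define F where "F = (\<lambda>p. f (chart_inv c1 (fst p) \<otimes> chart_inv c2 (snd p)))"
    have T: "open T" "loc_bdd_deriv T F" unfolding T_def F_def by (rule mult_chart_bdd[OF f c1(1) cr(1) c3(1)])+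
    define a0 b0 where "a0 = snd c1 g0" and "b0 = snd c2 p0"
    have "(a0,b0) \<in> T" using c1 k(2) cr c3 by (auto simp: T_def a0_def b0_def)
    then obtain e where e: "e > 0" "cball (a0,b0) e \<subseteq> T" using T(1) unfolding open_contains_cball by blast
    obtain B where B: "B \<ge> 0" "\<And>y w. y \<in> cball (a0,b0) e \<Longrightarrow> w \<in> cball (a0,b0) e \<Longrightarrow> norm (F y - F w) \<le> B * norm (y - w)"
      using loc_bdd_deriv_lipschitz[OF T(2) compact_cball convex_cball e(2)] by blast
    have inball: "(a,b) \<in> cball (a0,b0) e" if "norm (a - a0) < e/2" "norm (b - b0) < e/2" for a b
    proof -
      have "norm (a0 - a, b0 - b) \<le> norm (a0 - a) + norm (b0 - b)" by (rule norm_Pair_le)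
      then show ?thesis using that by (simp add: dist_norm norm_minus_commute)
    qed
    define N1 where "N1 = dom c1 \<inter> snd c1 -` ball a0 (e/2)"
    \<comment> \<open>The first set keeps the coordinates of \<open>p\<close> near those of
      \<open>p0\<close>; the second makes \<open>chart_control\<close> applicable at
      \<open>p\<close>.\<close>
    define N2 where "N2 = (dom c2 \<inter> snd c2 -` ball b0 (e/4)) \<inter> (dom c2 \<inter> snd c2 -` ball x0 r)"
    have oN: "open (N1 \<times> N2)" unfolding N1_def N2_def
      by (intro open_Times open_Int chart_preimage_open[OF c1(1) open_ball] chart_preimage_open[OF cr(1) open_ball])
    have zN: "z \<in> N1 \<times> N2" using z c1 k e by (auto simp: N1_def N2_def a0_def b0_def dist_norm norm_minus_commute)
    define Lc where "Lc = DIM('e) * (1 + norm x0 + 2 * r)"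
    have "1 + norm x0 + 2 * r > 0" using cr(2) norm_ge_zero[of x0] by linarith
    then have Lc: "Lc > 0" unfolding Lc_def by simp
    \<comment> \<open>Below 1/2 \<open>chart_control\<close> applies, and below
      \<open>e / (4 * Lc)\<close> the coordinates of \<open>q\<close> differ from those of
      \<open>p\<close> by at most \<open>e/4\<close>, so both points stay in the ball of radius
      \<open>e\<close>.\<close>
    define \<delta> where "\<delta> = min (1/2) (e / (4 * Lc))"
    have \<delta>: "\<delta> > 0" using e Lc by (simp add: \<delta>_def)
    define b where "b = max (B * Lc) (2 * M / \<delta>)"
    have "\<bar>f (g \<otimes> p) - f (g \<otimes> q)\<bar> \<le> b * d p q" if gp: "g \<in> N1" "p \<in> N2" for g p q
    proof (cases "d p q \<le> \<delta>")
      case True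
      have p: "p \<in> dom c2" "norm (snd c2 p - x0) \<le> r" "norm (snd c2 p - b0) < e/4"
        using gp by (auto simp: N2_def dist_norm norm_minus_commute)
      have g: "g \<in> dom c1" "norm (snd c1 g - a0) < e/2" using gp by (auto simp: N1_def dist_norm norm_minus_commute)
      have "d p q \<le> 1/2" using True by (simp add: \<delta>_def)
      note cc = chart_control[OF k(1) p(1,2) this]
      have n: "norm (snd c2 p - snd c2 q) \<le> Lc * d p q" using cc(3) by (simp add: Lc_def)
      also have "\<dots> \<le> Lc * (e / (4 * Lc))" using True Lc by (intro mult_left_mono) (auto simp: \<delta>_def)
      finally have "norm (snd c2 p - snd c2 q) \<le> e/4" using Lc by simp
      then have "norm (snd c2 q - b0) < e/2"
        using p(3) norm_triangle_ineq[of "snd c2 q - snd c2 p" "snd c2 p - b0"] by (simp add: norm_minus_commute)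
      then have in2: "(snd c1 g, snd c2 q) \<in> cball (a0,b0) e" using g by (intro inball)
      have in1: "(snd c1 g, snd c2 p) \<in> cball (a0,b0) e" using g p e by (intro inball) auto
      have "\<bar>f (g \<otimes> p) - f (g \<otimes> q)\<bar> = norm (F (snd c1 g, snd c2 p) - F (snd c1 g, snd c2 q))"
        using g p cc(1) c1 cr by (simp add: F_def)
      also have "\<dots> \<le> B * norm ((snd c1 g, snd c2 p) - (snd c1 g, snd c2 q))" by (rule B(2)[OF in1 in2])
      also have "norm ((snd c1 g, snd c2 p) - (snd c1 g, snd c2 q)) = norm (snd c2 p - snd c2 q)" by (simp add: norm_Pair)
      also have "B * norm (snd c2 p - snd c2 q) \<le> B * (Lc * d p q)" using n B(1) by (rule mult_left_mono)
      also have "\<dots> = (B * Lc) * d p q" by simp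
      also have "\<dots> \<le> b * d p q" using dn by (intro mult_right_mono) (auto simp: b_def)
      finally show ?thesis .
    next
      case False
      have M0: "M \<ge> 0" using M[of g] by linarith
      have "\<bar>f (g \<otimes> p) - f (g \<otimes> q)\<bar> \<le> 2 * M" using M[of "g \<otimes> p"] M[of "g \<otimes> q"] by linarith
      also have "\<dots> = 2 * M / \<delta> * \<delta>" using \<delta> by simp
      also have "\<dots> \<le> 2 * M / \<delta> * d p q" using False \<delta> M0 by (intro mult_left_mono) auto
      also have "\<dots> \<le> b * d p q" using dn by (intro mult_right_mono) (auto simp: b_def)
      finally show ?thesis .
    qed
    then have "\<forall>y\<in>N1 \<times> N2. \<forall>q. \<bar>f (fst y \<otimes> snd y) - f (fst y \<otimes> q)\<bar> \<le> b * d (snd y) q" by auto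
    then show "\<exists>U b. open U \<and> z \<in> U \<and> (\<forall>y\<in>U. \<forall>q. \<bar>f (fst y \<otimes> snd y) - f (fst y \<otimes> q)\<bar> \<le> b * d (snd y) q)"
      using oN zN by blast
  qed
  then obtain b where "\<And>z q. \<bar>f (fst z \<otimes> snd z) - f (fst z \<otimes> q)\<bar> \<le> b * d (snd z) q" by blast
  from this[of "(_, _)"] show ?thesis by auto
qed

lemma left_mult_lipschitz: obtains \<Lambda> where "\<Lambda> \<ge> 1" "\<And>g p q. d (g \<otimes> p) (g \<otimes> q) \<le> \<Lambda> * d p q"
proof -
  have dn: "d p q \<ge> 0" for p q by (intro sum_nonneg) auto
  have "\<forall>f\<in>\<Phi>. \<exists>b. \<forall>g p q. \<bar>f (g \<otimes> p) - f (g \<otimes> q)\<bar> \<le> b * d p q"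
    using left_mult_lipschitz_fun Phi_mfun by blast
  from bchoice[OF this] obtain b where b: "\<And>f g p q. f \<in> \<Phi> \<Longrightarrow> \<bar>f (g \<otimes> p) - f (g \<otimes> q)\<bar> \<le> b f * d p q" by blast
  have "d (g \<otimes> p) (g \<otimes> q) \<le> max 1 (\<Sum>f\<in>\<Phi>. b f) * d p q" for g p q
  proof -
    have "d (g \<otimes> p) (g \<otimes> q) \<le> (\<Sum>f\<in>\<Phi>. b f * d p q)" using b by (intro sum_mono)
    also have "\<dots> = (\<Sum>f\<in>\<Phi>. b f) * d p q" by (rule sum_distrib_right[symmetric])
    also have "\<dots> \<le> max 1 (\<Sum>f\<in>\<Phi>. b f) * d p q" using dn by (intro mult_right_mono) auto
    finally show ?thesis .
  qed
  then show ?thesis using that[of "max 1 (\<Sum>f\<in>\<Phi>. b f)"] by simp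
qed

lemma Phi_cone_bound:
  assumes conn: "connected (UNIV :: 'a set)"
  obtains B where "B \<ge> 1" "\<And>z w f. z \<in> cone \<Longrightarrow> w \<in> cone \<Longrightarrow> f \<in> \<Phi> \<Longrightarrow>
    \<bar>snd z * f (fst z) - snd w * f (fst w)\<bar> \<le> B * cone_dist \<A> \<rho> z w"
    "\<And>z w. z \<in> cone \<Longrightarrow> w \<in> cone \<Longrightarrow> \<bar>snd z - snd w\<bar> \<le> cone_dist \<A> \<rho> z w"
proof -
  \<comment> \<open>The constant function 1 has gradient bound 0; applied to it,
    \<open>cone_dist_ge\<close> compares heights with factor \<open>1 + 0\<close>.\<close>
  have one: "mfun (\<lambda>_. 1)" by (simp add: mfun_def loc_bdd_deriv_const)
  have g0: "grad_le (\<lambda>_. 1) p 0" for p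
    unfolding grad_le_def
  proof (intro ballI impI allI)
    fix c :: "('a, 'e) chart" and D v assume "((\<lambda>y. 1 :: real) has_derivative D) (at (snd c p))"
    then have "D = (\<lambda>_. 0)" using has_derivative_unique[OF _ has_derivative_const] by blast
    then show "\<bar>D v\<bar> \<le> 0 * sqrt (\<rho> c p v v)" by simp
  qed
  have ht: "\<bar>snd z - snd w\<bar> \<le> cone_dist \<A> \<rho> z w" if "z \<in> cone" "w \<in> cone" for z w
    using cone_dist_ge[OF gcurve_connected[OF conn] that one _ g0, of 1] by simp
  then have dn: "cone_dist \<A> \<rho> z w \<ge> 0" for z w by (simp add: cone_dist_def)
  have "\<forall>f\<in>\<Phi>. \<exists>B. \<forall>z\<in>cone. \<forall>w\<in>cone. \<bar>snd z * f (fst z) - snd w * f (fst w)\<bar> \<le> B * cone_dist \<A> \<rho> z w"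
  proof
    fix f assume "f \<in> \<Phi>"
    then have f: "mfun f" by (rule Phi_mfun)
    have "bounded (f ` UNIV)" by (intro compact_imp_bounded compact_continuous_image mfun_continuous[OF f] compact_space)
    then obtain M where M: "\<And>p. \<bar>f p\<bar> \<le> M" by (auto simp: bounded_iff)
    obtain b where b: "\<And>p. grad_le f p b" using mfun_grad_bound[OF f] by blast
    \<comment> \<open>Enlarging the bound to \<open>\<bar>b\<bar> + 1\<close> makes
      \<open>M + (\<bar>b\<bar> + 1)\<close> positive, as \<open>cone_dist_ge\<close>
      requires.\<close>
    have b': "grad_le f p (\<bar>b\<bar> + 1)" for p
      unfolding grad_le_def
    proof (intro ballI impI allI)
      fix c D v assume c: "c \<in> \<A>" "p \<in> dom c" and D: "((\<lambda>y. f (chart_inv c y)) has_derivative D) (at (snd c p))"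
      have "\<bar>D v\<bar> \<le> b * sqrt (\<rho> c p v v)" using b[of p] c D unfolding grad_le_def by blast
      also have "\<dots> \<le> (\<bar>b\<bar> + 1) * sqrt (\<rho> c p v v)" using rho_nonneg[OF c] by (intro mult_right_mono) auto
      finally show "\<bar>D v\<bar> \<le> (\<bar>b\<bar> + 1) * sqrt (\<rho> c p v v)" .
    qed
    have "M \<ge> 0" using M[of undefined] by linarith
    then have "\<forall>z\<in>cone. \<forall>w\<in>cone. \<bar>snd z * f (fst z) - snd w * f (fst w)\<bar> \<le> (M + (\<bar>b\<bar> + 1)) * cone_dist \<A> \<rho> z w"
      using cone_dist_ge[OF gcurve_connected[OF conn] _ _ f M b'] by auto
    then show "\<exists>B. \<forall>z\<in>cone. \<forall>w\<in>cone. \<bar>snd z * f (fst z) - snd w * f (fst w)\<bar> \<le> B * cone_dist \<A> \<rho> z w" by blast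
  qed
  from bchoice[OF this] obtain B where B: "\<And>f z w. f \<in> \<Phi> \<Longrightarrow> z \<in> cone \<Longrightarrow> w \<in> cone \<Longrightarrow>
    \<bar>snd z * f (fst z) - snd w * f (fst w)\<bar> \<le> B f * cone_dist \<A> \<rho> z w" by blast
  define B' where "B' = 1 + (\<Sum>f\<in>\<Phi>. \<bar>B f\<bar>)"
  have "\<bar>snd z * f (fst z) - snd w * f (fst w)\<bar> \<le> B' * cone_dist \<A> \<rho> z w" if "z \<in> cone" "w \<in> cone" "f \<in> \<Phi>" for z w f
  proof -
    have "\<bar>B f\<bar> \<le> (\<Sum>f\<in>\<Phi>. \<bar>B f\<bar>)" using that Phi_finite by (intro member_le_sum) auto
    then have "B f * cone_dist \<A> \<rho> z w \<le> B' * cone_dist \<A> \<rho> z w" using dn by (intro mult_right_mono) (auto simp: B'_def)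
    then show ?thesis using B[OF that(3,1,2)] by linarith
  qed
  moreover have "B' \<ge> 1" by (simp add: B'_def sum_nonneg)
  ultimately show ?thesis using that ht by blast
qed

text \<open>A Euclidean space has positive dimension, so a nonempty open chart image cannot be
  finite. This will force the number of vertices of the graphs to grow.\<close>

lemma infinite_UNIV_manifold: "infinite (UNIV :: 'a set)"
proof
  assume fin: "finite (UNIV :: 'a set)"
  obtain c where c: "c \<in> \<A>" "undefined \<in> dom c" using chart_ex by blast
  have "finite (img c)" by (intro finite_imageI finite_subset[OF subset_UNIV fin])
  then have "img c = {}" by (rule finite_imp_not_open[OF _ chart_open(2)[OF c(1)]])
  then show False using c(2) by blast
qed

end

section \<open>Expander graphs\<close>

lemma cheegerD:
  assumes "cheeger V E \<ge> ereal \<epsilon>" "finite V" "W \<noteq> {}" "W \<subset> V" "2 * card W \<le> card V"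
  shows "\<epsilon> * card W \<le> card (vertex_boundary E W)"
proof -
  have "ereal \<epsilon> \<le> ereal (real (card (vertex_boundary E W)) / real (card W))"
    using assms(1) unfolding cheeger_def le_INF_iff using assms(3-5) by (auto simp: field_simps)
  moreover have "card W > 0" using assms finite_subset[of W V] by (auto simp: card_gt_0_iff)
  ultimately show ?thesis by (simp add: field_simps)
qed

text \<open>A discrete coarea formula proved by peeling layers. Subtracting the least positive value
  \<open>m\<close> on the support \<open>W\<close> lowers the left sum by \<open>m * card W\<close>
  and the right one by \<open>m\<close> times the number of ordered edges crossing \<open>W\<close>,
  and expansion compares the two. The support only shrinks, so it stays within half of the
  vertices.\<close>

lemma coarea_support:
  fixes b :: "'v \<Rightarrow> real" and \<epsilon> :: real
  assumes V: "finite V" and E: "E \<subseteq> V \<times> V" and \<epsilon>: "\<epsilon> \<ge> 0"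
    and exp: "\<And>W. W \<subseteq> V \<Longrightarrow> 2 * card W \<le> card V \<Longrightarrow> \<epsilon> * card W \<le> card (vertex_boundary E W)"
    and "\<And>v. v \<in> V \<Longrightarrow> b v \<ge> 0" "2 * card {v\<in>V. b v > 0} \<le> card V"
  shows "\<epsilon> * (\<Sum>v\<in>V. b v) \<le> (\<Sum>(v,w)\<in>E. \<bar>b v - b w\<bar>)"
  using assms(5,6)
proof (induction "card {v\<in>V. b v > 0}" arbitrary: b rule: less_induct)
  case less
  define W where "W = {v\<in>V. b v > 0}"
  have finE: "finite E" using V E by (meson finite_SigmaI finite_subset)
  have finW: "finite W" "W \<subseteq> V" using V by (auto simp: W_def)
  show ?case
  proof (cases "W = {}")
    case True
    then have "\<forall>v\<in>V. b v = 0" using less.prems(1) by (force simp: W_def)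
    then have "(\<Sum>v\<in>V. b v) = 0" by simp
    then show ?thesis by (auto intro!: sum_nonneg simp: case_prod_beta)
  next
    case False
    define m where "m = Min (b ` W)"
    have mpos: "m > 0" using finW False by (auto simp: m_def W_def)
    have mle: "m \<le> b v" if "v \<in> W" for v using finW that by (auto simp: m_def)
    obtain v0 where v0: "v0 \<in> W" "b v0 = m"
    proof -
      have "m \<in> b ` W" unfolding m_def using finW False by (intro Min_in) auto
      then show ?thesis using that by auto
    qed
    define b' where "b' = (\<lambda>v. if v \<in> W then b v - m else b v)"
    have b'0: "b' v \<ge> 0" if "v \<in> V" for v using less.prems(1) that mle by (auto simp: b'_def)
    have "{v\<in>V. b' v > 0} \<subseteq> W - {v0}"
      using v0 less.prems(1) by (auto simp: b'_def W_def split: if_splits)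
    then have sm: "card {v\<in>V. b' v > 0} < card W"
      using finW v0 by (meson card_mono finite_Diff le_less_trans card_Diff1_less)
    have IH: "\<epsilon> * (\<Sum>v\<in>V. b' v) \<le> (\<Sum>(v,w)\<in>E. \<bar>b' v - b' w\<bar>)"
      using less.hyps[of b'] sm b'0 less.prems(2) by (auto simp: W_def)
    have s1: "(\<Sum>v\<in>V. b v) = (\<Sum>v\<in>V. b' v) + m * card W"
    proof -
      have "(\<Sum>v\<in>V. b v) = (\<Sum>v\<in>V. b' v + (if v \<in> W then m else 0))"
        by (auto intro!: sum.cong simp: b'_def)
      also have "\<dots> = (\<Sum>v\<in>V. b' v) + (\<Sum>v\<in>W. m)"
        using V finW by (simp add: sum.distrib sum.If_cases Int_absorb1 Int_commute)
      finally show ?thesis by simp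
    qed
    define D where "D = {(v,w)\<in>E. (v \<in> W) \<noteq> (w \<in> W)}"
    have DE: "D \<subseteq> E" "finite D" using finE by (auto simp: D_def intro: finite_subset)
    have z: "b v = 0" if "v \<in> V" "v \<notin> W" for v
      using that less.prems(1)[of v] by (auto simp: W_def)
    have s2: "(\<Sum>(v,w)\<in>E. \<bar>b v - b w\<bar>) = (\<Sum>(v,w)\<in>E. \<bar>b' v - b' w\<bar>) + m * card D"
    proof -
      have "(\<Sum>(v,w)\<in>E. \<bar>b v - b w\<bar>) = (\<Sum>e\<in>E. (case e of (v,w) \<Rightarrow> \<bar>b' v - b' w\<bar>) + (if e \<in> D then m else 0))"
      proof (rule sum.cong[OF refl])
        fix e assume "e \<in> E"
        obtain v w where e: "e = (v,w)" by fastforce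
        have vw: "v \<in> V" "w \<in> V" using \<open>e \<in> E\<close> E e by auto
        show "(case e of (v,w) \<Rightarrow> \<bar>b v - b w\<bar>) = (case e of (v,w) \<Rightarrow> \<bar>b' v - b' w\<bar>) + (if e \<in> D then m else 0)"
          using \<open>e \<in> E\<close> vw z[of v] z[of w] mle[of v] mle[of w] mpos
          by (auto simp: e D_def b'_def)
      qed
      also have "\<dots> = (\<Sum>(v,w)\<in>E. \<bar>b' v - b' w\<bar>) + (\<Sum>e\<in>D. m)"
        using finE DE by (simp add: sum.distrib sum.If_cases Int_absorb1)
      finally show ?thesis by simp
    qed
    \<comment> \<open>Each boundary vertex is the endpoint of some crossing pair, so there are at
      least as many crossing pairs as boundary vertices.\<close>
    have "vertex_boundary E W \<subseteq> snd ` D" by (force simp: vertex_boundary_def D_def)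
    then have "card (vertex_boundary E W) \<le> card D"
      using DE(2) by (meson card_image_le card_mono finite_imageI le_trans)
    moreover have "\<epsilon> * card W \<le> card (vertex_boundary E W)"
      using exp finW less.prems(2) by (simp add: W_def)
    ultimately have "\<epsilon> * card W \<le> card D" by linarith
    then have "m * (\<epsilon> * card W) \<le> m * card D" using mpos by (intro mult_left_mono) auto
    then show ?thesis using IH unfolding s1 s2 by (simp add: algebra_simps)
  qed
qed

text \<open>Take \<open>m\<close> as the least value with at most half of the vertices strictly
  above it. The next smaller value has more than half above it, and these are all vertices with
  value at least \<open>m\<close>; so fewer than half lie below \<open>m\<close>.\<close>

lemma finite_median:
  fixes a :: "'v \<Rightarrow> real"
  assumes "finite V"
  shows "\<exists>m. 2 * card {v\<in>V. a v > m} \<le> card V \<and> 2 * card {v\<in>V. a v < m} \<le> card V"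
proof (cases "V = {}")
  case True then show ?thesis by auto
next
  case False
  define A where "A = {v\<in>V. 2 * card {w\<in>V. a w > a v} \<le> card V}"
  have "Max (a ` V) \<in> a ` V" using assms False by auto
  then obtain vm where vm: "vm \<in> V" "a vm = Max (a ` V)" by (metis imageE)
  then have e: "{w\<in>V. a w > a vm} = {}" using assms by (auto simp: not_less)
  have "vm \<in> A" using vm(1) by (simp add: A_def e)
  moreover have finA: "finite A" using assms by (auto simp: A_def)
  ultimately have "Min (a ` A) \<in> a ` A" by (intro Min_in) auto
  then obtain u where u: "u \<in> A" "a u = Min (a ` A)" by (metis imageE)
  define m where "m = a u"
  have mle: "m \<le> a v" if "v \<in> A" for v using u that finA by (auto simp: m_def)
  have "2 * card {v\<in>V. a v < m} \<le> card V"
  proof (cases "{v\<in>V. a v < m} = {}")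
    case True then show ?thesis by (simp only: True) simp
  next
    case False
    define Lw where "Lw = {v\<in>V. a v < m}"
    have "finite Lw" "Lw \<noteq> {}" using assms False by (auto simp: Lw_def)
    then have "Max (a ` Lw) \<in> a ` Lw" by (intro Max_in) auto
    then obtain l where l: "l \<in> Lw" "a l = Max (a ` Lw)" by (metis imageE)
    then have "l \<notin> A" using mle[of l] by (auto simp: Lw_def)
    \<comment> \<open>\<open>l\<close> has the largest value below \<open>m\<close>, so exceeding
      \<open>a l\<close> is the same as being at least \<open>m\<close>.\<close>
    moreover have "{w\<in>V. a w > a l} = V - Lw"
      using l \<open>finite Lw\<close> by (auto simp: Lw_def not_less) (metis (no_types, lifting) Lw_def Max_ge \<open>finite Lw\<close> finite_imageI imageI linorder_not_less mem_Collect_eq)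
    ultimately have "\<not> 2 * card (V - Lw) \<le> card V" using l by (auto simp: A_def Lw_def)
    moreover have "card (V - Lw) = card V - card Lw" "card Lw \<le> card V"
      using assms by (auto simp: Lw_def intro!: card_Diff_subset card_mono)
    ultimately show ?thesis unfolding Lw_def[symmetric] by linarith
  qed
  moreover have "2 * card {v\<in>V. a v > m} \<le> card V" using u by (auto simp: A_def m_def)
  ultimately show ?thesis by blast
qed

lemma sum_edges_fst_le:
  fixes f :: "'v \<Rightarrow> real"
  assumes V: "finite V" and E: "E \<subseteq> V \<times> V"
    and deg: "\<And>v. v \<in> V \<Longrightarrow> real (card (E `` {v})) \<le> C" and f: "\<And>v. v \<in> V \<Longrightarrow> f v \<ge> 0"
  shows "(\<Sum>(v,w)\<in>E. f v) \<le> C * (\<Sum>v\<in>V. f v)"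
proof -
  have E': "E = Sigma V (\<lambda>v. E `` {v})" using E by auto
  have "(\<Sum>(v,w)\<in>E. f v) = (\<Sum>v\<in>V. \<Sum>w\<in>E `` {v}. f v)"
    by (subst E', subst sum.Sigma) (use V E in \<open>auto intro: finite_subset[of _ V]\<close>)
  also have "\<dots> \<le> (\<Sum>v\<in>V. C * f v)"
    by (intro sum_mono) (use deg f in \<open>auto intro!: mult_right_mono\<close>)
  finally show ?thesis by (simp add: sum_distrib_left)
qed

lemma sum_edges_swap:
  assumes "sym E"
  shows "(\<Sum>(v,w)\<in>E. f w v) = (\<Sum>(v,w)\<in>E. f v w)"
proof -
  have "E = prod.swap ` E" using assms by (auto simp: sym_def)
  then have "(\<Sum>e\<in>E. case_prod (\<lambda>v w. f w v) e) = (\<Sum>e\<in>prod.swap ` E. case_prod (\<lambda>v w. f w v) e)" by simp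
  also have "\<dots> = (\<Sum>e\<in>E. case_prod f e)"
    by (subst sum.reindex) (auto intro!: sum.cong simp: inj_on_def)
  finally show ?thesis .
qed

text \<open>Apply the coarea inequality to \<open>p\<^sup>2\<close>, using
  \<open>\<bar>x\<^sup>2 - y\<^sup>2\<bar> \<le> (x - y)\<^sup>2 / (2 \<eta>) + \<eta> (x\<^sup>2 + y\<^sup>2)\<close> with \<open>\<eta> = \<epsilon> / (4 C)\<close> and absorbing the last term.\<close>

lemma poincare_half_support:
  fixes p :: "'v \<Rightarrow> real" and \<epsilon> :: real
  assumes V: "finite V" and E: "E \<subseteq> V \<times> V" "sym E" and \<epsilon>: "\<epsilon> > 0" and C: "C > 0"
    and deg: "\<And>v. v \<in> V \<Longrightarrow> real (card (E `` {v})) \<le> C"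
    and exp: "\<And>W. W \<subseteq> V \<Longrightarrow> 2 * card W \<le> card V \<Longrightarrow> \<epsilon> * card W \<le> card (vertex_boundary E W)"
    and p: "\<And>v. v \<in> V \<Longrightarrow> p v \<ge> 0" "2 * card {v\<in>V. p v > 0} \<le> card V"
  shows "(\<Sum>v\<in>V. (p v)\<^sup>2) \<le> 4 * C / \<epsilon>\<^sup>2 * (\<Sum>(v,w)\<in>E. (p v - p w)\<^sup>2)"
proof -
  define \<eta> where "\<eta> = \<epsilon> / (4 * C)"
  have \<eta>: "\<eta> > 0" using \<epsilon> C by (simp add: \<eta>_def)
  have "{v\<in>V. (p v)\<^sup>2 > 0} = {v\<in>V. p v > 0}" using p by force
  then have c1: "2 * card {v\<in>V. (p v)\<^sup>2 > 0} \<le> card V" using p by simp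
  have "\<epsilon> * (\<Sum>v\<in>V. (p v)\<^sup>2) \<le> (\<Sum>(v,w)\<in>E. \<bar>(p v)\<^sup>2 - (p w)\<^sup>2\<bar>)"
    using coarea_support[OF V E(1) _ exp _ c1] \<epsilon> by simp
  also have "\<dots> \<le> (\<Sum>(v,w)\<in>E. (p v - p w)\<^sup>2 / (2 * \<eta>) + \<eta> * ((p v)\<^sup>2 + (p w)\<^sup>2))"
  proof (rule sum_mono, clarify)
    fix v w assume "(v,w) \<in> E"
    define x y where "x = p v" and "y = p w"
    have "\<bar>x\<^sup>2 - y\<^sup>2\<bar> = \<bar>x - y\<bar> * \<bar>x + y\<bar>" by (simp add: power2_eq_square abs_mult[symmetric] algebra_simps)
    then have "2 * \<eta> * \<bar>x\<^sup>2 - y\<^sup>2\<bar> = 2 * \<eta> * (\<bar>x - y\<bar> * \<bar>x + y\<bar>)" by simp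
    moreover have "0 \<le> (\<bar>x - y\<bar> - \<eta> * \<bar>x + y\<bar>)\<^sup>2" by simp
    then have "2 * \<eta> * (\<bar>x - y\<bar> * \<bar>x + y\<bar>) \<le> (x - y)\<^sup>2 + \<eta>\<^sup>2 * (x + y)\<^sup>2"
      by (simp add: power2_diff power_mult_distrib algebra_simps)
    moreover have "(x + y)\<^sup>2 \<le> 2 * (x\<^sup>2 + y\<^sup>2)"
      using zero_le_power2[of "x - y"] by (simp add: power2_eq_square algebra_simps)
    then have "\<eta>\<^sup>2 * (x + y)\<^sup>2 \<le> \<eta>\<^sup>2 * (2 * (x\<^sup>2 + y\<^sup>2))" by (intro mult_left_mono) auto
    ultimately have "2 * \<eta> * \<bar>x\<^sup>2 - y\<^sup>2\<bar> \<le> (x - y)\<^sup>2 + \<eta>\<^sup>2 * (2 * (x\<^sup>2 + y\<^sup>2))" by linarith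
    then show "\<bar>(p v)\<^sup>2 - (p w)\<^sup>2\<bar> \<le> (p v - p w)\<^sup>2 / (2 * \<eta>) + \<eta> * ((p v)\<^sup>2 + (p w)\<^sup>2)"
      using \<eta> unfolding x_def y_def by (simp add: field_simps power2_eq_square)
  qed
  also have "\<dots> = (\<Sum>(v,w)\<in>E. (p v - p w)\<^sup>2) / (2 * \<eta>) + \<eta> * (\<Sum>(v,w)\<in>E. (p v)\<^sup>2) + \<eta> * (\<Sum>(v,w)\<in>E. (p w)\<^sup>2)"
    by (simp add: sum.distrib case_prod_beta sum_divide_distrib sum_distrib_left distrib_left)
  also have "(\<Sum>(v,w)\<in>E. (p w)\<^sup>2) = (\<Sum>(v,w)\<in>E. (p v)\<^sup>2)"
    using sum_edges_swap[OF E(2), of "\<lambda>v w. (p v)\<^sup>2"] .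
  finally have "\<epsilon> * (\<Sum>v\<in>V. (p v)\<^sup>2) \<le> (\<Sum>(v,w)\<in>E. (p v - p w)\<^sup>2) / (2 * \<eta>) + 2 * \<eta> * (\<Sum>(v,w)\<in>E. (p v)\<^sup>2)"
    by simp
  also have "\<dots> \<le> (\<Sum>(v,w)\<in>E. (p v - p w)\<^sup>2) / (2 * \<eta>) + 2 * \<eta> * (C * (\<Sum>v\<in>V. (p v)\<^sup>2))"
    using sum_edges_fst_le[OF V E(1) deg, of "\<lambda>v. (p v)\<^sup>2"] \<eta> by (intro add_left_mono mult_left_mono) auto
  also have "2 * \<eta> * (C * (\<Sum>v\<in>V. (p v)\<^sup>2)) = \<epsilon> / 2 * (\<Sum>v\<in>V. (p v)\<^sup>2)"
    using C by (simp add: \<eta>_def)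
  finally have "\<epsilon> / 2 * (\<Sum>v\<in>V. (p v)\<^sup>2) \<le> (\<Sum>(v,w)\<in>E. (p v - p w)\<^sup>2) / (2 * \<eta>)" by simp
  then show ?thesis using \<epsilon> C by (simp add: \<eta>_def field_simps power2_eq_square)
qed

text \<open>Subtracting a median splits the function into its positive and negative part, each
  supported on at most half of the vertices. Truncation is 1-Lipschitz, so neither part has larger
  differences along edges.\<close>

lemma graph_poincare:
  fixes a :: "'v \<Rightarrow> real"
  assumes V: "finite V" and E: "E \<subseteq> V \<times> V" "sym E" and \<epsilon>: "\<epsilon> > 0" and C: "C > 0"
    and deg: "\<And>v. v \<in> V \<Longrightarrow> real (card (E `` {v})) \<le> C"
    and ch: "cheeger V E \<ge> ereal \<epsilon>"
  shows "\<exists>m. (\<Sum>v\<in>V. (a v - m)\<^sup>2) \<le> 8 * C / \<epsilon>\<^sup>2 * (\<Sum>(v,w)\<in>E. (a v - a w)\<^sup>2)"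
proof -
  obtain m where m: "2 * card {v\<in>V. a v > m} \<le> card V" "2 * card {v\<in>V. a v < m} \<le> card V"
    using finite_median[OF V] by blast
  have exp: "\<epsilon> * card W \<le> card (vertex_boundary E W)" if "W \<subseteq> V" "2 * card W \<le> card V" for W
  proof (cases "W = {}")
    case False
    then have "card W > 0" using that V finite_subset by (auto simp: card_gt_0_iff)
    then have "W \<noteq> V" using that(2) by auto
    then show ?thesis using cheegerD[OF ch V False] that by blast
  qed simp
  have c: "{v\<in>V. max 0 (a v - m) > 0} = {v\<in>V. a v > m}" "{v\<in>V. max 0 (m - a v) > 0} = {v\<in>V. a v < m}" by auto
  note P = poincare_half_support[OF V E \<epsilon> C deg exp]
  have "(\<Sum>v\<in>V. (a v - m)\<^sup>2) = (\<Sum>v\<in>V. (max 0 (a v - m))\<^sup>2) + (\<Sum>v\<in>V. (max 0 (m - a v))\<^sup>2)"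
    by (subst sum.distrib[symmetric], rule sum.cong) (auto simp: max_def power2_commute)
  also have "\<dots> \<le> 4 * C / \<epsilon>\<^sup>2 * (\<Sum>(v,w)\<in>E. (max 0 (a v - m) - max 0 (a w - m))\<^sup>2)
      + 4 * C / \<epsilon>\<^sup>2 * (\<Sum>(v,w)\<in>E. (max 0 (m - a v) - max 0 (m - a w))\<^sup>2)"
    by (intro add_mono P) (use c m in auto)
  also have "\<dots> \<le> 4 * C / \<epsilon>\<^sup>2 * (\<Sum>(v,w)\<in>E. (a v - a w)\<^sup>2) + 4 * C / \<epsilon>\<^sup>2 * (\<Sum>(v,w)\<in>E. (a v - a w)\<^sup>2)"
  proof (intro add_mono mult_left_mono sum_mono)
    show "(case e of (v,w) \<Rightarrow> (max 0 (a v - m) - max 0 (a w - m))\<^sup>2) \<le> (case e of (v,w) \<Rightarrow> (a v - a w)\<^sup>2)" for e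
      by (cases e) (auto simp: abs_le_square_iff[symmetric] max_def)
    show "(case e of (v,w) \<Rightarrow> (max 0 (m - a v) - max 0 (m - a w))\<^sup>2) \<le> (case e of (v,w) \<Rightarrow> (a v - a w)\<^sup>2)" for e
      by (cases e) (auto simp: abs_le_square_iff[symmetric] max_def)
  qed (use C in auto)
  finally show ?thesis by (intro exI[of _ m]) simp
qed

section \<open>Path distance and connectedness\<close>

lemma relpow_sym: "sym E \<Longrightarrow> sym (E ^^ n)"
proof (induction n)
  case (Suc n) then show ?case
    by (auto simp: sym_def) (metis relcomp.intros relpow_commute symD sym_def)
qed (auto simp: sym_def)

text \<open>A connected component has empty boundary, and so does its complement; one of the two has
  at most half of the vertices and would violate expansion.\<close>

lemma cheeger_connected:
  assumes V: "fin_graph V E" and \<epsilon>: "\<epsilon> > 0" and ch: "cheeger V E \<ge> ereal \<epsilon>" and xy: "x \<in> V" "y \<in> V"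
  shows "\<exists>n. (x,y) \<in> E ^^ n"
proof -
  define R where "R = (E\<^sup>*) `` {x}"
  have fin: "finite V" and EV: "E \<subseteq> V \<times> V" and sy: "sym E" using V by (auto simp: fin_graph_def)
  have RV: "R \<subseteq> V"
  proof
    fix z assume "z \<in> R"
    then have "(x,z) \<in> E\<^sup>*" by (auto simp: R_def)
    then show "z \<in> V" by (induction rule: rtrancl_induct) (use xy EV in auto)
  qed
  have b0: "vertex_boundary E R = {}" by (auto simp: vertex_boundary_def R_def intro: rtrancl_into_rtrancl)
  have b1: "vertex_boundary E (V - R) = {}"
    using sy EV by (auto simp: vertex_boundary_def R_def sym_def intro: rtrancl_into_rtrancl)
  have "R = V"
  proof (rule ccontr)
    assume ne: "R \<noteq> V"
    have Rx: "x \<in> R" by (auto simp: R_def)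
    have "2 * card R \<le> card V \<or> 2 * card (V - R) \<le> card V"
      using card_Diff_subset[of R V] RV fin card_mono[OF fin RV] finite_subset by fastforce
    then show False
    proof
      assume "2 * card R \<le> card V"
      then have "\<epsilon> * card R \<le> 0" using cheegerD[OF ch fin, of R] Rx RV ne b0 by auto
      moreover have "card R > 0" using Rx RV fin finite_subset by (auto simp: card_gt_0_iff)
      ultimately show False using \<epsilon> by (simp add: mult_le_0_iff)
    next
      assume "2 * card (V - R) \<le> card V"
      moreover have "V - R \<noteq> {}" "V - R \<subset> V" using Rx RV ne by auto
      ultimately have "\<epsilon> * card (V - R) \<le> 0" using cheegerD[OF ch fin, of "V - R"] b1 by auto
      moreover have "card (V - R) > 0" using RV ne fin by (auto simp: card_gt_0_iff)
      ultimately show False using \<epsilon> by (simp add: mult_le_0_iff)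
    qed
  qed
  then show ?thesis using xy by (auto simp: R_def rtrancl_power)
qed

lemma path_dist_le: "(x,y) \<in> E ^^ n \<Longrightarrow> path_dist E x y \<le> n"
  by (auto simp: path_dist_def intro: Least_le)

text \<open>\<open>LEAST\<close> is an arbitrary number when there is no path; hence the existence
  hypothesis here and in the triangle inequality.\<close>

lemma path_distE:
  assumes "\<exists>n. (x,y) \<in> E ^^ n"
  obtains n where "(x,y) \<in> E ^^ n" "path_dist E x y = n"
  using assms LeastI_ex[of "\<lambda>n. (x,y) \<in> E ^^ n"] unfolding path_dist_def by blast

lemma path_dist_triangle:
  assumes "\<exists>n. (x,y) \<in> E ^^ n" "\<exists>n. (y,z) \<in> E ^^ n"
  shows "path_dist E x z \<le> path_dist E x y + path_dist E y z"
proof -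
  obtain n where n: "(x,y) \<in> E ^^ n" "path_dist E x y = n" using assms path_distE by metis
  obtain m where m: "(y,z) \<in> E ^^ m" "path_dist E y z = m" using assms path_distE by metis
  have "(x,z) \<in> E ^^ (n + m)" using n m by (auto simp: relpow_add)
  then show ?thesis using path_dist_le n m by fastforce
qed

lemma path_dist_commute:
  assumes "sym E" shows "path_dist E x y = path_dist E y x"
proof -
  have "(x,y) \<in> E ^^ n \<longleftrightarrow> (y,x) \<in> E ^^ n" for n using relpow_sym[OF assms, of n] by (auto simp: sym_def)
  then show ?thesis by (simp add: path_dist_def)
qed

lemma card_relpow_le:
  assumes deg: "\<And>v. v \<in> V \<Longrightarrow> real (card (E `` {v})) \<le> C" and EV: "E \<subseteq> V \<times> V" and V: "finite V" and v: "v \<in> V" and C: "C \<ge> 0"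
  shows "real (card ((E ^^ n) `` {v})) \<le> C ^ n"
proof (induction n)
  case (Suc n)
  have sub: "(E ^^ n) `` {v} \<subseteq> V" for n
    by (induction n) (use v EV in auto)
  have "(E ^^ Suc n) `` {v} = (\<Union>w\<in>(E ^^ n) `` {v}. E `` {w})" by auto
  then have "real (card ((E ^^ Suc n) `` {v})) \<le> (\<Sum>w\<in>(E ^^ n) `` {v}. real (card (E `` {w})))"
    using of_nat_mono[OF card_UN_le[of "(E ^^ n) `` {v}" "\<lambda>w. E `` {w}"], where 'a = real] finite_subset[OF sub V]
    by simp
  also have "\<dots> \<le> (\<Sum>w\<in>(E ^^ n) `` {v}. C)" using deg sub by (intro sum_mono) blast
  also have "\<dots> \<le> C ^ n * C" using Suc C by (simp add: mult_right_mono)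
  finally show ?case by (simp add: mult.commute)
qed simp

section \<open>Warped distances\<close>

text \<open>A genuine metric \<open>D0\<close> below \<open>d\<close> guarantees that admissible
  distances exist; over an empty family the supremum would carry no information. It also turns
  pseudometrics given by test functions into metrics.\<close>

context
  fixes Z :: "'z set" and d D0 :: "'z \<Rightarrow> 'z \<Rightarrow> real" and S :: "'s set" and act :: "'s \<Rightarrow> 'z \<Rightarrow> 'z"
  assumes D0: "Metric_space Z D0" and D0_le: "\<And>x y. x \<in> Z \<Longrightarrow> y \<in> Z \<Longrightarrow> D0 x y \<le> d x y"
    and act: "\<And>s x. s \<in> S \<Longrightarrow> x \<in> Z \<Longrightarrow> act s x \<in> Z"
begin

private definition "Adm = {\<delta>. Metric_space Z \<delta> \<and> (\<forall>x\<in>Z. \<forall>y\<in>Z. \<delta> x y \<le> d x y) \<and> (\<forall>s\<in>S. \<forall>x\<in>Z. \<delta> x (act s x) \<le> 1)}"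

private lemma warped_Adm: "warped_dist Z d S act x y = (SUP \<delta>\<in>Adm. \<delta> x y)"
  by (simp add: warped_dist_def Adm_def)

text \<open>Truncating \<open>D0\<close> at 1 and taking the maximum with the pseudometric of \<open>h\<close> gives an admissible distance.\<close>

private lemma Adm_max:
  assumes "\<And>x y. x \<in> Z \<Longrightarrow> y \<in> Z \<Longrightarrow> \<bar>h x - h y\<bar> \<le> d x y" "\<And>s x. s \<in> S \<Longrightarrow> x \<in> Z \<Longrightarrow> \<bar>h (act s x) - h x\<bar> \<le> 1"
  shows "(\<lambda>x y. max (min 1 (D0 x y)) \<bar>h x - h y\<bar>) \<in> Adm"
proof -
  interpret D: Metric_space Z D0 by (rule D0)
  have "Metric_space Z (\<lambda>x y. max (min 1 (D0 x y)) \<bar>h x - h y\<bar>)"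
  proof
    fix x y z
    show "0 \<le> max (min 1 (D0 x y)) \<bar>h x - h y\<bar>" by auto
    show "max (min 1 (D0 x y)) \<bar>h x - h y\<bar> = max (min 1 (D0 y x)) \<bar>h y - h x\<bar>"
      by (simp only: D.commute[of x y] abs_minus_commute[of "h x"])
    show "(max (min 1 (D0 x y)) \<bar>h x - h y\<bar> = 0) = (x = y)" if "x \<in> Z" "y \<in> Z"
      using D.zero[OF that] D.nonneg[of x y] unfolding max_def min_def by (smt (verit))
    show "max (min 1 (D0 x z)) \<bar>h x - h z\<bar> \<le> max (min 1 (D0 x y)) \<bar>h x - h y\<bar> + max (min 1 (D0 y z)) \<bar>h y - h z\<bar>"
      if "x \<in> Z" "y \<in> Z" "z \<in> Z"
      using D.triangle[OF that] D.nonneg[of x y] D.nonneg[of y z] by (auto simp: max_def min_def split: if_splits)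
  qed
  moreover have "max (min 1 (D0 x y)) \<bar>h x - h y\<bar> \<le> d x y" if "x \<in> Z" "y \<in> Z" for x y
    using D0_le[OF that] assms(1)[OF that] by auto
  moreover have "max (min 1 (D0 x (act s x))) \<bar>h x - h (act s x)\<bar> \<le> 1" if "s \<in> S" "x \<in> Z" for s x
    using assms(2)[OF that] by (auto simp: abs_minus_commute)
  ultimately show ?thesis by (auto simp: Adm_def)
qed

private lemma Adm_ne: "Adm \<noteq> {}"
proof -
  have "0 \<le> d x y" if "x \<in> Z" "y \<in> Z" for x y
    using D0_le[OF that] Metric_space.nonneg[OF D0, of x y] by linarith
  then show ?thesis using Adm_max[of "\<lambda>_. 0"] by auto
qed

private lemma Adm_bdd: "x \<in> Z \<Longrightarrow> y \<in> Z \<Longrightarrow> bdd_above ((\<lambda>\<delta>. \<delta> x y) ` Adm)"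
  by (intro bdd_aboveI[of _ "d x y"]) (auto simp: Adm_def)

lemma warped_lower:
  assumes "\<And>x y. x \<in> Z \<Longrightarrow> y \<in> Z \<Longrightarrow> \<bar>h x - h y\<bar> \<le> d x y" "\<And>s x. s \<in> S \<Longrightarrow> x \<in> Z \<Longrightarrow> \<bar>h (act s x) - h x\<bar> \<le> 1"
    and "x \<in> Z" "y \<in> Z"
  shows "\<bar>h x - h y\<bar> \<le> warped_dist Z d S act x y"
  using cSUP_upper[OF Adm_max[OF assms(1,2)] Adm_bdd[OF assms(3,4)]] unfolding warped_Adm by simp

lemma warped_le: "x \<in> Z \<Longrightarrow> y \<in> Z \<Longrightarrow> warped_dist Z d S act x y \<le> d x y"
  unfolding warped_Adm by (intro cSUP_least Adm_ne) (auto simp: Adm_def)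

lemma warped_jump: "s \<in> S \<Longrightarrow> x \<in> Z \<Longrightarrow> warped_dist Z d S act x (act s x) \<le> 1"
  unfolding warped_Adm by (intro cSUP_least Adm_ne) (auto simp: Adm_def)

lemma warped_commute: "warped_dist Z d S act x y = warped_dist Z d S act y x"
  unfolding warped_Adm by (rule SUP_cong) (auto simp: Adm_def Metric_space.commute)

lemma warped_nonneg: "x \<in> Z \<Longrightarrow> y \<in> Z \<Longrightarrow> warped_dist Z d S act x y \<ge> 0"
proof -
  assume xy: "x \<in> Z" "y \<in> Z"
  obtain \<delta> where \<delta>: "\<delta> \<in> Adm" using Adm_ne by blast
  then have "0 \<le> \<delta> x y" by (auto simp: Adm_def Metric_space.nonneg)
  also have "\<dots> \<le> warped_dist Z d S act x y" unfolding warped_Adm using cSUP_upper[OF \<delta> Adm_bdd[OF xy]] .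
  finally show ?thesis .
qed

lemma warped_triangle:
  assumes "x \<in> Z" "y \<in> Z" "z \<in> Z"
  shows "warped_dist Z d S act x z \<le> warped_dist Z d S act x y + warped_dist Z d S act y z"
  unfolding warped_Adm
proof (rule cSUP_least[OF Adm_ne])
  fix \<delta> assume \<delta>: "\<delta> \<in> Adm"
  then have "\<delta> x z \<le> \<delta> x y + \<delta> y z" using assms by (auto simp: Adm_def Metric_space.triangle)
  then show "\<delta> x z \<le> (SUP \<delta>\<in>Adm. \<delta> x y) + (SUP \<delta>\<in>Adm. \<delta> y z)"
    using cSUP_upper[OF \<delta> Adm_bdd[OF assms(1,2)]] cSUP_upper[OF \<delta> Adm_bdd[OF assms(2,3)]] by linarith
qed

end

lemma connected_UNIV_clopen:
  fixes A :: "'a::topological_space set"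
  assumes "connected (UNIV :: 'a set)" "open A" "closed A" "A \<noteq> {}"
  shows "A = UNIV"
  using connectedD[OF assms(1), of A "- A"] assms by auto

definition fam_dist :: "('a \<Rightarrow> real) set \<Rightarrow> 'a \<Rightarrow> 'a \<Rightarrow> real" where
  "fam_dist \<Phi> x y = (\<Sum>f\<in>\<Phi>. \<bar>f x - f y\<bar>)"

text \<open>The distance \<open>d\<close> of the finite family \<open>\<Phi>\<close> replaces the
  Riemannian distance of \<open>G\<close>, to which it is bi-Lipschitz; \<open>dO\<close> stands for the distance of the open cone.\<close>

locale coarse_group =
  fixes G :: "'a::{t2_space,second_countable_topology} monoid" (structure)
    and \<mu> :: "'a measure" and \<Phi> :: "('a \<Rightarrow> real) set"
    and dO :: "'a \<times> real \<Rightarrow> 'a \<times> real \<Rightarrow> real" and r0 L \<Lambda> B :: real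
  fixes d :: "'a \<Rightarrow> 'a \<Rightarrow> real"
  defines "d \<equiv> fam_dist \<Phi>"
  assumes grp: "group G" and carr: "carrier G = UNIV"
    and cpt: "compact (UNIV :: 'a set)" and conn: "connected (UNIV :: 'a set)"
    and infin: "infinite (UNIV :: 'a set)"
    and mult_cont: "\<And>g. continuous_on UNIV (\<lambda>x. g \<otimes> x)"
    and haar: "haar_prob G \<mu>"
    and Phi_fin: "finite \<Phi>" and Phi_cont: "\<And>f. f \<in> \<Phi> \<Longrightarrow> continuous_on UNIV f"
    and Phi_sep: "\<And>x y. x \<noteq> y \<Longrightarrow> \<exists>f\<in>\<Phi>. f x \<noteq> f y"
    and cpos: "r0 > 0" "L \<ge> 1" "\<Lambda> \<ge> 1" "B \<ge> 1"
    and lip: "\<And>g x y. d (g \<otimes> x) (g \<otimes> y) \<le> \<Lambda> * d x y"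
    and dO_height: "\<And>z w. z \<in> cone \<Longrightarrow> w \<in> cone \<Longrightarrow> \<bar>snd z - snd w\<bar> \<le> dO z w"
    and dO_lower: "\<And>z w f. z \<in> cone \<Longrightarrow> w \<in> cone \<Longrightarrow> f \<in> \<Phi> \<Longrightarrow>
       \<bar>snd z * f (fst z) - snd w * f (fst w)\<bar> \<le> B * dO z w"
    and segment: "\<And>x y. d x y \<le> r0 \<Longrightarrow> \<exists>\<gamma>. \<gamma> 0 = x \<and> \<gamma> 1 = y \<and>
       (\<forall>s\<in>{0..1::real}. \<forall>s'\<in>{0..1}. d (\<gamma> s) (\<gamma> s') \<le> L * d x y * \<bar>s - s'\<bar>)"
    and dO_upper: "\<And>x y t. d x y \<le> r0 \<Longrightarrow> t \<ge> 1 \<Longrightarrow> dO (x,t) (y,t) \<le> L * t * d x y"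
begin

lemma d_nonneg [simp]: "d x y \<ge> 0" by (auto simp: d_def fam_dist_def intro: sum_nonneg)
lemma d_self [simp]: "d x x = 0" by (auto simp: d_def fam_dist_def)
lemma d_commute: "d x y = d y x" by (auto simp: d_def fam_dist_def abs_minus_commute)
lemma d_triangle: "d x z \<le> d x y + d y z"
  unfolding d_def fam_dist_def sum.distrib[symmetric] by (intro sum_mono) linarith
lemma d_pos: "x \<noteq> y \<Longrightarrow> d x y > 0"
  using Phi_sep[of x y] Phi_fin by (auto simp: d_def fam_dist_def intro!: sum_pos2)
lemma Phi_le_d: "f \<in> \<Phi> \<Longrightarrow> \<bar>f x - f y\<bar> \<le> d x y"
  using Phi_fin by (auto simp: d_def fam_dist_def intro!: member_le_sum)

lemma d_continuous_pair: "continuous_on UNIV (\<lambda>p. d (fst p) (snd p))"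
  unfolding d_def fam_dist_def
  by (intro continuous_intros continuous_on_compose2[OF Phi_cont]) auto
lemma d_continuous [continuous_intros]: "continuous_on A (\<lambda>y. d x y)"
  unfolding d_def fam_dist_def
  by (intro continuous_intros continuous_on_compose2[OF Phi_cont]) auto

lemma open_ball_d: "open {y. d x y < r}"
  by (intro open_Collect_less continuous_intros)

lemma compact_pairs: "compact (UNIV :: ('a \<times> 'a) set)"
  using compact_Times[OF cpt cpt] by simp

lemma d_bounded: obtains D where "D > 0" "\<And>x y. d x y \<le> D"
proof -
  have "compact ((\<lambda>p. d (fst p) (snd p)) ` UNIV)"
    by (rule compact_continuous_image[OF d_continuous_pair compact_pairs])
  then have "bounded ((\<lambda>p. d (fst p) (snd p)) ` UNIV)" by (rule compact_imp_bounded)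
  then obtain D where "\<forall>z\<in>(\<lambda>p. d (fst p) (snd p)) ` UNIV. norm z \<le> D" by (auto simp only: bounded_iff)
  then have D: "norm (d (fst p) (snd p)) \<le> D" for p by blast
  have "d x y \<le> max D 1" for x y using D[of "(x,y)"] by auto
  then show ?thesis using that[of "max D 1"] by auto
qed

text \<open>The pairs at which \<open>F\<close> differs by at least \<open>e\<close> form a compact
  set off the diagonal, on which \<open>d\<close> attains a positive minimum.\<close>

lemma uniform_continuity:
  fixes F :: "'a \<Rightarrow> real"
  assumes F: "continuous_on UNIV F" and e: "e > 0"
  obtains \<delta> where "\<delta> > 0" "\<And>x y. d x y < \<delta> \<Longrightarrow> \<bar>F x - F y\<bar> < e"
proof -
  define K where "K = {p. \<bar>F (fst p) - F (snd p)\<bar> \<ge> e}"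
  have "continuous_on UNIV (\<lambda>p. \<bar>F (fst p) - F (snd p)\<bar>)"
    by (intro continuous_intros continuous_on_compose2[OF F]) auto
  then have "closed K" unfolding K_def by (intro closed_Collect_le continuous_on_const)
  then have K: "compact K" using compact_pairs closed_Int_compact by fastforce
  show ?thesis
  proof (cases "K = {}")
    case True then show ?thesis using that[of 1] by (auto simp: K_def not_le)
  next
    case False
    obtain q where q: "q \<in> K" "\<And>p. p \<in> K \<Longrightarrow> d (fst q) (snd q) \<le> d (fst p) (snd p)"
      using continuous_attains_inf[OF K False continuous_on_subset[OF d_continuous_pair]] by auto
    then have "fst q \<noteq> snd q" using e by (auto simp: K_def)
    then have "d (fst q) (snd q) > 0" by (rule d_pos)
    moreover have "\<bar>F x - F y\<bar> < e" if "d x y < d (fst q) (snd q)" for x y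
      using q(2)[of "(x,y)"] that by (fastforce simp: K_def not_le)
    ultimately show ?thesis using that by blast
  qed
qed

section \<open>Chains, packings and nets\<close>

abbreviation "near r \<equiv> {(x,y). d x y \<le> r}"

lemma segment_chain:
  assumes "d x y \<le> r0" "r > 0"
  shows "\<exists>n. (x,y) \<in> near r ^^ n \<and> real n \<le> L * d x y / r + 1"
proof -
  obtain \<gamma> where \<gamma>: "\<gamma> 0 = x" "\<gamma> 1 = y"
    "\<And>s s'. s \<in> {0..1} \<Longrightarrow> s' \<in> {0..1} \<Longrightarrow> d (\<gamma> s) (\<gamma> s') \<le> L * d x y * \<bar>s - s'\<bar>"
    using segment[OF assms(1)] by blast
  \<comment> \<open>Rounding down and adding 1 makes the \<open>n\<close> pieces of the segment at
    most \<open>r\<close> long and keeps \<open>n\<close> positive when the segment is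
    trivial.\<close>
  define n where "n = Suc (nat \<lfloor>L * d x y / r\<rfloor>)"
  have pos: "0 \<le> L * d x y / r" using cpos assms by auto
  have n: "real n \<le> L * d x y / r + 1" "L * d x y / r \<le> n" "n > 0"
    using pos unfolding n_def by (simp_all add: of_nat_nat) linarith
  then have nr: "L * d x y / n \<le> r" using assms by (simp add: field_simps)
  have "(\<gamma> 0, \<gamma> (real i / n)) \<in> near r ^^ i" if "i \<le> n" for i
    using that
  proof (induction i)
    case (Suc i)
    have "d (\<gamma> (real i / n)) (\<gamma> (real (Suc i) / n)) \<le> L * d x y * \<bar>real i / n - real (Suc i) / n\<bar>"
      using Suc n by (intro \<gamma>(3)) auto
    also have "\<bar>real i / n - real (Suc i) / n\<bar> = 1 / n" by (simp add: diff_divide_distrib[symmetric] abs_divide)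
    finally have "(\<gamma> (real i / n), \<gamma> (real (Suc i) / n)) \<in> near r" using nr by simp
    then show ?case using Suc by auto
  qed simp
  from this[of n] show ?thesis using \<gamma>(1,2) n by auto
qed

lemma near_refl_mono: "(x,y) \<in> near r ^^ n \<Longrightarrow> n \<le> m \<Longrightarrow> r \<ge> 0 \<Longrightarrow> (x,y) \<in> near r ^^ m"
proof (induction "m - n" arbitrary: m)
  case (Suc k)
  obtain m' where m': "m = Suc m'" using Suc by (cases m) auto
  then have "(x,y) \<in> near r ^^ m'" using Suc.hyps(1)[of m'] Suc.hyps(2) Suc.prems by linarith
  moreover have "(y,y) \<in> near r" using Suc by auto
  ultimately show ?case unfolding m' by (rule relpow_Suc_I)
qed auto

lemma near_sym: "sym (near r)" by (auto simp: sym_def d_commute)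

text \<open>The points reachable from a fixed \<open>x0\<close> by finitely many steps form a clopen
  set; compactness bounds the number of steps, and two chains through \<open>x0\<close> join any
  pair.\<close>

lemma uniform_chain: "\<exists>N. \<forall>x y. (x,y) \<in> near r0 ^^ N"
proof -
  fix x0 :: 'a
  \<comment> \<open>\<open>near\<close> is a closed condition; ending with a strict step makes each
    \<open>A n\<close> open.\<close>
  define A where "A = (\<lambda>n. {y. \<exists>z. (x0,z) \<in> near r0 ^^ n \<and> d z y < r0})"
  have op: "open (A n)" for n
  proof -
    have "A n = (\<Union>z\<in>{z. (x0,z) \<in> near r0 ^^ n}. {y. d z y < r0})" by (auto simp: A_def)
    then show ?thesis using open_ball_d by auto
  qed
  have A_step: "z \<in> A n \<Longrightarrow> d z y < r0 \<Longrightarrow> y \<in> A (Suc n)" for z y n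
    by (auto simp: A_def intro!: exI[of _ z])
  have "closed (\<Union>n. A n)"
  proof -
    have "y \<in> A (Suc n)" if "z \<in> A n" "d y z < r0" for y z n
      using A_step[OF that(1), of y] that(2) by (simp add: d_commute)
    then have "(\<Union>y\<in>- (\<Union>n. A n). {z. d y z < r0}) \<subseteq> - (\<Union>n. A n)" by blast
    moreover have "- (\<Union>n. A n) \<subseteq> (\<Union>y\<in>- (\<Union>n. A n). {z. d y z < r0})" using cpos by auto
    ultimately have "- (\<Union>n. A n) = (\<Union>y\<in>- (\<Union>n. A n). {z. d y z < r0})" by (rule equalityI[rotated])
    moreover have "open (\<Union>y\<in>- (\<Union>n. A n). {z. d y z < r0})" using open_ball_d by auto
    ultimately show ?thesis unfolding closed_def by metis
  qed
  moreover have "open (\<Union>n. A n)" using op by auto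
  moreover have "x0 \<in> A 0" using cpos by (auto simp: A_def)
  ultimately have "closed (\<Union>n. A n)" "open (\<Union>n. A n)" "(\<Union>n. A n) \<noteq> {}" by auto
  then have "(\<Union>n. A n) = UNIV" by (intro connected_UNIV_clopen conn)
  then have "UNIV \<subseteq> (\<Union>n\<in>UNIV. A n)" by simp
  then obtain I where I: "finite I" "UNIV \<subseteq> (\<Union>n\<in>I. A n)"
    by (rule compactE_image[OF cpt op])
  define N where "N = Suc (Max I)"
  have "(x0,y) \<in> near r0 ^^ N" for y
  proof -
    obtain n where n: "n \<in> I" "y \<in> A n" using I by blast
    then have "(x0,y) \<in> near r0 ^^ Suc n" by (auto simp: A_def)
    moreover have "Suc n \<le> N" using n I by (auto simp: N_def)
    ultimately show ?thesis using near_refl_mono cpos by (meson less_imp_le)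
  qed
  moreover from this have "(y,x0) \<in> near r0 ^^ N" for y using relpow_sym[OF near_sym] by (meson symD)
  ultimately have "(x,y) \<in> near r0 ^^ (N + N)" for x y by (auto simp: relpow_add)
  then show ?thesis by blast
qed

lemma chain_refine:
  assumes "(x,y) \<in> near r0 ^^ n" "r > 0"
  shows "\<exists>m. (x,y) \<in> near r ^^ m \<and> real m \<le> n * (L * r0 / r + 1)"
  using assms(1)
proof (induction n arbitrary: y)
  case (Suc n)
  then obtain z where z: "(x,z) \<in> near r0 ^^ n" "d z y \<le> r0" by auto
  obtain m where m: "(x,z) \<in> near r ^^ m" "real m \<le> n * (L * r0 / r + 1)" using Suc.IH[OF z(1)] by blast
  obtain k where k: "(z,y) \<in> near r ^^ k" "real k \<le> L * d z y / r + 1" using segment_chain[OF z(2) assms(2)] by blast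
  define X where "X = L * r0 / r + 1"
  have "L * d z y / r \<le> L * r0 / r" using z cpos assms by (intro divide_right_mono mult_left_mono) auto
  then have "real m \<le> n * X" "real k \<le> X" using m k by (auto simp: X_def)
  then have "real (m + k) \<le> Suc n * (L * r0 / r + 1)" unfolding X_def[symmetric] by (simp add: algebra_simps)
  moreover have "(x,y) \<in> near r ^^ (m + k)" using m k by (auto simp: relpow_add)
  ultimately show ?case by blast
qed (auto intro: exI[of _ 0])

text \<open>Pairs at distance at most \<open>r0\<close> need a single subdivided segment. Other
  pairs need \<open>N\<close> of them, and there \<open>r0 < d x y\<close> absorbs the cost into the
  linear term.\<close>

lemma quasi_geodesic:
  obtains C where "C \<ge> 1" "\<And>x y r. r > 0 \<Longrightarrow> \<exists>n. (x,y) \<in> near r ^^ n \<and> real n \<le> C * d x y / r + C"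
proof -
  obtain N where N: "\<And>x y. (x,y) \<in> near r0 ^^ N" using uniform_chain by blast
  define C where "C = (N + 1) * L"
  have "(real N + 1) * 1 \<le> (real N + 1) * L" "1 * L \<le> (real N + 1) * L"
    using cpos by (intro mult_left_mono mult_right_mono; simp)+
  then have C: "C \<ge> N + 1" "C \<ge> L" using cpos by (auto simp: C_def)
  then have "C \<ge> 1" using cpos by linarith
  note C = C this
  have "\<exists>n. (x,y) \<in> near r ^^ n \<and> real n \<le> C * d x y / r + C" if r: "r > 0" for x y r
  proof (cases "d x y \<le> r0")
    case True
    obtain n where n: "(x,y) \<in> near r ^^ n" "real n \<le> L * d x y / r + 1"
      using segment_chain[OF True r] by blast
    have "L * d x y / r \<le> C * d x y / r" using C r by (intro divide_right_mono mult_right_mono) auto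
    then show ?thesis using n C by (intro exI[of _ n]) auto
  next
    case False
    obtain n where n: "(x,y) \<in> near r ^^ n" "real n \<le> N * (L * r0 / r + 1)"
      using chain_refine[OF N r] by blast
    have "N * L * r0 / r \<le> C * d x y / r" using False C r cpos
      by (intro divide_right_mono mult_mono) (auto simp: C_def)
    then show ?thesis using n C by (intro exI[of _ n]) (auto simp: algebra_simps)
  qed
  then show ?thesis using that C by blast
qed

text \<open>Round the values of the \<open>m\<close> functions to a grid of mesh
  \<open>r / (m + 1)\<close>. Separated points fall into different cells, and a ball of radius
  \<open>a * r\<close> meets a number of cells that depends only on \<open>a\<close> and
  \<open>m\<close>.\<close>

lemma packing_bound: "\<exists>K. \<forall>x r A. r > 0 \<longrightarrow> A \<subseteq> {y. d x y \<le> a * r} \<longrightarrow>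
    (\<forall>y\<in>A. \<forall>z\<in>A. y \<noteq> z \<longrightarrow> d y z \<ge> r) \<longrightarrow> finite A \<and> card A \<le> K"
proof -
  define m where "m = card \<Phi>"
  \<comment> \<open>An interval of length \<open>2 * \<bar>a\<bar> * (m + 1)\<close> contains at
    most this many integer parts; the 2 accounts for rounding.\<close>
  define K1 where "K1 = nat \<lceil>2 * \<bar>a\<bar> * (m + 1)\<rceil> + 2"
  have main: "finite A \<and> card A \<le> K1 ^ m" if r: "r > 0" and A: "A \<subseteq> {y. d x y \<le> a * r}"
    and sep: "\<And>y z. y \<in> A \<Longrightarrow> z \<in> A \<Longrightarrow> y \<noteq> z \<Longrightarrow> d y z \<ge> r" for x r A
  proof -
    \<comment> \<open>Two points in one cell differ by at most \<open>1 / c\<close> in each of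
      \<open>m\<close> functions, altogether by \<open>m / (m + 1) * r\<close>, which is less than
      \<open>r\<close>.\<close>
    define c where "c = (real m + 1) / r"
    have c: "c > 0" using r by (simp add: c_def)
    define q where "q = (\<lambda>y. \<lambda>f\<in>\<Phi>. \<lfloor>c * f y\<rfloor>)"
    define I where "I = (\<lambda>f. {\<lfloor>c * (f x - \<bar>a\<bar> * r)\<rfloor>..\<lfloor>c * (f x + \<bar>a\<bar> * r)\<rfloor>})"
    have qI: "q ` A \<subseteq> PiE \<Phi> I"
    proof (clarify)
      fix y assume y: "y \<in> A"
      have "\<lfloor>c * f y\<rfloor> \<in> I f" if f: "f \<in> \<Phi>" for f
      proof -
        have "d x y \<le> a * r" using A y by auto
        moreover have "a * r \<le> \<bar>a\<bar> * r" using r by (intro mult_right_mono) auto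
        ultimately have "\<bar>f x - f y\<bar> \<le> \<bar>a\<bar> * r" using Phi_le_d[OF f, of x y] by linarith
        then have "f x - \<bar>a\<bar> * r \<le> f y" "f y \<le> f x + \<bar>a\<bar> * r" by auto
        then show ?thesis unfolding I_def using c by (auto intro!: floor_mono mult_left_mono)
      qed
      then show "q y \<in> PiE \<Phi> I" by (auto simp: q_def)
    qed
    have inj: "inj_on q A"
    proof (rule inj_onI, rule ccontr)
      fix y z assume yz: "y \<in> A" "z \<in> A" "q y = q z" "y \<noteq> z"
      have "\<bar>f y - f z\<bar> \<le> 1 / c" if f: "f \<in> \<Phi>" for f
      proof -
        have "q y f = q z f" using yz(3) by simp
        then have "\<lfloor>c * f y\<rfloor> = \<lfloor>c * f z\<rfloor>" using f by (simp add: q_def)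
        then have "\<bar>c * f y - c * f z\<bar> \<le> 1" by linarith
        then have "c * \<bar>f y - f z\<bar> \<le> 1" using c by (simp add: right_diff_distrib[symmetric] abs_mult)
        then show ?thesis using c by (simp add: field_simps)
      qed
      then have "d y z \<le> (\<Sum>f\<in>\<Phi>. 1 / c)" unfolding d_def fam_dist_def by (intro sum_mono)
      also have "\<dots> = m / (real m + 1) * r" by (simp add: m_def c_def)
      also have "\<dots> < r" using r by (simp add: field_simps)
      finally show False using sep yz by fastforce
    qed
    have cI: "card (I f) \<le> K1" for f
    proof -
      have "card (I f) = nat (\<lfloor>c * (f x + \<bar>a\<bar> * r)\<rfloor> - \<lfloor>c * (f x - \<bar>a\<bar> * r)\<rfloor> + 1)" by (simp add: I_def)
      moreover have "c * (f x + \<bar>a\<bar> * r) - c * (f x - \<bar>a\<bar> * r) = 2 * \<bar>a\<bar> * (m + 1)"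
        using r by (simp add: c_def field_simps)
      ultimately show ?thesis unfolding K1_def by linarith
    qed
    have fin: "finite (PiE \<Phi> I)" using Phi_fin by (intro finite_PiE) (auto simp: I_def)
    have "card (PiE \<Phi> I) = (\<Prod>f\<in>\<Phi>. card (I f))" using Phi_fin by (rule card_PiE)
    also have "\<dots> \<le> (\<Prod>f\<in>\<Phi>. K1)" using cI by (intro prod_mono) auto
    finally have "card (PiE \<Phi> I) \<le> K1 ^ m" by (simp add: m_def)
    moreover have "card A = card (q ` A)" using inj by (simp add: card_image)
    moreover have "card (q ` A) \<le> card (PiE \<Phi> I)" using qI fin by (rule card_mono[rotated])
    moreover have "finite A" using inj qI fin finite_imageD finite_subset by metis
    ultimately show ?thesis by linarith
  qed
  show ?thesis by (intro exI[of _ "K1 ^ m"] allI impI, rule main) auto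
qed

text \<open>The packing bound allows choosing a separated subset of greatest cardinality, and
  maximality makes it an \<open>r\<close>-net of \<open>Y\<close>.\<close>

lemma maximal_separated:
  "\<exists>K. \<forall>x r Y. r > 0 \<longrightarrow> Y \<subseteq> {y. d x y \<le> a * r} \<longrightarrow>
    (\<exists>A\<subseteq>Y. finite A \<and> card A \<le> K \<and> (\<forall>y\<in>A. \<forall>z\<in>A. y \<noteq> z \<longrightarrow> d y z \<ge> r) \<and> (\<forall>y\<in>Y. \<exists>z\<in>A. d z y < r))"
proof -
  obtain K where K: "\<And>x r A. r > 0 \<Longrightarrow> A \<subseteq> {y. d x y \<le> a * r} \<Longrightarrow>
    (\<forall>y\<in>A. \<forall>z\<in>A. y \<noteq> z \<longrightarrow> d y z \<ge> r) \<Longrightarrow> finite A \<and> card A \<le> K" using packing_bound[of a] by blast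
  have main: "\<exists>A\<subseteq>Y. finite A \<and> card A \<le> K \<and> (\<forall>y\<in>A. \<forall>z\<in>A. y \<noteq> z \<longrightarrow> d y z \<ge> r) \<and> (\<forall>y\<in>Y. \<exists>z\<in>A. d z y < r)"
    if r: "r > 0" and Y: "Y \<subseteq> {y. d x y \<le> a * r}" for x r Y
  proof -
    define P where "P = (\<lambda>A. A \<subseteq> Y \<and> (\<forall>y\<in>A. \<forall>z\<in>A. y \<noteq> z \<longrightarrow> d y z \<ge> r))"
    have PK: "finite A \<and> card A \<le> K" if "P A" for A
      by (rule K[OF r, of A x]) (use that Y in \<open>auto simp: P_def\<close>)
    have "P {}" by (auto simp: P_def)
    moreover have "\<forall>A. P A \<longrightarrow> card A < Suc K" using PK by (auto simp: less_Suc_eq_le)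
    ultimately obtain A where A: "P A" "\<And>A'. P A' \<Longrightarrow> card A' \<le> card A"
      using ex_has_greatest_nat[of P "{}" card "Suc K"] by (metis less_imp_le)
    have "\<exists>z\<in>A. d z y < r" if y: "y \<in> Y" for y
    proof (rule ccontr)
      assume "\<not> ?thesis"
      then have far: "\<And>z. z \<in> A \<Longrightarrow> d z y \<ge> r" by (auto simp: not_less)
      then have "y \<notin> A" using r by fastforce
      moreover have "P (insert y A)" using A(1) far y by (auto simp: P_def d_commute)
      ultimately show False using A(2)[of "insert y A"] PK[OF A(1)] by simp
    qed
    then show ?thesis using PK[OF A(1)] A(1) unfolding P_def by (intro exI[of _ A]) auto
  qed
  show ?thesis by (intro exI[of _ K] allI impI, rule main)
qed

end

section \<open>Word length and the warped distance on a level\<close>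

context coarse_group begin

sublocale group G by (rule grp)

abbreviation W :: "'a set \<Rightarrow> 'a \<times> real \<Rightarrow> 'a \<times> real \<Rightarrow> real" where
  "W S \<equiv> warped_dist cone dO S (\<lambda>s (x, t). (s \<otimes> x, t))"

lemma mem_cone [simp]: "(x,t) \<in> cone \<longleftrightarrow> t \<ge> 1" by (auto simp: cone_def)

lemma carrier_UNIV [simp]: "x \<in> carrier G" by (simp add: carr)

text \<open>The functions \<open>t * f x\<close> only compare points of equal height directly.
  Writing \<open>t * (f x - f y)\<close> as \<open>(t * f x - t' * f y) + (t' - t) * f y\<close>
  reduces the general case to them and to the bound on heights.\<close>

lemma dO_scaled: obtains B' where "B' \<ge> 1"
  "\<And>x t y t'. t \<ge> 1 \<Longrightarrow> t' \<ge> 1 \<Longrightarrow> t * d x y \<le> B' * dO (x,t) (y,t') \<and> t' * d x y \<le> B' * dO (x,t) (y,t')"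
proof -
  have "\<exists>M. \<forall>x. \<bar>f x\<bar> \<le> M" if "f \<in> \<Phi>" for f
  proof -
    have "bounded (f ` UNIV)" by (intro compact_imp_bounded compact_continuous_image cpt Phi_cont that)
    then show ?thesis by (auto simp: bounded_iff)
  qed
  then obtain M where M: "\<And>f x. f \<in> \<Phi> \<Longrightarrow> \<bar>f x\<bar> \<le> M f" by metis
  define B' where "B' = 1 + (\<Sum>f\<in>\<Phi>. B + \<bar>M f\<bar>)"
  have "B' \<ge> 1" using cpos by (auto simp: B'_def intro!: sum_nonneg)
  moreover have "t * d x y \<le> B' * dO (x,t) (y,t') \<and> t' * d x y \<le> B' * dO (x,t) (y,t')" if t: "t \<ge> 1" "t' \<ge> 1" for x t y t'
  proof -
    have h: "\<bar>t - t'\<bar> \<le> dO (x,t) (y,t')" using dO_height[of "(x,t)" "(y,t')"] t by simp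
    have "t * \<bar>f x - f y\<bar> \<le> (B + \<bar>M f\<bar>) * dO (x,t) (y,t')" if f: "f \<in> \<Phi>" for f
    proof -
      have "t * \<bar>f x - f y\<bar> = \<bar>(t * f x - t' * f y) + (t' - t) * f y\<bar>"
        using t by (simp add: abs_mult_pos' algebra_simps)
      also have "\<dots> \<le> \<bar>t * f x - t' * f y\<bar> + \<bar>t' - t\<bar> * \<bar>f y\<bar>"
        by (rule order_trans[OF abs_triangle_ineq]) (simp add: abs_mult)
      also have "\<dots> \<le> B * dO (x,t) (y,t') + dO (x,t) (y,t') * \<bar>M f\<bar>"
        using dO_lower[of "(x,t)" "(y,t')" f] t f h M[OF f, of y]
        by (intro add_mono mult_mono) auto
      finally show ?thesis by (simp add: algebra_simps)
    qed
    then have 1: "t * d x y \<le> (\<Sum>f\<in>\<Phi>. (B + \<bar>M f\<bar>) * dO (x,t) (y,t'))"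
      unfolding d_def fam_dist_def sum_distrib_left by (intro sum_mono)
    have "t' * \<bar>f x - f y\<bar> \<le> (B + \<bar>M f\<bar>) * dO (x,t) (y,t')" if f: "f \<in> \<Phi>" for f
    proof -
      have "t' * \<bar>f x - f y\<bar> = \<bar>(t * f x - t' * f y) + (t' - t) * f x\<bar>"
        using t by (simp add: abs_mult_pos' algebra_simps)
      also have "\<dots> \<le> \<bar>t * f x - t' * f y\<bar> + \<bar>t' - t\<bar> * \<bar>f x\<bar>"
        by (rule order_trans[OF abs_triangle_ineq]) (simp add: abs_mult)
      also have "\<dots> \<le> B * dO (x,t) (y,t') + dO (x,t) (y,t') * \<bar>M f\<bar>"
        using dO_lower[of "(x,t)" "(y,t')" f] t f h M[OF f, of x]
        by (intro add_mono mult_mono) auto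
      finally show ?thesis by (simp add: algebra_simps)
    qed
    then have 2: "t' * d x y \<le> (\<Sum>f\<in>\<Phi>. (B + \<bar>M f\<bar>) * dO (x,t) (y,t'))"
      unfolding d_def fam_dist_def sum_distrib_left by (intro sum_mono)
    have "(\<Sum>f\<in>\<Phi>. (B + \<bar>M f\<bar>) * dO (x,t) (y,t')) = (B' - 1) * dO (x,t) (y,t')"
      by (simp add: B'_def sum_distrib_right)
    also have "\<dots> \<le> B' * dO (x,t) (y,t')" using h by (simp add: algebra_simps)
    finally have "(\<Sum>f\<in>\<Phi>. (B + \<bar>M f\<bar>) * dO (x,t) (y,t')) \<le> B' * dO (x,t) (y,t')" .
    then show ?thesis using 1 2 by linarith
  qed
  ultimately show ?thesis using that by blast
qed

text \<open>A concrete metric on the cone lying below \<open>dO\<close>: it has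
  \<open>card \<Phi> + 1\<close> summands, each at most \<open>B * dO\<close>, which explains the
  denominator. It serves as the \<open>D0\<close> of the warped distance lemmas.\<close>

definition base_dist :: "'a \<times> real \<Rightarrow> 'a \<times> real \<Rightarrow> real" where
  "base_dist z w = (\<bar>snd z - snd w\<bar> + (\<Sum>f\<in>\<Phi>. \<bar>snd z * f (fst z) - snd w * f (fst w)\<bar>)) / ((real (card \<Phi>) + 1) * B)"

lemma base_dist_metric: "Metric_space cone base_dist"
proof
  fix x y z :: "'a \<times> real"
  have pos: "(real (card \<Phi>) + 1) * B > 0" using cpos by (auto intro!: mult_pos_pos)
  show "0 \<le> base_dist x y" using pos by (auto simp: base_dist_def intro!: divide_nonneg_pos sum_nonneg add_nonneg_nonneg)
  show "base_dist x y = base_dist y x" by (simp add: base_dist_def abs_minus_commute)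
  show "(base_dist x y = 0) = (x = y)" if xy: "x \<in> cone" "y \<in> cone"
  proof
    assume "base_dist x y = 0"
    then have "\<bar>snd x - snd y\<bar> + (\<Sum>f\<in>\<Phi>. \<bar>snd x * f (fst x) - snd y * f (fst y)\<bar>) = 0"
      using pos cpos by (auto simp: base_dist_def)
    moreover have "0 \<le> (\<Sum>f\<in>\<Phi>. \<bar>snd x * f (fst x) - snd y * f (fst y)\<bar>)" by (intro sum_nonneg) auto
    ultimately have eq: "snd x = snd y" "(\<Sum>f\<in>\<Phi>. \<bar>snd x * f (fst x) - snd y * f (fst y)\<bar>) = 0" by linarith+
    have "\<forall>f\<in>\<Phi>. \<bar>snd x * f (fst x) - snd y * f (fst y)\<bar> = 0"
      using eq(2) sum_nonneg_eq_0_iff[OF Phi_fin, of "\<lambda>f. \<bar>snd x * f (fst x) - snd y * f (fst y)\<bar>"] by simp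
    then have "\<forall>f\<in>\<Phi>. snd x * f (fst x) = snd y * f (fst y)" by simp
    moreover have "snd x \<noteq> 0" using xy by (auto simp: cone_def)
    ultimately have "\<forall>f\<in>\<Phi>. f (fst x) = f (fst y)" using eq(1) by simp
    then have "fst x = fst y" using Phi_sep by blast
    then show "x = y" using eq by (simp add: prod_eq_iff)
  qed (simp add: base_dist_def)
  show "base_dist x z \<le> base_dist x y + base_dist y z" if "x \<in> cone" "y \<in> cone" "z \<in> cone"
  proof -
    have "(\<Sum>f\<in>\<Phi>. \<bar>snd x * f (fst x) - snd z * f (fst z)\<bar>) \<le> (\<Sum>f\<in>\<Phi>. \<bar>snd x * f (fst x) - snd y * f (fst y)\<bar>)
       + (\<Sum>f\<in>\<Phi>. \<bar>snd y * f (fst y) - snd z * f (fst z)\<bar>)"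
      unfolding sum.distrib[symmetric] by (intro sum_mono) linarith
    then show ?thesis unfolding base_dist_def add_divide_distrib[symmetric] using pos
      by (intro divide_right_mono) auto
  qed
qed

lemma base_dist_le: assumes "x \<in> cone" "y \<in> cone" shows "base_dist x y \<le> dO x y"
proof -
  have pos: "(real (card \<Phi>) + 1) * B > 0" using cpos by (auto intro!: mult_pos_pos)
  have h: "\<bar>snd x - snd y\<bar> \<le> dO x y" by (rule dO_height[OF assms])
  then have "1 * dO x y \<le> B * dO x y" using cpos by (intro mult_right_mono) auto
  then have "\<bar>snd x - snd y\<bar> \<le> B * dO x y" using h by linarith
  moreover have "(\<Sum>f\<in>\<Phi>. \<bar>snd x * f (fst x) - snd y * f (fst y)\<bar>) \<le> (\<Sum>f\<in>\<Phi>. B * dO x y)"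
    using dO_lower[OF assms] by (intro sum_mono)
  ultimately show ?thesis using pos unfolding base_dist_def by (simp add: divide_simps) (simp add: algebra_simps)
qed

lemma W_le: "x \<in> cone \<Longrightarrow> y \<in> cone \<Longrightarrow> W S x y \<le> dO x y"
  by (rule warped_le[OF base_dist_metric]) (auto intro: base_dist_le)

lemma W_jump: "s \<in> S \<Longrightarrow> t \<ge> 1 \<Longrightarrow> W S (x,t) (s \<otimes> x,t) \<le> 1"
proof -
  assume *: "s \<in> S" "t \<ge> 1"
  have "W S (x,t) (case (x,t) of (x, t) \<Rightarrow> (s \<otimes> x, t)) \<le> 1"
    by (rule warped_jump[OF base_dist_metric]) (use * in \<open>auto intro: base_dist_le\<close>)
  then show ?thesis by simp
qed

lemma W_nonneg: "x \<in> cone \<Longrightarrow> y \<in> cone \<Longrightarrow> W S x y \<ge> 0"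
  by (rule warped_nonneg[OF base_dist_metric]) (auto intro: base_dist_le)

lemma W_commute: "W S x y = W S y x"
  by (rule warped_commute[OF base_dist_metric]) (auto intro: base_dist_le)

lemma W_triangle: "x \<in> cone \<Longrightarrow> y \<in> cone \<Longrightarrow> z \<in> cone \<Longrightarrow> W S x z \<le> W S x y + W S y z"
  by (rule warped_triangle[OF base_dist_metric]) (auto intro: base_dist_le)

lemma W_lower:
  assumes "\<And>x y. x \<in> cone \<Longrightarrow> y \<in> cone \<Longrightarrow> \<bar>h x - h y\<bar> \<le> dO x y"
    "\<And>s x. s \<in> S \<Longrightarrow> x \<in> cone \<Longrightarrow> \<bar>h (case x of (x, t) \<Rightarrow> (s \<otimes> x, t)) - h x\<bar> \<le> 1" "x \<in> cone" "y \<in> cone"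
  shows "\<bar>h x - h y\<bar> \<le> W S x y"
  by (rule warped_lower[OF base_dist_metric]) (use assms in \<open>auto intro: base_dist_le\<close>)

lemma W_level_near:
  assumes "d x y \<le> r0" "t \<ge> 1" shows "W S (x,t) (y,t) \<le> L * t * d x y"
proof -
  have "W S (x,t) (y,t) \<le> dO (x,t) (y,t)" by (rule W_le) (use assms in auto)
  then show ?thesis using dO_upper[OF assms] by linarith
qed

text \<open>A crude bound on the diameter of a level, used for the levels too low for the net
  construction.\<close>

lemma W_level_bound: obtains C where "\<And>S x y t. t \<ge> 1 \<Longrightarrow> W S (x,t) (y,t) \<le> C * t"
proof -
  obtain N where N: "\<And>x y. (x,y) \<in> near r0 ^^ N" using uniform_chain by blast
  have "W S (x,t) (y,t) \<le> n * (L * t * r0)" if "(x,y) \<in> near r0 ^^ n" "t \<ge> 1" for S x y t n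
    using that(1)
  proof (induction n arbitrary: y)
    case 0
    then show ?case using W_level_near[of x x t S] that cpos by simp
  next
    case (Suc n)
    then obtain z where z: "(x,z) \<in> near r0 ^^ n" "d z y \<le> r0" by auto
    have "W S (x,t) (y,t) \<le> W S (x,t) (z,t) + W S (z,t) (y,t)" using that by (intro W_triangle) auto
    also have "\<dots> \<le> n * (L * t * r0) + L * t * d z y" using Suc.IH[OF z(1)] W_level_near[OF z(2) that(2), of S] by linarith
    also have "L * t * d z y \<le> L * t * r0" using z cpos that by (intro mult_left_mono) auto
    finally show ?case by (simp add: algebra_simps)
  qed
  then have "W S (x,t) (y,t) \<le> (N * L * r0) * t" if "t \<ge> 1" for S x y t
    using N[of x y] that by (fastforce simp: algebra_simps)
  then show ?thesis using that by blast
qed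

text \<open>The relation need not be symmetric, because undoing a translation can enlarge the error
  \<open>1 / T\<close>; path lengths are therefore counted from a fixed starting point.\<close>

definition hop :: "'a set \<Rightarrow> real \<Rightarrow> ('a \<times> 'a) set" where
  "hop S T = {(x,y). \<exists>s\<in>S. d (s \<otimes> x) y \<le> 1 / T}"

definition sym_gen :: "'a set \<Rightarrow> bool" where
  "sym_gen S \<longleftrightarrow> finite S \<and> \<one> \<in> S \<and> (\<forall>s\<in>S. inv s \<in> S)"

lemma relpow_mono: "(R :: ('b \<times> 'b) set) \<subseteq> R' \<Longrightarrow> R ^^ n \<subseteq> R' ^^ n"
  by (induction n) (auto simp: relcomp_mono)

lemma near_hop: "sym_gen S \<Longrightarrow> near (1 / T) \<subseteq> hop S T"
  by (auto simp: hop_def sym_gen_def intro!: bexI[of _ \<one>])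

lemma hop_bound: obtains C where "C \<ge> 1"
  "\<And>S T x y. sym_gen S \<Longrightarrow> T > 0 \<Longrightarrow> \<exists>n. (x,y) \<in> hop S T ^^ n"
  "\<And>S T x y. sym_gen S \<Longrightarrow> T > 0 \<Longrightarrow> path_dist (hop S T) x y \<le> C * T * d x y + C"
proof -
  obtain C where C: "C \<ge> 1" "\<And>x y r. r > 0 \<Longrightarrow> \<exists>n. (x,y) \<in> near r ^^ n \<and> real n \<le> C * d x y / r + C"
    using quasi_geodesic by blast
  have *: "\<exists>n. (x,y) \<in> hop S T ^^ n \<and> real n \<le> C * T * d x y + C" if S: "sym_gen S" and T: "T > 0" for S T x y
  proof -
    obtain n where "(x,y) \<in> near (1/T) ^^ n" "real n \<le> C * d x y / (1/T) + C"
      using C(2)[of "1/T" x y] T by auto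
    moreover have "near (1/T) ^^ n \<subseteq> hop S T ^^ n" by (rule relpow_mono[OF near_hop[OF S]])
    ultimately show ?thesis by (auto simp: mult_ac)
  qed
  show ?thesis
  proof (rule that[OF C(1)])
    show "\<exists>n. (x,y) \<in> hop S T ^^ n" if "sym_gen S" "T > 0" for S T x y using *[OF that] by blast
    show "path_dist (hop S T) x y \<le> C * T * d x y + C" if "sym_gen S" "T > 0" for S T x y
      using *[OF that, of x y] path_dist_le[of x y _ "hop S T"] by fastforce
  qed
qed

text \<open>The test function is \<open>min K (t - T/2)\<^sup>+\<close>, where \<open>K\<close> is a Lipschitz regularisation of the
  hop distance from \<open>x\<close> at scale \<open>1/T\<close>.  Cutting off below height \<open>T/2\<close> keeps it Lipschitz for the
  cone metric, whose level sets shrink towards the apex.\<close>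

lemma hop_le_W: obtains C where "C \<ge> 1"
  "\<And>S T x y. sym_gen S \<Longrightarrow> T \<ge> 1 \<Longrightarrow> path_dist (hop S T) x y \<le> C * W S (x,T) (y,T) + C"
proof -
  obtain C where C: "C \<ge> 1"
    "\<And>S T x y. sym_gen S \<Longrightarrow> T > 0 \<Longrightarrow> \<exists>n. (x,y) \<in> hop S T ^^ n"
    "\<And>S T x y. sym_gen S \<Longrightarrow> T > 0 \<Longrightarrow> path_dist (hop S T) x y \<le> C * T * d x y + C" using hop_bound by blast
  obtain B' where B': "B' \<ge> 1"
    "\<And>x t y t'. t \<ge> 1 \<Longrightarrow> t' \<ge> 1 \<Longrightarrow> t * d x y \<le> B' * dO (x,t) (y,t') \<and> t' * d x y \<le> B' * dO (x,t) (y,t')" using dO_scaled by blast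
  obtain D where D: "D > 0" "\<And>x y. d x y \<le> D" using d_bounded by blast
  \<comment> \<open>\<open>2 * C * B'\<close> will be the Lipschitz constant of the regularised hop
    distance above height \<open>T/2\<close>, and \<open>C + 1\<close> its largest change under a
    generator.\<close>
  define C3 where "C3 = 2 * C * B' + C + 1"
  have "1 * 1 \<le> C * B'" using C(1) B'(1) by (intro mult_mono) auto
  then have C3: "C3 \<ge> 1" "C3 \<ge> 2 * C * B'" "C3 \<ge> C + 1" "C3 > 0" using C(1) unfolding C3_def by linarith+
  have key: "min (path_dist (hop S T) x y - C) (T/2) \<le> C3 * W S (x,T) (y,T)"
    if S: "sym_gen S" and T: "T \<ge> 1" for S T x y
  proof -
    define H where "H = path_dist (hop S T)"
    have conn: "\<exists>n. (u,v) \<in> hop S T ^^ n" for u v using C(2) S T by auto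
    have Htri: "H u w \<le> H u v + H v w" for u v w unfolding H_def by (intro path_dist_triangle conn)
    have Hle: "H u v \<le> C * T * d u v + C" for u v unfolding H_def using C(3) S T by auto
    have H0: "H u v \<ge> 0" for u v by (simp add: H_def path_dist_def)
    have Hxx: "H u u = 0" for u using path_dist_le[of u u 0 "hop S T"] H0[of u u] by (simp add: H_def)
    have Hjump: "H u (s \<otimes> u) \<le> 1" if "s \<in> S" for s u
    proof -
      have "(u, s \<otimes> u) \<in> hop S T" using that T by (auto simp: hop_def intro!: bexI[of _ s])
      then show ?thesis using path_dist_le[of u "s \<otimes> u" 1 "hop S T"] by (simp add: H_def)
    qed
    \<comment> \<open>The hop distance is Lipschitz only up to the additive constant
      \<open>C\<close>. The infimal convolution with \<open>C * T * d\<close> is genuinely Lipschitz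
      and stays within \<open>C\<close> of it.\<close>
    define K where "K = (\<lambda>v. INF w. H x w + C * T * d w v)"
    have nn: "0 \<le> H x w + C * T * d w v" for w v using H0 C T by (auto intro!: add_nonneg_nonneg)
    have bdd: "bdd_below (range (\<lambda>w. H x w + C * T * d w v))" for v using nn by (intro bdd_belowI) auto
    have K0: "K v \<ge> 0" for v unfolding K_def using nn by (intro cINF_greatest) auto
    have Kle: "K v \<le> H x w + C * T * d w v" for v w unfolding K_def by (rule cINF_lower[OF bdd]) simp
    have KH: "K v \<le> H x v" for v using Kle[of v v] by simp
    have KL: "K v \<le> K u + C * T * d u v" for u v
    proof -
      have "K v - C * T * d u v \<le> H x w + C * T * d w u" for w
      proof -
        have "C * T * d w v \<le> C * T * (d w u + d u v)" using C T d_triangle by (intro mult_left_mono) auto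
        then show ?thesis using Kle[of v w] by (simp add: algebra_simps)
      qed
      then have "K v - C * T * d u v \<le> (INF w. H x w + C * T * d w u)" by (intro cINF_greatest) auto
      also have "\<dots> = K u" by (simp add: K_def)
      finally show ?thesis by simp
    qed
    have HK: "H x v - C \<le> K v" for v
    proof -
      have "H x v - C \<le> H x w + C * T * d w v" for w using Htri[of x v w] Hle[of w v] by linarith
      then show ?thesis unfolding K_def by (intro cINF_greatest) auto
    qed
    have Kj: "K (s \<otimes> v) \<le> K v + (C + 1)" if "s \<in> S" for s v
      using KH[of "s \<otimes> v"] Htri[of x "s \<otimes> v" v] Hjump[OF that, of v] HK[of v] by linarith
    have Kj': "\<bar>K (s \<otimes> v) - K v\<bar> \<le> C + 1" if s: "s \<in> S" for s v
    proof -
      have "inv s \<otimes> (s \<otimes> v) = v" by (simp add: m_assoc[symmetric])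
      then show ?thesis using Kj[OF s, of v] Kj[of "inv s" "s \<otimes> v"] s S by (auto simp: sym_gen_def)
    qed
    define h where "h = (\<lambda>(v,t). min (K v) (max 0 (t - T/2)) / C3)"
    have minab: "\<bar>min a b - min a' b'\<bar> \<le> max \<bar>a - a'\<bar> \<bar>b - b'\<bar>" for a b a' b' :: real by linarith
    have hd: "\<bar>h z - h w\<bar> \<le> dO z w" if zw: "z \<in> cone" "w \<in> cone" for z w
    proof -
      obtain u t v t' where [simp]: "z = (u,t)" "w = (v,t')" by fastforce
      have t: "t \<ge> 1" "t' \<ge> 1" using zw by auto
      have ht: "\<bar>t - t'\<bar> \<le> dO z w" using dO_height[OF zw] by simp
      have "dO z w \<ge> 0" using ht by linarith
      have main: "\<bar>min (K u) (max 0 (t - T/2)) - min (K v) (max 0 (t' - T/2))\<bar> \<le> C3 * dO z w"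
      \<comment> \<open>If both heights are at most \<open>T/2\<close>, the cut-off kills the
        function at both points. Otherwise one height exceeds \<open>T/2\<close>, and
        \<open>dO_scaled\<close> used at that height turns \<open>T/2 * d\<close> into a multiple of
        \<open>dO\<close>.\<close>
      proof (cases "t \<le> T/2 \<and> t' \<le> T/2")
        case True then show ?thesis using K0 \<open>dO z w \<ge> 0\<close> C3 by (simp add: min_absorb2)
      next
        case False
        have "t * d u v \<le> B' * dO z w" "t' * d u v \<le> B' * dO z w" using B'(2)[OF t] by auto
        then have "T/2 * d u v \<le> B' * dO z w"
          using False mult_right_mono[of "T/2" t "d u v"] mult_right_mono[of "T/2" t' "d u v"] by force
        then have "2 * C * (T/2 * d u v) \<le> 2 * C * (B' * dO z w)" using C by (intro mult_left_mono) auto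
        also have "\<dots> \<le> C3 * dO z w" using C3 mult_right_mono[OF C3(2) \<open>dO z w \<ge> 0\<close>] by (simp add: mult_ac)
        finally have "\<bar>K u - K v\<bar> \<le> C3 * dO z w"
          using KL[of u v] KL[of v u] by (simp add: d_commute[of v u] mult_ac)
        moreover have "\<bar>max 0 (t - T/2) - max 0 (t' - T/2)\<bar> \<le> C3 * dO z w"
          using ht mult_right_mono[OF C3(1) \<open>dO z w \<ge> 0\<close>] by linarith
        ultimately show ?thesis using minab order_trans by (meson max.boundedI)
      qed
      have "h z - h w = (min (K u) (max 0 (t - T/2)) - min (K v) (max 0 (t' - T/2))) / C3"
        by (simp add: h_def diff_divide_distrib)
      then show ?thesis using main C3 by (simp add: abs_divide divide_le_eq mult.commute)
    qed
    have hj: "\<bar>h (case z of (x, t) \<Rightarrow> (s \<otimes> x, t)) - h z\<bar> \<le> 1" if s: "s \<in> S" and "z \<in> cone" for s z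
    proof -
      obtain u t where [simp]: "z = (u,t)" by fastforce
      have "\<bar>min (K (s \<otimes> u)) (max 0 (t - T/2)) - min (K u) (max 0 (t - T/2))\<bar> \<le> C3"
        using Kj'[OF s, of u] C3 by linarith
      then show ?thesis using C3 by (simp add: h_def diff_divide_distrib[symmetric] abs_divide)
    qed
    have "\<bar>h (x,T) - h (y,T)\<bar> \<le> W S (x,T) (y,T)" by (rule W_lower[OF hd hj]) (use T in auto)
    moreover have "h (x,T) = 0" using K0[of x] KH[of x] Hxx T by (auto simp: h_def)
    moreover have "min (H x y - C) (T/2) \<le> min (K y) (max 0 (T - T/2))"
      using HK[of y] T by (intro min.mono) auto
    then have "min (H x y - C) (T/2) / C3 \<le> h (y,T)" unfolding h_def using C3 by (auto intro!: divide_right_mono)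
    ultimately have "min (H x y - C) (T/2) / C3 \<le> W S (x,T) (y,T)" by linarith
    then show ?thesis using C3 unfolding H_def by (simp add: divide_le_eq mult.commute)
  qed
  \<comment> \<open>When the minimum in \<open>key\<close> is \<open>T/2\<close>, the warped
    distance is at least of order \<open>T\<close>. Since a hop distance never exceeds
    \<open>C * T * D + C\<close>, the extra term \<open>2 * C * D * C3\<close> covers this
    case.\<close>
  define C4 where "C4 = C3 + 2 * C * D * C3 + C"
  have "2 * C * D * C3 \<ge> 0" using C(1) C3 D(1) by simp
  then have C4: "C4 \<ge> C3" "C4 \<ge> 2 * C * D * C3" "C4 \<ge> C" "C4 \<ge> 1" using C(1) C3 unfolding C4_def by linarith+
  have "path_dist (hop S T) x y \<le> C4 * W S (x,T) (y,T) + C4" if S: "sym_gen S" and T: "T \<ge> 1" for S T x y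
  proof (cases "path_dist (hop S T) x y - C \<le> T / 2")
    case True
    have "0 \<le> W S (x,T) (y,T)" by (rule W_nonneg) (use T in auto)
    then have "C3 * W S (x,T) (y,T) \<le> C4 * W S (x,T) (y,T)" using C4 by (intro mult_right_mono) auto
    then show ?thesis using key[OF S T, of x y] True C4 by simp
  next
    case False
    then have "T / 2 \<le> C3 * W S (x,T) (y,T)" using key[OF S T, of x y] by simp
    then have 1: "2 * C * D * (T / 2) \<le> 2 * C * D * (C3 * W S (x,T) (y,T))" using C D by (intro mult_left_mono) auto
    have "0 \<le> W S (x,T) (y,T)" by (rule W_nonneg) (use T in auto)
    then have "(2 * C * D * C3) * W S (x,T) (y,T) \<le> C4 * W S (x,T) (y,T)" using C4 by (intro mult_right_mono) auto
    then have "C * T * D \<le> C4 * W S (x,T) (y,T)" using 1 by (simp add: mult_ac)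
    moreover have "C * T * d x y \<le> C * T * D" using C T D by (intro mult_left_mono) auto
    ultimately show ?thesis using C(3)[OF S, of T x y] T C4 by linarith
  qed
  then show ?thesis using that C4 by blast
qed

text \<open>Products of exactly \<open>n\<close> generators; when \<open>S\<close> contains the
  identity, shorter words are included.\<close>

fun words :: "'a set \<Rightarrow> nat \<Rightarrow> 'a set" where
  "words S 0 = {\<one>}"
| "words S (Suc n) = (\<lambda>(s,w). s \<otimes> w) ` (S \<times> words S n)"

lemma words_finite: "finite S \<Longrightarrow> finite (words S n)" by (induction n) auto

lemma words_mono: "sym_gen S \<Longrightarrow> m \<le> n \<Longrightarrow> words S m \<subseteq> words S n"
proof (induction "n - m" arbitrary: n)
  case (Suc k)
  obtain n' where n': "n = Suc n'" using Suc by (cases n) auto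
  then have "words S m \<subseteq> words S n'" using Suc.hyps(1)[of n'] Suc.hyps(2) Suc.prems by linarith
  also have "\<dots> \<subseteq> words S n"
  proof
    fix w assume "w \<in> words S n'"
    then show "w \<in> words S n" using Suc.prems by (auto simp: n' sym_gen_def intro!: image_eqI[of _ _ "(\<one>, w)"])
  qed
  finally show ?case .
qed auto

text \<open>Moving all letters of a chain of hops to the front passes the accumulated errors through
  left translations, each of which expands by at most \<open>\<Lambda>\<close>.\<close>

lemma hop_words:
  assumes "(x,y) \<in> hop S T ^^ n" "T > 0"
  shows "\<exists>\<gamma>\<in>words S n. d (\<gamma> \<otimes> x) y \<le> real n * \<Lambda> ^ n / T"
  using assms(1)
proof (induction n arbitrary: y)
  case (Suc n)
  then obtain z where z: "(x,z) \<in> hop S T ^^ n" "(z,y) \<in> hop S T" by auto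
  obtain \<gamma> where \<gamma>: "\<gamma> \<in> words S n" "d (\<gamma> \<otimes> x) z \<le> real n * \<Lambda> ^ n / T" using Suc.IH[OF z(1)] by blast
  obtain s where s: "s \<in> S" "d (s \<otimes> z) y \<le> 1 / T" using z(2) by (auto simp: hop_def)
  have "d (s \<otimes> (\<gamma> \<otimes> x)) y \<le> d (s \<otimes> (\<gamma> \<otimes> x)) (s \<otimes> z) + d (s \<otimes> z) y" by (rule d_triangle)
  also have "\<dots> \<le> \<Lambda> * (real n * \<Lambda> ^ n / T) + 1 / T"
  proof -
    have "\<Lambda> * d (\<gamma> \<otimes> x) z \<le> \<Lambda> * (real n * \<Lambda> ^ n / T)" using \<gamma> cpos by (intro mult_left_mono) auto
    then show ?thesis using lip[of s "\<gamma> \<otimes> x" z] s by linarith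
  qed
  also have "1 / T \<le> \<Lambda> ^ Suc n / T" using cpos assms one_le_power[of \<Lambda> "Suc n"] by (intro divide_right_mono) auto
  finally have "d (s \<otimes> (\<gamma> \<otimes> x)) y \<le> real (Suc n) * \<Lambda> ^ Suc n / T"
    by (simp add: algebra_simps add_divide_distrib)
  then have "d ((s \<otimes> \<gamma>) \<otimes> x) y \<le> real (Suc n) * \<Lambda> ^ Suc n / T" by (simp add: m_assoc)
  moreover have "s \<otimes> \<gamma> \<in> words S (Suc n)" using s \<gamma> by auto
  ultimately show ?case by blast
qed auto

text \<open>Translates bounded warped distance into the group action: \<open>len\<close> and
  \<open>c\<close> depend on \<open>R\<close> but neither on the level nor on the points.\<close>

lemma bounded_W_words:
  obtains len c where "c \<ge> 0" "\<And>S T x y. sym_gen S \<Longrightarrow> T \<ge> 1 \<Longrightarrow> W S (x,T) (y,T) \<le> R \<Longrightarrow> \<exists>\<gamma>\<in>words S len. d (\<gamma> \<otimes> x) y \<le> c / T"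
proof -
  obtain C where C: "C \<ge> 1"
    "\<And>S T x y. sym_gen S \<Longrightarrow> T \<ge> 1 \<Longrightarrow> path_dist (hop S T) x y \<le> C * W S (x,T) (y,T) + C" using hop_le_W by blast
  define len where "len = nat \<lceil>C * R + C\<rceil>"
  define c where "c = real len * \<Lambda> ^ len"
  have "\<exists>\<gamma>\<in>words S len. d (\<gamma> \<otimes> x) y \<le> c / T" if S: "sym_gen S" and T: "T \<ge> 1" and R: "W S (x,T) (y,T) \<le> R" for S T x y
  proof -
    have "\<exists>n. (x,y) \<in> hop S T ^^ n" using hop_bound S T by (metis less_le_trans zero_less_one)
    then obtain n where n: "(x,y) \<in> hop S T ^^ n" "path_dist (hop S T) x y = n" by (rule path_distE)
    have "real n \<le> C * R + C" using C(2)[OF S T, of x y] n R mult_left_mono[OF R, of C] C(1) by linarith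
    then have nl: "n \<le> len" by (simp add: len_def) linarith
    obtain \<gamma> where \<gamma>: "\<gamma> \<in> words S n" "d (\<gamma> \<otimes> x) y \<le> real n * \<Lambda> ^ n / T" using hop_words[OF n(1)] T by auto
    have "real n * \<Lambda> ^ n / T \<le> c / T" unfolding c_def
      using nl cpos T by (intro divide_right_mono mult_mono power_increasing) auto
    then show ?thesis using \<gamma> words_mono[OF S nl] by (intro bexI[of _ \<gamma>]) auto
  qed
  moreover have "c \<ge> 0" using cpos by (simp add: c_def)
  ultimately show ?thesis using that by blast
qed

end

section \<open>Volume of balls\<close>

context coarse_group begin

lemma sets_mu [simp]: "sets \<mu> = sets borel" and prob_mu: "prob_space \<mu>"
  and mu_invariant: "distr \<mu> \<mu> (\<lambda>x. g \<otimes> x) = \<mu>"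
  using haar by (auto simp: haar_prob_def)

sublocale prob_space \<mu> by (rule prob_mu)

lemma space_mu [simp]: "space \<mu> = UNIV"
  using sets_eq_imp_space_eq[OF sets_mu] by simp

lemma prob_UNIV [simp]: "measure \<mu> UNIV = 1"
  using prob_space by simp

lemma measurable_mu [simp]: "measurable \<mu> N = measurable borel N"
  by (rule measurable_cong_sets) auto

lemma mult_measurable: "(\<lambda>x. g \<otimes> x) \<in> borel_measurable borel"
  by (intro borel_measurable_continuous_onI mult_cont)

lemma mult_measurable_mu: "(\<lambda>x. g \<otimes> x) \<in> measurable borel \<mu>"
  using mult_measurable measurable_cong_sets[of borel borel \<mu> borel] by auto

lemma measure_translate:
  assumes "A \<in> sets borel" shows "measure \<mu> {x. g \<otimes> x \<in> A} = measure \<mu> A"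
proof -
  have "measure \<mu> A = measure (distr \<mu> \<mu> (\<lambda>x. g \<otimes> x)) A" by (simp add: mu_invariant)
  also have "\<dots> = measure \<mu> ((\<lambda>x. g \<otimes> x) -` A \<inter> space \<mu>)"
    by (rule measure_distr) (use assms mult_measurable_mu in auto)
  finally show ?thesis by (simp add: vimage_def)
qed

lemma integral_translate:
  fixes F :: "'a \<Rightarrow> real"
  assumes "F \<in> borel_measurable borel" shows "(\<integral>x. F (g \<otimes> x) \<partial>\<mu>) = (\<integral>x. F x \<partial>\<mu>)"
proof -
  have "(\<integral>x. F x \<partial>\<mu>) = (\<integral>x. F x \<partial>(distr \<mu> \<mu> (\<lambda>x. g \<otimes> x)))" by (simp add: mu_invariant)
  also have "\<dots> = (\<integral>x. F (g \<otimes> x) \<partial>\<mu>)" by (rule integral_distr) (use assms mult_measurable_mu in auto)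
  finally show ?thesis by simp
qed

text \<open>Since Haar measure is invariant while \<open>d\<close> is only quasi-invariant, balls
  about the identity control all others after changing the radius by a factor
  \<open>\<Lambda>\<close>.\<close>

definition M :: "real \<Rightarrow> real" where "M r = measure \<mu> {y. d \<one> y < r}"

lemma ball_sets: "{y. d x y < r} \<in> sets borel" using open_ball_d by auto

lemma mu_mono: "A \<subseteq> A' \<Longrightarrow> A' \<in> sets borel \<Longrightarrow> measure \<mu> A \<le> measure \<mu> A'"
  by (rule finite_measure_mono) auto

lemma ball_lower: "M (r / \<Lambda>) \<le> measure \<mu> {y. d x y < r}"
proof -
  have "M (r / \<Lambda>) \<le> measure \<mu> {y. x \<otimes> y \<in> {y. d x y < r}}"
    unfolding M_def
  proof (rule mu_mono)
    show "{y. d \<one> y < r / \<Lambda>} \<subseteq> {y. x \<otimes> y \<in> {y. d x y < r}}"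
    proof clarify
      fix y assume "d \<one> y < r / \<Lambda>"
      then have "\<Lambda> * d \<one> y < r" using cpos by (simp add: field_simps)
      then show "d x (x \<otimes> y) < r" using lip[of x \<one> y] by simp
    qed
    show "{y. x \<otimes> y \<in> {y. d x y < r}} \<in> sets borel"
      using measurable_sets[OF mult_measurable ball_sets, of x x r] by (simp add: vimage_def)
  qed
  then show ?thesis by (simp only: measure_translate[OF ball_sets])
qed

lemma ball_upper: "measure \<mu> {y. d x y < r} \<le> M (\<Lambda> * r)"
proof -
  have "measure \<mu> {y. x \<otimes> y \<in> {y. d x y < r}} \<le> M (\<Lambda> * r)"
    unfolding M_def
  proof (rule mu_mono[OF _ ball_sets], clarify)
    fix y assume "d x (x \<otimes> y) < r"
    then have "\<Lambda> * d x (x \<otimes> y) < \<Lambda> * r" using cpos by simp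
    moreover have "inv x \<otimes> (x \<otimes> y) = y" by (simp add: m_assoc[symmetric])
    ultimately show "d \<one> y < \<Lambda> * r" using lip[of "inv x" x "x \<otimes> y"] by simp
  qed
  then show ?thesis by (simp only: measure_translate[OF ball_sets])
qed

text \<open>A ball of radius \<open>a * r\<close> is covered by boundedly many balls of radius
  \<open>r / \<Lambda>\<close>, wherever centred, and each of these has measure at most
  \<open>M r\<close>.\<close>

lemma M_doubling: "\<exists>K::nat. \<forall>r>0. M (a * r) \<le> K * M r"
proof -
  obtain K where K: "\<And>x r Y. r > 0 \<Longrightarrow> Y \<subseteq> {y. d x y \<le> (a * \<Lambda>) * r} \<Longrightarrow>
    (\<exists>A\<subseteq>Y. finite A \<and> card A \<le> K \<and> (\<forall>y\<in>A. \<forall>z\<in>A. y \<noteq> z \<longrightarrow> d y z \<ge> r) \<and> (\<forall>y\<in>Y. \<exists>z\<in>A. d z y < r))"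
    using maximal_separated[of "a * \<Lambda>"] by metis
  have "M (a * r) \<le> K * M r" if r: "r > 0" for r
  proof -
    have "r / \<Lambda> > 0" "{y. d \<one> y < a * r} \<subseteq> {y. d \<one> y \<le> (a * \<Lambda>) * (r / \<Lambda>)}" using r cpos by auto
    from K[OF this] obtain A where A: "finite A" "card A \<le> K" "\<forall>y\<in>{y. d \<one> y < a * r}. \<exists>z\<in>A. d z y < r / \<Lambda>" by blast
    have "M (a * r) \<le> measure \<mu> (\<Union>z\<in>A. {y. d z y < r / \<Lambda>})"
      unfolding M_def using A ball_sets by (intro mu_mono sets.finite_UN) auto
    also have "\<dots> \<le> (\<Sum>z\<in>A. measure \<mu> {y. d z y < r / \<Lambda>})"
      using A ball_sets by (intro finite_measure_subadditive_finite) auto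
    also have "\<dots> \<le> (\<Sum>z\<in>A. M r)" using ball_upper[of _ "r / \<Lambda>"] cpos by (intro sum_mono) auto
    also have "\<dots> \<le> K * M r" using A by (auto simp: M_def intro!: mult_right_mono)
    finally show ?thesis .
  qed
  then show ?thesis by blast
qed

text \<open>The whole group is a ball of large radius and has measure 1, so doubling down to radius
  \<open>r\<close> excludes measure 0.\<close>

lemma M_pos: assumes "r > 0" shows "M r > 0"
proof -
  obtain D where D: "D > 0" "\<And>x y. d x y \<le> D" using d_bounded by blast
  have "(D / r + 1) * r = D + r" using assms by (simp add: field_simps)
  then have "d x y < (D / r + 1) * r" for x y using D(2)[of x y] assms by linarith
  then have "M ((D / r + 1) * r) = 1" using prob_space by (simp add: M_def)
  moreover obtain K :: nat where "M ((D / r + 1) * r) \<le> K * M r" using M_doubling assms by blast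
  moreover have "M r \<ge> 0" by (simp add: M_def)
  ultimately show ?thesis by (metis less_eq_real_def mult_zero_right not_one_le_zero)
qed

lemma bounded_integrable:
  fixes F :: "'a \<Rightarrow> real"
  assumes "F \<in> borel_measurable borel" "\<And>x. \<bar>F x\<bar> \<le> C" shows "integrable \<mu> F"
  by (rule integrable_const_bound[of _ C]) (use assms in auto)

text \<open>The centred indicator has squared norm \<open>m * (1 - m)\<close>. If every generator
  moved less than the claimed measure out of \<open>A\<close>, the sum of the \<open>card S\<close>
  displacements would fall short of the gap.\<close>

lemma spectral_gap_sets:
  assumes S: "sym_gen S" and gap: "spectral_gap G \<mu> S"
  shows "\<exists>c>0. \<forall>A\<in>sets borel. \<exists>s\<in>S. c * (measure \<mu> A * (1 - measure \<mu> A)) \<le> measure \<mu> ({x. inv s \<otimes> x \<in> A} - A)"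
proof -
  obtain \<delta> where \<delta>: "\<delta> > 0" "\<And>f. f \<in> L2 \<mu> \<Longrightarrow> (\<integral>x. f x \<partial>\<mu>) = 0 \<Longrightarrow>
      (\<Sum>s\<in>S. L2_norm \<mu> (\<lambda>x. f (inv s \<otimes> x) - f x)) \<ge> \<delta> * L2_norm \<mu> f"
    using gap unfolding spectral_gap_def by blast
  have fS: "finite S" "S \<noteq> {}" "card S > 0" using S by (auto simp: sym_gen_def card_gt_0_iff)
  \<comment> \<open>Chosen such that \<open>sqrt (2 * c * v)\<close> equals
    \<open>\<delta> / card S * sqrt v\<close>.\<close>
  define c where "c = \<delta>\<^sup>2 / (2 * (card S)\<^sup>2)"
  have c: "c > 0" using \<delta> fS by (simp add: c_def)
  have "\<exists>s\<in>S. c * (measure \<mu> A * (1 - measure \<mu> A)) \<le> measure \<mu> ({x. inv s \<otimes> x \<in> A} - A)"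
    if A: "A \<in> sets borel" for A
  proof (rule ccontr)
    assume neg: "\<not> ?thesis"
    define m v where "m = measure \<mu> A" and "v = m * (1 - m)"
    have v0: "v \<ge> 0" by (auto simp: v_def m_def)
    define f where "f = (\<lambda>x. complex_of_real (indicator A x - m))"
    have fm: "f \<in> borel_measurable borel" unfolding f_def using A by measurable
    have sq: "(cmod (f x))\<^sup>2 = (1 - 2 * m) * indicator A x + m\<^sup>2" for x
      by (auto simp: f_def indicator_def power2_eq_square algebra_simps norm_mult[symmetric] simp del: of_real_diff)
    have intA: "integrable \<mu> (indicat_real A)" using A by (intro bounded_integrable[of _ 1]) (auto simp: indicator_def)
    have "f \<in> L2 \<mu>" unfolding L2_def using fm intA by (simp add: sq)
    moreover have "(\<integral>x. f x \<partial>\<mu>) = 0"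
    proof -
      have "(\<integral>x. (indicator A x - m) \<partial>\<mu>) = 0" using intA A by (simp add: m_def prob_space)
      then show ?thesis unfolding f_def by (subst integral_complex_of_real) simp
    qed
    ultimately have main: "\<delta> * L2_norm \<mu> f \<le> (\<Sum>s\<in>S. L2_norm \<mu> (\<lambda>x. f (inv s \<otimes> x) - f x))" by (rule \<delta>(2))
    have "(\<integral>x. (cmod (f x))\<^sup>2 \<partial>\<mu>) = (1 - 2 * m) * m + m\<^sup>2"
      using intA A by (simp add: sq m_def prob_space)
    also have "\<dots> = v" by (simp add: v_def power2_eq_square algebra_simps)
    finally have nf: "L2_norm \<mu> f = sqrt v" by (simp add: L2_norm_def)
    have ns: "L2_norm \<mu> (\<lambda>x. f (inv s \<otimes> x) - f x) < \<delta> / card S * sqrt v" if s: "s \<in> S" for s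
    proof -
      define A' where "A' = {x. inv s \<otimes> x \<in> A}"
      have A': "A' \<in> sets borel" unfolding A'_def
        using measurable_sets[OF mult_measurable A, of "inv s"] by (simp add: vimage_def)
      have mA': "measure \<mu> A' = measure \<mu> A" unfolding A'_def by (rule measure_translate[OF A])
      \<comment> \<open>The centring constant cancels. What remains is the indicator of the
        symmetric difference, whose two halves have equal measure by invariance.\<close>
      have eq: "(cmod (f (inv s \<otimes> x) - f x))\<^sup>2 = indicator (A' - A) x + indicator (A - A') x" for x
        by (auto simp: f_def A'_def indicator_def norm_minus_commute)
      have "measure \<mu> (A' - A) = measure \<mu> A' - measure \<mu> (A' \<inter> A)"
        "measure \<mu> (A - A') = measure \<mu> A - measure \<mu> (A' \<inter> A)"
        using A A' by (auto simp: finite_measure_Diff' Int_commute)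
      then have "measure \<mu> (A - A') = measure \<mu> (A' - A)" using mA' by simp
      moreover have "integrable \<mu> (indicat_real (A' - A))" "integrable \<mu> (indicat_real (A - A'))"
        using A A' by (auto intro!: bounded_integrable[of _ 1] simp: indicator_def)
      ultimately have "(\<integral>x. (cmod (f (inv s \<otimes> x) - f x))\<^sup>2 \<partial>\<mu>) = 2 * measure \<mu> (A' - A)"
        unfolding eq using A A' by simp
      then have "L2_norm \<mu> (\<lambda>x. f (inv s \<otimes> x) - f x) = sqrt (2 * measure \<mu> (A' - A))" by (simp add: L2_norm_def)
      also have "\<dots> < sqrt (2 * (c * v))" using neg s by (auto simp: A'_def v_def m_def not_le)
      also have "2 * (c * v) = (\<delta> / card S)\<^sup>2 * v" by (simp add: c_def power_divide)
      also have "sqrt \<dots> = \<delta> / card S * sqrt v" using \<delta> by (simp add: real_sqrt_mult)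
      finally show ?thesis .
    qed
    have "(\<Sum>s\<in>S. L2_norm \<mu> (\<lambda>x. f (inv s \<otimes> x) - f x)) < (\<Sum>s\<in>S. \<delta> / card S * sqrt v)"
      using fS ns by (intro sum_strict_mono) auto
    also have "\<dots> = \<delta> * sqrt v" using fS by simp
    finally show False using main nf by simp
  qed
  then show ?thesis using c by blast
qed

lemma net_exists:
  assumes r: "r > 0"
  obtains N :: nat and z :: "nat \<Rightarrow> 'a" where "N > 0"
    "\<And>i j. i < N \<Longrightarrow> j < N \<Longrightarrow> i \<noteq> j \<Longrightarrow> d (z i) (z j) \<ge> r" "\<And>x. \<exists>i<N. d (z i) x < r"
proof -
  obtain D where D: "D > 0" "\<And>x y. d x y \<le> D" using d_bounded by blast

  have "UNIV \<subseteq> {y. d \<one> y \<le> (D / r) * r}" using D(2) r by auto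
  then obtain A :: "'a set" where A: "finite A" "\<forall>y\<in>A. \<forall>z\<in>A. y \<noteq> z \<longrightarrow> d y z \<ge> r" "\<forall>y. \<exists>z\<in>A. d z y < r"
    using maximal_separated[of "D / r"] r by (metis UNIV_I)
  obtain z where z: "bij_betw z {..<card A} A" using ex_bij_betw_nat_finite[OF A(1)] by (auto simp: atLeast0LessThan)
  have 1: "card A > 0" using A by (auto simp: card_gt_0_iff)
  have 2: "d (z i) (z j) \<ge> r" if "i < card A" "j < card A" "i \<noteq> j" for i j
  proof -
    have "z i \<in> A" "z j \<in> A" "z i \<noteq> z j"
      using z that by (auto simp: bij_betw_def dest: inj_onD)
    then show ?thesis using A(2) by blast
  qed
  have 3: "\<exists>i<card A. d (z i) x < r" for x
  proof -
    obtain a where "a \<in> A" "d a x < r" using A(3) by blast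
    moreover have "a \<in> z ` {..<card A}" using \<open>a \<in> A\<close> bij_betw_imp_surj_on[OF z] by blast
    then obtain i where "i < card A" "z i = a" by blast
    ultimately show ?thesis by blast
  qed
  show thesis by (rule that[OF 1 2 3])
qed

end

section \<open>From the spectral gap to expanders\<close>

context coarse_group begin

text \<open>All constants are uniform in the level. The last clause, that points with the same image
  are close, is what later makes the number of vertices unbounded.\<close>

lemma gap_level_graph:
  assumes S: "sym_gen S" and gap: "spectral_gap G \<mu> S"
  obtains C \<epsilon> L' A' T0 where "C > 0" "\<epsilon> > 0" "L' > 0" "A' \<ge> 0" "T0 \<ge> 1"
    "\<And>T. T \<ge> T0 \<Longrightarrow> \<exists>(V :: nat set) E f. fin_graph V E \<and> (\<forall>v\<in>V. real (card (E `` {v})) \<le> C) \<and>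
       cheeger V E \<ge> ereal \<epsilon> \<and> quasi_isometry L' A' (UNIV \<times> {T}) (W S) V (path_dist E) f \<and>
       (\<forall>x y. f (x,T) = f (y,T) \<longrightarrow> d x y \<le> 2 / T)"
proof -
  obtain c where c: "c > 0" "\<And>A. A \<in> sets borel \<Longrightarrow>
      \<exists>s\<in>S. c * (measure \<mu> A * (1 - measure \<mu> A)) \<le> measure \<mu> ({x. inv s \<otimes> x \<in> A} - A)"
    using spectral_gap_sets[OF S gap] by blast
  \<comment> \<open>A cell lies in a ball of measure at most \<open>M (\<Lambda> / T)\<close> and
    contains one of measure at least \<open>M (1 / (2 * \<Lambda> * T))\<close>; the ratio of these
    radii is \<open>2 * \<Lambda>\<^sup>2\<close>.\<close>
  obtain K :: nat where K: "\<And>r. r > 0 \<Longrightarrow> M (2 * \<Lambda>\<^sup>2 * r) \<le> K * M r" using M_doubling by blast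
  have K0: "K > 0"
  proof (rule ccontr)
    assume "\<not> K > 0"
    then have "M (2 * \<Lambda>\<^sup>2 * 1) \<le> 0" using K[of 1] by simp
    moreover have "M (2 * \<Lambda>\<^sup>2 * 1) > 0" using cpos by (intro M_pos) auto
    ultimately show False by simp
  qed
  obtain C where C: "C \<ge> 1"
    "\<And>S T x y. sym_gen S \<Longrightarrow> T \<ge> 1 \<Longrightarrow> path_dist (hop S T) x y \<le> C * W S (x,T) (y,T) + C" using hop_le_W by blast
  \<comment> \<open>Replacing both ends of a hop by net points costs \<open>\<Lambda> / T\<close> at
    the translated end and \<open>1 / T\<close> at the other; the hop itself contributes another
    \<open>1 / T\<close>.\<close>
  define R where "R = \<Lambda> + 2"
  have R: "R \<ge> 1" using cpos by (simp add: R_def)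
  obtain Kd where Kd: "\<And>x r A. r > 0 \<Longrightarrow> A \<subseteq> {y. d x y \<le> \<Lambda> * R * r} \<Longrightarrow>
    (\<forall>y\<in>A. \<forall>z\<in>A. y \<noteq> z \<longrightarrow> d y z \<ge> r) \<Longrightarrow> finite A \<and> card A \<le> Kd" using packing_bound[of "\<Lambda> * R"] by blast
  \<comment> \<open>One factor \<open>K\<close> comes from the measure of the boundary cells, the
    factor \<open>2 * K\<close> from the measure of the complement, which is at least
    \<open>1 / (2 * K)\<close>.\<close>
  define \<epsilon> where "\<epsilon> = c / (2 * K\<^sup>2)"
  define P where "P = 1 + L * R"
  define L' where "L' = max C P"
  define A' where "A' = max C (2 * L)"
  define T0 where "T0 = max 1 (R / r0)"
  have fS: "finite S" "\<one> \<in> S" "\<And>s. s \<in> S \<Longrightarrow> inv s \<in> S" using S by (auto simp: sym_gen_def)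
  have main: "\<exists>(V :: nat set) E f. fin_graph V E \<and> (\<forall>v\<in>V. real (card (E `` {v})) \<le> real (card S * Kd) + 1) \<and>
       cheeger V E \<ge> ereal \<epsilon> \<and> quasi_isometry L' A' (UNIV \<times> {T}) (W S) V (path_dist E) f \<and>
       (\<forall>x y. f (x,T) = f (y,T) \<longrightarrow> d x y \<le> 2 / T)" if T: "T \<ge> T0" for T
  proof -
    have T1: "T \<ge> 1" "T > 0" and RT: "R / T \<le> r0" using T cpos by (auto simp: T0_def field_simps)
    then have T2: "1 / T \<le> r0" "1 / T > 0" using R divide_right_mono[of 1 R T] by auto
    obtain N :: nat and z where N: "N > 0"
      and zsep: "\<And>i j. i < N \<Longrightarrow> j < N \<Longrightarrow> i \<noteq> j \<Longrightarrow> d (z i) (z j) \<ge> 1 / T"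
      and zcov: "\<And>x. \<exists>i<N. d (z i) x < 1 / T" using net_exists[OF T2(2)] by metis
    \<comment> \<open>Each point is assigned to a nearest net point, ties being broken by the least
      index; this gives disjoint measurable Voronoi cells.\<close>
    define near1 where "near1 = (\<lambda>x i. i < N \<and> (\<forall>j<N. d (z i) x \<le> d (z j) x))"
    define p where "p = (\<lambda>x. LEAST i. near1 x i)"
    have ex: "\<exists>i. near1 x i" for x
    proof -
      have "finite ((\<lambda>i. d (z i) x) ` {..<N})" "(\<lambda>i. d (z i) x) ` {..<N} \<noteq> {}" using N by auto
      from Min_in[OF this] obtain i where "i < N" "d (z i) x = Min ((\<lambda>i. d (z i) x) ` {..<N})" by auto
      then have "near1 x i" unfolding near1_def by auto
      then show ?thesis by blast
    qed
    have pn: "near1 x (p x)" for x unfolding p_def by (rule LeastI_ex[OF ex])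
    have np: "\<not> near1 x j" if "j < p x" for x j using that unfolding p_def by (rule not_less_Least)
    have pN: "p x < N" for x using pn by (simp add: near1_def)
    have pd: "d (z (p x)) x < 1 / T" for x
    proof -
      obtain i where "i < N" "d (z i) x < 1 / T" using zcov by blast
      then show ?thesis using pn[of x] by (force simp: near1_def)
    qed
    \<comment> \<open>Half the separation of the net: every cell contains the ball of radius
      \<open>1 / (2 * T)\<close> about its centre, which bounds its measure from below.\<close>
    have puniq: "p x = i" if i: "i < N" and x: "d (z i) x < 1 / (2 * T)" for x i
    proof (rule ccontr)
      assume "p x \<noteq> i"
      then have "1 / T \<le> d (z (p x)) (z i)" using zsep pN i by blast
      also have "\<dots> \<le> d (z (p x)) x + d (z i) x" using d_triangle[of "z (p x)" "z i" x] d_commute[of x] by simp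
      also have "\<dots> \<le> 2 * d (z i) x" using pn[of x] i by (auto simp: near1_def)
      finally show False using x by simp
    qed
    have pz: "p (z i) = i" if "i < N" for i using puniq[OF that, of "z i"] T1 by simp
    define Q where "Q = (\<lambda>i. {x. p x = i})"
    have near_sets: "{x. near1 x i} \<in> sets borel" for i
    proof -
      have "closed {x. d (z i) x \<le> d (z j) x}" for j by (intro closed_Collect_le continuous_intros)
      then have "closed (\<Inter>j\<in>{..<N}. {x. d (z i) x \<le> d (z j) x})" by auto
      moreover have "{x. near1 x i} = (if i < N then (\<Inter>j\<in>{..<N}. {x. d (z i) x \<le> d (z j) x}) else {})"
        by (auto simp: near1_def)
      ultimately show ?thesis by auto
    qed
    have Q_sets: "Q i \<in> sets borel" for i
    proof -
      have "Q i = {x. near1 x i} - (\<Union>j<i. {x. near1 x j})"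
      proof (rule equalityI; rule subsetI)
        fix x assume "x \<in> Q i"
        then have "p x = i" by (simp add: Q_def)
        then show "x \<in> {x. near1 x i} - (\<Union>j<i. {x. near1 x j})"
          using pn[of x] np by blast
      next
        fix x assume "x \<in> {x. near1 x i} - (\<Union>j<i. {x. near1 x j})"
        then have "near1 x i" "\<not> p x < i" using pn[of x] by auto
        moreover from this(1) have "p x \<le> i" unfolding p_def by (rule Least_le)
        ultimately show "x \<in> Q i" by (simp add: Q_def)
      qed
      then show ?thesis using near_sets by auto
    qed
    define q1 where "q1 = M (1 / (2 * \<Lambda> * T))"
    have q1: "q1 > 0" unfolding q1_def using T1 cpos by (intro M_pos) auto
    have Qlow: "q1 \<le> measure \<mu> (Q i)" if "i < N" for i
    proof -
      have "q1 \<le> measure \<mu> {y. d (z i) y < 1 / (2 * T)}"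
        using ball_lower[of "1 / (2 * T)" "z i"] by (simp add: q1_def mult_ac)
      also have "\<dots> \<le> measure \<mu> (Q i)" by (intro mu_mono Q_sets) (use puniq[OF that] in \<open>auto simp: Q_def\<close>)
      finally show ?thesis .
    qed
    have Qup: "measure \<mu> (Q i) \<le> K * q1" for i
    proof -
      have "measure \<mu> (Q i) \<le> measure \<mu> {y. d (z i) y < 1 / T}"
        using pd by (intro mu_mono ball_sets) (auto simp: Q_def)
      also have "\<dots> \<le> M (\<Lambda> * (1 / T))" by (rule ball_upper)
      also have "\<Lambda> * (1 / T) = 2 * \<Lambda>\<^sup>2 * (1 / (2 * \<Lambda> * T))" using cpos T1 by (simp add: power2_eq_square)
      also have "M \<dots> \<le> K * q1" unfolding q1_def using cpos T1 by (intro K) auto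
      finally show ?thesis .
    qed
    define A where "A = (\<lambda>W. {x. p x \<in> W})"
    have A_UN: "A W = (\<Union>i\<in>W. Q i)" for W by (auto simp: A_def Q_def)
    have A_sets: "finite W \<Longrightarrow> A W \<in> sets borel" for W unfolding A_UN using Q_sets by (intro sets.finite_UN) auto
    have mA: "measure \<mu> (A W) = (\<Sum>i\<in>W. measure \<mu> (Q i))" if "finite W" for W
      unfolding A_UN using that Q_sets by (intro finite_measure_finite_Union) (auto simp: disjoint_family_on_def Q_def)
    have mAlow: "card W * q1 \<le> measure \<mu> (A W)" if "W \<subseteq> {..<N}" for W
    proof -
      have fW: "finite W" using that finite_subset by blast
      have "(\<Sum>i\<in>W. q1) \<le> (\<Sum>i\<in>W. measure \<mu> (Q i))" using that Qlow by (intro sum_mono) auto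
      then show ?thesis using mA[OF fW] by simp
    qed
    have mAup: "measure \<mu> (A W) \<le> card W * (K * q1)" if "finite W" for W
      unfolding mA[OF that] using sum_mono[of W "\<lambda>i. measure \<mu> (Q i)" "\<lambda>_. K * q1"] Qup by simp
    \<comment> \<open>The relation is symmetrised by hand, because the condition on \<open>s\<close>
      and the one on \<open>inv s\<close> agree only up to a factor
      \<open>\<Lambda>\<close>.\<close>
    define E where "E = {(i,j). i < N \<and> j < N \<and> i \<noteq> j \<and>
        ((\<exists>s\<in>S. d (s \<otimes> z i) (z j) \<le> R / T) \<or> (\<exists>s\<in>S. d (s \<otimes> z j) (z i) \<le> R / T))}"
    have graph: "fin_graph {..<N} E" by (auto simp: fin_graph_def E_def sym_def irrefl_def)
    have step: "(p x, p y) \<in> E \<or> p x = p y" if "s \<in> S" "d (s \<otimes> x) y \<le> 1 / T" for s x y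
    proof -
      have "d (s \<otimes> z (p x)) (z (p y)) \<le> d (s \<otimes> z (p x)) (s \<otimes> x) + d (s \<otimes> x) y + d y (z (p y))"
        using d_triangle[of "s \<otimes> z (p x)" "z (p y)" y] d_triangle[of "s \<otimes> z (p x)" y "s \<otimes> x"] by linarith
      also have "\<dots> \<le> \<Lambda> * (1 / T) + 1 / T + 1 / T"
      proof (intro add_mono that(2))
        have "\<Lambda> * d (z (p x)) x \<le> \<Lambda> * (1 / T)" using pd[of x] cpos by (intro mult_left_mono) auto
        then show "d (s \<otimes> z (p x)) (s \<otimes> x) \<le> \<Lambda> * (1 / T)" using lip[of s "z (p x)" x] by linarith
        show "d y (z (p y)) \<le> 1 / T" using pd[of y] by (simp add: d_commute[of y])
      qed
      also have "\<dots> = R / T" by (simp add: R_def add_divide_distrib)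
      finally show ?thesis using that(1) pN by (auto simp: E_def)
    qed
    have deg: "real (card (E `` {i})) \<le> real (card S * Kd) + 1" for i
    proof -
      \<comment> \<open>The radius is enlarged by \<open>\<Lambda>\<close> so that reversed edges,
        rewritten with \<open>inv s\<close>, are caught as well.\<close>
      define B where "B = (\<lambda>s. {j. j < N \<and> d (s \<otimes> z i) (z j) \<le> \<Lambda> * R * (1 / T)})"
      have cB: "card (B s) \<le> Kd" "finite (B s)" for s
      proof -
        show "finite (B s)" by (simp add: B_def)
        have inj: "inj_on z (B s)"
        proof (rule inj_onI, rule ccontr)
          fix i j assume "i \<in> B s" "j \<in> B s" "z i = z j" "i \<noteq> j"
          then have "1 / T \<le> d (z i) (z j)" by (intro zsep) (auto simp: B_def)
          then show False using T2 \<open>z i = z j\<close> by simp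
        qed
        have "finite (z ` B s) \<and> card (z ` B s) \<le> Kd"
        proof (rule Kd[OF T2(2)])
          show "z ` B s \<subseteq> {y. d (s \<otimes> z i) y \<le> \<Lambda> * R * (1 / T)}" by (auto simp: B_def)
          show "\<forall>y\<in>z ` B s. \<forall>w\<in>z ` B s. y \<noteq> w \<longrightarrow> 1 / T \<le> d y w" using zsep by (auto simp: B_def)
        qed
        then show "card (B s) \<le> Kd" using card_image[OF inj] by simp
      qed
      have "E `` {i} \<subseteq> (\<Union>s\<in>S. B s)"
      proof
        fix j assume "j \<in> E `` {i}"
        then consider s where "s \<in> S" "j < N" "d (s \<otimes> z i) (z j) \<le> R / T" | s where "s \<in> S" "j < N" "d (s \<otimes> z j) (z i) \<le> R / T"
          by (auto simp: E_def)
        then show "j \<in> (\<Union>s\<in>S. B s)"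
        proof cases
          case 1
          have "1 * (R * (1 / T)) \<le> \<Lambda> * (R * (1 / T))" using cpos R T1 by (intro mult_right_mono) auto
          then have "R / T \<le> \<Lambda> * R * (1 / T)" by (simp add: mult_ac)
          then have "j \<in> B s" using 1 by (auto simp: B_def)
          then show ?thesis using 1 by blast
        next
          case 2
          have "inv s \<otimes> (s \<otimes> z j) = z j" by (simp add: m_assoc[symmetric])
          then have "d (inv s \<otimes> z i) (z j) \<le> \<Lambda> * d (z i) (s \<otimes> z j)" using lip[of "inv s" "z i" "s \<otimes> z j"] by simp
          also have "\<dots> \<le> \<Lambda> * (R / T)" using 2 cpos by (intro mult_left_mono) (auto simp: d_commute)
          finally have "j \<in> B (inv s)" using 2 by (auto simp: B_def)
          then show ?thesis using 2 fS(3) by blast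
        qed
      qed
      then have "card (E `` {i}) \<le> card (\<Union>s\<in>S. B s)" using fS cB by (intro card_mono) auto
      also have "\<dots> \<le> (\<Sum>s\<in>S. card (B s))" by (rule card_UN_le[OF fS(1)])
      also have "\<dots> \<le> (\<Sum>s\<in>S. Kd)" by (intro sum_mono cB)
      finally have "real (card (E `` {i})) \<le> real (card S * Kd)" by (simp only: sum_constant of_nat_le_iff of_nat_id)
      then show ?thesis by simp
    qed
    have cheeg: "cheeger {..<N} E \<ge> ereal \<epsilon>"
      unfolding cheeger_def
    proof (rule INF_greatest)
      fix U assume "U \<in> {W. W \<noteq> {} \<and> W \<subset> {..<N} \<and> real (card W) \<le> real (card {..<N}) / 2}"
      then have U: "U \<noteq> {}" "U \<subset> {..<N}" "real (card U) \<le> real (card {..<N}) / 2" by auto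
      have fU: "finite U" "card U > 0" using U finite_subset[of U "{..<N}"] by (auto simp: card_gt_0_iff)
      obtain s where s: "s \<in> S" "c * (measure \<mu> (A U) * (1 - measure \<mu> (A U))) \<le> measure \<mu> ({x. inv s \<otimes> x \<in> A U} - A U)"
        using c(2)[OF A_sets[OF fU(1)]] by blast
      define bU where "bU = vertex_boundary E U"
      have fbU: "finite bU" unfolding bU_def vertex_boundary_def
        by (rule finite_subset[of _ "{..<N}"]) (auto simp: E_def)
      \<comment> \<open>A point outside \<open>A U\<close> that \<open>s\<close> reaches from inside
        lies in a cell adjacent to a cell of \<open>U\<close>. So the mass that leaves
        \<open>A U\<close> sits in boundary cells.\<close>
      have "{x. inv s \<otimes> x \<in> A U} - A U \<subseteq> A bU"
      proof
        fix x assume x: "x \<in> {x. inv s \<otimes> x \<in> A U} - A U"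
        have "s \<otimes> (inv s \<otimes> x) = x" by (simp add: m_assoc[symmetric])
        then have "(p (inv s \<otimes> x), p x) \<in> E \<or> p (inv s \<otimes> x) = p x"
          using step[OF s(1), of "inv s \<otimes> x" x] T1 by simp
        then show "x \<in> A bU" using x by (auto simp: A_def bU_def vertex_boundary_def)
      qed
      then have "measure \<mu> ({x. inv s \<otimes> x \<in> A U} - A U) \<le> card bU * (K * q1)"
        using mu_mono[OF _ A_sets[OF fbU]] mAup[OF fbU] order_trans by blast
      then have up: "c * (measure \<mu> (A U) * (1 - measure \<mu> (A U))) \<le> card bU * (K * q1)" using s by linarith
      have "UNIV = A U \<union> A ({..<N} - U)" using pN by (auto simp: A_def)
      moreover have "measure \<mu> (A U \<union> A ({..<N} - U)) = measure \<mu> (A U) + measure \<mu> (A ({..<N} - U))"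
        using A_sets[of U] A_sets[of "{..<N} - U"] fU by (intro finite_measure_Union) (auto simp: A_def)
      ultimately have sum1: "1 - measure \<mu> (A U) = measure \<mu> (A ({..<N} - U))" using prob_UNIV by simp
      have "real (card ({..<N} - U)) = real N - card U" using U fU by (subst card_Diff_subset) (auto intro: subset_eq_atLeast0_lessThan_card)
      then have "real N / 2 \<le> real (card ({..<N} - U))" using U by simp
      then have "real N / 2 * q1 \<le> real (card ({..<N} - U)) * q1" using q1 by (intro mult_right_mono) auto
      also have "\<dots> \<le> 1 - measure \<mu> (A U)" using mAlow[of "{..<N} - U"] sum1 by auto
      finally have lo1: "real N / 2 * q1 \<le> 1 - measure \<mu> (A U)" .
      have "A {..<N} = UNIV" using pN by (auto simp: A_def)
      \<comment> \<open>The \<open>N\<close> cells cover the group, hence \<open>N * K * q1\<close>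
        is at least 1. At least half of the cells lie outside \<open>U\<close>, each of measure at
        least \<open>q1\<close>, so the complement keeps a definite share.\<close>
      then have "1 \<le> N * (K * q1)" using mAup[of "{..<N}"] by simp
      then have "1 / (2 * K) \<le> real N / 2 * q1" using K0 by (simp add: field_simps)
      then have lo2: "1 / (2 * K) \<le> 1 - measure \<mu> (A U)" using lo1 by linarith
      have "card U * q1 * (1 / (2 * K)) \<le> measure \<mu> (A U) * (1 - measure \<mu> (A U))"
        using mAlow[of U] U lo2 q1 by (intro mult_mono) auto
      then have "c * (card U * q1 * (1 / (2 * K))) \<le> card bU * (K * q1)" using up c(1) by (meson mult_left_mono less_imp_le order_trans)
      then have "c * (card U * (1 / (2 * K))) * q1 \<le> (card bU * K) * q1" by (simp add: mult_ac)
      then have "c * (card U * (1 / (2 * K))) \<le> card bU * K" by (rule mult_right_le_imp_le[OF _ q1])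
      then have "\<epsilon> * card U \<le> card bU" using K0 by (simp add: \<epsilon>_def field_simps power2_eq_square)
      then show "ereal \<epsilon> \<le> ereal (real (card (vertex_boundary E U)) / real (card U))"
        using fU by (simp add: bU_def field_simps)
    qed
    \<comment> \<open>Projecting to the net may collapse a hop to a single vertex, so paths can only
      get shorter.\<close>
    have hopE: "\<exists>m\<le>n. (p x, p y) \<in> E ^^ m" if "(x,y) \<in> hop S T ^^ n" for x y n
      using that
    proof (induction n arbitrary: y)
      case (Suc n)
      then obtain w where w: "(x,w) \<in> hop S T ^^ n" "(w,y) \<in> hop S T" by auto
      obtain m where m: "m \<le> n" "(p x, p w) \<in> E ^^ m" using Suc.IH[OF w(1)] by blast
      have "(p w, p y) \<in> E \<or> p w = p y" using w(2) step by (auto simp: hop_def)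
      then show ?case
      proof
        assume "(p w, p y) \<in> E" then show ?thesis using m by (intro exI[of _ "Suc m"]) auto
      next
        assume "p w = p y" then show ?thesis using m by (intro exI[of _ m]) auto
      qed
    qed auto
    have hopn: "\<exists>n. (x,y) \<in> hop S T ^^ n" for x y using hop_bound S T1 by metis
    have Ecn: "\<exists>m. (p x, p y) \<in> E ^^ m" for x y using hopE hopn by metis
    have up: "path_dist E (p x) (p y) \<le> C * W S (x,T) (y,T) + C" for x y
    proof -
      obtain n where n: "(x,y) \<in> hop S T ^^ n" "path_dist (hop S T) x y = n" using path_distE[OF hopn] .
      obtain m where m: "m \<le> n" "(p x, p y) \<in> E ^^ m" using hopE[OF n(1)] by blast
      show ?thesis using path_dist_le[OF m(2)] m(1) n(2) C(2)[OF S T1(1), of x y] by linarith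
    qed
    have Wnn: "W S (x,T) (y,T) \<ge> 0" for x y by (rule W_nonneg) (use T1 in auto)
    have Wtri: "W S (x,T) (y,T) \<le> W S (x,T) (w,T) + W S (w,T) (y,T)" for x y w
      by (rule W_triangle) (use T1 in auto)
    have P: "P \<ge> 1" using cpos R by (simp add: P_def)
    have WE1: "W S (z i,T) (z j,T) \<le> P" if s: "s \<in> S" "d (s \<otimes> z i) (z j) \<le> R / T" for i j s
    proof -
      have "W S (z i,T) (z j,T) \<le> W S (z i,T) (s \<otimes> z i,T) + W S (s \<otimes> z i,T) (z j,T)" by (rule Wtri)
      also have "\<dots> \<le> 1 + L * T * d (s \<otimes> z i) (z j)"
        using W_jump[OF s(1) T1(1), of "z i"] W_level_near[of "s \<otimes> z i" "z j" T S] s RT T1 by linarith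
      also have "\<dots> \<le> 1 + L * T * (R / T)" using s cpos T1 by (intro add_left_mono mult_left_mono) auto
      finally show ?thesis using T1 by (simp add: P_def)
    qed
    have WE: "W S (z i,T) (z j,T) \<le> P" if "(i,j) \<in> E" for i j
      using that WE1[of _ i j] WE1[of _ j i] W_commute[of S "(z i,T)" "(z j,T)"] by (auto simp: E_def)
    have Wpath: "W S (z i,T) (z j,T) \<le> n * P" if "(i,j) \<in> E ^^ n" for i j n
      using that
    proof (induction n arbitrary: j)
      case 0 then show ?case using W_level_near[of "z i" "z i" T S] T1 cpos by simp
    next
      case (Suc n)
      then obtain l where l: "(i,l) \<in> E ^^ n" "(l,j) \<in> E" by auto
      show ?case using Suc.IH[OF l(1)] WE[OF l(2)] Wtri[of "z i" "z j" "z l"] by (simp add: algebra_simps)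
    qed
    have Wp: "W S (z (p x),T) (x,T) \<le> L" for x
    proof -
      have "W S (z (p x),T) (x,T) \<le> L * T * d (z (p x)) x" using pd[of x] T1 T2 by (intro W_level_near) auto
      also have "\<dots> \<le> L * T * (1 / T)" using pd[of x] cpos T1 by (intro mult_left_mono) auto
      finally show ?thesis using T1 by simp
    qed
    have lo: "W S (x,T) (y,T) / P - 2 * L \<le> path_dist E (p x) (p y)" for x y
    proof -
      obtain n where n: "(p x,p y) \<in> E ^^ n" "path_dist E (p x) (p y) = n" using path_distE[OF Ecn] .
      have "W S (x,T) (y,T) \<le> W S (x,T) (z (p x),T) + W S (z (p x),T) (z (p y),T) + W S (z (p y),T) (y,T)"
        using Wtri[of x y "z (p x)"] Wtri[of "z (p x)" y "z (p y)"] by linarith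
      also have "\<dots> \<le> L + n * P + L"
        using Wp[of x] Wp[of y] Wpath[OF n(1)] W_commute[of S "(x,T)"] by simp
      finally have "W S (x,T) (y,T) \<le> 2 * L + n * P" by simp
      also have "\<dots> \<le> 2 * L * P + n * P" using P cpos by (simp add: mult_le_cancel_left1)
      finally have "W S (x,T) (y,T) / P \<le> 2 * L + n" using P by (simp add: divide_le_eq algebra_simps)
      then show ?thesis using n by simp
    qed
    have LA: "L' \<ge> C" "L' \<ge> P" "A' \<ge> C" "A' \<ge> 2 * L" "L' > 0" using C(1) by (auto simp: L'_def A'_def)
    have "quasi_isometry L' A' (UNIV \<times> {T}) (W S) {..<N} (path_dist E) (\<lambda>w. p (fst w))"
      unfolding quasi_isometry_def
    proof (intro conjI ballI)
      show "(\<lambda>w. p (fst w)) ` (UNIV \<times> {T}) \<subseteq> {..<N}" using pN by auto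
      fix u v :: "'a \<times> real" assume uv: "u \<in> UNIV \<times> {T}" "v \<in> UNIV \<times> {T}"
      then obtain x y where [simp]: "u = (x,T)" "v = (y,T)" by auto
      have "W S u v / L' \<le> W S u v / P" using LA P Wnn[of x y] by (intro divide_left_mono) auto
      then show "W S u v / L' - A' \<le> path_dist E (p (fst u)) (p (fst v))" using lo[of x y] LA by simp
      have "C * W S u v \<le> L' * W S u v" using LA Wnn[of x y] by (intro mult_right_mono) auto
      then show "path_dist E (p (fst u)) (p (fst v)) \<le> L' * W S u v + A'" using up[of x y] LA by simp
    next
      fix i assume "i \<in> {..<N}"
      then have "p (z i) = i" using pz by simp
      moreover have "path_dist E i i \<le> 0" using path_dist_le[of i i 0 E] by simp
      ultimately show "\<exists>x\<in>UNIV \<times> {T}. path_dist E i (p (fst x)) \<le> A'" using LA C(1) by (intro bexI[of _ "(z i, T)"]) auto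
    qed
    moreover have "d x y \<le> 2 / T" if "p x = p y" for x y
      using d_triangle[of x y "z (p x)"] pd[of x] pd[of y] d_commute[of x "z (p x)"] that by simp
    ultimately show ?thesis using graph deg cheeg
      by (intro exI[of _ "{..<N}"] exI[of _ E] exI[of _ "\<lambda>w. p (fst w)"]) auto
  qed
  have pos: "real (card S * Kd) + 1 > 0" "\<epsilon> > 0" "L' > 0" "A' \<ge> 0" "T0 \<ge> 1"
    using c K0 C by (auto simp: \<epsilon>_def L'_def A'_def T0_def intro!: add_nonneg_pos)
  show ?thesis by (rule that[OF pos main])
qed

text \<open>Any \<open>m\<close> distinct points are sent to distinct vertices once
  \<open>2 / t n\<close> is below their least mutual distance.\<close>

lemma card_level_unbounded:
  fixes V :: "nat \<Rightarrow> 'b set" and t :: "nat \<Rightarrow> real"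
  assumes t: "filterlim t at_top sequentially" and fin: "\<And>n. finite (V n)"
    and f: "\<And>n x. t n \<ge> T0 \<Longrightarrow> f n x \<in> V n" "\<And>n x y. t n \<ge> T0 \<Longrightarrow> f n x = f n y \<Longrightarrow> d x y \<le> 2 / t n"
  shows "filterlim (\<lambda>n. card (V n)) at_top sequentially"
  unfolding filterlim_at_top
proof
  fix m
  obtain Y :: "'a set" where Y: "finite Y" "card Y = m" using infin infinite_arbitrarily_large by blast
  \<comment> \<open>Inserting 1 keeps the set nonempty when \<open>Y\<close> has fewer than two
    points.\<close>
  define \<eta> where "\<eta> = Min (insert 1 ((\<lambda>(x,y). d x y) ` {(x,y)\<in>Y \<times> Y. x \<noteq> y}))"
  have fin': "finite (insert 1 ((\<lambda>(x,y). d x y) ` {(x,y)\<in>Y \<times> Y. x \<noteq> y}))"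
    using Y by (auto intro: finite_subset[of _ "Y \<times> Y"])
  have \<eta>: "\<eta> > 0" unfolding \<eta>_def using d_pos by (subst Min_gr_iff[OF fin']) auto
  have \<eta>le: "\<eta> \<le> d x y" if "x \<in> Y" "y \<in> Y" "x \<noteq> y" for x y
    unfolding \<eta>_def using that by (intro Min_le[OF fin']) force
  have "eventually (\<lambda>n. t n > max 1 (max T0 (2 / \<eta>))) sequentially"
    using t by (rule filterlim_at_top_dense[THEN iffD1, rule_format])
  then show "\<forall>\<^sub>F n in sequentially. m \<le> card (V n)"
  proof eventually_elim
    case (elim n)
    have "2 / t n < \<eta>" using elim \<eta> by (simp add: field_simps)
    then have "inj_on (f n) Y" using f(2)[of n] elim \<eta>le by (force intro!: inj_onI)
    then have "card (f n ` Y) = m" using Y by (simp add: card_image)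
    moreover have "f n ` Y \<subseteq> V n" using f(1) elim by auto
    ultimately show ?case using card_mono[OF fin] by metis
  qed
qed

theorem gap_imp_expanders:
  assumes S: "sym_gen S" and gap: "spectral_gap G \<mu> S" and t: "level_seq t"
  shows "levels_form_expanders (W S) t"
proof -
  obtain C \<epsilon> L' A' T0 where c: "C > 0" "\<epsilon> > 0" "L' > 0" "A' \<ge> 0" "T0 \<ge> 1" and
    ex: "\<And>T. T \<ge> T0 \<Longrightarrow> \<exists>(V :: nat set) E f. fin_graph V E \<and> (\<forall>v\<in>V. real (card (E `` {v})) \<le> C) \<and>
       cheeger V E \<ge> ereal \<epsilon> \<and> quasi_isometry L' A' (UNIV \<times> {T}) (W S) V (path_dist E) f \<and>
       (\<forall>x y. f (x,T) = f (y,T) \<longrightarrow> d x y \<le> 2 / T)" using gap_level_graph[OF S gap] by metis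
  obtain C1 where C1: "\<And>S x y t. t \<ge> 1 \<Longrightarrow> W S (x,t) (y,t) \<le> C1 * t" using W_level_bound by blast
  \<comment> \<open>The second entry absorbs the bounded diameter of the levels below
    \<open>T0\<close>.\<close>
  define A1 where "A1 = max A' (\<bar>C1\<bar> * T0 / L')"
  have A1: "A1 \<ge> A'" "A1 \<ge> \<bar>C1\<bar> * T0 / L'" "A1 \<ge> 0" using c by (auto simp: A1_def)
  have "\<exists>(V :: nat set) E f. fin_graph V E \<and> (\<forall>v\<in>V. real (card (E `` {v})) \<le> C) \<and>
       cheeger V E \<ge> ereal \<epsilon> \<and> quasi_isometry L' A1 (UNIV \<times> {t n}) (W S) V (path_dist E) f \<and>
       (t n \<ge> T0 \<longrightarrow> (\<forall>x y. f (x,t n) = f (y,t n) \<longrightarrow> d x y \<le> 2 / t n))" for n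
  proof (cases "t n \<ge> T0")
    case True
    have "quasi_isometry L' A1 X D V D' f" if "quasi_isometry L' A' X D V D' f" for X D and V :: "nat set" and D' f
      using that A1(1) unfolding quasi_isometry_def by (smt (verit, best))
    then show ?thesis using ex[OF True] by blast
  next
    \<comment> \<open>A low level is modelled by a single vertex: its warped diameter is bounded,
      and its Cheeger constant is an infimum over the empty family, hence infinite.\<close>
    case False
    have t1: "t n \<ge> 1" using t by (simp add: level_seq_def)
    have e1: "{U. U \<noteq> {} \<and> U \<subset> {0::nat} \<and> real (card U) \<le> real (card {0::nat}) / 2} = {}" by auto
    have "cheeger {0::nat} {} \<ge> ereal \<epsilon>" unfolding cheeger_def e1 by (simp add: top_ereal_def)
    moreover have "fin_graph {0::nat} {}" by (auto simp: fin_graph_def sym_def irrefl_def)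
    moreover have "path_dist {} (0::nat) 0 = 0" using path_dist_le[of "0::nat" 0 0 "{}"] by (simp add: path_dist_def)
    then have "quasi_isometry L' A1 (UNIV \<times> {t n}) (W S) {0::nat} (path_dist {}) (\<lambda>_. 0)"
      unfolding quasi_isometry_def
    proof (intro conjI ballI)
      fix u v :: "'a \<times> real" assume "u \<in> UNIV \<times> {t n}" "v \<in> UNIV \<times> {t n}"
      then obtain x y where [simp]: "u = (x,t n)" "v = (y,t n)" by auto
      have nn: "W S u v \<ge> 0" by (rule W_nonneg) (use t1 in auto)
      have "W S u v \<le> C1 * t n" using C1[OF t1] by simp
      also have "\<dots> \<le> \<bar>C1\<bar> * T0" using False t1 by (intro mult_mono) auto
      finally have "W S u v / L' \<le> \<bar>C1\<bar> * T0 / L'" using c by (intro divide_right_mono) auto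
      then show "W S u v / L' - A1 \<le> path_dist {} (0::nat) 0" using A1 \<open>path_dist {} (0::nat) 0 = 0\<close> by linarith
      have "0 \<le> L' * W S u v" using nn c by simp
      then show "path_dist {} (0::nat) 0 \<le> L' * W S u v + A1" using A1 \<open>path_dist {} (0::nat) 0 = 0\<close> by linarith
    qed (use A1 in auto)
    ultimately show ?thesis using False c by (intro exI[of _ "{0}"] exI[of _ "{}"] exI[of _ "\<lambda>_. 0"]) auto
  qed
  then obtain V :: "nat \<Rightarrow> nat set" and E f where VE: "\<And>n. fin_graph (V n) (E n)" "\<And>n v. v \<in> V n \<Longrightarrow> real (card (E n `` {v})) \<le> C"
    "\<And>n. cheeger (V n) (E n) \<ge> ereal \<epsilon>" "\<And>n. quasi_isometry L' A1 (UNIV \<times> {t n}) (W S) (V n) (path_dist (E n)) (f n)"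
    "\<And>n x y. t n \<ge> T0 \<Longrightarrow> f n (x,t n) = f n (y,t n) \<Longrightarrow> d x y \<le> 2 / t n"
    by metis
  have "filterlim (\<lambda>n. card (V n)) at_top sequentially"
  proof (rule card_level_unbounded[of t V T0 "\<lambda>n x. f n (x, t n)"])
    show "filterlim t at_top sequentially" using t by (simp add: level_seq_def)
    show "finite (V n)" for n using VE(1)[of n] by (simp add: fin_graph_def)
    show "f n (x,t n) \<in> V n" for n x using VE(4)[of n] by (auto simp: quasi_isometry_def)
  qed (rule VE(5))
  then have "expander_graphs V E" unfolding expander_graphs_def using VE(1-3) c by blast
  then show ?thesis unfolding levels_form_expanders_def forms_expanders_def using VE(4) c A1(3) by blast
qed

end

section \<open>From expanders to the spectral gap\<close>

lemma sq_add3_le: "((a::real) + b + c)\<^sup>2 \<le> 3 * (a\<^sup>2 + b\<^sup>2 + c\<^sup>2)"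
proof -
  have "0 \<le> (a - b)\<^sup>2 + (b - c)\<^sup>2 + (a - c)\<^sup>2" by simp
  then show ?thesis by (simp add: power2_eq_square algebra_simps)
qed

lemma sq_add_le: "((a::real) + b)\<^sup>2 \<le> 2 * (a\<^sup>2 + b\<^sup>2)"
  using sq_add3_le[of "a" b 0] zero_le_power2[of "a - b"] by (simp add: power2_eq_square algebra_simps)

lemma abs_le_one_plus_sq: "\<bar>y\<bar> \<le> 1 + (y::real)\<^sup>2"
  using zero_le_power2[of "\<bar>y\<bar> - 1"] by (simp add: power2_eq_square algebra_simps)

lemma sq_le_of_abs_le: "\<bar>x\<bar> \<le> y \<Longrightarrow> x\<^sup>2 \<le> (y::real)\<^sup>2"
  by (metis abs_le_square_iff abs_of_nonneg abs_ge_zero order_trans)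

context coarse_group begin

lemma cont_borel: "continuous_on UNIV (F :: 'a \<Rightarrow> real) \<Longrightarrow> F \<in> borel_measurable borel"
  by (rule borel_measurable_continuous_onI)

lemma cont_integrable: "continuous_on UNIV F \<Longrightarrow> integrable \<mu> (F :: 'a \<Rightarrow> real)"
proof -
  assume F: "continuous_on UNIV F"
  have "bounded (F ` UNIV)" by (intro compact_imp_bounded compact_continuous_image cpt F)
  then obtain C where "\<forall>x. \<bar>F x\<bar> \<le> C" by (auto simp: bounded_iff)
  then show ?thesis using cont_borel[OF F] by (intro bounded_integrable) auto
qed

lemma indicator_integrable: "A \<in> sets borel \<Longrightarrow> integrable \<mu> (indicat_real A)"
  by (rule bounded_integrable[of _ 1]) (auto simp: indicator_def)

lemma cont_translate [continuous_intros]: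
  "continuous_on UNIV (F :: 'a \<Rightarrow> real) \<Longrightarrow> continuous_on UNIV (\<lambda>x. F (g \<otimes> x))"
  by (rule continuous_on_compose2[OF _ mult_cont]) auto

definition disp :: "('a \<Rightarrow> real) \<Rightarrow> 'a \<Rightarrow> real" where
  "disp F g = (\<integral>x. (F (g \<otimes> x) - F x)\<^sup>2 \<partial>\<mu>)"

text \<open>The constants do not depend on \<open>F\<close> or \<open>T\<close>, only the
  oscillation \<open>\<omega>\<close> does; it will be made small by going up the cone. The integral
  is bounded by sums over sample points through covering balls, and these sums are bounded by
  integrals again through small balls of bounded overlap.\<close>

lemma level_poincare:
  assumes \<epsilon>: "\<epsilon> > 0" and C: "C > 0" and L': "L' > 0" and A': "A' \<ge> 0" and S: "sym_gen S"
  shows "\<exists>K6 len c T0. c > 0 \<and> T0 \<ge> 1 \<and> K6 \<ge> 0 \<and> (\<forall>T (V :: nat set) E f F \<omega>. T \<ge> T0 \<longrightarrow> fin_graph V E \<longrightarrow>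
     (\<forall>v\<in>V. real (card (E `` {v})) \<le> C) \<longrightarrow> cheeger V E \<ge> ereal \<epsilon> \<longrightarrow>
     quasi_isometry L' A' (UNIV \<times> {T}) (W S) V (path_dist E) f \<longrightarrow> continuous_on UNIV F \<longrightarrow>
     (\<forall>x y. d x y \<le> c / T \<longrightarrow> \<bar>F x - F y\<bar> \<le> \<omega>) \<longrightarrow>
     (\<exists>m. (\<integral>x. (F x - m)\<^sup>2 \<partial>\<mu>) \<le> K6 * (\<omega>\<^sup>2 + (\<Sum>\<gamma>\<in>words S len. disp F \<gamma>))))"
proof -
  \<comment> \<open>Sample points of adjacent vertices have images at graph distance at most
    \<open>2 * A' + 1\<close>; the lower quasi-isometry bound adds \<open>A'\<close> and multiplies
    by \<open>L'\<close>.\<close>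
  define R1 where "R1 = L' * (3 * A' + 1)"
  obtain c len where c: "c \<ge> 0" "\<And>S T x y. sym_gen S \<Longrightarrow> T \<ge> 1 \<Longrightarrow> W S (x,T) (y,T) \<le> R1 \<Longrightarrow>
      \<exists>\<gamma>\<in>words S len. d (\<gamma> \<otimes> x) y \<le> c / T" by (rule bounded_W_words[of R1]) (rule that)
  define Wl where "Wl = words S len"
  have fW: "finite Wl" unfolding Wl_def using S by (intro words_finite) (auto simp: sym_gen_def)
  define nW where "nW = real (card Wl) + 1"
  have nW: "nW \<ge> 1" "card Wl \<le> nW" by (auto simp: nW_def)
  obtain K :: nat where K: "\<And>r. r > 0 \<Longrightarrow> M (\<Lambda>\<^sup>2 * (c + 1) * r) \<le> K * M r" using M_doubling by blast
  \<comment> \<open>Sample points within \<open>2 / T\<close> are at warped distance at most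
    \<open>2 * L\<close>, so their images are within \<open>2 * L * L' + A'\<close>, and the
    vertices within another \<open>2 * A'\<close>.\<close>
  define n0 where "n0 = nat \<lceil>3 * A' + 2 * L * L'\<rceil>"
  define K2 where "K2 = (\<Sum>i\<le>n0. C ^ i)"
  have K2: "K2 \<ge> 0" using C by (auto simp: K2_def intro!: sum_nonneg)
  define P where "P = 8 * C / \<epsilon>\<^sup>2"
  have P: "P \<ge> 0" using C by (simp add: P_def)
  \<comment> \<open>The largest scale, in units of \<open>1 / T\<close>, at which values of
    \<open>F\<close> are compared.\<close>
  define c' where "c' = max (c + 1) \<Lambda>"
  define K5 where "K5 = 3 * nW * (1 + 2 * C * P) * K * K2"
  have K5: "K5 \<ge> 0" unfolding K5_def using nW C P K2 by auto
  define K6 where "K6 = K5 * (1 + 6 * nW)"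
  have K6: "K6 \<ge> 0" using K5 nW by (auto simp: K6_def)
  define T0 where "T0 = max 1 (2 / r0)"
  have main: "\<exists>m. (\<integral>x. (F x - m)\<^sup>2 \<partial>\<mu>) \<le> K6 * (\<omega>\<^sup>2 + (\<Sum>\<gamma>\<in>Wl. disp F \<gamma>))"
    if T: "T \<ge> T0" and gr: "fin_graph V E" and deg: "\<forall>v\<in>V. real (card (E `` {v})) \<le> C" and ch: "cheeger V E \<ge> ereal \<epsilon>"
      and qi: "quasi_isometry L' A' (UNIV \<times> {T}) (W S) V (path_dist E) f" and F: "continuous_on UNIV F"
      and \<omega>: "\<And>x y. d x y \<le> c' / T \<Longrightarrow> \<bar>F x - F y\<bar> \<le> \<omega>" for T and V :: "nat set" and E f F \<omega>
  proof -
    have T1: "T \<ge> 1" "T > 0" "2 / T \<le> r0" using T cpos by (auto simp: T0_def field_simps)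
    have finV: "finite V" and EV: "E \<subseteq> V \<times> V" and sE: "sym E" using gr by (auto simp: fin_graph_def)
    have cn: "\<exists>n. (v,w) \<in> E ^^ n" if "v \<in> V" "w \<in> V" for v w using cheeger_connected[OF gr \<epsilon> ch that] .
    define q where "q = (\<lambda>x. f (x,T))"
    have qV: "q x \<in> V" for x using qi by (auto simp: quasi_isometry_def q_def)
    have qi1: "W S (x,T) (y,T) / L' - A' \<le> path_dist E (q x) (q y)" "path_dist E (q x) (q y) \<le> L' * W S (x,T) (y,T) + A'" for x y
      using qi by (auto simp: quasi_isometry_def q_def)
    have Wle: "W S (x,T) (y,T) \<le> L' * (r + A')" if "path_dist E (q x) (q y) \<le> r" for x y r
    proof -
      have "W S (x,T) (y,T) / L' \<le> r + A'" using qi1(1)[of x y] that by linarith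
      then show ?thesis using L' by (simp add: field_simps)
    qed
    have "\<exists>x. path_dist E v (q x) \<le> A'" if "v \<in> V" for v
      using qi that by (auto simp: quasi_isometry_def q_def)
    \<comment> \<open>A quasi-inverse: one sample point for every vertex.\<close>
    then obtain xv where xv: "\<And>v. v \<in> V \<Longrightarrow> path_dist E v (q (xv v)) \<le> A'" by metis
    have pc: "path_dist E v w = path_dist E w v" for v w by (rule path_dist_commute[OF sE])
    have ptri: "path_dist E u w \<le> path_dist E u v + path_dist E v w" if "u \<in> V" "v \<in> V" "w \<in> V" for u v w
      by (intro path_dist_triangle cn that)
    have edge: "\<exists>\<gamma>\<in>Wl. d (\<gamma> \<otimes> xv v) (xv w) \<le> c / T" if "(v,w) \<in> E" for v w
    proof -
      have vw: "v \<in> V" "w \<in> V" using that EV by auto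
      have "path_dist E v w \<le> 1" using path_dist_le[of v w 1 E] that by simp
      then have "path_dist E (q (xv v)) (q (xv w)) \<le> 2 * A' + 1"
        using ptri[of "q (xv v)" v "q (xv w)"] ptri[of v w "q (xv w)"] qV vw xv[of v] xv[of w] pc by fastforce
      from Wle[OF this] have "W S (xv v,T) (xv w,T) \<le> R1" by (simp add: R1_def algebra_simps)
      from c(2)[OF S T1(1) this] show ?thesis by (simp add: Wl_def)
    qed
    \<comment> \<open>Every point is at bounded warped distance from the sample point of its own
      vertex, hence close to a translate of it by a word from \<open>Wl\<close>.\<close>
    have cover: "\<exists>v\<in>V. \<exists>\<gamma>\<in>Wl. d (\<gamma> \<otimes> xv v) x < (c + 1) / T" for x
    proof -
      define v where "v = q x"
      have "path_dist E (q (xv v)) (q x) \<le> A'" using xv[of v] qV pc by (simp add: v_def)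
      from Wle[OF this] have "W S (xv v,T) (x,T) \<le> L' * (A' + A')" .
      also have "\<dots> \<le> R1" unfolding R1_def using L' A' by (intro mult_left_mono) auto
      finally obtain \<gamma> where \<gamma>: "\<gamma> \<in> Wl" "d (\<gamma> \<otimes> xv v) x \<le> c / T" using c(2)[OF S T1(1)] by (auto simp: Wl_def)
      moreover have "c / T < (c + 1) / T" using T1 by (intro divide_strict_right_mono) auto
      ultimately show ?thesis using qV v_def by (intro bexI[of _ v] bexI[of _ \<gamma>]) auto
    qed
    \<comment> \<open>Bounded overlap: vertices whose sample points are near a common
      \<open>y\<close> lie in a graph ball of radius \<open>n0\<close>, whose size is bounded by the
      degree.\<close>
    have mult: "real (card {v\<in>V. d (xv v) y < 1 / T}) \<le> K2" for y
    proof (cases "{v\<in>V. d (xv v) y < 1 / T} = {}")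
      case True then show ?thesis using K2 by (simp only: True card.empty of_nat_0)
    next
      case False
      then obtain v where v: "v \<in> V" "d (xv v) y < 1 / T" by blast
      have "{v\<in>V. d (xv v) y < 1 / T} \<subseteq> (\<Union>i\<in>{..n0}. (E ^^ i) `` {v})"
      proof clarify
        fix w assume w: "w \<in> V" "d (xv w) y < 1 / T"
        have "d (xv v) (xv w) \<le> 2 / T" using d_triangle[of "xv v" "xv w" y] v w d_commute[of y "xv w"] by simp
        then have "W S (xv v,T) (xv w,T) \<le> L * T * d (xv v) (xv w)" using T1 by (intro W_level_near) auto
        also have "\<dots> \<le> L * T * (2 / T)" using \<open>d (xv v) (xv w) \<le> 2 / T\<close> cpos T1 by (intro mult_left_mono) auto
        finally have "W S (xv v,T) (xv w,T) \<le> 2 * L" using T1 by simp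
        then have "L' * W S (xv v,T) (xv w,T) \<le> L' * (2 * L)" using L' by (intro mult_left_mono) auto
        then have "path_dist E (q (xv v)) (q (xv w)) \<le> 2 * L * L' + A'" using qi1(2)[of "xv v" "xv w"] by (simp add: mult_ac)
        then have le: "path_dist E v w \<le> 3 * A' + 2 * L * L'"
          using ptri[of v "q (xv v)" w] ptri[of "q (xv v)" "q (xv w)" w] qV v w xv[of v] xv[of w] pc by fastforce
        obtain n where n: "(v,w) \<in> E ^^ n" "path_dist E v w = n" using path_distE[OF cn[OF v(1) w(1)]] .
        have "n \<le> n0" using le n(2) unfolding n0_def by linarith
        then show "w \<in> (\<Union>i\<in>{..n0}. (E ^^ i) `` {v})" using n by auto
      qed
      then have "card {v\<in>V. d (xv v) y < 1 / T} \<le> card (\<Union>i\<in>{..n0}. (E ^^ i) `` {v})"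
      proof (rule card_mono[rotated])
        have "(E ^^ i) `` {v} \<subseteq> V" for i by (induction i) (use EV v in auto)
        then show "finite (\<Union>i\<in>{..n0}. (E ^^ i) `` {v})" using finV finite_subset by blast
      qed
      also have "\<dots> \<le> (\<Sum>i\<le>n0. card ((E ^^ i) `` {v}))" by (rule card_UN_le) simp
      finally have "real (card {v\<in>V. d (xv v) y < 1 / T}) \<le> (\<Sum>i\<le>n0. real (card ((E ^^ i) `` {v})))"
        unfolding of_nat_sum[symmetric] by (rule of_nat_mono)
      also have "\<dots> \<le> K2" unfolding K2_def using card_relpow_le[of V E C v] deg EV finV v C by (intro sum_mono) auto
      finally show ?thesis .
    qed
    define a where "a = (\<lambda>v. F (xv v))"
    define e where "e = (\<lambda>\<gamma> x. (F (\<gamma> \<otimes> x) - F x)\<^sup>2)"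
    have e0: "e \<gamma> x \<ge> 0" for \<gamma> x by (simp add: e_def)
    \<comment> \<open>A quantity at \<open>v\<close> alone that controls the difference of
      \<open>a\<close> along every edge leaving \<open>v\<close>.\<close>
    define h where "h = (\<lambda>v. \<omega>\<^sup>2 + (\<Sum>\<gamma>\<in>Wl. e \<gamma> (xv v)))"
    have h0: "h v \<ge> 0" for v using e0 by (auto simp: h_def intro!: add_nonneg_nonneg sum_nonneg)
    have cc': "c / T \<le> c' / T" "(c + 1) / T \<le> c' / T" "\<Lambda> / T \<le> c' / T" "1 / T \<le> c' / T"
      using T1 cpos c(1) by (auto simp: c'_def intro!: divide_right_mono)
    have eedge: "(a v - a w)\<^sup>2 \<le> 2 * h v" if vw: "(v,w) \<in> E" for v w
    proof -
      obtain \<gamma> where \<gamma>: "\<gamma> \<in> Wl" "d (\<gamma> \<otimes> xv v) (xv w) \<le> c / T" using edge[OF vw] by blast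
      have "\<bar>F (\<gamma> \<otimes> xv v) - F (xv w)\<bar> \<le> \<omega>" using \<gamma> cc' by (intro \<omega>) linarith
      then have "(F (\<gamma> \<otimes> xv v) - F (xv w))\<^sup>2 \<le> \<omega>\<^sup>2" by (rule sq_le_of_abs_le)
      moreover have "(a v - a w)\<^sup>2 \<le> 2 * ((F (xv v) - F (\<gamma> \<otimes> xv v))\<^sup>2 + (F (\<gamma> \<otimes> xv v) - F (xv w))\<^sup>2)"
        using sq_add_le[of "F (xv v) - F (\<gamma> \<otimes> xv v)" "F (\<gamma> \<otimes> xv v) - F (xv w)"] by (simp add: a_def)
      moreover have "(F (xv v) - F (\<gamma> \<otimes> xv v))\<^sup>2 = e \<gamma> (xv v)" by (simp add: e_def power2_commute)
      moreover have "e \<gamma> (xv v) \<le> (\<Sum>\<gamma>\<in>Wl. e \<gamma> (xv v))" using \<gamma> fW e0 by (intro member_le_sum) auto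
      ultimately show ?thesis by (simp add: h_def)
    qed
    obtain m where m: "(\<Sum>v\<in>V. (a v - m)\<^sup>2) \<le> P * (\<Sum>(v,w)\<in>E. (a v - a w)\<^sup>2)"
      using graph_poincare[OF finV EV sE \<epsilon> C _ ch, of a] deg unfolding P_def by auto
    have "(\<Sum>(v,w)\<in>E. (a v - a w)\<^sup>2) \<le> (\<Sum>(v,w)\<in>E. 2 * h v)" using eedge by (intro sum_mono) auto
    also have "\<dots> \<le> C * (\<Sum>v\<in>V. 2 * h v)" using deg h0 by (intro sum_edges_fst_le finV EV) auto
    also have "\<dots> = 2 * C * (\<Sum>v\<in>V. h v)" by (simp add: sum_distrib_left[symmetric])
    finally have "P * (\<Sum>(v,w)\<in>E. (a v - a w)\<^sup>2) \<le> P * (2 * C * (\<Sum>v\<in>V. h v))" using P by (rule mult_left_mono)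
    then have m2: "(\<Sum>v\<in>V. (a v - m)\<^sup>2) \<le> 2 * C * P * (\<Sum>v\<in>V. h v)" using m by (simp add: mult_ac)
    define b where "b = M (\<Lambda> * ((c + 1) / T))"
    define b1 where "b1 = M (1 / T / \<Lambda>)"
    have b0: "b \<ge> 0" "b1 \<ge> 0" by (auto simp: b_def b1_def M_def)
    have bK: "b \<le> K * b1"
    proof -
      have "\<Lambda> * ((c + 1) / T) = \<Lambda>\<^sup>2 * (c + 1) * (1 / T / \<Lambda>)" using cpos by (simp add: power2_eq_square)
      then show ?thesis unfolding b_def b1_def using K[of "1 / T / \<Lambda>"] T1 cpos by simp
    qed
    define Bv where "Bv = (\<lambda>v \<gamma>. {x. d (\<gamma> \<otimes> xv v) x < (c + 1) / T})"
    define u where "u = (\<lambda>v \<gamma>. 3 * (\<omega>\<^sup>2 + e \<gamma> (xv v) + (a v - m)\<^sup>2))"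
    have u0: "u v \<gamma> \<ge> 0" for v \<gamma> using e0 by (simp add: u_def)
    \<comment> \<open>One covering ball containing \<open>x\<close> already gives the bound; the
      other summands are nonnegative.\<close>
    have pw: "(F x - m)\<^sup>2 \<le> (\<Sum>v\<in>V. \<Sum>\<gamma>\<in>Wl. indicator (Bv v \<gamma>) x * u v \<gamma>)" for x
    proof -
      obtain v \<gamma> where v: "v \<in> V" "\<gamma> \<in> Wl" "d (\<gamma> \<otimes> xv v) x < (c + 1) / T" using cover by blast
      have "\<bar>F x - F (\<gamma> \<otimes> xv v)\<bar> \<le> \<omega>" using v cc' \<omega>[of "\<gamma> \<otimes> xv v" x] by (simp add: abs_minus_commute)
      then have "(F x - F (\<gamma> \<otimes> xv v))\<^sup>2 \<le> \<omega>\<^sup>2" by (rule sq_le_of_abs_le)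
      moreover have "(F x - m)\<^sup>2 \<le> 3 * ((F x - F (\<gamma> \<otimes> xv v))\<^sup>2 + (F (\<gamma> \<otimes> xv v) - F (xv v))\<^sup>2 + (F (xv v) - m)\<^sup>2)"
        using sq_add3_le[of "F x - F (\<gamma> \<otimes> xv v)" "F (\<gamma> \<otimes> xv v) - F (xv v)" "F (xv v) - m"] by simp
      ultimately have "(F x - m)\<^sup>2 \<le> u v \<gamma>" by (simp add: u_def e_def a_def)
      also have "\<dots> = indicator (Bv v \<gamma>) x * u v \<gamma>" using v by (simp add: Bv_def)
      also have "\<dots> \<le> (\<Sum>\<gamma>\<in>Wl. indicator (Bv v \<gamma>) x * u v \<gamma>)"
        using v fW u0 by (intro member_le_sum) auto
      also have "\<dots> \<le> (\<Sum>v\<in>V. \<Sum>\<gamma>\<in>Wl. indicator (Bv v \<gamma>) x * u v \<gamma>)"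
        using v finV u0 by (intro member_le_sum[of v V "\<lambda>v. \<Sum>\<gamma>\<in>Wl. indicator (Bv v \<gamma>) x * u v \<gamma>"]) (auto intro!: sum_nonneg)
      finally show ?thesis .
    qed
    have Bint: "integrable \<mu> (\<lambda>x. indicator (Bv v \<gamma>) x * u v \<gamma>)" for v \<gamma>
      using ball_sets by (intro integrable_mult_left indicator_integrable) (auto simp: Bv_def)
    have Fint: "integrable \<mu> (\<lambda>x. (F x - m)\<^sup>2)" by (intro cont_integrable continuous_intros F)
    have Sint: "integrable \<mu> (\<lambda>x. \<Sum>\<gamma>\<in>Wl. indicator (Bv v \<gamma>) x * u v \<gamma>)" for v
      by (rule Bochner_Integration.integrable_sum) (rule Bint)
    have "(\<integral>x. (F x - m)\<^sup>2 \<partial>\<mu>) \<le> (\<integral>x. (\<Sum>v\<in>V. \<Sum>\<gamma>\<in>Wl. indicator (Bv v \<gamma>) x * u v \<gamma>) \<partial>\<mu>)"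
      by (rule integral_mono[OF Fint _ pw]) (rule Bochner_Integration.integrable_sum, rule Sint)
    also have "\<dots> = (\<Sum>v\<in>V. \<integral>x. (\<Sum>\<gamma>\<in>Wl. indicator (Bv v \<gamma>) x * u v \<gamma>) \<partial>\<mu>)"
      by (rule Bochner_Integration.integral_sum) (rule Sint)
    also have "\<dots> = (\<Sum>v\<in>V. \<Sum>\<gamma>\<in>Wl. \<integral>x. indicator (Bv v \<gamma>) x * u v \<gamma> \<partial>\<mu>)"
      by (intro sum.cong refl Bochner_Integration.integral_sum Bint)
    also have "\<dots> = (\<Sum>v\<in>V. \<Sum>\<gamma>\<in>Wl. measure \<mu> (Bv v \<gamma>) * u v \<gamma>)"
      using ball_sets by (intro sum.cong refl) (simp add: Bv_def)
    also have "\<dots> \<le> (\<Sum>v\<in>V. \<Sum>\<gamma>\<in>Wl. b * u v \<gamma>)"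
      unfolding Bv_def b_def by (intro sum_mono mult_right_mono ball_upper u0)
    also have "\<dots> \<le> (\<Sum>v\<in>V. b * (3 * nW * (h v + (a v - m)\<^sup>2)))"
    proof (rule sum_mono)
      fix v
      have "(\<Sum>\<gamma>\<in>Wl. u v \<gamma>) = 3 * (card Wl * \<omega>\<^sup>2 + (\<Sum>\<gamma>\<in>Wl. e \<gamma> (xv v)) + card Wl * (a v - m)\<^sup>2)"
        by (simp add: u_def sum_distrib_left[symmetric] sum.distrib)
      also have "\<dots> \<le> 3 * (nW * \<omega>\<^sup>2 + nW * (\<Sum>\<gamma>\<in>Wl. e \<gamma> (xv v)) + nW * (a v - m)\<^sup>2)"
      proof -
        have "1 * (\<Sum>\<gamma>\<in>Wl. e \<gamma> (xv v)) \<le> nW * (\<Sum>\<gamma>\<in>Wl. e \<gamma> (xv v))"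
          using nW e0 by (intro mult_right_mono sum_nonneg) auto
        moreover have "card Wl * \<omega>\<^sup>2 \<le> nW * \<omega>\<^sup>2" "card Wl * (a v - m)\<^sup>2 \<le> nW * (a v - m)\<^sup>2"
          using nW by (auto intro!: mult_right_mono)
        ultimately show ?thesis by (intro mult_left_mono add_mono) auto
      qed
      also have "\<dots> = 3 * nW * (h v + (a v - m)\<^sup>2)" by (simp add: h_def algebra_simps)
      finally show "(\<Sum>\<gamma>\<in>Wl. b * u v \<gamma>) \<le> b * (3 * nW * (h v + (a v - m)\<^sup>2))"
        unfolding sum_distrib_left[symmetric] using b0 by (intro mult_left_mono) auto
    qed
    also have "\<dots> = b * (3 * nW * ((\<Sum>v\<in>V. h v) + (\<Sum>v\<in>V. (a v - m)\<^sup>2)))"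
      by (simp add: sum_distrib_left[symmetric] sum.distrib)
    also have "\<dots> \<le> b * (3 * nW * ((\<Sum>v\<in>V. h v) + 2 * C * P * (\<Sum>v\<in>V. h v)))"
      using b0 nW m2 by (intro mult_left_mono add_left_mono) auto
    also have "\<dots> = 3 * nW * (1 + 2 * C * P) * (b * (\<Sum>v\<in>V. h v))" by (simp add: algebra_simps)
    also have "\<dots> \<le> 3 * nW * (1 + 2 * C * P) * (K * b1 * (\<Sum>v\<in>V. h v))"
      using nW C P bK h0 by (intro mult_left_mono mult_right_mono sum_nonneg) auto
    also have "\<dots> = 3 * nW * (1 + 2 * C * P) * K * (\<Sum>v\<in>V. b1 * h v)" by (simp add: sum_distrib_left mult_ac)
    finally have I1: "(\<integral>x. (F x - m)\<^sup>2 \<partial>\<mu>) \<le> 3 * nW * (1 + 2 * C * P) * K * (\<Sum>v\<in>V. b1 * h v)" .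
    \<comment> \<open>A continuous majorant: it dominates \<open>h v\<close> throughout the ball of
      radius \<open>1 / T\<close> about the sample point of \<open>v\<close>, where comparing
      \<open>xv v\<close> with \<open>y\<close> costs \<open>6 * \<omega>\<^sup>2\<close> for each
      word.\<close>
    define H where "H = (\<lambda>y. (1 + 6 * nW) * \<omega>\<^sup>2 + 3 * (\<Sum>\<gamma>\<in>Wl. e \<gamma> y))"
    have H0: "H y \<ge> 0" for y using nW e0 by (auto simp: H_def intro!: add_nonneg_nonneg mult_nonneg_nonneg sum_nonneg)
    have ec: "continuous_on UNIV (e \<gamma>)" for \<gamma> unfolding e_def by (intro continuous_intros F)
    have Hc: "continuous_on UNIV H" unfolding H_def by (intro continuous_intros ec)
    have hH: "h v \<le> H y" if y: "d (xv v) y < 1 / T" for v y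
    proof -
      have "e \<gamma> (xv v) \<le> 3 * e \<gamma> y + 6 * \<omega>\<^sup>2" for \<gamma>
      proof -
        have "d (\<gamma> \<otimes> xv v) (\<gamma> \<otimes> y) \<le> \<Lambda> * d (xv v) y" by (rule lip)
        also have "\<dots> \<le> \<Lambda> * (1 / T)" using y cpos by (intro mult_left_mono) auto
        finally have "\<bar>F (\<gamma> \<otimes> xv v) - F (\<gamma> \<otimes> y)\<bar> \<le> \<omega>" using cc' by (intro \<omega>) simp
        then have 1: "(F (\<gamma> \<otimes> xv v) - F (\<gamma> \<otimes> y))\<^sup>2 \<le> \<omega>\<^sup>2" by (rule sq_le_of_abs_le)
        have "\<bar>F y - F (xv v)\<bar> \<le> \<omega>" using \<omega>[of y "xv v"] y cc' d_commute[of y] by simp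
        then have 2: "(F y - F (xv v))\<^sup>2 \<le> \<omega>\<^sup>2" by (rule sq_le_of_abs_le)
        have "e \<gamma> (xv v) \<le> 3 * ((F (\<gamma> \<otimes> xv v) - F (\<gamma> \<otimes> y))\<^sup>2 + (F (\<gamma> \<otimes> y) - F y)\<^sup>2 + (F y - F (xv v))\<^sup>2)"
          using sq_add3_le[of "F (\<gamma> \<otimes> xv v) - F (\<gamma> \<otimes> y)" "F (\<gamma> \<otimes> y) - F y" "F y - F (xv v)"] by (simp add: e_def)
        then show ?thesis using 1 2 by (simp add: e_def)
      qed
      then have "(\<Sum>\<gamma>\<in>Wl. e \<gamma> (xv v)) \<le> (\<Sum>\<gamma>\<in>Wl. 3 * e \<gamma> y + 6 * \<omega>\<^sup>2)" by (intro sum_mono)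
      also have "\<dots> = 3 * (\<Sum>\<gamma>\<in>Wl. e \<gamma> y) + card Wl * (6 * \<omega>\<^sup>2)" by (simp add: sum.distrib sum_distrib_left)
      also have "\<dots> \<le> 3 * (\<Sum>\<gamma>\<in>Wl. e \<gamma> y) + nW * (6 * \<omega>\<^sup>2)" using nW by (intro add_left_mono mult_right_mono) auto
      finally show ?thesis by (simp add: h_def H_def algebra_simps)
    qed
    define Dv where "Dv = (\<lambda>v. {y. d (xv v) y < 1 / T})"
    have DvH: "integrable \<mu> (\<lambda>y. indicator (Dv v) y * H y)" for v
      using integrable_mult_indicator[OF _ cont_integrable[OF Hc], of "Dv v"] ball_sets by (simp add: Dv_def)
    have "(\<Sum>v\<in>V. b1 * h v) \<le> (\<Sum>v\<in>V. \<integral>y. indicator (Dv v) y * H y \<partial>\<mu>)"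
    proof (rule sum_mono)
      fix v
      have "b1 * h v \<le> measure \<mu> (Dv v) * h v" unfolding b1_def Dv_def by (intro mult_right_mono ball_lower h0)
      also have "\<dots> = (\<integral>y. indicator (Dv v) y * h v \<partial>\<mu>)" using ball_sets by (simp add: Dv_def)
      also have "\<dots> \<le> (\<integral>y. indicator (Dv v) y * H y \<partial>\<mu>)"
        using ball_sets hH by (intro integral_mono DvH integrable_mult_left indicator_integrable)
          (auto simp: Dv_def split: split_indicator)
      finally show "b1 * h v \<le> (\<integral>y. indicator (Dv v) y * H y \<partial>\<mu>)" .
    qed
    also have "\<dots> = (\<integral>y. (\<Sum>v\<in>V. indicator (Dv v) y * H y) \<partial>\<mu>)"
      by (rule Bochner_Integration.integral_sum[symmetric]) (rule DvH)
    also have "\<dots> \<le> (\<integral>y. K2 * H y \<partial>\<mu>)"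
    proof (rule integral_mono)
      show "integrable \<mu> (\<lambda>y. \<Sum>v\<in>V. indicator (Dv v) y * H y)" by (intro Bochner_Integration.integrable_sum DvH)
      show "integrable \<mu> (\<lambda>y. K2 * H y)" by (intro integrable_mult_right cont_integrable Hc)
      fix y
      have "(\<Sum>v\<in>V. indicator (Dv v) y * H y) = card {v\<in>V. d (xv v) y < 1 / T} * H y"
        unfolding sum_distrib_right[symmetric] using finV by (simp add: indicator_def Dv_def sum.If_cases Int_def)
      also have "\<dots> \<le> K2 * H y" using mult H0 by (intro mult_right_mono)
      finally show "(\<Sum>v\<in>V. indicator (Dv v) y * H y) \<le> K2 * H y" .
    qed
    also have "\<dots> = K2 * ((1 + 6 * nW) * \<omega>\<^sup>2 + 3 * (\<Sum>\<gamma>\<in>Wl. disp F \<gamma>))"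
      using cont_integrable[OF ec] by (simp add: H_def disp_def e_def)
    also have "\<dots> \<le> K2 * ((1 + 6 * nW) * \<omega>\<^sup>2 + (1 + 6 * nW) * (\<Sum>\<gamma>\<in>Wl. disp F \<gamma>))"
      using K2 nW by (intro mult_left_mono add_left_mono mult_right_mono sum_nonneg) (auto simp: disp_def)
    finally have I2: "(\<Sum>v\<in>V. b1 * h v) \<le> K2 * ((1 + 6 * nW) * \<omega>\<^sup>2 + (1 + 6 * nW) * (\<Sum>\<gamma>\<in>Wl. disp F \<gamma>))" .
    have "0 \<le> 3 * nW * (1 + 2 * C * P) * K" using nW C P by auto
    from mult_left_mono[OF I2 this] I1
    have "(\<integral>x. (F x - m)\<^sup>2 \<partial>\<mu>) \<le> 3 * nW * (1 + 2 * C * P) * K * (K2 * ((1 + 6 * nW) * \<omega>\<^sup>2 + (1 + 6 * nW) * (\<Sum>\<gamma>\<in>Wl. disp F \<gamma>)))"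
      by linarith
    also have "\<dots> = K6 * (\<omega>\<^sup>2 + (\<Sum>\<gamma>\<in>Wl. disp F \<gamma>))" by (simp add: K6_def K5_def algebra_simps)
    finally show ?thesis by blast
  qed
  have "c' > 0" "T0 \<ge> 1" using cpos by (auto simp: c'_def T0_def)
  then show ?thesis using K6
    by - (rule exI[of _ K6], rule exI[of _ len], rule exI[of _ c'], rule exI[of _ T0], intro conjI allI impI,
      assumption+, rule main[unfolded Wl_def], auto)
qed

lemma disp_mult:
  assumes F: "continuous_on UNIV F"
  shows "disp F (s \<otimes> g) \<le> 2 * disp F s + 2 * disp F g"
proof -
  have c: "continuous_on UNIV (\<lambda>x. (F (s \<otimes> x) - F x)\<^sup>2)" for s by (intro continuous_intros F)
  have "disp F (s \<otimes> g) \<le> (\<integral>x. 2 * (F (s \<otimes> (g \<otimes> x)) - F (g \<otimes> x))\<^sup>2 + 2 * (F (g \<otimes> x) - F x)\<^sup>2 \<partial>\<mu>)"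
    unfolding disp_def
  proof (rule integral_mono)
    show "integrable \<mu> (\<lambda>x. (F (s \<otimes> g \<otimes> x) - F x)\<^sup>2)" by (intro cont_integrable c)
    show "integrable \<mu> (\<lambda>x. 2 * (F (s \<otimes> (g \<otimes> x)) - F (g \<otimes> x))\<^sup>2 + 2 * (F (g \<otimes> x) - F x)\<^sup>2)"
      by (intro cont_integrable continuous_on_add continuous_on_mult continuous_on_const c cont_translate[OF c])
    show "(F (s \<otimes> g \<otimes> x) - F x)\<^sup>2 \<le> 2 * (F (s \<otimes> (g \<otimes> x)) - F (g \<otimes> x))\<^sup>2 + 2 * (F (g \<otimes> x) - F x)\<^sup>2" for x
      using sq_add_le[of "F (s \<otimes> (g \<otimes> x)) - F (g \<otimes> x)" "F (g \<otimes> x) - F x"] by (simp add: m_assoc)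
  qed
  also have "\<dots> = 2 * (\<integral>x. (F (s \<otimes> (g \<otimes> x)) - F (g \<otimes> x))\<^sup>2 \<partial>\<mu>) + 2 * disp F g"
    using cont_integrable[OF c] cont_integrable[OF cont_translate[OF c, of s g]] by (simp add: disp_def)
  also have "(\<integral>x. (F (s \<otimes> (g \<otimes> x)) - F (g \<otimes> x))\<^sup>2 \<partial>\<mu>) = disp F s"
    unfolding disp_def by (rule integral_translate[OF cont_borel[OF c]])
  finally show ?thesis .
qed

lemma disp_nonneg: "disp F g \<ge> 0" by (simp add: disp_def)

text \<open>Each letter costs a factor 2 from squaring the triangle inequality; 4 leaves room for
  the letter's own displacement.\<close>

lemma disp_words:
  assumes F: "continuous_on UNIV F" and S: "finite S" and g: "g \<in> words S n"
  shows "disp F g \<le> 4 ^ n * (\<Sum>s\<in>S. disp F s)"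
  using g
proof (induction n arbitrary: g)
  case 0
  then show ?case using disp_nonneg by (auto simp: disp_def intro!: sum_nonneg)
next
  case (Suc n)
  define X where "X = (\<Sum>s\<in>S. disp F s)"
  have X0: "X \<ge> 0" using disp_nonneg by (auto simp: X_def intro!: sum_nonneg)
  obtain s w where sw: "s \<in> S" "w \<in> words S n" "g = s \<otimes> w" using Suc.prems by auto
  have "disp F g \<le> 2 * disp F s + 2 * disp F w" using disp_mult[OF F] sw by simp
  also have "disp F s \<le> X" unfolding X_def using sw S disp_nonneg by (intro member_le_sum) auto
  also have "disp F w \<le> 4 ^ n * X" using Suc.IH[OF sw(2)] by (simp add: X_def)
  also have "2 * X + 2 * (4 ^ n * X) \<le> 4 ^ Suc n * X"
  proof -
    have "1 * X \<le> 4 ^ n * X" using X0 by (intro mult_right_mono) auto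
    then show ?thesis by (simp add: algebra_simps)
  qed
  finally show ?case by (simp add: X_def)
qed

section \<open>Square-integrable functions and density of continuous functions\<close>

definition sqint :: "('a \<Rightarrow> real) \<Rightarrow> bool" where
  "sqint f \<longleftrightarrow> f \<in> borel_measurable borel \<and> integrable \<mu> (\<lambda>x. (f x)\<^sup>2)"

lemma sqint_integrable: assumes "sqint f" shows "integrable \<mu> f"
proof (rule Bochner_Integration.integrable_bound)
  show "integrable \<mu> (\<lambda>x. 1 + (f x)\<^sup>2)" using assms by (auto simp: sqint_def)
  show "AE x in \<mu>. norm (f x) \<le> norm (1 + (f x)\<^sup>2)" using abs_le_one_plus_sq by simp
qed (use assms in \<open>simp add: sqint_def\<close>)

lemma sqint_add: assumes "sqint f" "sqint g" shows "sqint (\<lambda>x. f x + g x)"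
  unfolding sqint_def
proof
  show "(\<lambda>x. f x + g x) \<in> borel_measurable borel" using assms by (auto simp: sqint_def)
  show "integrable \<mu> (\<lambda>x. (f x + g x)\<^sup>2)"
  proof (rule Bochner_Integration.integrable_bound)
    show "integrable \<mu> (\<lambda>x. 2 * ((f x)\<^sup>2 + (g x)\<^sup>2))" using assms by (auto simp: sqint_def)
    show "AE x in \<mu>. norm ((f x + g x)\<^sup>2) \<le> norm (2 * ((f x)\<^sup>2 + (g x)\<^sup>2))" using sq_add_le by simp
  qed (use assms in \<open>auto simp: sqint_def\<close>)
qed

lemma sqint_scale: "sqint f \<Longrightarrow> sqint (\<lambda>x. c * f x)"
  by (auto simp: sqint_def power_mult_distrib)

lemma sqint_diff: "sqint f \<Longrightarrow> sqint g \<Longrightarrow> sqint (\<lambda>x. f x - g x)"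
  using sqint_add[OF _ sqint_scale[of g "-1"], of f] by simp

lemma sqint_cont: "continuous_on UNIV F \<Longrightarrow> sqint F"
  unfolding sqint_def by (intro conjI cont_borel cont_integrable continuous_intros)

lemma sqint_translate:
  assumes "sqint f" shows "sqint (\<lambda>x. f (g \<otimes> x))" "(\<integral>x. (f (g \<otimes> x))\<^sup>2 \<partial>\<mu>) = (\<integral>x. (f x)\<^sup>2 \<partial>\<mu>)"
proof -
  have m: "f \<in> borel_measurable borel" using assms by (simp add: sqint_def)
  have "(\<lambda>x. f (g \<otimes> x)) \<in> borel_measurable borel" using measurable_compose[OF mult_measurable m] .
  moreover have "integrable \<mu> (\<lambda>x. (f (g \<otimes> x))\<^sup>2)"
  proof -
    have "integrable (distr \<mu> \<mu> (\<lambda>x. g \<otimes> x)) (\<lambda>x. (f x)\<^sup>2)" using assms by (simp add: mu_invariant sqint_def)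
    then show ?thesis by (subst (asm) integrable_distr_eq) (use m mult_measurable_mu in auto)
  qed
  ultimately show "sqint (\<lambda>x. f (g \<otimes> x))" by (simp add: sqint_def)
  show "(\<integral>x. (f (g \<otimes> x))\<^sup>2 \<partial>\<mu>) = (\<integral>x. (f x)\<^sup>2 \<partial>\<mu>)"
    by (rule integral_translate[where F = "\<lambda>x. (f x)\<^sup>2"]) (use m in auto)
qed

lemma sqint_sq_add:
  assumes "sqint f" "sqint g"
  shows "(\<integral>x. (f x + g x)\<^sup>2 \<partial>\<mu>) \<le> 2 * (\<integral>x. (f x)\<^sup>2 \<partial>\<mu>) + 2 * (\<integral>x. (g x)\<^sup>2 \<partial>\<mu>)"
proof -
  have "(\<integral>x. (f x + g x)\<^sup>2 \<partial>\<mu>) \<le> (\<integral>x. 2 * ((f x)\<^sup>2 + (g x)\<^sup>2) \<partial>\<mu>)"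
    using assms sqint_add[OF assms] sq_add_le by (intro integral_mono) (auto simp: sqint_def)
  also have "\<dots> = 2 * (\<integral>x. (f x)\<^sup>2 \<partial>\<mu>) + 2 * (\<integral>x. (g x)\<^sup>2 \<partial>\<mu>)" using assms by (simp add: sqint_def)
  finally show ?thesis .
qed

lemma variance_minimal:
  assumes "sqint f" "(\<integral>x. f x \<partial>\<mu>) = 0"
  shows "(\<integral>x. (f x)\<^sup>2 \<partial>\<mu>) \<le> (\<integral>x. (f x - m)\<^sup>2 \<partial>\<mu>)"
proof -
  have "(f x - m)\<^sup>2 = (f x)\<^sup>2 - 2 * m * f x + m\<^sup>2" for x by (simp add: power2_eq_square algebra_simps)
  then have "(\<integral>x. (f x - m)\<^sup>2 \<partial>\<mu>) = (\<integral>x. (f x)\<^sup>2 \<partial>\<mu>) + m\<^sup>2"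
    using assms sqint_integrable[OF assms(1)] by (simp add: sqint_def)
  then show ?thesis by simp
qed

text \<open>Density is proved in \<open>L^1\<close> first, where the class is closed under dominated
  limits and integrable functions can be treated by induction; truncation then gives
  \<open>L^2\<close>.\<close>

definition L1approx :: "('a \<Rightarrow> real) \<Rightarrow> bool" where
  "L1approx f \<longleftrightarrow> integrable \<mu> f \<and> (\<forall>\<eta>>0. \<exists>F. continuous_on UNIV F \<and> (\<integral>x. \<bar>f x - F x\<bar> \<partial>\<mu>) < \<eta>)"

lemma L1approx_cont: "continuous_on UNIV F \<Longrightarrow> L1approx F"
  unfolding L1approx_def by (auto intro!: cont_integrable exI[of _ F])

lemma L1approx_add: assumes "L1approx f" "L1approx g" shows "L1approx (\<lambda>x. f x + g x)"
  unfolding L1approx_def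
proof (intro conjI allI impI)
  have i: "integrable \<mu> f" "integrable \<mu> g" using assms by (auto simp: L1approx_def)
  then show "integrable \<mu> (\<lambda>x. f x + g x)" by auto
  fix \<eta> :: real assume "\<eta> > 0"
  then have e2: "\<eta> / 2 > 0" by simp
  obtain F H where F: "continuous_on UNIV F" "(\<integral>x. \<bar>f x - F x\<bar> \<partial>\<mu>) < \<eta> / 2"
    and H: "continuous_on UNIV H" "(\<integral>x. \<bar>g x - H x\<bar> \<partial>\<mu>) < \<eta> / 2"
    using assms e2 unfolding L1approx_def by metis
  have FH: "integrable \<mu> (\<lambda>x. \<bar>f x - F x\<bar>)" "integrable \<mu> (\<lambda>x. \<bar>g x - H x\<bar>)"
    using i cont_integrable F(1) H(1) by auto
  have "(\<integral>x. \<bar>f x + g x - (F x + H x)\<bar> \<partial>\<mu>) \<le> (\<integral>x. \<bar>f x - F x\<bar> + \<bar>g x - H x\<bar> \<partial>\<mu>)"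
    using i FH cont_integrable[OF F(1)] cont_integrable[OF H(1)] by (intro integral_mono) auto
  also have "\<dots> < \<eta>" using FH F H by simp
  finally show "\<exists>F. continuous_on UNIV F \<and> (\<integral>x. \<bar>f x + g x - F x\<bar> \<partial>\<mu>) < \<eta>"
    using F H by (intro exI[of _ "\<lambda>x. F x + H x"]) (auto intro: continuous_on_add)
qed

lemma L1approx_scale: assumes "L1approx f" shows "L1approx (\<lambda>x. c * f x)"
  unfolding L1approx_def
proof (intro conjI allI impI)
  have i: "integrable \<mu> f" using assms by (auto simp: L1approx_def)
  then show "integrable \<mu> (\<lambda>x. c * f x)" by auto
  fix \<eta> :: real assume e: "\<eta> > 0"
  then have e2: "\<eta> / (\<bar>c\<bar> + 1) > 0" by simp
  obtain F where F: "continuous_on UNIV F" "(\<integral>x. \<bar>f x - F x\<bar> \<partial>\<mu>) < \<eta> / (\<bar>c\<bar> + 1)"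
    using assms e2 unfolding L1approx_def by metis
  have "(\<integral>x. \<bar>c * f x - c * F x\<bar> \<partial>\<mu>) = \<bar>c\<bar> * (\<integral>x. \<bar>f x - F x\<bar> \<partial>\<mu>)"
    by (simp add: right_diff_distrib[symmetric] abs_mult)
  also have "\<dots> \<le> (\<bar>c\<bar> + 1) * (\<integral>x. \<bar>f x - F x\<bar> \<partial>\<mu>)" by (intro mult_right_mono) auto
  also have "\<dots> < \<eta>" using F(2) by (simp add: pos_less_divide_eq mult.commute)
  finally show "\<exists>F. continuous_on UNIV F \<and> (\<integral>x. \<bar>c * f x - F x\<bar> \<partial>\<mu>) < \<eta>"
    using F by (intro exI[of _ "\<lambda>x. c * F x"]) (auto intro!: continuous_intros)
qed

lemma L1approx_lim:
  assumes s: "\<And>i. L1approx (s i)" and f: "f \<in> borel_measurable borel"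
    and lim: "\<And>x. (\<lambda>i. s i x) \<longlonglongrightarrow> f x" and w: "integrable \<mu> w" "\<And>i x. \<bar>s i x\<bar> \<le> w x"
  shows "L1approx f"
  unfolding L1approx_def
proof (intro conjI allI impI)
  have i: "integrable \<mu> (s i)" for i using s by (auto simp: L1approx_def)
  have sm: "s i \<in> borel_measurable \<mu>" for i by (rule borel_measurable_integrable[OF i])
  have "norm (f x) \<le> w x" for x using lim[of x] w(2) by (intro LIMSEQ_le_const2[OF tendsto_norm[OF lim]]) auto
  then have fw: "\<bar>f x\<bar> \<le> w x" for x by simp
  show fi: "integrable \<mu> f"
    by (rule Bochner_Integration.integrable_bound[OF w(1)]) (use f fw in \<open>auto intro: order_trans[OF _ abs_ge_self]\<close>)
  fix \<eta> :: real assume e: "\<eta> > 0"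
  have "(\<lambda>i. \<integral>x. \<bar>f x - s i x\<bar> \<partial>\<mu>) \<longlonglongrightarrow> (\<integral>x. 0 \<partial>\<mu>)"
  proof (rule integral_dominated_convergence[where w = "\<lambda>x. 2 * w x"])
    show "AE x in \<mu>. (\<lambda>i. \<bar>f x - s i x\<bar>) \<longlonglongrightarrow> 0"
    proof (rule AE_I2)
      fix x
      have "(\<lambda>i. \<bar>f x - s i x\<bar>) \<longlonglongrightarrow> \<bar>f x - f x\<bar>" by (intro tendsto_intros lim)
      then show "(\<lambda>i. \<bar>f x - s i x\<bar>) \<longlonglongrightarrow> 0" by simp
    qed
    show "AE x in \<mu>. norm \<bar>f x - s i x\<bar> \<le> 2 * w x" for i
    proof (rule AE_I2)
      fix x show "norm \<bar>f x - s i x\<bar> \<le> 2 * w x" using fw[of x] w(2)[of i x] by simp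
    qed
    show "(\<lambda>x. \<bar>f x - s i x\<bar>) \<in> borel_measurable \<mu>" for i using f sm[of i] by auto
  qed (use w in auto)
  then have "eventually (\<lambda>i. (\<integral>x. \<bar>f x - s i x\<bar> \<partial>\<mu>) < \<eta> / 2) sequentially"
    by (rule order_tendstoD(2)) (use e in simp)
  then obtain i0 where i0: "(\<integral>x. \<bar>f x - s i0 x\<bar> \<partial>\<mu>) < \<eta> / 2" by (auto simp: eventually_sequentially)
  obtain F where F: "continuous_on UNIV F" "(\<integral>x. \<bar>s i0 x - F x\<bar> \<partial>\<mu>) < \<eta> / 2"
    using s[of i0] e unfolding L1approx_def by (meson half_gt_zero)
  have FH: "integrable \<mu> (\<lambda>x. \<bar>f x - s i0 x\<bar>)" "integrable \<mu> (\<lambda>x. \<bar>s i0 x - F x\<bar>)" "integrable \<mu> (\<lambda>x. \<bar>f x - F x\<bar>)"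
    using i fi cont_integrable[OF F(1)] by auto
  have "(\<integral>x. \<bar>f x - F x\<bar> \<partial>\<mu>) \<le> (\<integral>x. \<bar>f x - s i0 x\<bar> + \<bar>s i0 x - F x\<bar> \<partial>\<mu>)"
    using FH by (intro integral_mono) auto
  also have "\<dots> < \<eta>" using FH i0 F by simp
  finally show "\<exists>F. continuous_on UNIV F \<and> (\<integral>x. \<bar>f x - F x\<bar> \<partial>\<mu>) < \<eta>" using F(1) by blast
qed

text \<open>The functions \<open>min 1 (n * D x)\<close>, with \<open>D\<close> the distance to the
  complement, tend to the indicator, because compactness of the complement makes \<open>D\<close>
  positive on \<open>U\<close>. The case of an empty complement is separate, as the infimum would be
  undefined.\<close>

lemma L1approx_open:
  assumes U: "open U" shows "L1approx (indicat_real U)"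
proof (cases "U = UNIV")
  case True
  then have "indicat_real U = (\<lambda>_. 1)" by auto
  then show ?thesis by (auto intro!: L1approx_cont)
next
  case False
  define D where "D = (\<lambda>x. INF y\<in>-U. d x y)"
  have bdd: "bdd_below ((\<lambda>y. d x y) ` (-U))" for x by (intro bdd_belowI[of _ 0]) auto
  have D0: "D x \<ge> 0" for x unfolding D_def using False by (intro cINF_greatest) auto
  have Dle: "D x \<le> d x y" if "y \<notin> U" for x y unfolding D_def by (rule cINF_lower[OF bdd]) (use that in simp)
  have DL: "D x \<le> D y + d x y" for x y
  proof -
    have "D x - d x y \<le> d y z" if "z \<in> -U" for z using Dle[of z x] that d_triangle[of x z y] by simp
    then have "D x - d x y \<le> (INF z\<in>-U. d y z)" using False by (intro cINF_greatest) auto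
    also have "\<dots> = D y" by (simp add: D_def)
    finally show ?thesis by simp
  qed
  have Dc: "continuous_on UNIV D"
    unfolding continuous_on_def
  proof
    fix x
    have "((\<lambda>y. d x y) \<longlongrightarrow> d x x) (at x)" using d_continuous[of UNIV x] unfolding continuous_on_def by blast
    then have dx: "((\<lambda>y. d x y) \<longlongrightarrow> 0) (at x)" by simp
    have "((\<lambda>y. D y - D x) \<longlongrightarrow> 0) (at x)"
    proof (rule Lim_null_comparison[OF _ dx])
      have "norm (D y - D x) \<le> d x y" for y using DL[of x y] DL[of y x] d_commute[of x y] by auto
      then show "\<forall>\<^sub>F y in at x. norm (D y - D x) \<le> d x y" by simp
    qed
    then show "(D \<longlongrightarrow> D x) (at x)" by (simp add: LIM_zero_iff)
  qed
  have Dpos: "D x > 0" if x: "x \<in> U" for x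
  proof -
    have "closed (-U)" using U by (rule closed_Compl)
    then have "compact (-U)" using closed_Int_compact[OF _ cpt] by fastforce
    then obtain y where y: "y \<in> -U" "\<And>z. z \<in> -U \<Longrightarrow> d x y \<le> d x z"
      using continuous_attains_inf[of "-U" "\<lambda>y. d x y"] False d_continuous by blast
    have "0 < d x y" using y x by (intro d_pos) auto
    also have "d x y \<le> D x" unfolding D_def using False y by (intro cINF_greatest) auto
    finally show ?thesis .
  qed
  have Dz: "D x = 0" if "x \<notin> U" for x using Dle[OF that, of x] D0[of x] by simp
  show ?thesis
  proof (rule L1approx_lim[where s = "\<lambda>n x. min 1 (real n * D x)" and w = "\<lambda>_. 1"])
    show "L1approx (\<lambda>x. min 1 (real n * D x))" for n by (intro L1approx_cont continuous_intros Dc)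
    show "indicat_real U \<in> borel_measurable borel" using U by simp
    show "(\<lambda>n. min 1 (real n * D x)) \<longlonglongrightarrow> indicat_real U x" for x
    proof (cases "x \<in> U")
      case True
      obtain N :: nat where N: "1 / D x < N" using reals_Archimedean2 by blast
      have "\<forall>n\<ge>N. min 1 (real n * D x) = 1"
      proof (intro allI impI)
        fix n assume "N \<le> n"
        then have "1 / D x \<le> real n" using N by (meson less_imp_le of_nat_mono order_trans)
        then show "min 1 (real n * D x) = 1" using Dpos[OF True] by (simp add: pos_divide_le_eq)
      qed
      then have "eventually (\<lambda>n. min 1 (real n * D x) = 1) sequentially" by (auto simp: eventually_sequentially)
      then show ?thesis using True by (simp add: tendsto_eventually)
    qed (simp add: Dz)
    show "\<bar>min 1 (real n * D x)\<bar> \<le> 1" for n x using D0[of x] by simp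
  qed simp
qed

text \<open>Dynkin's theorem: the open sets are stable under intersection and generate the Borel
  sets, and the property passes to complements and disjoint countable unions.\<close>

lemma L1approx_indicator:
  assumes "A \<in> sets borel" shows "L1approx (indicat_real A)"
proof -
  have "Int_stable {U :: 'a set. open U}" by (auto simp: Int_stable_def)
  moreover have "{U :: 'a set. open U} \<subseteq> Pow UNIV" by simp
  moreover have "A \<in> sigma_sets UNIV {U :: 'a set. open U}" using assms by (simp add: borel_def)
  ultimately show ?thesis
  proof (induction rule: sigma_sets_induct_disjoint)
    case (basic A) then show ?case by (simp add: L1approx_open)
  next
    case empty then show ?case by (auto intro!: L1approx_cont)
  next
    case (compl A)
    have "indicat_real (UNIV - A) = (\<lambda>x. 1 + (-1) * indicat_real A x)" by (auto simp: indicator_def)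
    then show ?case using L1approx_add[OF L1approx_cont[of "\<lambda>_. 1"] L1approx_scale[OF compl(2), of "-1"]] by simp
  next
    case (union A)
    have Ab: "A i \<in> sets borel" for i using union(2) by (auto simp: borel_def)
    have sm: "(\<lambda>n. \<Sum>i<n. indicat_real (A i) x) \<longlonglongrightarrow> indicat_real (\<Union>i. A i) x" for x
      using indicator_sums[of A x] union(1) by (auto simp: sums_def disjoint_family_on_def)
    have le1: "(\<Sum>i<n. indicat_real (A i) x) \<le> indicat_real (\<Union>i. A i) x" for n x
      using sm by (intro incseq_le[of "\<lambda>n. \<Sum>i<n. indicat_real (A i) x"]) (auto intro!: incseq_SucI)
    show ?case
    proof (rule L1approx_lim[where s = "\<lambda>n x. \<Sum>i<n. indicat_real (A i) x" and w = "\<lambda>_. 1"])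
      show "L1approx (\<lambda>x. \<Sum>i<n. indicat_real (A i) x)" for n
      proof (induction n)
        case (Suc n) then show ?case using L1approx_add[OF Suc union(3)[of n]] by simp
      qed (simp add: L1approx_cont)
      show "indicat_real (\<Union>i. A i) \<in> borel_measurable borel" using Ab by simp
      show "\<bar>\<Sum>i<n. indicat_real (A i) x\<bar> \<le> 1" for n x
      proof -
        have "0 \<le> (\<Sum>i<n. indicat_real (A i) x)" by (intro sum_nonneg) auto
        moreover have "indicat_real (\<Union>i. A i) x \<le> 1" by (simp add: indicator_def)
        ultimately show ?thesis using le1[of x n] by linarith
      qed
    qed (use sm in auto)
  qed
qed

lemma L1_dense: assumes "integrable \<mu> f" shows "L1approx f"
  using assms
proof (induction rule: integrable_induct)
  case (base A c)
  have "L1approx (\<lambda>x. c * indicat_real A x)" using base by (intro L1approx_scale L1approx_indicator) auto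
  then show ?case by (simp add: mult.commute)
next
  case (add f g) then show ?case by (intro L1approx_add)
next
  case (lim f s)
  show ?case
    by (rule L1approx_lim[where s = s and w = "\<lambda>x. 2 * \<bar>f x\<bar>"]) (use lim in auto)
qed

text \<open>First truncate \<open>f\<close>. The truncation is approximated in \<open>L^1\<close>
  and the approximant clipped to the same range; the square of a difference of such functions is at
  most \<open>2 * n + 1\<close> times its absolute value.\<close>

lemma L2_dense:
  assumes f: "sqint f" and \<eta>: "\<eta> > 0"
  obtains F where "continuous_on UNIV F" "(\<integral>x. (f x - F x)\<^sup>2 \<partial>\<mu>) < \<eta>"
proof -
  have fm: "f \<in> borel_measurable borel" and fi: "integrable \<mu> (\<lambda>x. (f x)\<^sup>2)" using f by (auto simp: sqint_def)
  define clip where "clip = (\<lambda>n y. max (- real n) (min (real n) y))"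
  have clip_b: "\<bar>clip n y\<bar> \<le> real n" for n y by (auto simp: clip_def)
  have clip_L: "\<bar>clip n y - clip n z\<bar> \<le> \<bar>y - z\<bar>" for n y z by (auto simp: clip_def)
  have clip_d: "\<bar>y - clip n y\<bar> \<le> \<bar>y\<bar>" for n y by (auto simp: clip_def)
  have clip_m: "(\<lambda>x. clip n (f x)) \<in> borel_measurable borel" for n using fm by (simp add: clip_def)
  have "(\<lambda>n. \<integral>x. (f x - clip n (f x))\<^sup>2 \<partial>\<mu>) \<longlonglongrightarrow> (\<integral>x. 0 \<partial>\<mu>)"
  proof (rule integral_dominated_convergence[where w = "\<lambda>x. (f x)\<^sup>2"])
    show "AE x in \<mu>. (\<lambda>n. (f x - clip n (f x))\<^sup>2) \<longlonglongrightarrow> 0"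
    proof (rule AE_I2)
      fix x
      obtain N :: nat where N: "\<bar>f x\<bar> < N" using reals_Archimedean2 by blast
      have "(f x - clip n (f x))\<^sup>2 = 0" if "n \<ge> N" for n
      proof -
        have "\<bar>f x\<bar> < real n" using N that by (meson less_le_trans of_nat_mono)
        then show ?thesis by (simp add: clip_def)
      qed
      then have "eventually (\<lambda>n. (f x - clip n (f x))\<^sup>2 = 0) sequentially" by (auto simp: eventually_sequentially)
      then show "(\<lambda>n. (f x - clip n (f x))\<^sup>2) \<longlonglongrightarrow> 0" by (rule tendsto_eventually)
    qed
    show "AE x in \<mu>. norm ((f x - clip n (f x))\<^sup>2) \<le> (f x)\<^sup>2" for n
      using clip_d by (simp add: abs_le_square_iff[symmetric])
    show "(\<lambda>x. (f x - clip n (f x))\<^sup>2) \<in> borel_measurable \<mu>" for n using fm clip_m[of n] by simp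
  qed (use fi in auto)
  then have "eventually (\<lambda>n. (\<integral>x. (f x - clip n (f x))\<^sup>2 \<partial>\<mu>) < \<eta> / 4) sequentially"
    by (rule order_tendstoD(2)) (use \<eta> in simp)
  then obtain n where n: "(\<integral>x. (f x - clip n (f x))\<^sup>2 \<partial>\<mu>) < \<eta> / 4" by (auto simp: eventually_sequentially)
  have ci: "integrable \<mu> (\<lambda>x. clip n (f x))" by (rule bounded_integrable[OF clip_m clip_b])
  \<comment> \<open>Chosen such that \<open>(2 * n + 1) * \<eta>'\<close> is
    \<open>\<eta> / 4\<close>; adding 1 to \<open>2 * n\<close> keeps the denominator positive for
    \<open>n = 0\<close>.\<close>
  define \<eta>' where "\<eta>' = \<eta> / (4 * (2 * real n + 1))"
  have "\<eta>' > 0" using \<eta> by (simp add: \<eta>'_def)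
  then obtain F0 where F0: "continuous_on UNIV F0" "(\<integral>x. \<bar>clip n (f x) - F0 x\<bar> \<partial>\<mu>) < \<eta>'"
    using L1_dense[OF ci] unfolding L1approx_def by blast
  define F where "F = (\<lambda>x. clip n (F0 x))"
  have Fc: "continuous_on UNIV F" unfolding F_def clip_def by (intro continuous_intros F0)
  have cc: "clip n (clip n y) = clip n y" for y by (auto simp: clip_def)
  have s1: "sqint (\<lambda>x. clip n (f x))" unfolding sqint_def
    using clip_m by (auto intro!: bounded_integrable[of _ "(real n)\<^sup>2"] sq_le_of_abs_le clip_b)
  have pw: "(clip n (f x) - F x)\<^sup>2 \<le> (2 * real n + 1) * \<bar>clip n (f x) - F0 x\<bar>" for x
  proof -
    have "\<bar>clip n (f x) - F x\<bar> \<le> \<bar>clip n (f x) - F0 x\<bar>" using clip_L[of n "clip n (f x)" "F0 x"] by (simp add: F_def cc)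
    moreover have "\<bar>clip n (f x) - F x\<bar> \<le> 2 * real n + 1" using clip_b[of n "f x"] clip_b[of n "F0 x"] by (simp add: F_def)
    ultimately have "\<bar>clip n (f x) - F x\<bar> * \<bar>clip n (f x) - F x\<bar> \<le> (2 * real n + 1) * \<bar>clip n (f x) - F0 x\<bar>"
      by (intro mult_mono) auto
    then show ?thesis by (simp add: power2_eq_square)
  qed
  have "(\<integral>x. (clip n (f x) - F x)\<^sup>2 \<partial>\<mu>) \<le> (\<integral>x. (2 * real n + 1) * \<bar>clip n (f x) - F0 x\<bar> \<partial>\<mu>)"
    using sqint_diff[OF s1 sqint_cont[OF Fc]] ci cont_integrable[OF F0(1)] pw by (intro integral_mono) (auto simp: sqint_def)
  also have "\<dots> = (2 * real n + 1) * (\<integral>x. \<bar>clip n (f x) - F0 x\<bar> \<partial>\<mu>)" by simp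
  also have "\<dots> < (2 * real n + 1) * \<eta>'" using F0(2) by (intro mult_strict_left_mono) auto
  also have "\<dots> = \<eta> / 4" by (simp add: \<eta>'_def field_simps)
  finally have n2: "(\<integral>x. (clip n (f x) - F x)\<^sup>2 \<partial>\<mu>) < \<eta> / 4" .
  have "(\<integral>x. (f x - F x)\<^sup>2 \<partial>\<mu>) \<le> 2 * (\<integral>x. (f x - clip n (f x))\<^sup>2 \<partial>\<mu>) + 2 * (\<integral>x. (clip n (f x) - F x)\<^sup>2 \<partial>\<mu>)"
    using sqint_sq_add[OF sqint_diff[OF f s1] sqint_diff[OF s1 sqint_cont[OF Fc]]] by simp
  also have "\<dots> < \<eta>" using n n2 by simp
  finally show ?thesis using that Fc by blast
qed

theorem expanders_imp_gap:
  assumes S: "sym_gen S" and t: "level_seq t" and ex: "levels_form_expanders (W S) t"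
  shows "spectral_gap G \<mu> S"
proof -
  obtain V :: "nat \<Rightarrow> nat set" and E where VE: "expander_graphs V E"
    and "\<exists>L>0. \<exists>A\<ge>0. \<forall>n. \<exists>f. quasi_isometry L A (UNIV \<times> {t n}) (W S) (V n) (path_dist (E n)) f"
    using ex unfolding levels_form_expanders_def forms_expanders_def by blast
  then obtain L' A' where LA: "L' > 0" "A' \<ge> 0"
    "\<forall>n. \<exists>f. quasi_isometry L' A' (UNIV \<times> {t n}) (W S) (V n) (path_dist (E n)) f" by blast
  then obtain f where f: "\<And>n. quasi_isometry L' A' (UNIV \<times> {t n}) (W S) (V n) (path_dist (E n)) (f n)" by metis
  obtain C \<epsilon> :: real where C: "C > 0" "\<epsilon> > 0" "\<And>n. \<forall>v\<in>V n. real (card (E n `` {v})) \<le> C"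
    "\<And>n. cheeger (V n) (E n) \<ge> ereal \<epsilon>" "\<And>n. fin_graph (V n) (E n)"
    using VE unfolding expander_graphs_def by blast
  have fS: "finite S" "S \<noteq> {}" "\<And>s. s \<in> S \<Longrightarrow> inv s \<in> S" using S by (auto simp: sym_gen_def)
  obtain K6 len c T0 where K6: "c > 0" "T0 \<ge> 1" "K6 \<ge> 0" "\<forall>T (V :: nat set) E f F \<omega>. T \<ge> T0 \<longrightarrow> fin_graph V E \<longrightarrow>
     (\<forall>v\<in>V. real (card (E `` {v})) \<le> C) \<longrightarrow> cheeger V E \<ge> ereal \<epsilon> \<longrightarrow>
     quasi_isometry L' A' (UNIV \<times> {T}) (W S) V (path_dist E) f \<longrightarrow> continuous_on UNIV F \<longrightarrow>
     (\<forall>x y. d x y \<le> c / T \<longrightarrow> \<bar>F x - F y\<bar> \<le> \<omega>) \<longrightarrow>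
     (\<exists>m. (\<integral>x. (F x - m)\<^sup>2 \<partial>\<mu>) \<le> K6 * (\<omega>\<^sup>2 + (\<Sum>\<gamma>\<in>words S len. disp F \<gamma>)))"
    using level_poincare[OF C(2,1) LA(1,2) S] by blast
  \<comment> \<open>Displacements by words of length \<open>len\<close> are reduced to displacements
    by generators through \<open>disp_words\<close>.\<close>
  define K7 where "K7 = K6 * (card (words S len) * 4 ^ len)"
  have K7: "K7 \<ge> 0" using K6 by (simp add: K7_def)
  have cont: "\<exists>m. (\<integral>x. (F x - m)\<^sup>2 \<partial>\<mu>) \<le> K7 * (\<Sum>s\<in>S. disp F s) + \<eta>"
    if F: "continuous_on UNIV F" and \<eta>: "\<eta> > 0" for F \<eta>
  proof -
    define \<omega> where "\<omega> = sqrt (\<eta> / (K6 + 1))"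
    have \<omega>: "\<omega> > 0" using \<eta> K6 by (simp add: \<omega>_def)
    obtain \<delta> where \<delta>: "\<delta> > 0" "\<And>x y. d x y < \<delta> \<Longrightarrow> \<bar>F x - F y\<bar> < \<omega>" using uniform_continuity[OF F \<omega>] by blast
    have "eventually (\<lambda>n. t n > max T0 (c / \<delta>)) sequentially"
      using t unfolding level_seq_def by (intro filterlim_at_top_dense[THEN iffD1, rule_format]) auto
    \<comment> \<open>For given \<open>F\<close> and \<open>\<eta>\<close> a single level suffices,
      high enough for \<open>F\<close> to oscillate by at most \<open>\<omega>\<close> at scale
      \<open>c / t n\<close>.\<close>
    then obtain n where n: "t n > max T0 (c / \<delta>)" by (auto simp: eventually_sequentially)
    have tn: "t n \<ge> T0" "c / t n < \<delta>" using n K6 \<delta> by (auto simp: field_simps)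
    have "\<forall>x y. d x y \<le> c / t n \<longrightarrow> \<bar>F x - F y\<bar> \<le> \<omega>"
      using \<delta>(2) tn(2) by (meson le_less_trans less_imp_le)
    then obtain m where m: "(\<integral>x. (F x - m)\<^sup>2 \<partial>\<mu>) \<le> K6 * (\<omega>\<^sup>2 + (\<Sum>\<gamma>\<in>words S len. disp F \<gamma>))"
      using K6(4) tn(1) C(3)[of n] C(4)[of n] C(5)[of n] f[of n] F by blast
    have "(\<Sum>\<gamma>\<in>words S len. disp F \<gamma>) \<le> (\<Sum>\<gamma>\<in>words S len. 4 ^ len * (\<Sum>s\<in>S. disp F s))"
      using disp_words[OF F fS(1)] by (intro sum_mono)
    then have "K6 * (\<Sum>\<gamma>\<in>words S len. disp F \<gamma>) \<le> K6 * (card (words S len) * (4 ^ len * (\<Sum>s\<in>S. disp F s)))"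
      using K6 by (intro mult_left_mono) auto
    then have "K6 * (\<Sum>\<gamma>\<in>words S len. disp F \<gamma>) \<le> K7 * (\<Sum>s\<in>S. disp F s)" by (simp add: K7_def mult_ac)
    moreover have "K6 * \<omega>\<^sup>2 \<le> \<eta>"
    proof -
      have "K6 * \<omega>\<^sup>2 = K6 * \<eta> / (K6 + 1)" using K6 \<eta> by (simp add: \<omega>_def)
      also have "\<dots> \<le> \<eta>" using K6 \<eta> by (simp add: pos_divide_le_eq algebra_simps)
      finally show ?thesis .
    qed
    ultimately have "K6 * (\<omega>\<^sup>2 + (\<Sum>\<gamma>\<in>words S len. disp F \<gamma>)) \<le> K7 * (\<Sum>s\<in>S. disp F s) + \<eta>" by (simp add: distrib_left)
    then show ?thesis using m by (meson order_trans)
  qed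
  define K8 where "K8 = 8 * K7 + 1"
  have real_gap: "(\<integral>x. (f x)\<^sup>2 \<partial>\<mu>) \<le> K8 * (\<Sum>s\<in>S. disp f s)" if f: "sqint f" "(\<integral>x. f x \<partial>\<mu>) = 0" for f
  proof (rule field_le_epsilon)
    fix e :: real assume e: "e > 0"
    \<comment> \<open>The total coefficient of \<open>\<eta>\<close>: 4 from replacing
      \<open>f\<close> by \<open>F\<close> on the left, and \<open>2 * K7 * 8\<close> for each
      generator from replacing \<open>F\<close> by \<open>f\<close> on the right.\<close>
    define c0 where "c0 = 4 + 16 * K7 * card S"
    have c0: "c0 > 0" using K7 by (auto simp: c0_def intro!: add_pos_nonneg)
    define \<eta> where "\<eta> = e / c0"
    have \<eta>: "\<eta> > 0" using e c0 by (simp add: \<eta>_def)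
    obtain F where F: "continuous_on UNIV F" "(\<integral>x. (f x - F x)\<^sup>2 \<partial>\<mu>) < \<eta>" using L2_dense[OF f(1) \<eta>] by blast
    obtain m where m: "(\<integral>x. (F x - m)\<^sup>2 \<partial>\<mu>) \<le> K7 * (\<Sum>s\<in>S. disp F s) + \<eta>" using cont[OF F(1) \<eta>] by blast
    note sF = sqint_cont[OF F(1)]
    have "(\<integral>x. (f x)\<^sup>2 \<partial>\<mu>) \<le> (\<integral>x. (f x - m)\<^sup>2 \<partial>\<mu>)" by (rule variance_minimal[OF f])
    also have "\<dots> \<le> 2 * (\<integral>x. (f x - F x)\<^sup>2 \<partial>\<mu>) + 2 * (\<integral>x. (F x - m)\<^sup>2 \<partial>\<mu>)"
      using sqint_sq_add[OF sqint_diff[OF f(1) sF] sqint_diff[OF sF sqint_cont[of "\<lambda>_. m"]]] by simp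
    also have "\<dots> \<le> 4 * \<eta> + 2 * K7 * (\<Sum>s\<in>S. disp F s)" using m F(2) by simp
    finally have 1: "(\<integral>x. (f x)\<^sup>2 \<partial>\<mu>) \<le> 4 * \<eta> + 2 * K7 * (\<Sum>s\<in>S. disp F s)" .
    have "disp F s \<le> 8 * \<eta> + 4 * disp f s" for s
    proof -
      have a: "sqint (\<lambda>x. F x - f x)" by (rule sqint_diff[OF sF f(1)])
      have b: "(\<integral>x. (F x - f x)\<^sup>2 \<partial>\<mu>) < \<eta>" using F(2) by (simp add: power2_commute)
      have fs: "sqint (\<lambda>x. f (s \<otimes> x))" by (rule sqint_translate[OF f(1)])
      have "disp F s \<le> 2 * (\<integral>x. ((F (s \<otimes> x) - f (s \<otimes> x)) + (f x - F x))\<^sup>2 \<partial>\<mu>) + 2 * (\<integral>x. (f (s \<otimes> x) - f x)\<^sup>2 \<partial>\<mu>)"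
        using sqint_sq_add[OF sqint_add[OF sqint_translate(1)[OF a, of s] sqint_diff[OF f(1) sF]] sqint_diff[OF fs f(1)]]
        by (simp add: disp_def algebra_simps)
      also have "(\<integral>x. ((F (s \<otimes> x) - f (s \<otimes> x)) + (f x - F x))\<^sup>2 \<partial>\<mu>) \<le> 2 * (\<integral>x. (F (s \<otimes> x) - f (s \<otimes> x))\<^sup>2 \<partial>\<mu>) + 2 * (\<integral>x. (f x - F x)\<^sup>2 \<partial>\<mu>)"
        by (rule sqint_sq_add[OF sqint_translate(1)[OF a] sqint_diff[OF f(1) sF]])
      also have "(\<integral>x. (F (s \<otimes> x) - f (s \<otimes> x))\<^sup>2 \<partial>\<mu>) = (\<integral>x. (F x - f x)\<^sup>2 \<partial>\<mu>)" by (rule sqint_translate(2)[OF a])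
      finally have "disp F s \<le> 2 * (2 * (\<integral>x. (F x - f x)\<^sup>2 \<partial>\<mu>) + 2 * (\<integral>x. (f x - F x)\<^sup>2 \<partial>\<mu>)) + 2 * disp f s"
        by (simp add: disp_def)
      moreover have "2 * (\<integral>x. (F x - f x)\<^sup>2 \<partial>\<mu>) + 2 * (\<integral>x. (f x - F x)\<^sup>2 \<partial>\<mu>) \<le> 2 * \<eta> + 2 * \<eta>"
        using b F(2) by (intro add_mono mult_left_mono) auto
      ultimately have "disp F s \<le> 2 * (2 * \<eta> + 2 * \<eta>) + 2 * disp f s" by simp
      also have "2 * disp f s \<le> 4 * disp f s" using disp_nonneg[of f s] by simp
      finally show ?thesis by simp
    qed
    then have "(\<Sum>s\<in>S. disp F s) \<le> (\<Sum>s\<in>S. 8 * \<eta> + 4 * disp f s)" by (intro sum_mono)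
    also have "\<dots> = card S * (8 * \<eta>) + 4 * (\<Sum>s\<in>S. disp f s)" by (simp add: sum.distrib sum_distrib_left)
    finally have "2 * K7 * (\<Sum>s\<in>S. disp F s) \<le> 2 * K7 * (card S * (8 * \<eta>) + 4 * (\<Sum>s\<in>S. disp f s))"
      using K7 by (intro mult_left_mono) auto
    then have "(\<integral>x. (f x)\<^sup>2 \<partial>\<mu>) \<le> c0 * \<eta> + 8 * K7 * (\<Sum>s\<in>S. disp f s)" using 1 by (simp add: c0_def algebra_simps)
    also have "c0 * \<eta> = e" using c0 by (simp add: \<eta>_def)
    also have "8 * K7 * (\<Sum>s\<in>S. disp f s) \<le> K8 * (\<Sum>s\<in>S. disp f s)"
      by (intro mult_right_mono sum_nonneg) (auto simp: K8_def disp_nonneg)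
    finally show "(\<integral>x. (f x)\<^sup>2 \<partial>\<mu>) \<le> K8 * (\<Sum>s\<in>S. disp f s) + e" by simp
  qed
  have K8: "K8 > 0" using K7 by (simp add: K8_def)
  show ?thesis unfolding spectral_gap_def
  proof (intro exI[of _ "1 / sqrt K8"] conjI ballI impI)
    show "1 / sqrt K8 > 0" using K8 by simp
    fix f assume f: "f \<in> L2 \<mu>" "(\<integral>x. f x \<partial>\<mu>) = 0"
    have fm: "f \<in> borel_measurable borel" and fi: "integrable \<mu> (\<lambda>x. (cmod (f x))\<^sup>2)" using f by (auto simp: L2_def)
    have csq: "(cmod z)\<^sup>2 = (Re z)\<^sup>2 + (Im z)\<^sup>2" for z by (simp add: cmod_def)
    have sR: "sqint (\<lambda>x. Re (f x))" unfolding sqint_def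
      using fm by (auto intro!: Bochner_Integration.integrable_bound[OF fi] simp: csq)
    have sI: "sqint (\<lambda>x. Im (f x))" unfolding sqint_def
      using fm by (auto intro!: Bochner_Integration.integrable_bound[OF fi] simp: csq)
    have intf: "integrable \<mu> f"
    proof (rule Bochner_Integration.integrable_bound)
      show "integrable \<mu> (\<lambda>x. 1 + (cmod (f x))\<^sup>2)" using fi by auto
      have "y \<le> 1 + y\<^sup>2" for y :: real using abs_le_one_plus_sq[of y] by linarith
      then show "AE x in \<mu>. norm (f x) \<le> norm (1 + (cmod (f x))\<^sup>2)" by simp
    qed (use fm in simp)
    have R0: "(\<integral>x. Re (f x) \<partial>\<mu>) = 0" "(\<integral>x. Im (f x) \<partial>\<mu>) = 0" using f(2) intf by simp_all
    define N where "N = (\<lambda>s. L2_norm \<mu> (\<lambda>x. f (inv s \<otimes> x) - f x))"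
    have N0: "N s \<ge> 0" for s by (simp add: N_def L2_norm_def)
    have dN: "disp (\<lambda>x. Re (f x)) (inv s) + disp (\<lambda>x. Im (f x)) (inv s) = (N s)\<^sup>2" for s
    proof -
      have i: "integrable \<mu> (\<lambda>x. (Re (f (inv s \<otimes> x)) - Re (f x))\<^sup>2)" "integrable \<mu> (\<lambda>x. (Im (f (inv s \<otimes> x)) - Im (f x))\<^sup>2)"
        using sqint_diff[OF sqint_translate(1)[OF sR, of "inv s"] sR] sqint_diff[OF sqint_translate(1)[OF sI, of "inv s"] sI]
        by (auto simp: sqint_def)
      have "(N s)\<^sup>2 = (\<integral>x. (Re (f (inv s \<otimes> x)) - Re (f x))\<^sup>2 + (Im (f (inv s \<otimes> x)) - Im (f x))\<^sup>2 \<partial>\<mu>)"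
        by (simp add: N_def L2_norm_def csq)
      also have "\<dots> = disp (\<lambda>x. Re (f x)) (inv s) + disp (\<lambda>x. Im (f x)) (inv s)" using i by (simp add: disp_def)
      finally show ?thesis by simp
    qed
    \<comment> \<open>The spectral gap is stated with \<open>inv s\<close>, while displacements are
      summed over \<open>s\<close>; \<open>S\<close> is closed under inversion.\<close>
    have reind: "(\<Sum>s\<in>S. h (inv s)) = (\<Sum>s\<in>S. h s)" for h :: "'a \<Rightarrow> real"
      by (rule sum.reindex_bij_witness[of _ "\<lambda>s. inv s" "\<lambda>s. inv s"]) (use fS in auto)
    have "(L2_norm \<mu> f)\<^sup>2 = (\<integral>x. (Re (f x))\<^sup>2 + (Im (f x))\<^sup>2 \<partial>\<mu>)" by (simp add: L2_norm_def csq)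
    also have "\<dots> = (\<integral>x. (Re (f x))\<^sup>2 \<partial>\<mu>) + (\<integral>x. (Im (f x))\<^sup>2 \<partial>\<mu>)" using sR sI by (simp add: sqint_def)
    also have "\<dots> \<le> K8 * (\<Sum>s\<in>S. disp (\<lambda>x. Re (f x)) s) + K8 * (\<Sum>s\<in>S. disp (\<lambda>x. Im (f x)) s)"
      by (intro add_mono real_gap sR sI R0)
    also have "\<dots> = K8 * (\<Sum>s\<in>S. (N s)\<^sup>2)"
      unfolding dN[symmetric] sum.distrib reind[of "disp (\<lambda>x. Re (f x))"] reind[of "disp (\<lambda>x. Im (f x))"] by (simp add: distrib_left)
    also have "\<dots> \<le> K8 * (\<Sum>s\<in>S. N s)\<^sup>2"
    proof (intro mult_left_mono)
      have "(\<Sum>s\<in>S. (N s)\<^sup>2) \<le> (\<Sum>s\<in>S. N s * (\<Sum>s\<in>S. N s))"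
        unfolding power2_eq_square using fS N0 by (intro sum_mono mult_left_mono member_le_sum) auto
      then show "(\<Sum>s\<in>S. (N s)\<^sup>2) \<le> (\<Sum>s\<in>S. N s)\<^sup>2" by (simp add: power2_eq_square sum_distrib_right)
    qed (use K8 in simp)
    finally have "L2_norm \<mu> f \<le> sqrt (K8 * (\<Sum>s\<in>S. N s)\<^sup>2)" by (rule real_le_rsqrt)
    also have "\<dots> = sqrt K8 * (\<Sum>s\<in>S. N s)" using N0 by (simp add: real_sqrt_mult sum_nonneg)
    finally show "1 / sqrt K8 * L2_norm \<mu> f \<le> (\<Sum>s\<in>S. L2_norm \<mu> (\<lambda>x. f (inv s \<otimes> x) - f x))"
      using K8 by (simp add: N_def field_simps)
  qed
qed

end

section \<open>The theorem\<close>

lemma (in lie_geometry) coarse_group_cone: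
  assumes conn: "connected (UNIV :: 'a set)" and haar: "haar_prob G \<mu>"
  shows "\<exists>L \<Lambda> B. coarse_group G \<mu> \<Phi> (cone_dist \<A> \<rho>) (1/2) L \<Lambda> B"
proof -
  have fd: "fam_dist \<Phi> x y = d x y" for x y by (simp add: fam_dist_def)
  have dn: "d x y \<ge> 0" for x y by (intro sum_nonneg) auto
  obtain L0 where L0: "L0 > 0" "\<And>x y. d x y \<le> 1/2 \<Longrightarrow> \<exists>\<gamma>. \<gamma> 0 = x \<and> \<gamma> 1 = y \<and>
     (\<forall>s\<in>{0..1}. \<forall>s'\<in>{0..1}. d (\<gamma> s) (\<gamma> s') \<le> L0 * d x y * \<bar>s - s'\<bar>) \<and> gcurve \<gamma> (L0 * d x y)"
    by (rule near_segment) (rule that)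
  obtain \<Lambda> where \<Lambda>: "\<Lambda> \<ge> 1" "\<And>g p q. d (g \<otimes> p) (g \<otimes> q) \<le> \<Lambda> * d p q" by (rule left_mult_lipschitz) (rule that)
  obtain B where B: "B \<ge> 1" "\<And>z w f. z \<in> cone \<Longrightarrow> w \<in> cone \<Longrightarrow> f \<in> \<Phi> \<Longrightarrow>
    \<bar>snd z * f (fst z) - snd w * f (fst w)\<bar> \<le> B * cone_dist \<A> \<rho> z w"
    "\<And>z w. z \<in> cone \<Longrightarrow> w \<in> cone \<Longrightarrow> \<bar>snd z - snd w\<bar> \<le> cone_dist \<A> \<rho> z w"
    by (rule Phi_cone_bound[OF conn]) (rule that)
  define L where "L = max 1 L0"
  have L: "L \<ge> 1" "L0 * d x y \<le> L * d x y" for x y using dn by (auto simp: L_def intro: mult_right_mono)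
  have "coarse_group G \<mu> \<Phi> (cone_dist \<A> \<rho>) (1/2) L \<Lambda> B"
  proof (rule coarse_group.intro)
    show "group G" "carrier G = UNIV" using lie by (auto simp: lie_group_def)
    show "compact (UNIV :: 'a set)" by (rule compact_space)
    show "connected (UNIV :: 'a set)" by (rule conn)
    show "infinite (UNIV :: 'a set)" by (rule infinite_UNIV_manifold)
    show "continuous_on UNIV (\<lambda>x. g \<otimes> x)" for g
      using continuous_on_compose2[OF mult_continuous, of UNIV "\<lambda>x. (g, x)"] by (simp add: continuous_on_Pair continuous_on_const continuous_on_id)
    show "haar_prob G \<mu>" by (rule haar)
    show "finite \<Phi>" by (rule Phi_finite)
    show "continuous_on UNIV f" if "f \<in> \<Phi>" for f by (rule mfun_continuous[OF Phi_mfun[OF that]])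
    show "\<exists>f\<in>\<Phi>. f x \<noteq> f y" if "x \<noteq> y" for x y by (rule Phi_separates[OF that])
    show "(1/2 :: real) > 0" "L \<ge> 1" "\<Lambda> \<ge> 1" "B \<ge> 1" using L \<Lambda>(1) B(1) by auto
    show "fam_dist \<Phi> (g \<otimes> x) (g \<otimes> y) \<le> \<Lambda> * fam_dist \<Phi> x y" for g x y unfolding fd by (rule \<Lambda>(2))
    show "\<bar>snd z - snd w\<bar> \<le> cone_dist \<A> \<rho> z w" if "z \<in> cone" "w \<in> cone" for z w by (rule B(3)[OF that])
    show "\<bar>snd z * f (fst z) - snd w * f (fst w)\<bar> \<le> B * cone_dist \<A> \<rho> z w" if "z \<in> cone" "w \<in> cone" "f \<in> \<Phi>" for z w f
      by (rule B(2)[OF that])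
    fix x y :: 'a assume "fam_dist \<Phi> x y \<le> 1/2"
    then have xy: "d x y \<le> 1/2" by (simp only: fd)
    obtain \<gamma> where \<gamma>: "\<gamma> 0 = x" "\<gamma> 1 = y" "\<And>s s'. s \<in> {0..1} \<Longrightarrow> s' \<in> {0..1} \<Longrightarrow> d (\<gamma> s) (\<gamma> s') \<le> L0 * d x y * \<bar>s - s'\<bar>"
      "gcurve \<gamma> (L0 * d x y)" using L0(2)[OF xy] by blast
    have "d (\<gamma> s) (\<gamma> s') \<le> L * d x y * \<bar>s - s'\<bar>" if "s \<in> {0..1}" "s' \<in> {0..1}" for s s'
      using \<gamma>(3)[OF that] mult_right_mono[OF L(2)[of x y], of "\<bar>s - s'\<bar>"] by linarith
    then show "\<exists>\<gamma>. \<gamma> 0 = x \<and> \<gamma> 1 = y \<and> (\<forall>s\<in>{0..1}. \<forall>s'\<in>{0..1}. fam_dist \<Phi> (\<gamma> s) (\<gamma> s') \<le> L * fam_dist \<Phi> x y * \<bar>s - s'\<bar>)"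
      unfolding fd using \<gamma>(1,2) by (intro exI[of _ \<gamma>]) auto
    fix t :: real assume t: "t \<ge> 1"
    have "cone_dist \<A> \<rho> (x,t) (y,t) \<le> t * (L0 * d x y)"
      by (rule cone_dist_le[OF \<gamma>(4) _ \<gamma>(1,2) t]) (use L0(1) dn in simp)
    also have "\<dots> \<le> t * (L * d x y)" using L(2) t by (intro mult_left_mono) auto
    finally show "cone_dist \<A> \<rho> (x,t) (y,t) \<le> L * t * fam_dist \<Phi> x y" unfolding fd by (simp add: mult_ac)
  qed
  then show ?thesis by blast
qed

lemma (in coarse_group) sym_gen_gens: "sym_gen (gens G k g)"
  by (auto simp: sym_gen_def gens_def)

theorem theoremC:
  fixes G :: "'a::{t2_space,second_countable_topology} monoid"
    and \<A> :: "('a, 'e::euclidean_space) chart set"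
    and \<rho> :: "('a, 'e) chart \<Rightarrow> 'a \<Rightarrow> 'e \<Rightarrow> 'e \<Rightarrow> real"
    and \<mu> :: "'a measure"
  assumes "compact_simple_lie_group G \<A>"
    and "riemannian_metric \<A> \<rho>"
    and "haar_prob G \<mu>"
  defines "gap \<equiv> \<lambda>k g. spectral_gap G \<mu> (gens G k g)"
    and "expanders \<equiv> \<lambda>k g t. levels_form_expanders (warped_cone_dist G \<A> \<rho> (gens G k g)) t"
  shows "((\<forall>k\<ge>2. AE g in (\<Pi>\<^sub>M i\<in>{..<k}. \<mu>). gap k g) \<longleftrightarrow>
          (\<forall>k\<ge>2. AE g in (\<Pi>\<^sub>M i\<in>{..<k}. \<mu>). \<exists>t. level_seq t \<and> expanders k g t)) \<and>
         ((\<forall>k\<ge>2. AE g in (\<Pi>\<^sub>M i\<in>{..<k}. \<mu>). gap k g) \<longleftrightarrow>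
          (\<forall>k\<ge>2. AE g in (\<Pi>\<^sub>M i\<in>{..<k}. \<mu>). \<forall>t. level_seq t \<longrightarrow> expanders k g t)) \<and>
         (\<forall>k\<ge>2. AE g in (\<Pi>\<^sub>M i\<in>{..<k}. \<mu>).
            (\<exists>t. level_seq t \<and> expanders k g t) \<longleftrightarrow> (\<forall>t. level_seq t \<longrightarrow> expanders k g t))"
proof -
  have csl: "lie_group G \<A>" "compact (UNIV :: 'a set)" "connected (UNIV :: 'a set)"
    using assms(1) by (auto simp: compact_simple_lie_group_def)
  have "atlas \<A>" using csl by unfold_locales (auto simp: lie_group_def)
  then obtain P where P: "atlas_family \<A> P" by (rule atlas.family_exists)
  interpret atlas_family \<A> P by (rule P)
  interpret lie_geometry \<A> \<rho> P G by unfold_locales (rule assms(2), rule csl(1))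
  obtain L \<Lambda> B where "coarse_group G \<mu> \<Phi> (cone_dist \<A> \<rho>) (1/2) L \<Lambda> B"
    using coarse_group_cone[OF csl(3) assms(3)] by blast
  then interpret C: coarse_group G \<mu> \<Phi> "cone_dist \<A> \<rho>" "1/2" L \<Lambda> B "fam_dist \<Phi>" .
  have W: "warped_cone_dist G \<A> \<rho> S = C.W S" for S by (simp add: warped_cone_dist_def)
  have 1: "expanders k g t" if "gap k g" "level_seq t" for k g t
    using C.gap_imp_expanders[OF C.sym_gen_gens _ that(2)] that(1) by (simp add: gap_def expanders_def W)
  have 2: "gap k g" if "level_seq t" "expanders k g t" for k g t
    using C.expanders_imp_gap[OF C.sym_gen_gens that(1)] that(2) by (simp add: gap_def expanders_def W)
  \<comment> \<open>Some level sequence exists, so expansion along all sequences implies expansion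
    along one.\<close>
  have "filterlim (\<lambda>n. real n + 1) at_top sequentially"
    by (intro filterlim_tendsto_add_at_top[OF tendsto_const, of _ _ 1, simplified add.commute[of 1]] filterlim_real_sequentially)
  then have 3: "level_seq (\<lambda>n. real n + 1)" by (simp add: level_seq_def)
  \<comment> \<open>For each fixed tuple both expander conditions coincide with the spectral gap, so
    the almost-everywhere statements become identical.\<close>
  have e1: "(\<exists>t. level_seq t \<and> expanders k g t) = gap k g" for k g using 1 2 3 by blast
  have e2: "(\<forall>t. level_seq t \<longrightarrow> expanders k g t) = gap k g" for k g using 1 2 3 by blast
  show ?thesis unfolding e1 e2 by simp
qed

end
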